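(* Let $p\colon X\to Y$ be a morphism of schemes and $Z$ a closed subscheme of $X$. Let $\Omega$ denote the set of closed subschemes $W$ of $Y$ such that $Z_W\hookrightarrow X_W$ is an isomorphism, and denote by $\Sigma_{\Omega}$ the closed subscheme $\Sigma_{W\in\Omega}W$ of $Y$ (schematic union). If $p$ is $\aleph_1$-projective, then the scheme $\Sigma_{\Omega}$ represents the functor $\mathrm{Iso}_p^Z$.
   Context: For a morphism $T\to Y$, write $X_T=X\times_Y T$ and $Z_T=Z\times_Y T$. The contravariant functor $\mathrm{Iso}_p^Z$ from $Y$-schemes to sets sends $T\to Y$ to a one-point set $\{*\}$ if $Z_T\to X_T$ is an isomorphism, and to $\emptyset$ otherwise. Thus a closed subscheme $Y'$ of $Y$ represents $\mathrm{Iso}_p^Z$ when: a morphism $T\to Y$ factorises through $Y'\hookrightarrow Y$ if and only if $Z_T\hookrightarrow X_T$ is an isomorphism. Schematic union: for a family $\{Y_l\}_l$ of closed subschemes of a scheme $Y$, with quasi-coherent ideals $\mathscr{I}_l$, $\Sigma_l Y_l$ is the closed subscheme of $Y$ corresponding to the quasi-coherent ideal $\bigcap_l\mathscr{I}_l$ (the intersection being taken among quasi-coherent ideals, i.e. the largest quasi-coherent ideal contained in every $\mathscr{I}_l$), so it is the smallest closed subscheme containing every $Y_l$. An $R$-module $M$ is Mittag-Leffler if for every family $(Q_i)_{i\in I}$ of $R$-modules the natural homomorphism $M\otimes_R\prod_i Q_i\to\prod_i M\otimes_R Q_i$ is injective. A ring homomorphism $A\to B$ is $\aleph_1$-projective if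 $B$ is a flat and Mittag-Leffler $A$-module. A morphism $p\colon X\to Y$ is $\aleph_1$-projective if there are an affine open cover $\{U_i\}_i$ of $Y$ and, for every $i$, an affine open cover $\{V_{i,j}\}_j$ of $p^{-1}(U_i)$ such that for all $i,j$ the ring homomorphism corresponding to $V_{i,j}\to U_i$ is $\aleph_1$-projective. *)

theory Defs
  imports
    "HOL-Analysis.Abstract_Topology"
    "HOL-Algebra.QuotRing"
    "HOL-Algebra.Module"
    "HOL-Algebra.Free_Abelian_Groups"
begin

text \<open>This shadows the ring operation of \<open>HOL-Algebra\<close>.\<close>

hide_const (open) Wellorder_Constructions.zero

section \<open>Commutative algebra\<close>

subsection \<open>Products and localisations of rings\<close>

definition pi_ring :: "'i set \<Rightarrow> ('i \<Rightarrow> ('a, 'b) ring_scheme) \<Rightarrow> ('i \<Rightarrow> 'a) ring" where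
  "pi_ring I R =
     \<lparr>carrier = (\<Pi>\<^sub>E i\<in>I. carrier (R i)),
      mult = (\<lambda>f g. \<lambda>i\<in>I. f i \<otimes>\<^bsub>R i\<^esub> g i),
      one = (\<lambda>i\<in>I. \<one>\<^bsub>R i\<^esub>),
      zero = (\<lambda>i\<in>I. \<zero>\<^bsub>R i\<^esub>),
      add = (\<lambda>f g. \<lambda>i\<in>I. f i \<oplus>\<^bsub>R i\<^esub> g i)\<rparr>"

text \<open>A fraction is the equivalence class of all pairs (numerator, denominator) that represent it.\<close>

definition frac :: "('a, 'b) ring_scheme \<Rightarrow> 'a set \<Rightarrow> 'a \<Rightarrow> 'a \<Rightarrow> ('a \<times> 'a) set" where
  "frac A S a s =
     {(b, t). b \<in> carrier A \<and> t \<in> S \<and>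
        (\<exists>u\<in>S. u \<otimes>\<^bsub>A\<^esub> (a \<otimes>\<^bsub>A\<^esub> t) = u \<otimes>\<^bsub>A\<^esub> (b \<otimes>\<^bsub>A\<^esub> s))}"

definition localisation :: "('a, 'b) ring_scheme \<Rightarrow> 'a set \<Rightarrow> ('a \<times> 'a) set ring" where
  "localisation A S =
     \<lparr>carrier = {frac A S a s | a s. a \<in> carrier A \<and> s \<in> S},
      mult = (\<lambda>x y. THE z. \<exists>a\<in>carrier A. \<exists>b\<in>carrier A. \<exists>s\<in>S. \<exists>t\<in>S.
                x = frac A S a s \<and> y = frac A S b t \<and>
                z = frac A S (a \<otimes>\<^bsub>A\<^esub> b) (s \<otimes>\<^bsub>A\<^esub> t)),
      one = frac A S \<one>\<^bsub>A\<^esub> \<one>\<^bsub>A\<^esub>,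
      zero = frac A S \<zero>\<^bsub>A\<^esub> \<one>\<^bsub>A\<^esub>,
      add = (\<lambda>x y. THE z. \<exists>a\<in>carrier A. \<exists>b\<in>carrier A. \<exists>s\<in>S. \<exists>t\<in>S.
                x = frac A S a s \<and> y = frac A S b t \<and>
                z = frac A S (a \<otimes>\<^bsub>A\<^esub> t \<oplus>\<^bsub>A\<^esub> b \<otimes>\<^bsub>A\<^esub> s) (s \<otimes>\<^bsub>A\<^esub> t))\<rparr>"

definition local_ring :: "('a, 'b) ring_scheme \<Rightarrow> bool" where
  "local_ring R \<longleftrightarrow> cring R \<and> (\<exists>!M. maximalideal M R)"


subsection \<open>Tensor products, flat and Mittag-Leffler modules\<close>

definition module_hom :: "('a, 'c) ring_scheme \<Rightarrow> ('a, 'm, 'd) module_scheme \<Rightarrow>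
    ('a, 'n, 'e) module_scheme \<Rightarrow> ('m \<Rightarrow> 'n) set" where
  "module_hom R M N = {f \<in> hom (add_monoid M) (add_monoid N).
     \<forall>r\<in>carrier R. \<forall>m\<in>carrier M. f (r \<odot>\<^bsub>M\<^esub> m) = r \<odot>\<^bsub>N\<^esub> f m}"

definition prod_module :: "'i set \<Rightarrow> ('i \<Rightarrow> ('a, 'm) module) \<Rightarrow> ('a, 'i \<Rightarrow> 'm) module" where
  "prod_module I Q =
     \<lparr>carrier = carrier (pi_ring I Q), mult = mult (pi_ring I Q), one = one (pi_ring I Q),
      zero = zero (pi_ring I Q), add = add (pi_ring I Q),
      smult = (\<lambda>r f. \<lambda>i\<in>I. r \<odot>\<^bsub>Q i\<^esub> f i)\<rparr>"

abbreviation tensor_free :: "('a, 'm, 'd) module_scheme \<Rightarrow> ('a, 'n, 'e) module_scheme \<Rightarrow>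
    ('m \<times> 'n \<Rightarrow>\<^sub>0 int) monoid" where
  "tensor_free M N \<equiv> free_Abelian_group (carrier M \<times> carrier N)"

definition tensor_relations :: "('a, 'c) ring_scheme \<Rightarrow> ('a, 'm, 'd) module_scheme \<Rightarrow>
    ('a, 'n, 'e) module_scheme \<Rightarrow> ('m \<times> 'n \<Rightarrow>\<^sub>0 int) set" where
  "tensor_relations R M N = generate (tensor_free M N)
     ({frag_of (x \<oplus>\<^bsub>M\<^esub> x', y) - frag_of (x, y) - frag_of (x', y) | x x' y.
         x \<in> carrier M \<and> x' \<in> carrier M \<and> y \<in> carrier N} \<union>
      {frag_of (x, y \<oplus>\<^bsub>N\<^esub> y') - frag_of (x, y) - frag_of (x, y') | x y y'.
         x \<in> carrier M \<and> y \<in> carrier N \<and> y' \<in> carrier N} \<union>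
      {frag_of (r \<odot>\<^bsub>M\<^esub> x, y) - frag_of (x, r \<odot>\<^bsub>N\<^esub> y) | r x y.
         r \<in> carrier R \<and> x \<in> carrier M \<and> y \<in> carrier N})"

text \<open>Only the underlying abelian group of the tensor product is needed, since injectivity of
  a homomorphism does not refer to the scalar multiplication.\<close>

definition tensor :: "('a, 'c) ring_scheme \<Rightarrow> ('a, 'm, 'd) module_scheme \<Rightarrow>
    ('a, 'n, 'e) module_scheme \<Rightarrow> ('m \<times> 'n \<Rightarrow>\<^sub>0 int) set monoid" where
  "tensor R M N = tensor_free M N Mod tensor_relations R M N"

definition pure_tensor :: "('a, 'c) ring_scheme \<Rightarrow> ('a, 'm, 'd) module_scheme \<Rightarrow>
    ('a, 'n, 'e) module_scheme \<Rightarrow> 'm \<Rightarrow> 'n \<Rightarrow> ('m \<times> 'n \<Rightarrow>\<^sub>0 int) set" where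
  "pure_tensor R M N x y = tensor_relations R M N #>\<^bsub>tensor_free M N\<^esub> frag_of (x, y)"

text \<open>
  HOL cannot quantify over all types inside a formula, so the test modules (and the index sets)
  in the two definitions below live in the single type \<open>(nat \<Rightarrow> 'a) set\<close>, where \<open>'a\<close> is
  the type of the ring \<open>R\<close>. This is no restriction.

  Let \<open>R\<^sup>(\<^sup>\<nat>\<^sup>)\<close> denote the free module of finitely supported sequences.
  Every finitely generated module is isomorphic to some \<open>R\<^sup>(\<^sup>\<nat>\<^sup>)/N\<close>, whose elements are cosets,
  i.e. elements of the type above; the type also contains copies of all ideals of \<open>R\<close>.
  So flatness in the sense below implies the criterion "\<open>M \<otimes> \<aa> \<rightarrow> M\<close> is
  injective for all ideals \<open>\<aa>\<close>", which implies flatness with respect to all modules.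

  For the Mittag-Leffler condition let \<open>z = \<Sum>\<^sub>k\<^sub><\<^sub>n m\<^sub>k \<otimes> q\<^sub>k\<close> map to zero in every
  \<open>M \<otimes> Q\<^sub>i\<close>, for an arbitrary family \<open>(Q\<^sub>i)\<close>. For each \<open>i\<close> there is a finitely generated
  submodule of \<open>Q\<^sub>i\<close> that contains all \<open>q\<^sub>k(i)\<close> and in whose tensor product with \<open>M\<close> the element
  \<open>\<Sum>\<^sub>k m\<^sub>k \<otimes> q\<^sub>k(i)\<close> is already zero; write it as \<open>R\<^sup>(\<^sup>\<nat>\<^sup>)/N\<^sub>i\<close> with
  \<open>q\<^sub>k(i)\<close> the class of the \<open>k\<close>-th basis vector for \<open>k < n\<close>. Index a family by the
  set of all occurring submodules \<open>N\<close>. Then \<open>z\<close> is the image of the element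
  \<open>\<Sum>\<^sub>k m\<^sub>k \<otimes> (e\<^sub>k mod N)\<^sub>N\<close> of \<open>M \<otimes> \<Prod>\<^sub>N R\<^sup>(\<^sup>\<nat>\<^sup>)/N\<close>, which has
  zero components and hence vanishes.
\<close>

type_synonym 'a test = "(nat \<Rightarrow> 'a) set"

definition flat_module :: "('a, 'c) ring_scheme \<Rightarrow> ('a, 'm, 'd) module_scheme \<Rightarrow> bool" where
  "flat_module R M \<longleftrightarrow> module R M \<and>
     (\<forall>(N :: ('a, 'a test) module) (N' :: ('a, 'a test) module) f.
        module R N \<longrightarrow> module R N' \<longrightarrow> f \<in> module_hom R N N' \<longrightarrow> inj_on f (carrier N) \<longrightarrow>
        (\<exists>h \<in> hom (tensor R M N) (tensor R M N').
           (\<forall>x\<in>carrier M. \<forall>y\<in>carrier N. h (pure_tensor R M N x y) = pure_tensor R M N' x (f y)) \<and>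
           inj_on h (carrier (tensor R M N))))"

text \<open>As pure tensors generate the tensor product, the map \<open>h\<close> here and above is the natural
  homomorphism.\<close>

definition mittag_leffler :: "('a, 'c) ring_scheme \<Rightarrow> ('a, 'm, 'd) module_scheme \<Rightarrow> bool" where
  "mittag_leffler R M \<longleftrightarrow> module R M \<and>
     (\<forall>(I :: 'a test set) (Q :: 'a test \<Rightarrow> ('a, 'a test) module).
        (\<forall>i\<in>I. module R (Q i)) \<longrightarrow>
        (\<exists>h \<in> hom (tensor R M (prod_module I Q)) (product_group I (\<lambda>i. tensor R M (Q i))).
           (\<forall>x\<in>carrier M. \<forall>q\<in>carrier (prod_module I Q).
              h (pure_tensor R M (prod_module I Q) x q) = (\<lambda>i\<in>I. pure_tensor R M (Q i) x (q i))) \<and>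
           inj_on h (carrier (tensor R M (prod_module I Q)))))"

definition module_via :: "('b, 'd) ring_scheme \<Rightarrow> ('a \<Rightarrow> 'b) \<Rightarrow> ('a, 'b) module" where
  "module_via B \<phi> =
     \<lparr>carrier = carrier B, mult = mult B, one = one B, zero = zero B, add = add B,
      smult = (\<lambda>a b. \<phi> a \<otimes>\<^bsub>B\<^esub> b)\<rparr>"

definition aleph1_projective_hom ::
    "('a, 'c) ring_scheme \<Rightarrow> ('b, 'd) ring_scheme \<Rightarrow> ('a \<Rightarrow> 'b) \<Rightarrow> bool" where
  "aleph1_projective_hom A B \<phi> \<longleftrightarrow> \<phi> \<in> ring_hom A B \<and>
     flat_module A (module_via B \<phi>) \<and> mittag_leffler A (module_via B \<phi>)"


section \<open>Ringed spaces and schemes\<close>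

subsection \<open>Ringed spaces, stalks\<close>

text \<open>\<open>res X U V\<close> is the restriction from \<open>U\<close> to \<open>V\<close>. Only the values of \<open>sec\<close> and \<open>res\<close> at
  open sets matter.\<close>

record ('p, 'r) ringed_space =
  pts :: "'p topology"
  sec :: "'p set \<Rightarrow> 'r ring"
  res :: "'p set \<Rightarrow> 'p set \<Rightarrow> 'r \<Rightarrow> 'r"

abbreviation points :: "('p, 'r) ringed_space \<Rightarrow> 'p set" where
  "points X \<equiv> topspace (pts X)"

abbreviation opn :: "('p, 'r) ringed_space \<Rightarrow> 'p set \<Rightarrow> bool" where
  "opn X U \<equiv> openin (pts X) U"

definition presheaf_of_rings :: "('p, 'r) ringed_space \<Rightarrow> bool" where
  "presheaf_of_rings X \<longleftrightarrow>
     (\<forall>U. opn X U \<longrightarrow> cring (sec X U)) \<and>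
     (\<forall>U V. opn X U \<longrightarrow> opn X V \<longrightarrow> V \<subseteq> U \<longrightarrow> res X U V \<in> ring_hom (sec X U) (sec X V)) \<and>
     (\<forall>U. opn X U \<longrightarrow> (\<forall>s\<in>carrier (sec X U). res X U U s = s)) \<and>
     (\<forall>U V W. opn X U \<longrightarrow> opn X V \<longrightarrow> opn X W \<longrightarrow> W \<subseteq> V \<longrightarrow> V \<subseteq> U \<longrightarrow>
        (\<forall>s\<in>carrier (sec X U). res X V W (res X U V s) = res X U W s))"

definition sheaf_of_rings :: "('p, 'r) ringed_space \<Rightarrow> bool" where
  "sheaf_of_rings X \<longleftrightarrow> presheaf_of_rings X \<and>
     (\<forall>\<U> s. (\<forall>U\<in>\<U>. opn X U) \<longrightarrow> (\<forall>U\<in>\<U>. s U \<in> carrier (sec X U)) \<longrightarrow>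
        (\<forall>U\<in>\<U>. \<forall>V\<in>\<U>. res X U (U \<inter> V) (s U) = res X V (U \<inter> V) (s V)) \<longrightarrow>
        (\<exists>!t. t \<in> carrier (sec X (\<Union>\<U>)) \<and> (\<forall>U\<in>\<U>. res X (\<Union>\<U>) U t = s U)))"

text \<open>The germ of \<open>s \<in> \<O>(U)\<close> at \<open>x\<close> is the set of all (neighbourhood, section) pairs that agree with
  \<open>s\<close> near \<open>x\<close>.\<close>

definition germ :: "('p, 'r) ringed_space \<Rightarrow> 'p \<Rightarrow> 'p set \<Rightarrow> 'r \<Rightarrow> ('p set \<times> 'r) set" where
  "germ X x U s =
     {(V, t). opn X V \<and> x \<in> V \<and> t \<in> carrier (sec X V) \<and>
        (\<exists>W. opn X W \<and> x \<in> W \<and> W \<subseteq> U \<inter> V \<and> res X U W s = res X V W t)}"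

definition stalk :: "('p, 'r) ringed_space \<Rightarrow> 'p \<Rightarrow> ('p set \<times> 'r) set ring" where
  "stalk X x =
     \<lparr>carrier = {germ X x U s | U s. opn X U \<and> x \<in> U \<and> s \<in> carrier (sec X U)},
      mult = (\<lambda>a b. THE c. \<exists>U s t. opn X U \<and> x \<in> U \<and> s \<in> carrier (sec X U) \<and> t \<in> carrier (sec X U) \<and>
                a = germ X x U s \<and> b = germ X x U t \<and> c = germ X x U (s \<otimes>\<^bsub>sec X U\<^esub> t)),
      one = germ X x (points X) \<one>\<^bsub>sec X (points X)\<^esub>,
      zero = germ X x (points X) \<zero>\<^bsub>sec X (points X)\<^esub>,
      add = (\<lambda>a b. THE c. \<exists>U s t. opn X U \<and> x \<in> U \<and> s \<in> carrier (sec X U) \<and> t \<in> carrier (sec X U) \<and>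
                a = germ X x U s \<and> b = germ X x U t \<and> c = germ X x U (s \<oplus>\<^bsub>sec X U\<^esub> t))\<rparr>"

definition locally_ringed_space :: "('p, 'r) ringed_space \<Rightarrow> bool" where
  "locally_ringed_space X \<longleftrightarrow> sheaf_of_rings X \<and> (\<forall>x\<in>points X. local_ring (stalk X x))"


subsection \<open>Morphisms\<close>

text \<open>\<open>smap f V\<close> is the comorphism from the sections on \<open>V\<close> to the sections on the preimage of
  \<open>V\<close>.\<close>

record ('p, 'r, 'q, 's) ringed_map =
  pmap :: "'p \<Rightarrow> 'q"
  smap :: "'q set \<Rightarrow> 's \<Rightarrow> 'r"

definition preim :: "('p, 'r) ringed_space \<Rightarrow> ('p, 'r, 'q, 's) ringed_map \<Rightarrow> 'q set \<Rightarrow> 'p set" where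
  "preim X f V = {x \<in> points X. pmap f x \<in> V}"

definition stalk_map :: "('p, 'r) ringed_space \<Rightarrow> ('q, 's) ringed_space \<Rightarrow>
    ('p, 'r, 'q, 's) ringed_map \<Rightarrow> 'p \<Rightarrow> ('q set \<times> 's) set \<Rightarrow> ('p set \<times> 'r) set" where
  "stalk_map X Y f x a = (THE b. \<exists>V s. opn Y V \<and> pmap f x \<in> V \<and> s \<in> carrier (sec Y V) \<and>
     a = germ Y (pmap f x) V s \<and> b = germ X x (preim X f V) (smap f V s))"

text \<open>Morphisms of locally ringed spaces; between schemes these are the morphisms of schemes. A
  homomorphism of local rings is local iff it reflects units.\<close>

definition morphism :: "('p, 'r) ringed_space \<Rightarrow> ('q, 's) ringed_space \<Rightarrow>
    ('p, 'r, 'q, 's) ringed_map \<Rightarrow> bool" where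
  "morphism X Y f \<longleftrightarrow>
     continuous_map (pts X) (pts Y) (pmap f) \<and>
     (\<forall>V. opn Y V \<longrightarrow> smap f V \<in> ring_hom (sec Y V) (sec X (preim X f V))) \<and>
     (\<forall>U V. opn Y U \<longrightarrow> opn Y V \<longrightarrow> V \<subseteq> U \<longrightarrow>
        (\<forall>s\<in>carrier (sec Y U).
           smap f V (res Y U V s) = res X (preim X f U) (preim X f V) (smap f U s))) \<and>
     (\<forall>x\<in>points X. \<forall>a\<in>carrier (stalk Y (pmap f x)).
        stalk_map X Y f x a \<in> Units (stalk X x) \<longrightarrow> a \<in> Units (stalk Y (pmap f x)))"

text \<open>Equality of morphisms \<open>X \<rightarrow> Y\<close>, which disregards values outside the carriers.\<close>

definition mor_eq :: "('p, 'r) ringed_space \<Rightarrow> ('q, 's) ringed_space \<Rightarrow>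
    ('p, 'r, 'q, 's) ringed_map \<Rightarrow> ('p, 'r, 'q, 's) ringed_map \<Rightarrow> bool" where
  "mor_eq X Y f g \<longleftrightarrow> (\<forall>x\<in>points X. pmap f x = pmap g x) \<and>
     (\<forall>V. opn Y V \<longrightarrow> (\<forall>s\<in>carrier (sec Y V). smap f V s = smap g V s))"

definition id_mor :: "('p, 'r, 'p, 'r) ringed_map" where
  "id_mor = \<lparr>pmap = (\<lambda>x. x), smap = (\<lambda>V s. s)\<rparr>"

text \<open>\<open>comp_mor Y f g\<close> is the composite \<open>X \<rightarrow> Y \<rightarrow> Z\<close> of \<open>f : X \<rightarrow> Y\<close> followed by \<open>g : Y \<rightarrow> Z\<close>.\<close>

definition comp_mor :: "('q, 's) ringed_space \<Rightarrow> ('p, 'r, 'q, 's) ringed_map \<Rightarrow>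
    ('q, 's, 'u, 'v) ringed_map \<Rightarrow> ('p, 'r, 'u, 'v) ringed_map" where
  "comp_mor Y f g =
     \<lparr>pmap = (\<lambda>x. pmap g (pmap f x)), smap = (\<lambda>V s. smap f (preim Y g V) (smap g V s))\<rparr>"

definition iso_mor :: "('p, 'r) ringed_space \<Rightarrow> ('q, 's) ringed_space \<Rightarrow>
    ('p, 'r, 'q, 's) ringed_map \<Rightarrow> bool" where
  "iso_mor X Y f \<longleftrightarrow> morphism X Y f \<and>
     (\<exists>g. morphism Y X g \<and> mor_eq X X (comp_mor Y f g) id_mor \<and> mor_eq Y Y (comp_mor X g f) id_mor)"


subsection \<open>Schemes\<close>

definition restrict_space :: "('p, 'r) ringed_space \<Rightarrow> 'p set \<Rightarrow> ('p, 'r) ringed_space" where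
  "restrict_space X U = X\<lparr>pts := subtopology (pts X) U\<rparr>"

text \<open>Sections of the structure sheaf of \<open>Spec A\<close> over \<open>U\<close> are the functions on \<open>U\<close> with values
  in the local rings of \<open>A\<close> that are locally given by a single fraction.\<close>

definition Spec :: "('a, 'b) ring_scheme \<Rightarrow> ('a set, 'a set \<Rightarrow> ('a \<times> 'a) set) ringed_space" where
  "Spec A =
     (let \<Z> = topology_generated_by {{\<pp>. primeideal \<pp> A \<and> f \<notin> \<pp>} | f. f \<in> carrier A};
          local_at = (\<lambda>\<pp>. localisation A (carrier A - \<pp>))
      in \<lparr>pts = \<Z>,
          sec = (\<lambda>U. (pi_ring U local_at)
             \<lparr>carrier := {s \<in> carrier (pi_ring U local_at).
                \<forall>\<pp>\<in>U. \<exists>V. openin \<Z> V \<and> \<pp> \<in> V \<and> V \<subseteq> U \<and>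
                  (\<exists>a\<in>carrier A. \<exists>f\<in>carrier A. \<forall>\<qq>\<in>V. f \<notin> \<qq> \<and> s \<qq> = frac A (carrier A - \<qq>) a f)}\<rparr>),
          res = (\<lambda>U V s. restrict s V)\<rparr>)"

text \<open>It suffices to consider rings \<open>A\<close> over the type of the sections, since \<open>A\<close> is necessarily
  isomorphic to the ring of global sections.\<close>

definition affine_scheme :: "('p, 'r) ringed_space \<Rightarrow> bool" where
  "affine_scheme X \<longleftrightarrow> locally_ringed_space X \<and>
     (\<exists>(A :: 'r ring) f. cring A \<and> iso_mor X (Spec A) f)"

definition affine_open :: "('p, 'r) ringed_space \<Rightarrow> 'p set \<Rightarrow> bool" where
  "affine_open X U \<longleftrightarrow> opn X U \<and> affine_scheme (restrict_space X U)"

definition scheme :: "('p, 'r) ringed_space \<Rightarrow> bool" where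
  "scheme X \<longleftrightarrow> locally_ringed_space X \<and> (\<forall>x\<in>points X. \<exists>U. x \<in> U \<and> affine_open X U)"

definition aleph1_projective :: "('p, 'r) ringed_space \<Rightarrow> ('q, 's) ringed_space \<Rightarrow>
    ('p, 'r, 'q, 's) ringed_map \<Rightarrow> bool" where
  "aleph1_projective X Y p \<longleftrightarrow>
     (\<exists>\<U>. (\<forall>U\<in>\<U>. affine_open Y U) \<and> \<Union>\<U> = points Y \<and>
        (\<forall>U\<in>\<U>. \<exists>\<V>. (\<forall>V\<in>\<V>. affine_open X V) \<and> \<Union>\<V> = preim X p U \<and>
           (\<forall>V\<in>\<V>. aleph1_projective_hom (sec Y U) (sec X V)
                      (\<lambda>s. res X (preim X p U) V (smap p U s)))))"


subsection \<open>Closed subschemes\<close>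

text \<open>Ideal sheaves are empty at non-open sets, so that distinct functions are distinct ideal
  sheaves.\<close>

definition ideal_sheaf :: "('p, 'r) ringed_space \<Rightarrow> ('p set \<Rightarrow> 'r set) \<Rightarrow> bool" where
  "ideal_sheaf X I \<longleftrightarrow>
     (\<forall>U. \<not> opn X U \<longrightarrow> I U = {}) \<and>
     (\<forall>U. opn X U \<longrightarrow> ideal (I U) (sec X U)) \<and>
     (\<forall>U V. opn X U \<longrightarrow> opn X V \<longrightarrow> V \<subseteq> U \<longrightarrow> (\<forall>s\<in>I U. res X U V s \<in> I V)) \<and>
     (\<forall>\<U> s. (\<forall>U\<in>\<U>. opn X U) \<longrightarrow> s \<in> carrier (sec X (\<Union>\<U>)) \<longrightarrow>
        (\<forall>U\<in>\<U>. res X (\<Union>\<U>) U s \<in> I U) \<longrightarrow> s \<in> I (\<Union>\<U>))"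

text \<open>Every point has an affine open neighbourhood \<open>U\<close> on which the ideal sheaf is the sheaf
  associated with an ideal \<open>\<aa>\<close> of \<open>\<O>(U)\<close>, i.e. the subsheaf of all sections whose germs lie in
  the extensions of \<open>\<aa>\<close> to the local rings.\<close>

definition quasi_coherent_ideal :: "('p, 'r) ringed_space \<Rightarrow> ('p set \<Rightarrow> 'r set) \<Rightarrow> bool" where
  "quasi_coherent_ideal X I \<longleftrightarrow> ideal_sheaf X I \<and>
     (\<forall>x\<in>points X. \<exists>U. x \<in> U \<and> affine_open X U \<and>
        (\<exists>\<aa>. ideal \<aa> (sec X U) \<and>
           (\<forall>V. opn X V \<longrightarrow> V \<subseteq> U \<longrightarrow>
              I V = {s \<in> carrier (sec X V). \<forall>y\<in>V. germ X y V s \<in> genideal (stalk X y) (germ X y U ` \<aa>)})))"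

definition ideal_stalk :: "('p, 'r) ringed_space \<Rightarrow> ('p set \<Rightarrow> 'r set) \<Rightarrow> 'p \<Rightarrow> ('p set \<times> 'r) set set" where
  "ideal_stalk X I x = {germ X x U s | U s. opn X U \<and> x \<in> U \<and> s \<in> I U}"

definition ideal_support :: "('p, 'r) ringed_space \<Rightarrow> ('p set \<Rightarrow> 'r set) \<Rightarrow> 'p set" where
  "ideal_support X I = {x \<in> points X. ideal_stalk X I x \<noteq> carrier (stalk X x)}"

text \<open>
  The closed subscheme corresponding to a quasi-coherent ideal \<open>I\<close>: its space is the support of
  \<open>\<O>/I\<close>, its structure sheaf is the restriction of \<open>\<O>/I\<close> to the support, whose sections are the
  families of elements of \<open>\<O>\<^sub>x/I\<^sub>x\<close> that are locally induced by a section of \<open>\<O>\<close>.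
  Throughout, a closed subscheme of \<open>X\<close> is given by its quasi-coherent ideal.\<close>

definition subscheme :: "('p, 'r) ringed_space \<Rightarrow> ('p set \<Rightarrow> 'r set) \<Rightarrow>
    ('p, 'p \<Rightarrow> ('p set \<times> 'r) set set) ringed_space" where
  "subscheme X I =
     (let quot = (\<lambda>x. stalk X x Quot ideal_stalk X I x)
      in \<lparr>pts = subtopology (pts X) (ideal_support X I),
          sec = (\<lambda>U. (pi_ring U quot)
             \<lparr>carrier := {s \<in> carrier (pi_ring U quot).
                \<forall>x\<in>U. \<exists>N. opn X N \<and> x \<in> N \<and> N \<inter> ideal_support X I \<subseteq> U \<and>
                  (\<exists>a\<in>carrier (sec X N). \<forall>z\<in>N \<inter> ideal_support X I.
                     s z = ideal_stalk X I z +>\<^bsub>stalk X z\<^esub> germ X z N a)}\<rparr>),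
          res = (\<lambda>U V s. restrict s V)\<rparr>)"

definition inclusion :: "('p, 'r) ringed_space \<Rightarrow> ('p set \<Rightarrow> 'r set) \<Rightarrow>
    ('p, 'p \<Rightarrow> ('p set \<times> 'r) set set, 'p, 'r) ringed_map" where
  "inclusion X I =
     \<lparr>pmap = (\<lambda>x. x),
      smap = (\<lambda>U s. \<lambda>x\<in>U \<inter> ideal_support X I. ideal_stalk X I x +>\<^bsub>stalk X x\<^esub> germ X x U s)\<rparr>"

text \<open>The quasi-coherent ideal of the schematic union of a set of closed subschemes.\<close>

definition schematic_union ::
    "('p, 'r) ringed_space \<Rightarrow> ('p set \<Rightarrow> 'r set) set \<Rightarrow> ('p set \<Rightarrow> 'r set)" where
  "schematic_union Y \<F> = (GREATEST I. quasi_coherent_ideal Y I \<and> (\<forall>J\<in>\<F>. I \<le> J))"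

definition factors_through :: "('t, 'v) ringed_space \<Rightarrow> ('p, 'r) ringed_space \<Rightarrow>
    ('p set \<Rightarrow> 'r set) \<Rightarrow> ('t, 'v, 'p, 'r) ringed_map \<Rightarrow> bool" where
  "factors_through T Y I g \<longleftrightarrow>
     (\<exists>h. morphism T (subscheme Y I) h \<and> mor_eq T Y g (comp_mor (subscheme Y I) h (inclusion Y I)))"


subsection \<open>Fibre products and the functor Iso\<close>

text \<open>Universal property of \<open>P = X \<times>\<^sub>Y T\<close> with projections \<open>a\<close>, \<open>b\<close>, tested on the schemes whose
  points and sections belong to the type \<open>'k\<close>.\<close>

definition fibre_product :: "('x, 'rx) ringed_space \<Rightarrow> ('t, 'rt) ringed_space \<Rightarrow>
    ('y, 'ry) ringed_space \<Rightarrow> ('x, 'rx, 'y, 'ry) ringed_map \<Rightarrow> ('t, 'rt, 'y, 'ry) ringed_map \<Rightarrow>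
    ('k, 'k) ringed_space \<Rightarrow> ('k, 'k, 'x, 'rx) ringed_map \<Rightarrow> ('k, 'k, 't, 'rt) ringed_map \<Rightarrow> bool" where
  "fibre_product X T Y p g P a b \<longleftrightarrow>
     scheme P \<and> morphism P X a \<and> morphism P T b \<and> mor_eq P Y (comp_mor X a p) (comp_mor T b g) \<and>
     (\<forall>(Q :: ('k, 'k) ringed_space) a' b'.
        scheme Q \<longrightarrow> morphism Q X a' \<longrightarrow> morphism Q T b' \<longrightarrow>
        mor_eq Q Y (comp_mor X a' p) (comp_mor T b' g) \<longrightarrow>
        (\<exists>h. morphism Q P h \<and> mor_eq Q X (comp_mor P h a) a' \<and> mor_eq Q T (comp_mor P h b) b' \<and>
           (\<forall>h'. morphism Q P h' \<longrightarrow> mor_eq Q X (comp_mor P h' a) a' \<longrightarrow>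
              mor_eq Q T (comp_mor P h' b) b' \<longrightarrow> mor_eq Q P h h')))"

text \<open>
  The type below is large enough to contain a copy of \<open>X \<times>\<^sub>Y T\<close> and of \<open>Z \<times>\<^sub>Y T\<close>, for \<open>Z\<close> a closed
  subscheme of \<open>X\<close>, so that the objects having the universal property above for this type are
  precisely the copies of the fibre product in the category of all schemes. Indeed, let \<open>\<kappa>\<close> be
  the (infinite) cardinality of \<open>'x + 'rx + 't + 'rt + nat\<close>. The stalks of \<open>X\<close> and \<open>T\<close>, being
  localisations of rings of sections over affine opens, have at most \<open>\<kappa>\<close> elements. A point of
  \<open>X \<times>\<^sub>Y T\<close> consists of points \<open>x\<close>, \<open>t\<close> and a prime ideal of \<open>\<O>\<^sub>x \<otimes> \<O>\<^sub>t\<close>, so there are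
  at most \<open>2\<^sup>\<kappa>\<close> points, and the stalks of \<open>X \<times>\<^sub>Y T\<close> have at most \<open>\<kappa>\<close> elements. A
  section over an open set is determined by its germs, so there are at most
  \<open>2\<^sup>(2\<^sup>\<kappa>)\<close> of them. As a closed subscheme of \<open>X \<times>\<^sub>Y T\<close>, the scheme \<open>Z \<times>\<^sub>Y T\<close> obeys the same
  bounds.\<close>

type_synonym ('x, 'rx, 't, 'rt) fp = "('x + 'rx + 't + 'rt + nat) set set"

text \<open>\<open>base_change_iso X Y p J T g\<close>: for the closed subscheme \<open>Z\<close> of \<open>X\<close> with ideal \<open>J\<close> and
  \<open>g : T \<rightarrow> Y\<close>, the base change \<open>Z\<^sub>T \<rightarrow> X\<^sub>T\<close> of the inclusion is an isomorphism, i.e.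
  \<open>Iso(T)\<close> is a one-point set.\<close>

definition base_change_iso :: "('x, 'rx) ringed_space \<Rightarrow> ('y, 'ry) ringed_space \<Rightarrow>
    ('x, 'rx, 'y, 'ry) ringed_map \<Rightarrow> ('x set \<Rightarrow> 'rx set) \<Rightarrow>
    ('t, 'rt) ringed_space \<Rightarrow> ('t, 'rt, 'y, 'ry) ringed_map \<Rightarrow> bool" where
  "base_change_iso X Y p J T g \<longleftrightarrow>
     (\<exists>(XT :: (('x, 'rx, 't, 'rt) fp, ('x, 'rx, 't, 'rt) fp) ringed_space) a b
        (ZT :: (('x, 'rx, 't, 'rt) fp, ('x, 'rx, 't, 'rt) fp) ringed_space) c d h.
        fibre_product X T Y p g XT a b \<and>
        fibre_product (subscheme X J) T Y (comp_mor X (inclusion X J) p) g ZT c d \<and>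
        morphism ZT XT h \<and>
        mor_eq ZT X (comp_mor XT h a) (comp_mor (subscheme X J) c (inclusion X J)) \<and>
        mor_eq ZT T (comp_mor XT h b) d \<and>
        iso_mor ZT XT h)"

definition Omega :: "('x, 'rx) ringed_space \<Rightarrow> ('y, 'ry) ringed_space \<Rightarrow>
    ('x, 'rx, 'y, 'ry) ringed_map \<Rightarrow> ('x set \<Rightarrow> 'rx set) \<Rightarrow> ('y set \<Rightarrow> 'ry set) set" where
  "Omega X Y p J =
     {W. quasi_coherent_ideal Y W \<and> base_change_iso X Y p J (subscheme Y W) (inclusion Y W)}"

end

(*
Over affine opens U of Y and V of the preimage of U, the sections of V form a flat Mittag-Leffler
module B over A = O(U).  Mapping B (x) prod A/a -> prod B/aB injectively, the Mittag-Leffler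
condition makes extension of ideals commute with arbitrary intersections, so there is a smallest
ideal a_U of A with J(V) contained in a_U B for all these V.

Let t be a point of T over U.  If the a_U die in O_{T,t} for all t, then J dies on X x T, which is the
base change condition.  Conversely, under this condition J(V) dies in Spec(B (x) O_{T,t}), and by
flatness every b with b (x) 1 = 0 lies in K B for the kernel K of A -> O_{T,t}; hence a_U <= K.
Testing this with T = Spec(O_{Y,y}/a_U O_{Y,y}) shows that the a_U agree at the stalks, so they glue
to a quasi-coherent ideal on Y, whose vanishing on T characterises the functor.  It is the smallest
element of Omega, and therefore the ideal of the schematic union.

The fibre product is the localisation of the presheaf of rings W |-> O(pr1 W) (x) O(pr2 W) on the
product space at those primes of its stalks that lie over both maximal ideals.
*)
theory Submission
 imports Defs "HOL-Algebra.Ring_Divisibility" "HOL-Library.Multiset" "HOL-Analysis.Product_Topology" "HOL-Algebra.Weak_Morphisms"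
begin

hide_const (open) Multiset.mult

text \<open>Two restrictions of the formal setting shape the work. The universal property in
  \<open>fibre_product\<close> is tested only on schemes over the type \<open>fp\<close>. Existence
  of a fibre product thus involves bounding its points, stalks and sections, and a test scheme has
  to be copied into \<open>fp\<close> before it can be mapped to a given fibre product. Test modules
  have to fit into the type \<open>test\<close> in the same way.

  A given fibre product enters through its universal property alone. Stalks of \<open>T\<close> are
  used instead of affine opens, because the behaviour of the smallest ideals under shrinking of
  \<open>U\<close> is not known beforehand; they are compared at points. Flatness yields
  \<open>K B\<close> since the quotient of \<open>A\<close> by \<open>K\<close> embeds into the
  stalk.

  Affine opens are handled through the locale \<open>chart\<close>, which lists what is used to
  construct and to compare morphisms to them. Affineness is proved by exhibiting a left inverse of
  the canonical morphism to the spectrum of the sections (\<open>affine_openI\<close>). Closed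
  subschemes and fibre products are recognised as schemes in this way, without computing their rings
  of sections.\<close>

abbreviation (input) equivalent (infixr "<->" 25) where "A <-> B == A \<longleftrightarrow> B"
abbreviation (input) elem_carrier (infix "el" 50) where "x el R == x : carrier R"
abbreviation (input) mult_in ("_ *[_] _" [70, 0, 71] 70) where "x *[R] y == x \<otimes>\<^bsub>R\<^esub> y"
abbreviation (input) add_in ("_ +[_] _" [65, 0, 66] 65) where "x +[R] y == x \<oplus>\<^bsub>R\<^esub> y"
abbreviation (input) uminus_in ("-[_] _" [0, 81] 80) where "-[R] x == \<ominus>\<^bsub>R\<^esub> x"
abbreviation (input) minus_in ("_ -[_] _" [65, 0, 66] 65) where "x -[R] y == x \<ominus>\<^bsub>R\<^esub> y"
abbreviation (input) zero_in ("0[_]") where "0[R] == \<zero>\<^bsub>R\<^esub>"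
abbreviation (input) one_in ("1[_]") where "1[R] == \<one>\<^bsub>R\<^esub>"
abbreviation (input) inv_in ("inv[_] _" [0, 81] 80) where "inv[R] x == inv\<^bsub>R\<^esub> x"
abbreviation (input) pow_in ("_ ^[_] _" [76, 0, 75] 75) where "x ^[R] n == x [^]\<^bsub>R\<^esub> n"
abbreviation (input) smult_in ("_ .[_] _" [70, 0, 71] 70) where "a .[M] x == a \<odot>\<^bsub>M\<^esub> x"

section \<open>Rings\<close>

lemma hom_car: "h : ring_hom R S ==> x el R ==> h x el S"
 by (auto simp: ring_hom_def)

lemma ring_hom_Units:
 assumes "h : ring_hom R S" "x : Units R"
 shows "h x : Units S"
proof -
 obtain y where y: "x el R" "y el R" "y *[R] x = 1[R]" "x *[R] y = 1[R]"
  using assms(2) by (auto simp: Units_def)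
 have "h y *[S] h x = 1[S]" "h x *[S] h y = 1[S]"
  using y ring_hom_mult[OF assms(1)] ring_hom_one[OF assms(1)] by metis+
 then show ?thesis
  using hom_car[OF assms(1)] y by (auto simp: Units_def)
qed

lemma hom_comp:
 assumes "f : ring_hom R S" "g : ring_hom S T"
 shows "(%x. g (f x)) : ring_hom R T"
 using ring_hom_trans[OF assms] unfolding comp_def .

lemma ring_hom_cong:
 assumes "f : ring_hom R S" "!!x. x el R ==> g x = f x" "ring R"
 shows "g : ring_hom R S"
proof -
 interpret ring R by fact
 show ?thesis using assms by (auto simp: ring_hom_def Pi_def)
qed

lemma ring_hom_inv:
 assumes "h : ring_hom R S" "x : Units R" "cring R" "cring S"
 shows "h (inv[R] x) = inv[S] (h x)"
proof -
 interpret R: cring R by fact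
 interpret S: cring S by fact
 have x: "x el R" "inv[R] x el R" using assms by auto
 have "h x *[S] h (inv[R] x) = 1[S]"
  using ring_hom_mult[OF assms(1) x] ring_hom_one[OF assms(1)] R.Units_r_inv[OF assms(2)] by simp
 then show ?thesis
  using x hom_car[OF assms(1)] S.comm_inv_char[of "h x" "h (inv[R] x)"]
  by metis
qed

lemma cring_vimage_ideal:
 assumes "h : ring_hom R S" "cring R" "cring S" "ideal I S"
 shows "ideal {r : carrier R. h r : I} R"
proof -
 interpret R: cring R by fact
 interpret S: cring S by fact
 interpret I: ideal I S by fact
 interpret ring_hom_ring R S h
  using assms R.ring_axioms S.ring_axioms by (simp add: ring_hom_ringI2)
 show ?thesis using ideal_vimage[OF assms(4)] .
qed

lemma (in cring) idealI':
 assumes "I <= carrier R" "\<zero> : I" "!!x y. x : I ==> y : I ==> x \<oplus> y : I"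
  "!!a x. a el R ==> x : I ==> a \<otimes> x : I"
 shows "ideal I R"
proof (rule idealI)
 show "ring R" by (rule ring_axioms)
 have neg: "\<ominus> x : I" if "x : I" for x
 proof -
  have "\<ominus> \<one> \<otimes> x : I" using that assms(4) by simp
  moreover have "\<ominus> \<one> \<otimes> x = \<ominus> x" using that assms(1) by (simp add: l_minus subset_iff)
  ultimately show ?thesis by simp
 qed
 show "subgroup I (add_monoid R)"
  by (rule add.subgroupI) (use assms neg in "auto simp flip: a_inv_def")
 show "a : I ==> x el R ==> x \<otimes> a : I" for a x using assms by blast
 show "a : I ==> x el R ==> a \<otimes> x : I" for a x
  using assms m_comm by (metis subsetD)
qed

lemma cringI':
 fixes R (structure)
 assumes "\<zero> el R" "\<one> el R" "!!x. x el R ==> EX y:carrier R. y \<oplus> x = \<zero>"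
  "!!x y z. x el R ==> y el R ==> z el R ==> x \<oplus> y el R & x \<otimes> y el R & x \<oplus> y \<oplus> z = x \<oplus> (y \<oplus> z)
   & x \<oplus> y = y \<oplus> x & \<zero> \<oplus> x = x & x \<otimes> y \<otimes> z = x \<otimes> (y \<otimes> z) & x \<otimes> y = y \<otimes> x
   & \<one> \<otimes> x = x & (x \<oplus> y) \<otimes> z = x \<otimes> z \<oplus> y \<otimes> z"
 shows "cring R"
 by (intro cringI abelian_groupI comm_monoidI) (use assms in metis)+

subsection \<open>Prime ideals\<close>

definition mult_closed :: "('a, 'b) ring_scheme => 'a set => bool" where
 "mult_closed R S <-> S <= carrier R & 1[R] : S & (ALL a:S. ALL b:S. a *[R] b : S)"

text \<open>Zorn's lemma on the ideals that contain \<open>c\<close> and avoid \<open>S\<close>; the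
  union bounds a nonempty chain, and \<open>c\<close> bounds the empty one. General \<open>S\<close>
  leads to primes in \<open>prime_disjoint\<close>, while \<open>S = {\<one>}\<close> leads to
  maximal ideals in \<open>local_ringD\<close>.\<close>

lemma (in cring) maximal_disjoint_ideal:
 assumes "ideal c R" "mult_closed R S" "c Int S = {}"
 obtains P where "ideal P R" "c <= P" "P Int S = {}"
  "!!J. ideal J R ==> P <= J ==> J Int S = {} ==> J = P"
proof -
 let ?A = "{I. ideal I R & c <= I & I Int S = {}}"
 have "EX U:?A. ALL X:C. X <= U" if C: "subset.chain ?A C" for C
 proof (cases "C = {}")
  case False
  then have "ideal (\<Union>C) R" using chain_Union_is_ideal[of C] C by (auto simp: subset.chain_def)
  then show ?thesis using False C by (intro bexI[of _ "\<Union>C"]) (auto simp: subset.chain_def)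
 qed (use assms in blast)
 then have "EX M:?A. ALL X:?A. M <= X --> X = M" by (rule subset_Zorn)
 then obtain P where P: "P : ?A" "ALL X:?A. P <= X --> X = P" by (elim bexE)
 then show ?thesis by (intro that[of P]) auto
qed

lemma (in cring) prime_disjoint:
 assumes "ideal c R" "mult_closed R S" "c Int S = {}"
 obtains P where "primeideal P R" "c <= P" "P Int S = {}"
proof -
 obtain P where P: "ideal P R" "c <= P" "P Int S = {}"
  "!!J. ideal J R ==> P <= J ==> J Int S = {} ==> J = P"
  using maximal_disjoint_ideal[OF assms] by blast
 interpret P: ideal P R by fact
 have S: "S <= carrier R" "\<one> : S" "!!a b. a : S ==> b : S ==> a \<otimes> b : S"
  using assms by (auto simp: mult_closed_def)
 \<comment> \<open>By maximality, adjoining an element outside \<open>P\<close> produces an element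
   of \<open>S\<close>. If \<open>a\<close> and \<open>b\<close> are both outside, the product of
   the two elements obtained lies in \<open>S\<close>, and it lies in \<open>P\<close> as soon as
   \<open>a \<otimes> b\<close> does.\<close>
 have meet: "EX p:P. EX r:carrier R. p \<oplus> r \<otimes> a : S" if a: "a el R" "a ~: P" for a
 proof (rule ccontr)
  assume n: "~ ?thesis"
  let ?J = "P <+>\<^bsub>R\<^esub> PIdl a"
  have J: "x : ?J <-> (EX p:P. EX r:carrier R. x = p \<oplus> r \<otimes> a)" for x
   by (auto simp: set_add_def set_mult_def cgenideal_def)
  have "p : ?J" if "p : P" for p unfolding J using that a by (intro bexI[of _ p] bexI[of _ \<zero>]) auto
  then have sub: "P <= ?J" by (rule subsetI)
  have "?J Int S = {}" unfolding disjoint_iff J using n by blast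
  then have "?J = P" by (rule P(4)[OF add_ideals[OF P(1) cgenideal_ideal[OF a(1)]] sub])
  moreover have "a : ?J" unfolding J using a by (intro bexI[of _ \<zero>] bexI[of _ \<one>]) auto
  ultimately show False using a by blast
 qed
 have "primeideal P R"
 proof (rule primeidealI[OF P(1) cring_axioms])
  show "carrier R ~= P" using P(3) S by blast
  fix a b assume ab: "a el R" "b el R" "a \<otimes> b : P"
  show "a : P | b : P"
  proof (rule ccontr)
   assume "~ ?thesis"
   then obtain p r p' r' where *: "p : P" "r el R" "p \<oplus> r \<otimes> a : S"
    "p' : P" "r' el R" "p' \<oplus> r' \<otimes> b : S" using meet ab by metis
   have "(p \<oplus> r \<otimes> a) \<otimes> (p' \<oplus> r' \<otimes> b) = (p' \<oplus> r' \<otimes> b) \<otimes> p \<oplus> ((r \<otimes> a) \<otimes> p' \<oplus> (r \<otimes> r') \<otimes> (a \<otimes> b))"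
    using * ab P.Icarr by algebra
   moreover have "... : P"
    using * ab P.Icarr by (simp add: P.I_l_closed)
   ultimately show False using S(3)[OF *(3,6)] P(3) by auto
  qed
 qed
 then show ?thesis using that P by blast
qed

lemma primeideal_one: "primeideal P R ==> 1[R] ~: P"
 using ideal.one_imp_carrier primeideal.I_notcarr primeideal.axioms(1) by metis

lemma (in cring) Units_iff: "a : Units R <-> a el R & (EX b:carrier R. a \<otimes> b = \<one>)"
 using m_comm unfolding Units_def by auto

lemma (in cring) Units_mult_iff:
 assumes "a el R" "b el R" shows "a \<otimes> b : Units R <-> a : Units R & b : Units R"
proof
 assume "a \<otimes> b : Units R"
 then obtain c where c: "c el R" "a \<otimes> b \<otimes> c = \<one>" using Units_iff by blast
 then have "a \<otimes> (b \<otimes> c) = \<one>" "b \<otimes> (a \<otimes> c) = \<one>" using assms by (simp_all add: m_ac)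
 then show "a : Units R & b : Units R" using assms c Units_iff by blast
qed auto

text \<open>A nonunit lies in some maximal ideal, obtained from
  \<open>maximal_disjoint_ideal\<close> with \<open>S = {\<one>}\<close>, and hence in the only one.
  The resulting criterion on sums of two elements no longer mentions ideals and can be carried back
  along homomorphisms.\<close>

lemma local_ringD:
 fixes R (structure)
 assumes "local_ring R"
 shows "cring R" "1[R] ~= 0[R]"
  "!!a b. a el R ==> b el R ==> a +[R] b : Units R ==> a : Units R | b : Units R"
proof -
 show "cring R" using assms by (simp add: local_ring_def)
 then interpret cring R .
 obtain M where M: "maximalideal M R" "!!N. maximalideal N R ==> N = M"
  using assms by (auto simp: local_ring_def)
 interpret M: maximalideal M R by fact
 have oneM: "\<one> ~: M" using M.one_imp_carrier M.I_notcarr by metis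
 then show "\<one> ~= \<zero>" using M.zero_closed by auto
 have inM: "a : M" if a: "a el R" "a ~: Units R" for a
 proof -
  have "PIdl a Int {\<one>} = {}" using a m_comm by (auto simp: cgenideal_def Units_iff)
  moreover have "mult_closed R {\<one>}" by (auto simp: mult_closed_def)
  ultimately obtain P where P: "ideal P R" "PIdl a <= P" "P Int {\<one>} = {}"
   "!!J. ideal J R ==> P <= J ==> J Int {\<one>} = {} ==> J = P"
   using maximal_disjoint_ideal[OF cgenideal_ideal[OF a(1)]] by metis
  have "maximalideal P R"
   by (rule maximalidealI[OF P(1)]) (use P(3,4) ideal.one_imp_carrier in blast)+
  then show ?thesis using M(2) P(2) cgenideal_self[OF a(1)] by blast
 qed
 fix a b assume ab: "a el R" "b el R" "a \<oplus> b : Units R"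
 then have "\<one> : M" if "a \<oplus> b : M" using M.I_l_closed[OF that, of "inv (a \<oplus> b)"] by simp
 then show "a : Units R | b : Units R" using ab inM M.a_closed oneM by blast
qed

lemma local_ringI:
 fixes R (structure)
 assumes "cring R" "1[R] ~= 0[R]"
  "!!a b. a el R ==> b el R ==> a +[R] b : Units R ==> a : Units R | b : Units R"
 shows "local_ring R"
proof -
 interpret cring R by fact
 let ?M = "carrier R - Units R"
 have "\<zero> ~: Units R" using assms(2) by (auto simp: Units_iff)
 then have idl: "ideal ?M R"
  by (intro idealI') (use assms(3) Units_mult_iff in blast)+
 have proper: "J <= ?M" if J: "ideal J R" "J ~= carrier R" for J
 proof
  fix x assume x: "x : J"
  interpret J: ideal J R by fact
  have "\<one> : J" if "x : Units R" using J.I_l_closed[OF x, of "inv x"] that by simp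
  then show "x : ?M" using x J.Icarr J.one_imp_carrier J(2) by blast
 qed
 have "maximalideal ?M R"
  by (rule maximalidealI[OF idl]) (use proper in blast)+
 moreover have "N = ?M" if "maximalideal N R" for N
 proof -
  interpret N: maximalideal N R by fact
  show ?thesis using proper[OF N.is_ideal] N.I_notcarr N.I_maximal[OF idl] by auto
 qed
 ultimately show ?thesis unfolding local_ring_def using assms(1) by blast
qed

text \<open>This is the preimage of the maximal ideal of \<open>E\<close>. It is the way in which a
  homomorphism to a local ring selects a point of a spectrum.\<close>

lemma nonunit_prime:
 assumes R: "cring R" and E: "local_ring E" and h: "h : ring_hom R E"
 shows "primeideal {r : carrier R. h r ~: Units E} R" (is "primeideal ?I R")
proof -
 interpret R: cring R by fact
 interpret E: cring E by (rule local_ringD(1)[OF E])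
 note [simp] = hom_car[OF h] ring_hom_mult[OF h] ring_hom_add[OF h] ring_hom_one[OF h]
  ring_hom_zero[OF h R.ring_axioms E.ring_axioms]
 show ?thesis
 proof (rule primeidealI)
  have "0[E] ~: Units E" using local_ringD(2)[OF E] E.Units_iff by auto
  then show "ideal ?I R" by (intro R.idealI') (auto simp: E.Units_mult_iff dest: local_ringD(3)[OF E, rotated 2])
  have "1[R] ~: ?I" by simp
  then show "carrier R ~= ?I" using R.one_closed by metis
  show "a : ?I | b : ?I" if "a el R" "b el R" "a *[R] b : ?I" for a b
   using that by (simp add: E.Units_mult_iff)
 qed (rule R.cring_axioms)
qed

text \<open>The uniqueness half of the universal property of localisation, at a single element
  \<open>x\<close> with denominator \<open>d\<close>. It is used to compare stalk maps of two
  morphisms.\<close>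

lemma hom_eq_on_fraction:
 assumes E: "cring E" and h: "h : ring_hom S E" and h': "h' : ring_hom S E" and x: "x el S" "d el S" "h d : Units E"
  and e: "h d = h' d" "h (x *[S] d) = h' (x *[S] d)"
 shows "h x = h' x"
proof -
 interpret E: cring E by fact
 note c = hom_car[OF h x(1)] hom_car[OF h' x(1)]
 have "h d *[E] h x = h d *[E] h' x"
  using e(2) ring_hom_mult[OF h x(1,2)] ring_hom_mult[OF h' x(1,2)] E.m_comm[OF E.Units_closed[OF x(3)]] c e(1) by simp
 then show ?thesis using E.Units_l_cancel[OF x(3) c] by simp
qed

subsection \<open>Localisation\<close>

text \<open>The universal property is stated for any ring \<open>S\<close> whose elements are
  fractions of \<open>A\<close>, since it serves both for \<open>localisation\<close> and for the
  stalks over a chart. In place of a description of the kernel of \<open>g\<close>, the assumption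
  \<open>k\<close> asks that \<open>ps\<close> respect the identifications made by
  \<open>g\<close>.\<close>

lemma fraction_hom:
 assumes A: "cring A" and S: "cring S" and E: "cring E" and g: "g : ring_hom A S" and ps: "ps : ring_hom A E"
  and D: "1[A] : D" "!!d d'. d : D ==> d' : D ==> d *[A] d' : D" and u: "!!d. d : D ==> d el A & ps d : Units E"
  and fr: "!!x. x el S ==> EX a:carrier A. EX d:D. x *[S] g d = g a"
  and k: "!!a b. a el A ==> b el A ==> g a = g b ==> ps a = ps b"
 obtains h where "h : ring_hom S E" "!!x a d. x el S ==> a el A ==> d : D ==> x *[S] g d = g a ==> h x *[E] ps d = ps a"
proof -
 interpret A: cring A by fact
 interpret S: cring S by fact
 interpret E: cring E by fact
 note [simp] = hom_car[OF g] hom_car[OF ps] ring_hom_mult[OF g] ring_hom_mult[OF ps]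
  ring_hom_add[OF g] ring_hom_add[OF ps] u D
 \<comment> \<open>\<open>P x e\<close> holds if \<open>e\<close> is the value demanded by some
   representation of \<open>x\<close> as a fraction. By \<open>det\<close> such an \<open>e\<close>
   then satisfies the demand of every representation, so that values are unique and any convenient
   representation may be used for sums and products.\<close>
 define P where "P x e <-> e el E & (EX a:carrier A. EX d:D. x *[S] g d = g a & e *[E] ps d = ps a)" for x e
 have ex: "EX e. P x e" if x: "x el S" for x
 proof -
  obtain a d where "a el A" "d : D" "x *[S] g d = g a" using fr[OF x] by blast
  then show ?thesis unfolding P_def by (intro exI[of _ "ps a *[E] inv[E] ps d"] conjI bexI[of _ a] bexI[of _ d]) (auto simp: E.m_assoc)
 qed
 have det: "e *[E] ps d = ps a" if h: "x el S" "P x e" "a el A" "d : D" "x *[S] g d = g a" for x e a d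
 proof -
  obtain b c where b: "e el E" "b el A" "c : D" "x *[S] g c = g b" "e *[E] ps c = ps b" using h(2) unfolding P_def by blast
  have "g (c *[A] a) = g (d *[A] b)" using h b by (simp add: S.m_ac flip: h(5) b(4))
  then have "ps c *[E] ps a = ps d *[E] ps b" using k[of "c *[A] a" "d *[A] b"] h b by simp
  also have "... = ps c *[E] (e *[E] ps d)" unfolding b(5)[symmetric] using h(4) b(1,3) by (simp add: E.m_ac)
  finally show ?thesis using h b by simp
 qed
 have uniq: "e = e'" if h: "x el S" "P x e" "P x e'" for x e e'
 proof -
  obtain a d where d: "e' el E" "a el A" "d : D" "x *[S] g d = g a" "e' *[E] ps d = ps a" using h(3) unfolding P_def by blast
  have "ps d *[E] e = ps d *[E] e'" using det[OF h(1,2) d(2-4)] d h(2) by (simp add: P_def E.m_comm)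
  then show ?thesis using d h(2) by (simp add: P_def)
 qed
 define h where "h x = (SOME e. P x e)" for x
 have h: "P x (h x)" if "x el S" for x unfolding h_def by (rule someI_ex[OF ex[OF that]])
 have hI: "h x = e" if "x el S" "P x e" for x e by (rule uniq[OF that(1) h[OF that(1)] that(2)])
 have "h : ring_hom S E"
 proof (rule ring_hom_memI)
  fix x assume x: "x el S"
  show "h x el E" using h[OF x] by (simp add: P_def)
  fix y assume y: "y el S"
  obtain a d where a: "h x el E" "a el A" "d : D" "x *[S] g d = g a" "h x *[E] ps d = ps a" using h[OF x] unfolding P_def by blast
  obtain b c where b: "h y el E" "b el A" "c : D" "y *[S] g c = g b" "h y *[E] ps c = ps b" using h[OF y] unfolding P_def by blast
  note c = a b x y
  have cl: "g d el S" "g c el S" "ps d el E" "ps c el E" using a b by auto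
  show "h (x *[S] y) = h x *[E] h y"
  proof (rule hI)
   have "(x *[S] y) *[S] (g d *[S] g c) = (x *[S] g d) *[S] (y *[S] g c)"
    "(h x *[E] h y) *[E] (ps d *[E] ps c) = (h x *[E] ps d) *[E] (h y *[E] ps c)" using cl x y a(1) b(1) by algebra+
   then show "P (x *[S] y) (h x *[E] h y)" unfolding P_def using c
    by (intro conjI bexI[of _ "a *[A] b"] bexI[of _ "d *[A] c"]) auto
  qed (use x y in simp)
  show "h (x +[S] y) = h x +[E] h y"
  proof (rule hI)
   have "(x +[S] y) *[S] (g d *[S] g c) = (x *[S] g d) *[S] g c +[S] (y *[S] g c) *[S] g d"
    "(h x +[E] h y) *[E] (ps d *[E] ps c) = (h x *[E] ps d) *[E] ps c +[E] (h y *[E] ps c) *[E] ps d"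
    using cl x y a(1) b(1) by algebra+
   then show "P (x +[S] y) (h x +[E] h y)" unfolding P_def using c
    by (intro conjI bexI[of _ "a *[A] c +[A] b *[A] d"] bexI[of _ "d *[A] c"]) auto
  qed (use x y in simp)
 next
  show "h 1[S] = 1[E]" by (rule hI) (use ring_hom_one[OF g] ring_hom_one[OF ps] in \<open>auto simp: P_def intro!: bexI[of _ "1[A]"]\<close>)
 qed
 then show ?thesis using that det h by blast
qed

locale mult_set = cring R for R (structure) +
 fixes S
 assumes mult_closed: "mult_closed R S"
begin

abbreviation "L == localisation R S"
abbreviation fr (infixl "'/:" 75) where "a /: s == frac R S a s"

lemma S_carr: "s : S ==> s el R"
 and S_one [simp]: "\<one> : S"
 and S_mult [simp]: "s : S ==> t : S ==> s \<otimes> t : S"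
 using mult_closed by (auto simp: mult_closed_def)

lemma frac_eq_iff:
 assumes "a el R" "b el R" "s : S" "t : S"
 shows "a /: s = b /: t <-> (EX u:S. u \<otimes> (a \<otimes> t) = u \<otimes> (b \<otimes> s))"
proof
 assume eq: "a /: s = b /: t"
 have "(b, t) : b /: t" unfolding frac_def using assms S_one by blast
 then show "EX u:S. u \<otimes> (a \<otimes> t) = u \<otimes> (b \<otimes> s)" unfolding eq[symmetric] by (auto simp: frac_def)
next
 assume "EX u:S. u \<otimes> (a \<otimes> t) = u \<otimes> (b \<otimes> s)"
 then obtain u where u: "u : S" "u \<otimes> (a \<otimes> t) = u \<otimes> (b \<otimes> s)" by blast
 \<comment> \<open>Transitivity of equality of fractions: the multiplier is the product of the two
   given multipliers with the denominator of the fraction in the middle.\<close>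
 have sub: "(c, w) : b /: t"
  if h: "a el R" "b el R" "s : S" "t : S" "u : S" "u \<otimes> (a \<otimes> t) = u \<otimes> (b \<otimes> s)" "(c, w) : a /: s" for a b s t u c w
 proof -
  obtain v where v: "c el R" "w : S" "v : S" "v \<otimes> (a \<otimes> w) = v \<otimes> (c \<otimes> s)" using h by (auto simp: frac_def)
  note car = that(1-2) v(1) that(3-5)[THEN S_carr] v(2,3)[THEN S_carr]
  have "(u \<otimes> v \<otimes> s) \<otimes> (b \<otimes> w) = (v \<otimes> w) \<otimes> (u \<otimes> (b \<otimes> s))" using car by algebra
  also have "... = (u \<otimes> t) \<otimes> (v \<otimes> (a \<otimes> w))" unfolding h(6)[symmetric] using car by algebra
  also have "... = (u \<otimes> v \<otimes> s) \<otimes> (c \<otimes> t)" unfolding v(4) using car by algebra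
  finally show ?thesis using v that S_mult by (auto simp: frac_def intro!: bexI[of _ "u \<otimes> v \<otimes> s"])
 qed
 show "a /: s = b /: t"
  using sub[OF assms u] sub[OF assms(2,1,4,3) u(1) u(2)[symmetric]] by auto
qed

lemma frac_eqI:
 assumes "a el R" "b el R" "s : S" "t : S" "a \<otimes> t = b \<otimes> s"
 shows "a /: s = b /: t"
 by (subst frac_eq_iff[OF assms(1-4)]) (rule bexI[of _ \<one>], simp_all add: assms(5))

lemma
 assumes "a el R" "b el R" "s : S" "t : S"
 shows loc_mult: "a /: s *[L] b /: t = (a \<otimes> b) /: (s \<otimes> t)"
  and loc_add: "a /: s +[L] b /: t = (a \<otimes> t \<oplus> b \<otimes> s) /: (s \<otimes> t)"
proof -
 have "(a' \<otimes> b') /: (s' \<otimes> t') = (a \<otimes> b) /: (s \<otimes> t) & (a' \<otimes> t' \<oplus> b' \<otimes> s') /: (s' \<otimes> t') = (a \<otimes> t \<oplus> b \<otimes> s) /: (s \<otimes> t)"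
  if h: "a' el R" "b' el R" "s' : S" "t' : S" "a /: s = a' /: s'" "b /: t = b' /: t'" for a' b' s' t'
 proof -
  obtain u v where uv: "u : S" "u \<otimes> (a \<otimes> s') = u \<otimes> (a' \<otimes> s)" "v : S" "v \<otimes> (b \<otimes> t') = v \<otimes> (b' \<otimes> t)"
   using h assms frac_eq_iff by metis
  note car = assms(1,2) h(1,2) assms(3,4)[THEN S_carr] h(3,4)[THEN S_carr] uv(1,3)[THEN S_carr]
  have "(u \<otimes> v) \<otimes> ((a' \<otimes> b') \<otimes> (s \<otimes> t)) = (u \<otimes> (a' \<otimes> s)) \<otimes> (v \<otimes> (b' \<otimes> t))" using car by algebra
  also have "... = (u \<otimes> v) \<otimes> ((a \<otimes> b) \<otimes> (s' \<otimes> t'))" unfolding uv(2,4)[symmetric] using car by algebra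
  finally have 1: "(u \<otimes> v) \<otimes> ((a' \<otimes> b') \<otimes> (s \<otimes> t)) = (u \<otimes> v) \<otimes> ((a \<otimes> b) \<otimes> (s' \<otimes> t'))" .
  have "(u \<otimes> v) \<otimes> ((a' \<otimes> t' \<oplus> b' \<otimes> s') \<otimes> (s \<otimes> t))
   = (u \<otimes> (a' \<otimes> s)) \<otimes> (v \<otimes> t \<otimes> t') \<oplus> (v \<otimes> (b' \<otimes> t)) \<otimes> (u \<otimes> s \<otimes> s')" using car by algebra
  also have "... = (u \<otimes> v) \<otimes> ((a \<otimes> t \<oplus> b \<otimes> s) \<otimes> (s' \<otimes> t'))" unfolding uv(2,4)[symmetric] using car by algebra
  finally show ?thesis using 1 S_mult[OF uv(1,3)] car assms h by (subst (1 2) frac_eq_iff) auto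
 qed
 then show "a /: s *[L] b /: t = (a \<otimes> b) /: (s \<otimes> t)" "a /: s +[L] b /: t = (a \<otimes> t \<oplus> b \<otimes> s) /: (s \<otimes> t)"
  unfolding localisation_def monoid.simps ring.simps by (intro the_equality; use assms in blast)+
qed

lemma loc_carrier: "x el L <-> (EX a:carrier R. EX s:S. x = a /: s)"
 by (auto simp: localisation_def)

lemma frac_closed [simp]: "a el R ==> s : S ==> a /: s el L"
 by (auto simp: loc_carrier)

lemma loc_one: "1[L] = \<one> /: \<one>"
 and loc_zero: "0[L] = \<zero> /: \<one>"
 by (simp_all add: localisation_def)

lemma loc_cring: "cring L"
proof (rule cringI')
 fix x y z assume "x el L" "y el L" "z el L"
 then obtain a b c s t w where *: "a el R" "b el R" "c el R" "s : S" "t : S" "w : S"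
   "x = a /: s" "y = b /: t" "z = c /: w" by (auto simp: loc_carrier)
 note car = *(1-3) *(4-6)[THEN S_carr]
 have e: "((a \<otimes> t \<oplus> b \<otimes> s) \<otimes> c) /: (s \<otimes> t \<otimes> w) = (a \<otimes> c \<otimes> (t \<otimes> w) \<oplus> b \<otimes> c \<otimes> (s \<otimes> w)) /: (s \<otimes> w \<otimes> (t \<otimes> w))"
 proof (rule frac_eqI)
  show "(a \<otimes> t \<oplus> b \<otimes> s) \<otimes> c \<otimes> (s \<otimes> w \<otimes> (t \<otimes> w)) = (a \<otimes> c \<otimes> (t \<otimes> w) \<oplus> b \<otimes> c \<otimes> (s \<otimes> w)) \<otimes> (s \<otimes> t \<otimes> w)"
   using car by algebra
 qed (use * car in auto)
 show "x +[L] y el L & x *[L] y el L & x +[L] y +[L] z = x +[L] (y +[L] z) & x +[L] y = y +[L] x & 0[L] +[L] x = x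
  & x *[L] y *[L] z = x *[L] (y *[L] z) & x *[L] y = y *[L] x & 1[L] *[L] x = x & (x +[L] y) *[L] z = x *[L] z +[L] y *[L] z"
  using * car e by (simp add: loc_add loc_mult loc_zero loc_one m_ac a_ac l_distr r_distr)
next
 fix x assume "x el L"
 then obtain a s where x: "a el R" "s : S" "x = a /: s" by (auto simp: loc_carrier)
 show "EX y:carrier L. y +[L] x = 0[L]"
  by (rule bexI[of _ "(\<ominus> a) /: s"]) (use x S_carr S_one in "auto simp: loc_add loc_zero l_minus l_neg frac_eq_iff")
qed (simp_all add: loc_zero loc_one)

lemma loc_neg: "a el R ==> s : S ==> -[L] (a /: s) = (\<ominus> a) /: s"
 by (intro abelian_group.minus_equality[OF ring.axioms(1)[OF cring.axioms(1)[OF loc_cring]]])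
  (use S_carr S_one in "auto simp: loc_add loc_zero l_minus l_neg frac_eq_iff")

lemma loc_hom: "(%a. a /: \<one>) : ring_hom R L"
 by (auto simp: ring_hom_def loc_mult loc_add loc_one)

lemma loc_frac_eq_mult: "a el R ==> s : S ==> a /: s *[L] s /: \<one> = a /: \<one>"
 using S_carr by (simp add: loc_mult) (rule frac_eqI; simp)

lemma loc_unit:
 assumes "s : S" "t : S"
 shows "s /: t : Units L"
proof -
 have "(s \<otimes> t) /: (t \<otimes> s) = \<one> /: \<one>" by (rule frac_eqI) (use assms S_carr m_comm in auto)
 then show ?thesis unfolding cring.Units_iff[OF loc_cring] using assms S_carr by (auto simp: loc_mult loc_one intro!: bexI[of _ "t /: s"])
qed

lemma loc_eq_zero_iff: "a el R ==> s : S ==> a /: s = 0[L] <-> (EX u:S. u \<otimes> a = \<zero>)"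
 unfolding loc_zero using S_carr by (subst frac_eq_iff) auto

lemma lift:
 assumes E: "cring E" and ph: "ph : ring_hom R E" and u: "!!s. s : S ==> ph s : Units E"
 obtains h where "h : ring_hom L E" "!!a s. a el R ==> s : S ==> h (a /: s) *[E] ph s = ph a"
proof (rule fraction_hom[OF cring_axioms loc_cring E loc_hom ph S_one S_mult])
 interpret E: cring E by fact
 show "ph a = ph b" if ab: "a el R" "b el R" "a /: \<one> = b /: \<one>" for a b
 proof -
  obtain s where s: "s : S" "s \<otimes> a = s \<otimes> b" using ab by (auto simp: frac_eq_iff)
  then have "ph s *[E] ph a = ph s *[E] ph b" using ring_hom_mult[OF ph S_carr[OF s(1)]] ab by metis
  then show ?thesis using u[OF s(1)] hom_car[OF ph] ab by simp
 qed
 show "d el R & ph d : Units E" if "d : S" for d using that S_carr u by blast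
 show "EX a:carrier R. EX d:S. x *[L] d /: \<one> = a /: \<one>" if "x el L" for x
  using that loc_frac_eq_mult unfolding loc_carrier by metis
 fix h assume "h : ring_hom L E" "!!x a d. x el L ==> a el R ==> d : S ==> x *[L] d /: \<one> = a /: \<one> ==> h x *[E] ph d = ph a"
 then show thesis using loc_frac_eq_mult frac_closed by (intro that) blast+
qed

end

lemma prime_mult_set:
 assumes "primeideal P R"
 shows "mult_set R (carrier R - P)"
proof -
 interpret primeideal P R by fact
 show ?thesis
  by unfold_locales (use I_prime primeideal_one[OF assms] in "auto simp: mult_closed_def")
qed

lemma loc_prime_unit_iff:
 assumes "primeideal P R" "a el R" "s : carrier R - P"
 shows "frac R (carrier R - P) a s : Units (localisation R (carrier R - P)) <-> a ~: P"
proof -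
 interpret P: primeideal P R by fact
 interpret M: mult_set R "carrier R - P" by (rule prime_mult_set[OF assms(1)])
 show ?thesis
 proof
  assume "M.fr a s : Units M.L"
  then obtain b t where bt: "b el R" "t : carrier R - P" "M.fr a s *[M.L] M.fr b t = 1[M.L]"
   using cring.Units_iff[OF M.loc_cring] M.loc_carrier by auto
  then obtain u where u: "u : carrier R - P" "u *[R] (a *[R] b) = u *[R] (s *[R] t)"
   using assms M.frac_eq_iff[of "a *[R] b" "1[R]" "s *[R] t" "1[R]"] M.S_mult[OF assms(3) bt(2)] M.S_one by (auto simp: M.loc_mult M.loc_one)
  then have "u *[R] (s *[R] t) : P" if "a : P" using u(1) P.I_l_closed[OF P.I_r_closed[OF that bt(1)], of u] by simp
  then show "a ~: P" using M.S_mult u assms bt by blast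
 qed (use assms M.loc_unit in auto)
qed

lemma loc_prime_local:
 assumes "primeideal P R"
 shows "local_ring (localisation R (carrier R - P))"
proof -
 interpret P: primeideal P R by fact
 interpret M: mult_set R "carrier R - P" by (rule prime_mult_set[OF assms(1)])
 show ?thesis
 proof (rule local_ringI[OF M.loc_cring])
  show "1[M.L] ~= 0[M.L]"
   unfolding M.loc_one using P.zero_closed M.loc_eq_zero_iff[OF P.one_closed M.S_one] by auto
  fix x y assume "x el M.L" "y el M.L"
  then obtain a b s t where *: "a el R" "b el R" "s : carrier R - P" "t : carrier R - P"
   "x = M.fr a s" "y = M.fr b t" by (auto simp: M.loc_carrier)
  assume "x +[M.L] y : Units M.L"
  then have "a *[R] t +[R] b *[R] s ~: P"
   using * M.S_mult loc_prime_unit_iff[OF assms, of "a *[R] t +[R] b *[R] s" "s *[R] t"] by (auto simp: M.loc_add)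
  moreover have "a *[R] t +[R] b *[R] s : P" if "a : P" "b : P"
   using * that by (simp add: P.I_r_closed)
  ultimately show "x : Units M.L | y : Units M.L" using * loc_prime_unit_iff[OF assms] by blast
 qed
qed

section \<open>Ringed spaces\<close>

subsection \<open>Stalks\<close>

text \<open>A homomorphism that reflects units carries the criterion on sums back to its source.
  Stalks of newly built spaces are recognised as local by such a comparison with a ring known to be
  local.\<close>

lemma local_ring_reflect:
 fixes R (structure)
 assumes "cring R" "local_ring S" "h : ring_hom R S" "!!r. r el R ==> h r : Units S ==> r : Units R"
 shows "local_ring R"
proof (rule local_ringI)
 interpret R: cring R by fact
 interpret S: cring S by (rule local_ringD(1)[OF assms(2)])
 show "cring R" by fact
 show "\<one> ~= \<zero>"
  using ring_hom_one[OF assms(3)] ring_hom_zero[OF assms(3) R.ring_axioms S.ring_axioms] local_ringD(2)[OF assms(2)] by metis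
 fix a b assume ab: "a el R" "b el R" "a \<oplus> b : Units R"
 have "h a +[S] h b : Units S"
  using ring_hom_Units[OF assms(3) ab(3)] ring_hom_add[OF assms(3) ab(1,2)] by simp
 then have "h a : Units S | h b : Units S"
  using local_ringD(3)[OF assms(2)] hom_car[OF assms(3)] ab by simp
 then show "a : Units R | b : Units R" using assms(4) ab by blast
qed

locale presheaf =
 fixes X :: "('p, 'r) ringed_space"
 assumes presheaf: "presheaf_of_rings X"
begin

lemma sec_cring: "opn X U ==> cring (sec X U)"
 using presheaf by (auto simp: presheaf_of_rings_def)

lemma sec_ring: "opn X U ==> ring (sec X U)"
 using sec_cring cring.axioms(1) by blast

lemma res_hom: "opn X U ==> opn X V ==> V <= U ==> res X U V : ring_hom (sec X U) (sec X V)"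
 using presheaf by (auto simp: presheaf_of_rings_def)

lemma res_closed: "opn X U ==> opn X V ==> V <= U ==> s el sec X U ==> res X U V s el sec X V"
 by (rule hom_car[OF res_hom])

lemma res_id: "opn X U ==> s el sec X U ==> res X U U s = s"
 using presheaf by (auto simp: presheaf_of_rings_def)

lemma res_res: "opn X U ==> opn X V ==> opn X W ==> W <= V ==> V <= U ==> s el sec X U ==>
  res X V W (res X U V s) = res X U W s"
 using presheaf by (auto simp: presheaf_of_rings_def)

lemma germ_res:
 assumes o: "opn X U" "opn X V" "x : V" "V <= U" "s el sec X U"
 shows "germ X x V (res X U V s) = germ X x U s"
proof -
 have 1: "EX W'. opn X W' & x : W' & W' <= V Int N & res X V W' (res X U V s) = res X N W' r"
  if h: "opn X N" "r el sec X N" "opn X W" "x : W" "W <= U Int N" "res X U W s = res X N W r" for N r W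
 proof (intro exI[of _ "W Int V"] conjI)
  have "res X W (W Int V) (res X U W s) = res X W (W Int V) (res X N W r)" using h(6) by simp
  then show "res X V (W Int V) (res X U V s) = res X N (W Int V) r"
   using openin_Int[OF h(3) o(2)] h(1-3,5) o res_res[of U W "W Int V" s] res_res[of N W "W Int V" r] res_res[of U V "W Int V" s] by auto
 qed (use h o in auto)
 have 2: "EX W'. opn X W' & x : W' & W' <= U Int N & res X U W' s = res X N W' r"
  if "opn X W" "x : W" "W <= V Int N" "res X V W (res X U V s) = res X N W r" for N r W
  using that o res_res[of U V W s] by (intro exI[of _ W]) auto
 show ?thesis
  unfolding germ_def by (intro equalityI subrelI; unfold mem_Collect_eq case_prod_conv) (use 1 2 in meson)+
qed

lemma germ_eq_iff:
 assumes "opn X U" "x : U" "s el sec X U" "opn X V" "x : V" "t el sec X V"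
 shows "germ X x U s = germ X x V t <->
  (EX W. opn X W & x : W & W <= U Int V & res X U W s = res X V W t)"
proof
 assume eq: "germ X x U s = germ X x V t"
 have "(V, t) : germ X x U s" unfolding eq using assms by (auto simp: germ_def)
 then show "EX W. opn X W & x : W & W <= U Int V & res X U W s = res X V W t"
  unfolding germ_def by auto
qed (use assms germ_res in "metis le_inf_iff")

lemma germ_eqI:
 assumes "opn X U" "opn X V" "opn X W" "x : W" "W <= U" "W <= V" "s el sec X U" "t el sec X V"
  "res X U W s = res X V W t"
 shows "germ X x U s = germ X x V t"
 using assms germ_res[of U W x s] germ_res[of V W x t] by simp

lemma germ_eqE:
 assumes "germ X x U s = germ X x V t" "opn X U" "x : U" "s el sec X U" "opn X V" "x : V" "t el sec X V"
 obtains W where "opn X W" "x : W" "W <= U" "W <= V" "res X U W s = res X V W t"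
 using germ_eq_iff[OF assms(2-7)] assms(1) by auto

lemma stalk_carrier: "a el stalk X x <-> (EX U s. opn X U & x : U & s el sec X U & a = germ X x U s)"
 unfolding stalk_def by auto

lemma stalkE:
 assumes "a el stalk X x"
 obtains U s where "opn X U" "x : U" "s el sec X U" "a = germ X x U s"
 using assms unfolding stalk_carrier by blast

lemma stalkE_in:
 assumes "a el stalk X x" "opn X N" "x : N"
 obtains U s where "opn X U" "x : U" "U <= N" "s el sec X U" "a = germ X x U s"
proof -
 obtain U s where U: "opn X U" "x : U" "s el sec X U" "a = germ X x U s"
  using stalkE[OF assms(1)] .
 have o: "opn X (U Int N)" using U assms by auto
 show ?thesis
  by (rule that[of "U Int N" "res X U (U Int N) s"])
   (use U assms o res_closed germ_res[of U "U Int N" x s] in auto)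
qed

lemma stalkE2:
 assumes "a el stalk X x" "b el stalk X x"
 obtains U s t where "opn X U" "x : U" "s el sec X U" "a = germ X x U s"
  "t el sec X U" "b = germ X x U t"
proof -
 obtain U s where U: "opn X U" "x : U" "s el sec X U" "a = germ X x U s"
  using stalkE[OF assms(1)] .
 obtain V t where V: "opn X V" "x : V" "V <= U" "t el sec X V" "b = germ X x V t"
  using stalkE_in[OF assms(2) U(1,2)] .
 show ?thesis
  by (rule that[of V "res X U V s" t]) (use U V res_closed germ_res[of U V x s] in auto)
qed

lemma stalkE3:
 assumes "a el stalk X x" "b el stalk X x" "c el stalk X x"
 obtains U s t r where "opn X U" "x : U" "s el sec X U" "a = germ X x U s"
  "t el sec X U" "b = germ X x U t" "r el sec X U" "c = germ X x U r"
proof -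
 obtain U s t where U: "opn X U" "x : U" "s el sec X U" "a = germ X x U s"
  "t el sec X U" "b = germ X x U t"
  using stalkE2[OF assms(1,2)] .
 obtain V r where V: "opn X V" "x : V" "V <= U" "r el sec X V" "c = germ X x V r"
  using stalkE_in[OF assms(3) U(1,2)] .
 show ?thesis
  by (rule that[of V "res X U V s" "res X U V t" r])
   (use U V res_closed germ_res[of U V x s] germ_res[of U V x t] in auto)
qed

lemma germ_closed: "opn X U ==> x : U ==> s el sec X U ==> germ X x U s el stalk X x"
 unfolding stalk_carrier by blast

lemma
 assumes U: "opn X U" "x : U" "s el sec X U" "t el sec X U"
 shows stalk_mult: "germ X x U s *[stalk X x] germ X x U t = germ X x U (s *[sec X U] t)"
  and stalk_add: "germ X x U s +[stalk X x] germ X x U t = germ X x U (s +[sec X U] t)"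
proof -
 have "germ X x V (s' *[sec X V] t') = germ X x U (s *[sec X U] t) & germ X x V (s' +[sec X V] t') = germ X x U (s +[sec X U] t)"
  if V: "opn X V" "x : V" "s' el sec X V" "t' el sec X V"
   and e: "germ X x U s = germ X x V s'" "germ X x U t = germ X x V t'" for V s' t'
 proof -
  interpret U: cring "sec X U" by (rule sec_cring[OF U(1)])
  interpret V: cring "sec X V" by (rule sec_cring[OF V(1)])
  obtain W where W: "opn X W" "x : W" "W <= U" "W <= V" "res X U W s = res X V W s'"
   using germ_eqE[OF e(1) U(1-3) V(1-3)] .
  obtain W' where W': "opn X W'" "x : W'" "W' <= U" "W' <= V" "res X U W' t = res X V W' t'"
   using germ_eqE[OF e(2) U(1,2,4) V(1,2,4)] .
  have o: "opn X (W Int W')" "W Int W' <= U" "W Int W' <= V" "x : W Int W'" using W W' by auto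
  have "res X U (W Int W') s = res X V (W Int W') s'"
   using res_res[of U W "W Int W'" s] res_res[of V W "W Int W'" s'] W U V o by simp
  moreover have "res X U (W Int W') t = res X V (W Int W') t'"
   using res_res[of U W' "W Int W'" t] res_res[of V W' "W Int W'" t'] W' U V o by simp
  moreover note hU = res_hom[OF U(1) o(1,2)] and hV = res_hom[OF V(1) o(1,3)]
  note ring_hom_mult[OF hU U(3,4)] ring_hom_mult[OF hV V(3,4)] ring_hom_add[OF hU U(3,4)] ring_hom_add[OF hV V(3,4)]
  ultimately show ?thesis using germ_eqI[OF V(1) U(1) o(1,4,3,2)] U(3,4) V(3,4) by simp
 qed
 then show "germ X x U s *[stalk X x] germ X x U t = germ X x U (s *[sec X U] t)"
  "germ X x U s +[stalk X x] germ X x U t = germ X x U (s +[sec X U] t)"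
  unfolding stalk_def monoid.simps ring.simps by (intro the_equality; use U in blast)+
qed

lemma opn_sub: "opn X U ==> U <= points X"
 by (rule openin_subset)

lemma
 assumes U: "opn X U" "x : U"
 shows germ_one: "germ X x U 1[sec X U] = 1[stalk X x]" and germ_zero: "germ X x U 0[sec X U] = 0[stalk X x]"
proof -
 have P: "opn X (points X)" by simp
 note h = res_hom[OF P U(1) opn_sub[OF U(1)]] and r = germ_res[OF P U opn_sub[OF U(1)]]
 show "germ X x U 1[sec X U] = 1[stalk X x]" "germ X x U 0[sec X U] = 0[stalk X x]"
  using r[of "1[sec X (points X)]"] r[of "0[sec X (points X)]"] ring_hom_one[OF h] ring_hom_zero[OF h sec_ring[OF P] sec_ring[OF U(1)]]
   ring.ring_simprules(2,6)[OF sec_ring[OF P]] by (simp_all add: stalk_def)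
qed

lemma germ_hom: "opn X U ==> x : U ==> germ X x U : ring_hom (sec X U) (stalk X x)"
 by (rule ring_hom_memI) (auto simp: stalk_mult stalk_add germ_one germ_closed)

lemma stalk_cring:
 assumes x: "x : points X"
 shows "cring (stalk X x)"
proof (rule cringI')
 have P: "opn X (points X)" by simp
 interpret P: cring "sec X (points X)" by (rule sec_cring[OF P])
 show "0[stalk X x] el stalk X x" "1[stalk X x] el stalk X x"
  using hom_car[OF germ_hom[OF P x]] by (simp_all flip: germ_zero[OF P x] germ_one[OF P x])
 show "EX y:carrier (stalk X x). y +[stalk X x] a = 0[stalk X x]" if a: "a el stalk X x" for a
 proof -
  obtain U s where U: "opn X U" "x : U" "s el sec X U" "a = germ X x U s" using stalkE[OF a] .
  interpret C: cring "sec X U" by (rule sec_cring[OF U(1)])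
  show ?thesis
   by (rule bexI[of _ "germ X x U (-[sec X U] s)"]) (use U germ_closed in "auto simp: stalk_add C.l_neg germ_zero")
 qed
 fix a b c assume "a el stalk X x" "b el stalk X x" "c el stalk X x"
 then obtain U s t r where U: "opn X U" "x : U" "s el sec X U" "a = germ X x U s"
  "t el sec X U" "b = germ X x U t" "r el sec X U" "c = germ X x U r" by (rule stalkE3)
 interpret C: cring "sec X U" by (rule sec_cring[OF U(1)])
 show "a +[stalk X x] b el stalk X x & a *[stalk X x] b el stalk X x
  & a +[stalk X x] b +[stalk X x] c = a +[stalk X x] (b +[stalk X x] c) & a +[stalk X x] b = b +[stalk X x] a
  & 0[stalk X x] +[stalk X x] a = a & a *[stalk X x] b *[stalk X x] c = a *[stalk X x] (b *[stalk X x] c)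
  & a *[stalk X x] b = b *[stalk X x] a & 1[stalk X x] *[stalk X x] a = a
  & (a +[stalk X x] b) *[stalk X x] c = a *[stalk X x] c +[stalk X x] b *[stalk X x] c"
  using U by (simp add: stalk_mult stalk_add germ_closed C.a_ac C.m_ac C.r_distr flip: germ_zero[OF U(1,2)] germ_one[OF U(1,2)])
qed

text \<open>The stalk is the colimit of the sections over the neighbourhoods of \<open>x\<close>;
  the compatibility \<open>er\<close> makes the value independent of the representative of a
  germ.\<close>

lemma stalk_univ:
 assumes x: "x : points X" and R: "cring R"
  and e: "!!U. opn X U ==> x : U ==> e U : ring_hom (sec X U) R"
  and er: "!!U V s. opn X U ==> opn X V ==> x : V ==> V <= U ==> s el sec X U ==> e V (res X U V s) = e U s"
 obtains h where "h : ring_hom (stalk X x) R"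
  "!!U s. opn X U ==> x : U ==> s el sec X U ==> h (germ X x U s) = e U s"
proof -
 define h where "h a = (THE r. EX U s. opn X U & x : U & s el sec X U & a = germ X x U s & r = e U s)" for a
 have h: "h (germ X x U s) = e U s" if U: "opn X U" "x : U" "s el sec X U" for U s
  unfolding h_def
 proof (rule the_equality)
  fix r assume "EX V t. opn X V & x : V & t el sec X V & germ X x U s = germ X x V t & r = e V t"
  then obtain V t where V: "opn X V" "x : V" "t el sec X V" and g: "germ X x U s = germ X x V t"
   and r: "r = e V t" by blast
  obtain W where W: "opn X W" "x : W" "W <= U" "W <= V" "res X U W s = res X V W t"
   using germ_eqE[OF g U V] .
  then show "r = e U s" using er[of U W s] er[of V W t] U V r by simp
 qed (use U in blast)
 have "h : ring_hom (stalk X x) R"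
 proof (rule ring_hom_memI)
  show "h 1[stalk X x] = 1[R]"
   using h[of "points X" "1[sec X (points X)]"] germ_one[of "points X" x] x ring_hom_one[OF e[of "points X"]]
    ring.ring_simprules(6)[OF sec_ring, of "points X"] by simp
  fix a assume a: "a el stalk X x"
  then obtain U s where U: "opn X U" "x : U" "s el sec X U" "a = germ X x U s" by (rule stalkE)
  then show "h a el R" using h[OF U(1-3)] hom_car[OF e[OF U(1,2)]] by simp
  fix b assume b: "b el stalk X x"
  obtain U s t where U: "opn X U" "x : U" "s el sec X U" "a = germ X x U s"
   "t el sec X U" "b = germ X x U t" using stalkE2[OF a b] .
  interpret C: cring "sec X U" by (rule sec_cring[OF U(1)])
  show "h (a *[stalk X x] b) = h a *[R] h b" "h (a +[stalk X x] b) = h a +[R] h b"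
   using U h by (simp_all add: stalk_mult stalk_add ring_hom_mult[OF e[OF U(1,2)]] ring_hom_add[OF e[OF U(1,2)]])
 qed
 then show ?thesis using that h by blast
qed

text \<open>The inverse germ and the equation that defines it are both represented over some smaller
  neighbourhood.\<close>

lemma germ_unit_iff:
 assumes "opn X U" "x : U" "s el sec X U"
 shows "germ X x U s : Units (stalk X x) <-> (EX W. opn X W & x : W & W <= U & res X U W s : Units (sec X W))"
proof
 have x: "x : points X" using assms opn_sub by blast
 assume "germ X x U s : Units (stalk X x)"
 then obtain b where b: "b el stalk X x" "germ X x U s *[stalk X x] b = 1[stalk X x]"
  using cring.Units_iff[OF stalk_cring[OF x]] by blast
 obtain V t where V: "opn X V" "x : V" "V <= U" "t el sec X V" "b = germ X x V t"
  using stalkE_in[OF b(1) assms(1,2)] .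
 interpret C: cring "sec X V" by (rule sec_cring[OF V(1)])
 have r: "res X U V s el sec X V" using res_closed assms V by simp
 have "germ X x V (res X U V s *[sec X V] t) = germ X x V 1[sec X V]"
  using b V assms r germ_res[of U V x s] by (simp add: stalk_mult[symmetric] germ_one)
 then obtain W where W: "opn X W" "x : W" "W <= V" "res X V W (res X U V s *[sec X V] t) = res X V W 1[sec X V]"
  using germ_eqE[OF _ V(1,2) C.m_closed[OF r V(4)] V(1,2) C.one_closed] by metis
 have h: "res X V W : ring_hom (sec X V) (sec X W)" using res_hom V W by simp
 have "res X U W s *[sec X W] res X V W t = 1[sec X W]"
  using W(4) ring_hom_mult[OF h r V(4)] ring_hom_one[OF h] res_res[of U V W s] V W assms by simp
 moreover have "res X U W s el sec X W" "res X V W t el sec X W"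
  using res_closed V W assms by auto
 ultimately have "res X U W s : Units (sec X W)"
  using cring.Units_iff[OF sec_cring[OF W(1)]] by blast
 then show "EX W. opn X W & x : W & W <= U & res X U W s : Units (sec X W)"
  using W V by blast
next
 assume "EX W. opn X W & x : W & W <= U & res X U W s : Units (sec X W)"
 then obtain W where W: "opn X W" "x : W" "W <= U" "res X U W s : Units (sec X W)" by blast
 then show "germ X x U s : Units (stalk X x)"
  using ring_hom_Units[OF germ_hom[OF W(1,2)] W(4)] germ_res[of U W x s] assms by simp
qed

lemma germ_unit_nbhd:
 assumes "opn X U" "x : U" "s el sec X U" "germ X x U s : Units (stalk X x)"
 obtains W where "opn X W" "x : W" "W <= U" "res X U W s : Units (sec X W)"
  "!!y. y : W ==> germ X y U s : Units (stalk X y)"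
proof -
 obtain W where W: "opn X W" "x : W" "W <= U" "res X U W s : Units (sec X W)"
  using germ_unit_iff[OF assms(1-3)] assms(4) by blast
 have "germ X y U s : Units (stalk X y)" if "y : W" for y
  using germ_unit_iff[OF assms(1) _ assms(3), of y] W that by blast
 then show ?thesis using that W by blast
qed

lemma stalk_local_reflect:
 assumes x: "x : points X" and R: "local_ring R"
  and e: "!!U. opn X U ==> x : U ==> e U : ring_hom (sec X U) R"
  and er: "!!U V s. opn X U ==> opn X V ==> x : V ==> V <= U ==> s el sec X U ==> e V (res X U V s) = e U s"
  and eu: "!!U s. opn X U ==> x : U ==> s el sec X U ==> e U s : Units R ==> germ X x U s : Units (stalk X x)"
 shows "local_ring (stalk X x)"
proof -
 obtain h where h: "h : ring_hom (stalk X x) R"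
  "!!U s. opn X U ==> x : U ==> s el sec X U ==> h (germ X x U s) = e U s"
  by (rule stalk_univ[OF x local_ringD(1)[OF R], of e]) (assumption | rule e er that)+
 show ?thesis
 proof (rule local_ring_reflect[OF stalk_cring[OF x] R h(1)])
  fix a assume a: "a el stalk X x" "h a : Units R"
  obtain U s where U: "opn X U" "x : U" "s el sec X U" "a = germ X x U s" using stalkE[OF a(1)] .
  then show "a : Units (stalk X x)" using eu[OF U(1-3)] h(2)[OF U(1-3)] a by simp
 qed
qed

end

subsection \<open>Sheaves\<close>

locale sheaf = presheaf X for X :: "('p, 'r) ringed_space" +
 assumes sheaf: "sheaf_of_rings X"

lemma sheafI: "sheaf_of_rings X ==> sheaf X"
 by (simp add: sheaf_def sheaf_axioms_def presheaf_def sheaf_of_rings_def)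

context sheaf
begin

lemma glue:
 assumes "!!U. U : UU ==> opn X U" "!!U. U : UU ==> s U el sec X U"
  "!!U V. U : UU ==> V : UU ==> res X U (U Int V) (s U) = res X V (U Int V) (s V)"
 shows "EX! t. t el sec X (\<Union>UU) & (ALL U:UU. res X (\<Union>UU) U t = s U)"
proof -
 have "ALL UU s. (ALL U:UU. opn X U) --> (ALL U:UU. s U el sec X U) -->
    (ALL U:UU. ALL V:UU. res X U (U Int V) (s U) = res X V (U Int V) (s V)) -->
    (EX! t. t el sec X (\<Union>UU) & (ALL U:UU. res X (\<Union>UU) U t = s U))"
  using sheaf unfolding sheaf_of_rings_def by (rule conjunct2)
 then show ?thesis by (rule allE[of _ UU]) (use assms in blast)
qed

text \<open>The opens on which \<open>s\<close> and \<open>t\<close> restrict to the same section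
  cover \<open>U\<close>, and the uniqueness part of glueing over this cover identifies
  \<open>s\<close> with \<open>t\<close>.\<close>

lemma sec_eqI:
 assumes U: "opn X U" "s el sec X U" "t el sec X U"
  and g: "!!x. x : U ==> germ X x U s = germ X x U t"
 shows "s = t"
proof -
 define UU where "UU = {W. opn X W & W <= U & res X U W s = res X U W t}"
 have "x : \<Union>UU" if h: "x : U" for x
 proof -
  obtain W where "opn X W" "x : W" "W <= U" "res X U W s = res X U W t"
   using germ_eqE[OF g[OF h] U(1) h U(2) U(1) h U(3)] by metis
  then show ?thesis unfolding UU_def by blast
 qed
 then have un: "\<Union>UU = U" unfolding UU_def by blast
 have mem: "opn X V" "V <= U" "res X U V s = res X U V t" if "V : UU" for V
  using that unfolding UU_def by auto
 have "EX! r. r el sec X (\<Union>UU) & (ALL V:UU. res X (\<Union>UU) V r = res X U V s)"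
 proof (rule glue)
  fix V assume V: "V : UU"
  show "opn X V" "res X U V s el sec X V" using mem[OF V] U res_closed by auto
  fix W assume W: "W : UU"
  have o: "opn X (V Int W)" using mem[OF V] mem[OF W] by auto
  show "res X V (V Int W) (res X U V s) = res X W (V Int W) (res X U W s)"
   using res_res[of U V "V Int W" s] res_res[of U W "V Int W" s] o mem[OF V] mem[OF W] U by simp
 qed
 then have uniq: "EX! r. r el sec X U & (ALL V:UU. res X U V r = res X U V s)"
  unfolding un .
 show ?thesis
  by (rule ex1E[OF uniq]) (use U mem(3) in metis)
qed

lemma hom_by_germs:
 assumes U: "opn X U" and A: "cring A" and c: "!!a. a el A ==> f a el sec X U"
  and h: "!!x. x : U ==> (%a. germ X x U (f a)) : ring_hom A (stalk X x)"
 shows "f : ring_hom A (sec X U)"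
proof -
 interpret A: cring A by fact
 interpret U: cring "sec X U" by (rule sec_cring[OF U])
 show ?thesis
  by (intro ring_hom_memI sec_eqI[OF U])
   (simp_all add: c ring_hom_mult[OF h] ring_hom_add[OF h] ring_hom_one[OF h] germ_one[OF U] flip: stalk_mult[OF U] stalk_add[OF U])
qed

text \<open>Glueing in terms of germs: compatibility on overlaps comes for free, because sections
  with equal germs are equal. New sections are mostly produced in this form.\<close>

lemma glue_germs:
 assumes U: "opn X U"
  and loc: "!!x. x : U ==> EX N t. opn X N & x : N & N <= U & t el sec X N & (ALL y:N. germ X y N t = ga y)"
 obtains t where "t el sec X U" "!!y. y : U ==> germ X y U t = ga y"
proof -
 define P where "P N t <-> opn X N & N <= U & t el sec X N & (ALL y:N. germ X y N t = ga y)" for N t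
 define UU where "UU = {N. EX t. P N t}"
 define s where "s N = (SOME t. P N t)" for N
 have s: "P N (s N)" if "N : UU" for N
  using that unfolding UU_def s_def by (auto intro: someI_ex)
 have un: "\<Union>UU = U"
 proof
  show "\<Union>UU <= U" using s P_def by blast
  show "U <= \<Union>UU"
  proof
   fix x assume "x : U"
   then obtain N t where "x : N" "P N t" using loc[of x] unfolding P_def by auto
   then show "x : \<Union>UU" unfolding UU_def by blast
  qed
 qed
 have "EX! r. r el sec X (\<Union>UU) & (ALL V:UU. res X (\<Union>UU) V r = s V)"
 proof (rule glue)
  fix V assume V: "V : UU"
  show "opn X V" "s V el sec X V" using s[OF V] P_def by auto
  fix W assume W: "W : UU"
  have PV: "opn X V" "s V el sec X V" "!!y. y : V ==> germ X y V (s V) = ga y"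
   using s[OF V] P_def by auto
  have PW: "opn X W" "s W el sec X W" "!!y. y : W ==> germ X y W (s W) = ga y"
   using s[OF W] P_def by auto
  have o: "opn X (V Int W)" using PV PW by auto
  show "res X V (V Int W) (s V) = res X W (V Int W) (s W)"
  proof (rule sec_eqI[OF o])
   show "res X V (V Int W) (s V) el (sec X (V Int W))" "res X W (V Int W) (s W) el (sec X (V Int W))"
    using res_closed PV PW o by auto
   fix x assume x: "x : V Int W"
   then show "germ X x (V Int W) (res X V (V Int W) (s V)) = germ X x (V Int W) (res X W (V Int W) (s W))"
    using germ_res[of V "V Int W" x "s V"] germ_res[of W "V Int W" x "s W"] PV PW o by simp
  qed
 qed
 then obtain r where r: "r el sec X U" "!!V. V : UU ==> res X U V r = s V" unfolding un by auto
 have "germ X y U r = ga y" if y: "y : U" for y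
 proof -
  obtain N where N: "N : UU" "y : N" using y un by blast
  then show ?thesis using r(2)[OF N(1)] s[OF N(1)] germ_res[of U N y r] U r(1) unfolding P_def by auto
 qed
 then show ?thesis using that r by blast
qed

text \<open>Inverses are unique, so the local inverses have prescribed germs and glue.\<close>

lemma sec_unitI:
 assumes U: "opn X U" "s el sec X U" and g: "!!x. x : U ==> germ X x U s : Units (stalk X x)"
 shows "s : Units (sec X U)"
proof -
 have st: "cring (stalk X x)" if "x : U" for x using stalk_cring that opn_sub[OF U(1)] by blast
 interpret U: cring "sec X U" by (rule sec_cring[OF U(1)])
 obtain t where t: "t el sec X U" "!!y. y : U ==> germ X y U t = inv[stalk X y] germ X y U s"
 proof (rule glue_germs[OF U(1), of "%y. inv[stalk X y] germ X y U s"])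
  fix x assume x: "x : U"
  obtain W where W: "opn X W" "x : W" "W <= U" "res X U W s : Units (sec X W)"
   using germ_unit_nbhd[OF U(1) x U(2) g[OF x]] by metis
  interpret W: cring "sec X W" by (rule sec_cring[OF W(1)])
  have "germ X y W (inv[sec X W] res X U W s) = inv[stalk X y] germ X y U s" if y: "y : W" for y
   using ring_hom_inv[OF germ_hom[OF W(1) y] W(4) sec_cring[OF W(1)] st[OF subsetD[OF W(3) y]]]
    germ_res[OF U(1) W(1) y W(3) U(2)] by simp
  then show "EX N t. opn X N & x : N & N <= U & t el sec X N & (ALL y:N. germ X y N t = inv[stalk X y] germ X y U s)"
   using W W.Units_inv_closed[OF W(4)] by blast
 qed blast
 have "s *[sec X U] t = 1[sec X U]"
  by (rule sec_eqI[OF U(1)])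
   (use U t g monoid.Units_r_inv[OF ring.is_monoid[OF cring.axioms(1)[OF st]]] in "simp_all add: germ_one flip: stalk_mult")
 then show ?thesis using U.Units_iff U t by blast
qed

lemma sec_fraction:
 assumes U: "opn X U" "a el sec X U" "d el sec X U" and u: "!!y. y : U ==> germ X y U d : Units (stalk X y)"
  and e: "!!y. y : U ==> ga y el stalk X y & ga y *[stalk X y] germ X y U d = germ X y U a"
 obtains t where "t el sec X U" "!!y. y : U ==> germ X y U t = ga y"
proof -
 interpret U: cring "sec X U" by (rule sec_cring[OF U(1)])
 let ?t = "a *[sec X U] inv[sec X U] d"
 have d: "d : Units (sec X U)" by (rule sec_unitI[OF U(1,3) u])
 have "germ X y U ?t = ga y" if y: "y : U" for y
 proof -
  interpret S: cring "stalk X y" using stalk_cring y opn_sub[OF U(1)] by blast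
  have "d *[sec X U] ?t = a" using d U by (simp add: U.m_lcomm)
  moreover have c: "germ X y U d el stalk X y" "germ X y U ?t el stalk X y" using U d y germ_closed by simp_all
  ultimately have "germ X y U d *[stalk X y] germ X y U ?t = germ X y U d *[stalk X y] ga y"
   using e[OF y] stalk_mult[OF U(1) y U(3), of ?t] U d by (simp add: S.m_comm)
  then show ?thesis using S.Units_l_cancel[OF u[OF y] c(2)] e[OF y] by blast
 qed
 then show ?thesis by (rule that[OF U.m_closed[OF U(2) U.Units_inv_closed[OF d]]])
qed

end

lemma lrsD:
 assumes "locally_ringed_space X"
 shows "sheaf X" "!!x. x : points X ==> local_ring (stalk X x)" "presheaf X"
 using assms sheafI[of X] sheaf.axioms(1)[of X] by (auto simp: locally_ringed_space_def)

subsection \<open>Morphisms\<close>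

lemma in_preim [simp]: "x : preim X f V <-> x : points X & pmap f x : V"
 by (simp add: preim_def)

lemma preim_mono: "V <= W ==> preim X f V <= preim X f W"
 by (auto simp: preim_def)

text \<open>Morphisms without the locality condition, between spaces that are merely presheaves.
  This generality is for the product space in the construction of fibre products: it is only a
  presheaf of rings, and its projections need not be local.\<close>

locale premor = X: presheaf X + Y: presheaf Y
 for X :: "('p, 'r) ringed_space" and Y :: "('q, 's) ringed_space" +
 fixes f :: "('p, 'r, 'q, 's) ringed_map"
 assumes cont: "continuous_map (pts X) (pts Y) (pmap f)"
  and smap_hom: "!!V. opn Y V ==> smap f V : ring_hom (sec Y V) (sec X (preim X f V))"
  and smap_res: "!!U V s. opn Y U ==> opn Y V ==> V <= U ==> s el sec Y U ==>
   smap f V (res Y U V s) = res X (preim X f U) (preim X f V) (smap f U s)"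
begin

lemma pmap_in: "x : points X ==> pmap f x : points Y"
 using cont by (auto simp: continuous_map_def)

lemma preim_open: "opn Y V ==> opn X (preim X f V)"
 using cont unfolding preim_def by (simp add: continuous_map_def)

lemma preim_points: "preim X f (points Y) = points X"
 using pmap_in by (auto simp: preim_def)

lemma smap_closed: "opn Y V ==> s el sec Y V ==> smap f V s el sec X (preim X f V)"
 by (rule hom_car[OF smap_hom])

lemma germ_smap_cong:
 assumes x: "x : points X"
  and U: "opn Y U" "pmap f x : U" "s el sec Y U"
  and V: "opn Y V" "pmap f x : V" "t el sec Y V"
  and e: "germ Y (pmap f x) U s = germ Y (pmap f x) V t"
 shows "germ X x (preim X f U) (smap f U s) = germ X x (preim X f V) (smap f V t)"
proof -
 obtain W where W: "opn Y W" "pmap f x : W" "W <= U" "W <= V" "res Y U W s = res Y V W t"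
  using Y.germ_eqE[OF e U V] .
 show ?thesis
 proof (rule X.germ_eqI)
  show "opn X (preim X f U)" "opn X (preim X f V)" "opn X (preim X f W)" using preim_open U V W by auto
  show "x : preim X f W" using x W by simp
  show "preim X f W <= preim X f U" "preim X f W <= preim X f V" using W by (simp_all add: preim_mono)
  show "smap f U s el sec X (preim X f U)" "smap f V t el sec X (preim X f V)"
   using smap_closed U V by auto
  show "res X (preim X f U) (preim X f W) (smap f U s) = res X (preim X f V) (preim X f W) (smap f V t)"
   using smap_res[of U W s] smap_res[of V W t] U V W by simp
 qed
qed

lemma stalk_map_germ:
 assumes x: "x : points X" and U: "opn Y U" "pmap f x : U" "s el sec Y U"
 shows "stalk_map X Y f x (germ Y (pmap f x) U s) = germ X x (preim X f U) (smap f U s)"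
 unfolding stalk_map_def
proof (rule the_equality)
 show "EX V t. opn Y V & pmap f x : V & t el sec Y V & germ Y (pmap f x) U s = germ Y (pmap f x) V t &
  germ X x (preim X f U) (smap f U s) = germ X x (preim X f V) (smap f V t)"
  using U by (intro exI[of _ U] exI[of _ s]) simp
 fix b assume "EX V t. opn Y V & pmap f x : V & t el sec Y V & germ Y (pmap f x) U s = germ Y (pmap f x) V t &
  b = germ X x (preim X f V) (smap f V t)"
 then obtain V t where V: "opn Y V" "pmap f x : V" "t el sec Y V"
  and e: "germ Y (pmap f x) U s = germ Y (pmap f x) V t" and b: "b = germ X x (preim X f V) (smap f V t)" by (elim exE conjE)
 show "b = germ X x (preim X f U) (smap f U s)"
  using germ_smap_cong[OF x U V e] b by simp
qed

lemma stalk_map_hom: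
 assumes x: "x : points X"
 shows "stalk_map X Y f x : ring_hom (stalk Y (pmap f x)) (stalk X x)"
proof -
 have 1: "!!U. opn Y U ==> pmap f x : U ==>
  (%s. germ X x (preim X f U) (smap f U s)) : ring_hom (sec Y U) (stalk X x)"
  by (rule hom_comp[OF smap_hom X.germ_hom]) (use x preim_open in auto)
 have 2: "!!U V s. opn Y U ==> opn Y V ==> pmap f x : V ==> V <= U ==> s el sec Y U ==>
  germ X x (preim X f V) (smap f V (res Y U V s)) = germ X x (preim X f U) (smap f U s)"
  by (rule germ_smap_cong[OF x]) (auto simp: Y.res_closed Y.germ_res)
 obtain h where h: "h : ring_hom (stalk Y (pmap f x)) (stalk X x)"
  "!!U s. opn Y U ==> pmap f x : U ==> s el sec Y U ==>
   h (germ Y (pmap f x) U s) = germ X x (preim X f U) (smap f U s)"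
  by (rule Y.stalk_univ[OF pmap_in[OF x] X.stalk_cring[OF x],
   of "%U s. germ X x (preim X f U) (smap f U s)"]) (assumption | rule 1 2 that)+
 show ?thesis
 proof (rule ring_hom_cong[OF h(1)])
  show "ring (stalk Y (pmap f x))" using Y.stalk_cring[OF pmap_in[OF x]] cring.axioms(1) by blast
  fix a assume "a el stalk Y (pmap f x)"
  then obtain U s where U: "opn Y U" "pmap f x : U" "s el sec Y U" "a = germ Y (pmap f x) U s"
   by (rule Y.stalkE)
  show "stalk_map X Y f x a = h a" using h(2)[OF U(1-3)] stalk_map_germ[OF x U(1-3)] U(4) by simp
 qed
qed

end

text \<open>The locality condition is phrased with representatives of germs, which keeps the
  description operator of \<open>stalk_map\<close> out of later verifications.\<close>

definition reflects_units :: "('p, 'r) ringed_space => ('q, 's) ringed_space => ('p, 'r, 'q, 's) ringed_map => bool" where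
 "reflects_units X Y f <-> (ALL x:points X. ALL V s. opn Y V --> pmap f x : V --> s el sec Y V -->
  germ X x (preim X f V) (smap f V s) : Units (stalk X x) --> germ Y (pmap f x) V s : Units (stalk Y (pmap f x)))"

lemma morphism_iff:
 assumes "presheaf X" "presheaf Y"
 shows "morphism X Y f <-> premor X Y f & reflects_units X Y f"
proof -
 interpret X: presheaf X by fact
 interpret Y: presheaf Y by fact
 have 2: "(ALL x:points X. ALL a:carrier (stalk Y (pmap f x)). stalk_map X Y f x a : Units (stalk X x) --> a : Units (stalk Y (pmap f x)))
  <-> reflects_units X Y f" if p: "premor X Y f"
 proof -
  interpret premor X Y f by fact
  show ?thesis unfolding reflects_units_def
  proof (intro ball_cong refl iffI ballI allI impI)
   fix x a assume x: "x : points X" and h: "ALL V s. opn Y V --> pmap f x : V --> s el sec Y V -->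
    germ X x (preim X f V) (smap f V s) : Units (stalk X x) --> germ Y (pmap f x) V s : Units (stalk Y (pmap f x))"
    and a: "a el stalk Y (pmap f x)" "stalk_map X Y f x a : Units (stalk X x)"
   from a(1) show "a : Units (stalk Y (pmap f x))" by (rule Y.stalkE) (use h a stalk_map_germ[OF x] in simp)
  qed (use Y.germ_closed in "simp add: stalk_map_germ")
 qed
 have "morphism X Y f <-> premor X Y f & (ALL x:points X. ALL a:carrier (stalk Y (pmap f x)). stalk_map X Y f x a : Units (stalk X x) --> a : Units (stalk Y (pmap f x)))"
  unfolding morphism_def premor_def premor_axioms_def using assms by auto
 then show ?thesis using 2 by auto
qed

locale mor = premor X Y f for X :: "('p, 'r) ringed_space" and Y :: "('q, 's) ringed_space" and f +
 assumes unit_reflect: "reflects_units X Y f"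
begin

lemma germ_unit_reflect:
 "x : points X ==> opn Y V ==> pmap f x : V ==> s el sec Y V ==>
 germ X x (preim X f V) (smap f V s) : Units (stalk X x) ==> germ Y (pmap f x) V s : Units (stalk Y (pmap f x))"
 using unit_reflect unfolding reflects_units_def by blast

lemma stalk_map_unit_iff:
 assumes x: "x : points X" and a: "a el stalk Y (pmap f x)"
 shows "stalk_map X Y f x a : Units (stalk X x) <-> a : Units (stalk Y (pmap f x))"
proof -
 obtain V s where V: "opn Y V" "pmap f x : V" "s el sec Y V" "a = germ Y (pmap f x) V s"
  using Y.stalkE[OF a] .
 have "stalk_map X Y f x a = germ X x (preim X f V) (smap f V s)"
  unfolding V(4) by (rule stalk_map_germ[OF x V(1-3)])
 then show ?thesis
  using ring_hom_Units[OF stalk_map_hom[OF x], of a] germ_unit_reflect[OF x V(1-3)] unfolding V(4) by metis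
qed

lemma germ_unit_smap_iff:
 assumes "x : points X" "opn Y V" "pmap f x : V" "s el sec Y V"
 shows "germ X x (preim X f V) (smap f V s) : Units (stalk X x) <-> germ Y (pmap f x) V s : Units (stalk Y (pmap f x))"
 using stalk_map_unit_iff[OF assms(1) Y.germ_closed[OF assms(2-4)]] stalk_map_germ[OF assms] by simp

end

lemma morI: "presheaf X ==> presheaf Y ==> morphism X Y f ==> mor X Y f"
 using morphism_iff[of X Y f] by (simp add: mor_def mor_axioms_def)

lemma mor_morphism: "mor X Y f ==> morphism X Y f"
 using morphism_iff[of X Y f] by (simp add: mor_def mor_axioms_def premor_def)

lemma lrs_mor: "locally_ringed_space X ==> locally_ringed_space Y ==> morphism X Y f ==> mor X Y f"
 by (rule morI[OF lrsD(3) lrsD(3)])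

lemma preim_comp:
 assumes "premor X Y f"
 shows "preim X (comp_mor Y f g) V = preim X f (preim Y g V)"
 using premor.pmap_in[OF assms] by (auto simp: comp_mor_def)

lemma comp_simps [simp]:
 "pmap (comp_mor Y f g) x = pmap g (pmap f x)"
 "smap (comp_mor Y f g) V s = smap f (preim Y g V) (smap g V s)"
 "pmap id_mor z = z" "smap id_mor W t = t"
 by (simp_all add: comp_mor_def id_mor_def)

lemma premor_comp:
 assumes "premor X Y f" "premor Y Z g"
 shows "premor X Z (comp_mor Y f g)"
proof -
 interpret f: premor X Y f by fact
 interpret g: premor Y Z g by fact
 note pc = preim_comp[OF assms(1)]
 show ?thesis
 proof unfold_locales
  show "continuous_map (pts X) (pts Z) (pmap (comp_mor Y f g))"
   using continuous_map_compose[OF f.cont g.cont] by (simp add: comp_mor_def comp_def)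
  show "smap (comp_mor Y f g) V : ring_hom (sec Z V) (sec X (preim X (comp_mor Y f g) V))" if "opn Z V" for V
   using hom_comp[OF g.smap_hom[OF that] f.smap_hom[OF g.preim_open[OF that]]] unfolding pc by (simp add: comp_mor_def)
  show "smap (comp_mor Y f g) V (res Z U V s) = res X (preim X (comp_mor Y f g) U) (preim X (comp_mor Y f g) V) (smap (comp_mor Y f g) U s)"
   if "opn Z U" "opn Z V" "V <= U" "s el sec Z U" for U V s
   unfolding pc using g.smap_res[OF that] that preim_mono[OF that(3), of Y g]
    f.smap_res[of "preim Y g U" "preim Y g V" "smap g U s"] g.preim_open g.smap_closed by simp
 qed
qed

lemma mor_comp:
 assumes "mor X Y f" "mor Y Z g"
 shows "mor X Z (comp_mor Y f g)"
proof -
 interpret f: mor X Y f by fact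
 interpret g: mor Y Z g by fact
 have "reflects_units X Z (comp_mor Y f g)"
  unfolding reflects_units_def preim_comp[OF f.premor_axioms] comp_simps
  using f.germ_unit_reflect[OF _ g.preim_open _ g.smap_closed] g.germ_unit_reflect[OF f.pmap_in] f.pmap_in by simp
 then show ?thesis by (intro mor.intro mor_axioms.intro premor_comp f.premor_axioms g.premor_axioms)
qed

lemma preim_id: "U <= points X ==> preim X id_mor U = U"
 by (auto simp: preim_def)

lemma mor_id:
 assumes "presheaf X"
 shows "mor X X id_mor"
proof -
 interpret presheaf X by fact
 show ?thesis
 proof unfold_locales
  show "continuous_map (pts X) (pts X) (pmap id_mor)" by (simp add: id_mor_def)
  show "opn X V ==> smap id_mor V : ring_hom (sec X V) (sec X (preim X id_mor V))" for V
   using preim_id[OF opn_sub, of V] by (auto simp: ring_hom_def)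
  show "smap id_mor V (res X U V s) = res X (preim X id_mor U) (preim X id_mor V) (smap id_mor U s)"
   if "opn X U" "opn X V" "V <= U" "s el sec X U" for U V s
   using that preim_id[OF opn_sub, of V] preim_id[OF opn_sub, of U] by simp
  show "reflects_units X X id_mor"
   unfolding reflects_units_def using preim_id[OF opn_sub] by simp
 qed
qed

lemma mor_eq_refl [simp]: "mor_eq X Y f f"
 by (simp add: mor_eq_def)

lemma mor_eq_sym: "mor_eq X Y f g ==> mor_eq X Y g f"
 by (simp add: mor_eq_def)

lemma mor_trans: "mor_eq X Y f g ==> mor_eq X Y g h ==> mor_eq X Y f h"
 by (simp add: mor_eq_def)

lemma mor_eq_preim: "mor_eq X Y f g ==> preim X f V = preim X g V"
 by (auto simp: mor_eq_def preim_def)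

lemma mor_eq_smap: "mor_eq X Y f g ==> opn Y V ==> s el sec Y V ==> smap f V s = smap g V s"
 by (simp add: mor_eq_def)

lemma mor_eq_pmap: "mor_eq X Y f g ==> x : points X ==> pmap f x = pmap g x"
 by (simp add: mor_eq_def)

lemma mor_eq_comp:
 assumes "mor_eq X Y f f'" "mor_eq Y Z g g'" "mor X Y f" "mor Y Z g"
 shows "mor_eq X Z (comp_mor Y f g) (comp_mor Y f' g')"
proof -
 interpret f: mor X Y f by fact
 interpret g: mor Y Z g by fact
 show ?thesis
  unfolding mor_eq_def comp_simps
 proof (intro conjI ballI allI impI)
  fix x assume x: "x : points X"
  show "pmap g (pmap f x) = pmap g' (pmap f' x)"
   using mor_eq_pmap[OF assms(1) x] mor_eq_pmap[OF assms(2) f.pmap_in[OF x]] by simp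
 next
  fix V s assume V: "opn Z V" "s el sec Z V"
  show "smap f (preim Y g V) (smap g V s) = smap f' (preim Y g' V) (smap g' V s)"
   using mor_eq_smap[OF assms(2) V] mor_eq_preim[OF assms(2), of V]
    mor_eq_smap[OF assms(1) g.preim_open[OF V(1)] g.smap_closed[OF V]] by simp
 qed
qed

lemma mor_eq_comp_left: "mor_eq X Y f f' ==> mor X Y f ==> mor Y Z g ==> mor_eq X Z (comp_mor Y f g) (comp_mor Y f' g)"
 by (rule mor_eq_comp) auto

lemma mor_eq_comp_right: "mor_eq Y Z g g' ==> mor X Y f ==> mor Y Z g ==> mor_eq X Z (comp_mor Y f g) (comp_mor Y f g')"
 by (rule mor_eq_comp) auto

lemma comp_assoc:
 assumes "mor Y Z g"
 shows "mor_eq X W (comp_mor Z (comp_mor Y f g) h) (comp_mor Y f (comp_mor Z g h))"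
 unfolding mor_eq_def by (simp add: preim_comp[OF mor.axioms(1)[OF assms]])

lemma comp_id_right:
 assumes "presheaf Y"
 shows "mor_eq X Y (comp_mor Y f id_mor) f"
 unfolding mor_eq_def using preim_id[OF presheaf.opn_sub[OF assms]] by simp

lemma comp_id_left:
 assumes "mor X Y f"
 shows "mor_eq X Y (comp_mor X id_mor f) f"
 by (simp add: mor_eq_def)

lemma mor_eqI:
 assumes "sheaf X" "mor X Y f" "mor X Y g"
  and p: "!!x. x : points X ==> pmap f x = pmap g x"
  and s: "!!x V s. x : points X ==> opn Y V ==> pmap f x : V ==> s el sec Y V ==>
   germ X x (preim X f V) (smap f V s) = germ X x (preim X g V) (smap g V s)"
 shows "mor_eq X Y f g"
proof -
 interpret X: sheaf X by fact
 interpret f: mor X Y f by fact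
 interpret g: mor X Y g by fact
 have pre: "preim X f V = preim X g V" for V using p by (auto simp: preim_def)
 show ?thesis
  unfolding mor_eq_def
 proof (intro conjI ballI allI impI)
  fix V t assume V: "opn Y V" "t el sec Y V"
  show "smap f V t = smap g V t"
  proof (rule X.sec_eqI[OF f.preim_open[OF V(1)]])
   show "smap f V t el sec X (preim X f V)" using f.smap_closed V by simp
   show "smap g V t el sec X (preim X f V)" unfolding pre using g.smap_closed V by simp
   fix x assume "x : preim X f V"
   then show "germ X x (preim X f V) (smap f V t) = germ X x (preim X f V) (smap g V t)"
    using s[of x V t] p[of x] V pre by simp
  qed
 qed (use p in simp)
qed

lemma mor_eq_mor:
 assumes "mor_eq X Y f g" "mor X Y f"
 shows "mor X Y g"
proof -
 interpret mor X Y f by fact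
 note pre = mor_eq_preim[OF assms(1), symmetric]
 note sm = mor_eq_smap[OF assms(1), symmetric]
 note pm = mor_eq_pmap[OF assms(1), symmetric]
 show ?thesis
 proof unfold_locales
  show "continuous_map (pts X) (pts Y) (pmap g)"
   by (rule continuous_map_eq[OF cont]) (simp add: pm)
  show "smap g V : ring_hom (sec Y V) (sec X (preim X g V))" if "opn Y V" for V
   unfolding pre by (rule ring_hom_cong[OF smap_hom]) (use that sm Y.sec_ring in auto)
  show "smap g V (res Y U V s) = res X (preim X g U) (preim X g V) (smap g U s)"
   if "opn Y U" "opn Y V" "V <= U" "s el sec Y U" for U V s
   unfolding pre using smap_res[OF that] sm[of V "res Y U V s"] sm[of U s] that Y.res_closed by simp
  show "reflects_units X Y g"
   unfolding reflects_units_def pre using germ_unit_reflect by (simp add: pm sm)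
 qed
qed

text \<open>A morphism into \<open>X\<close> is determined by a continuous map and compatible germs of the pulled back
 sections.\<close>

lemma morphism_from_germs:
 fixes ep :: "'q => 'p set => 'r => ('q set \<times> 's) set"
 assumes Q: "sheaf (Q :: ('q, 's) ringed_space)" and X: "presheaf (X :: ('p, 'r) ringed_space)"
  and cont: "continuous_map (pts Q) (pts X) f"
  and hom: "!!q V. q : points Q ==> opn X V ==> f q : V ==> ep q V : ring_hom (sec X V) (stalk Q q)"
  and res: "!!q U V s. q : points Q ==> opn X U ==> opn X V ==> f q : V ==> V <= U ==> s el sec X U ==>
   ep q V (res X U V s) = ep q U s"
  and unit: "!!q V s. q : points Q ==> opn X V ==> f q : V ==> s el sec X V ==>
   ep q V s : Units (stalk Q q) ==> germ X (f q) V s : Units (stalk X (f q))"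
  and loc: "!!q V s. q : points Q ==> opn X V ==> f q : V ==> s el sec X V ==>
   EX N t. opn Q N & q : N & (ALL y:N. f y : V) & t el sec Q N & (ALL y:N. germ Q y N t = ep y V s)"
 obtains h where "mor Q X h" "pmap h = f"
  "!!q V s. q : points Q ==> opn X V ==> f q : V ==> s el sec X V ==>
   germ Q q (preim Q h V) (smap h V s) = ep q V s"
proof -
 interpret Q: sheaf Q by fact
 interpret X: presheaf X by fact
 define pre where "pre V = {q : points Q. f q : V}" for V
 define sm where "sm V s = (SOME t. t el sec Q (pre V) & (ALL q:pre V. germ Q q (pre V) t = ep q V s))" for V s
 have pre_open: "opn Q (pre V)" if "opn X V" for V
  using cont that unfolding pre_def by (simp add: continuous_map_def)
 have sm: "sm V s el sec Q (pre V) & (ALL q:pre V. germ Q q (pre V) (sm V s) = ep q V s)"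
  if V: "opn X V" "s el sec X V" for V s
  unfolding sm_def
 proof (rule someI_ex)
  have "EX N t. opn Q N & q : N & N <= pre V & t el sec Q N & (ALL y:N. germ Q y N t = ep y V s)" if "q : pre V" for q
  proof -
   obtain N t where N: "opn Q N" "q : N" "ALL y:N. f y : V" "t el sec Q N" "ALL y:N. germ Q y N t = ep y V s"
    using loc[of q V s] V \<open>q : pre V\<close> unfolding pre_def by blast
   have "N <= pre V" using N Q.opn_sub[OF N(1)] unfolding pre_def by blast
   then show ?thesis using N by blast
  qed
  from Q.glue_germs[OF pre_open[OF V(1)] this]
  obtain t where "t el sec Q (pre V)" "!!y. y : pre V ==> germ Q y (pre V) t = ep y V s"
   by metis
  then show "EX t. t el sec Q (pre V) & (ALL q:pre V. germ Q q (pre V) t = ep q V s)" by blast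
 qed
 note smc = conjunct1[OF sm] and smg = bspec[OF conjunct2[OF sm]]
 define h where "h = (|pmap = f, smap = sm|)"
 have h: "pmap h = f" "smap h = sm" "preim Q h = pre"
  by (auto simp: h_def preim_def pre_def fun_eq_iff)
 have pr: "q : points Q" "f q : V" if "q : pre V" for q V using that by (auto simp: pre_def)
 have "mor Q X h"
 proof unfold_locales
  show "continuous_map (pts Q) (pts X) (pmap h)" by (simp add: h cont)
  show "smap h V : ring_hom (sec X V) (sec Q (preim Q h V))" if V: "opn X V" for V
   unfolding h
   by (rule Q.hom_by_germs[OF pre_open[OF V] X.sec_cring[OF V] smc[OF V]], assumption, rule ring_hom_cong[OF hom[OF pr(1) V pr(2)]])
    (use smg[OF V] X.sec_ring[OF V] in auto)
  show "smap h V (res X U V s) = res Q (preim Q h U) (preim Q h V) (smap h U s)"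
   if "opn X U" "opn X V" "V <= U" "s el sec X U" for U V s
   unfolding h
  proof (rule Q.sec_eqI[OF pre_open[OF that(2)]])
   have sub: "pre V <= pre U" using that by (auto simp: pre_def)
   have r: "res X U V s el sec X V" using X.res_closed that by simp
   show "sm V (res X U V s) el sec Q (pre V)" using smc[OF that(2) r] .
   show "res Q (pre U) (pre V) (sm U s) el sec Q (pre V)"
    using Q.res_closed[OF pre_open pre_open sub smc] that by simp
   fix q assume q: "q : pre V"
   then have qU: "q : pre U" using sub by blast
   show "germ Q q (pre V) (sm V (res X U V s)) = germ Q q (pre V) (res Q (pre U) (pre V) (sm U s))"
    using smg[OF that(2) r q] smg[OF that(1,4) qU] res[OF pr(1)[OF q] that(1,2) pr(2)[OF q] that(3,4)]
     Q.germ_res[OF pre_open[OF that(1)] pre_open[OF that(2)] q sub smc[OF that(1,4)]] by simp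
  qed
  show "reflects_units Q X h"
   unfolding reflects_units_def h
   using unit smg by (simp add: pre_def)
 qed
 moreover have "germ Q q (preim Q h V) (smap h V s) = ep q V s"
  if "q : points Q" "opn X V" "f q : V" "s el sec X V" for q V s
  unfolding h using smg[OF that(2,4), of q] that by (simp add: pre_def)
 ultimately show ?thesis using that h(1) by blast
qed

subsection \<open>Open subspaces\<close>

lemma restrict_simps [simp]:
 "sec (restrict_space X U) = sec X" "res (restrict_space X U) = res X"
 "pts (restrict_space X U) = subtopology (pts X) U"
 by (simp_all add: restrict_space_def)

lemma restrict_points: "opn X U ==> points (restrict_space X U) = U"
 using openin_subset by fastforce

lemma restrict_opn: "opn X U ==> opn (restrict_space X U) V <-> opn X V & V <= U"
 by (simp add: openin_open_subtopology)

lemma presheaf_restrict: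
 assumes "presheaf X" "opn X U"
 shows "presheaf (restrict_space X U)"
proof
 interpret presheaf X by fact
 show "presheaf_of_rings (restrict_space X U)"
  unfolding presheaf_of_rings_def restrict_simps(1,2)
  using restrict_opn[OF assms(2)] sec_cring res_hom res_id res_res by simp
qed

lemma sheaf_restrict:
 assumes "sheaf X" "opn X U"
 shows "sheaf (restrict_space X U)"
proof -
 interpret sheaf X by fact
 have "presheaf (restrict_space X U)" by (rule presheaf_restrict[OF presheaf_axioms assms(2)])
 moreover have "EX! t. t el sec X (\<Union>UU) & (ALL V:UU. res X (\<Union>UU) V t = s V)"
  if "ALL U:UU. opn X U" "ALL U:UU. s U el sec X U"
   "ALL U:UU. ALL V:UU. res X U (U Int V) (s U) = res X V (U Int V) (s V)" for UU s
  by (rule glue) (use that in blast)+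
 ultimately have "sheaf_of_rings (restrict_space X U)"
  unfolding sheaf_of_rings_def presheaf_def restrict_simps(1,2)
  using restrict_opn[OF assms(2)] by simp
 then show ?thesis by (rule sheafI)
qed

definition open_incl :: "('p, 'r) ringed_space => 'p set => ('p, 'r, 'p, 'r) ringed_map" where
 "open_incl X U = (|pmap = (%x. x), smap = (%V. res X V (U Int V))|)"

lemma open_incl_simps [simp]: "pmap (open_incl X U) x = x" "smap (open_incl X U) V s = res X V (U Int V) s"
 by (simp_all add: open_incl_def)

text \<open>Germs in the open subspace are different sets from germs in \<open>X\<close>, as they
  contain only pairs with a neighbourhood inside \<open>U\<close>. Invertibility is decided on
  arbitrarily small neighbourhoods and therefore has the same meaning in both stalks.\<close>

lemma germ_unit_restrict:
 assumes "presheaf X" "opn X U" "opn X V" "V <= U" "x : V" "s el sec X V"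
 shows "germ (restrict_space X U) x V s : Units (stalk (restrict_space X U) x) <-> germ X x V s : Units (stalk X x)"
proof -
 interpret presheaf X by fact
 interpret R: presheaf "restrict_space X U" by (rule presheaf_restrict[OF assms(1,2)])
 have "opn X W & x : W & W <= V & res X V W s : Units (sec X W) <->
  opn (restrict_space X U) W & x : W & W <= V & res X V W s : Units (sec X W)" for W
  using restrict_opn[OF assms(2)] assms(4) by blast
 then show ?thesis
  using R.germ_unit_iff[of V x s] germ_unit_iff[of V x s] assms restrict_opn[OF assms(2), of V] by simp
qed

lemma preim_open_incl: "opn X U ==> preim (restrict_space X U) (open_incl X U) V = U Int V"
 unfolding preim_def by (auto simp: restrict_points dest: openin_subset)

lemma mor_open_incl:
 assumes "presheaf X" "opn X U"
 shows "mor (restrict_space X U) X (open_incl X U)"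
proof -
 interpret presheaf X by fact
 interpret R: presheaf "restrict_space X U" by (rule presheaf_restrict[OF assms(1,2)])
 note pre = preim_open_incl[OF assms(2)]
 show ?thesis
 proof unfold_locales
  show "continuous_map (pts (restrict_space X U)) (pts X) (pmap (open_incl X U))"
   by (simp add: open_incl_def continuous_map_from_subtopology flip: id_def)
  show "smap (open_incl X U) V : ring_hom (sec X V) (sec (restrict_space X U) (preim (restrict_space X U) (open_incl X U) V))"
   if "opn X V" for V
   unfolding pre using res_hom[of V "U Int V"] that openin_Int[OF assms(2) that] by (simp add: open_incl_def)
  show "smap (open_incl X U) V (res X W V s) = res (restrict_space X U) (preim (restrict_space X U) (open_incl X U) W)
    (preim (restrict_space X U) (open_incl X U) V) (smap (open_incl X U) W s)"
   if "opn X W" "opn X V" "V <= W" "s el sec X W" for W V s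
  proof -
   have "opn X (U Int V)" "opn X (U Int W)" "U Int V <= U Int W" using that assms by auto
   then show ?thesis
    unfolding pre using that res_res[of W V "U Int V" s] res_res[of W "U Int W" "U Int V" s] by simp
  qed
  show "reflects_units (restrict_space X U) X (open_incl X U)"
   unfolding reflects_units_def pre
  proof (intro ballI allI impI)
   fix x V s assume x: "x : points (restrict_space X U)" and V: "opn X V" "pmap (open_incl X U) x : V" "s el sec X V"
    and u: "germ (restrict_space X U) x (U Int V) (smap (open_incl X U) V s) : Units (stalk (restrict_space X U) x)"
   have x': "x : U Int V" "opn X (U Int V)" using x V restrict_points[OF assms(2)] assms by auto
   then have "germ X x (U Int V) (res X V (U Int V) s) : Units (stalk X x)"
    using u germ_unit_restrict[OF assms x'(2) _ x'(1), of "res X V (U Int V) s"] res_closed V by simp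
   then show "germ X (pmap (open_incl X U) x) V s : Units (stalk X (pmap (open_incl X U) x))"
    using germ_res[OF V(1) x'(2) x'(1) _ V(3)] by simp
  qed
 qed
qed

lemma lrs_restrict:
 assumes "locally_ringed_space X" "opn X U"
 shows "locally_ringed_space (restrict_space X U)"
proof -
 interpret X: sheaf X by (rule lrsD(1)[OF assms(1)])
 interpret R: sheaf "restrict_space X U" by (rule sheaf_restrict[OF X.sheaf_axioms assms(2)])
 have "local_ring (stalk (restrict_space X U) x)" if x: "x : points (restrict_space X U)" for x
 proof (rule R.stalk_local_reflect[OF x, of "stalk X x" "germ X x"])
  show "local_ring (stalk X x)" using x restrict_points[OF assms(2)] X.opn_sub[OF assms(2)] lrsD(2)[OF assms(1)] by auto
 qed (use restrict_opn[OF assms(2)] X.germ_hom X.germ_res germ_unit_restrict[OF X.presheaf_axioms assms(2)] in "simp_all del: restrict_simps(3)")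
 then show ?thesis unfolding locally_ringed_space_def using R.sheaf by blast
qed

lemma mor_into_restrict:
 assumes "mor Q X f" "opn X U" "!!q. q : points Q ==> pmap f q : U"
 shows "mor Q (restrict_space X U) f"
proof -
 interpret mor Q X f by fact
 interpret R: presheaf "restrict_space X U" by (rule presheaf_restrict[OF Y.presheaf_axioms assms(2)])
 note o = restrict_opn[OF assms(2)]
 show ?thesis
 proof unfold_locales
  show "continuous_map (pts Q) (pts (restrict_space X U)) (pmap f)"
   using cont assms(3) by (auto simp: continuous_map_in_subtopology)
  show "reflects_units Q (restrict_space X U) f"
   unfolding reflects_units_def
   using germ_unit_reflect germ_unit_restrict[OF Y.presheaf_axioms assms(2)] o by (simp del: restrict_simps(3))
 qed (use o smap_hom smap_res in "simp_all del: restrict_simps(3)")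
qed

subsection \<open>Sheaves of functions\<close>

text \<open>The common shape of the structure sheaves of \<open>Spec\<close>, of a closed subscheme
  and of the fibre product: functions with values in prescribed rings that locally coincide with a
  basic one. The sheaf property and the stalks are then treated once for all three.\<close>

definition fun_space :: "'p topology => ('p => 'r ring) => ('p set => ('p => 'r) => bool) =>
  ('p, 'p => 'r) ringed_space" where
 "fun_space T R L =
  (|pts = T,
   sec = (%U. (pi_ring U R)
      (|carrier := {s : carrier (pi_ring U R).
        ALL z:U. EX N s'. L N s' & z : N & N <= U & (ALL w:N. s w = s' w)}|)),
   res = (%U V s. restrict s V)|)"

text \<open>\<open>L N s\<close> means that \<open>s\<close> is a basic section over
  \<open>N\<close>. Through \<open>L_eq\<close>, evaluation at \<open>z\<close> is injective on the
  stalk, and through \<open>L_surj\<close> it is surjective, so that the stalk at \<open>z\<close>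
  is a copy of \<open>R z\<close>.\<close>

locale fun_data =
 fixes T :: "'p topology" and R :: "'p => 'r ring" and L :: "'p set => ('p => 'r) => bool"
 assumes R_cring: "!!z. z : topspace T ==> cring (R z)"
  and L_open: "!!N s. L N s ==> openin T N"
  and L_sub: "!!N N' s. L N s ==> openin T N' ==> N' <= N ==> L N' s"
  and L_val: "!!N s z. L N s ==> z : N ==> s z el R z"
  and L_one: "L (topspace T) (%w. 1[R w])"
  and L_add: "!!N s t. L N s ==> L N t ==> L N (%w. s w +[R w] t w)"
  and L_mult: "!!N s t. L N s ==> L N t ==> L N (%w. s w *[R w] t w)"
  and L_neg: "!!N s. L N s ==> L N (%w. -[R w] s w)"
  and L_eq: "!!N s t z. L N s ==> L N t ==> z : N ==> s z = t z ==>
   EX W. openin T W & z : W & W <= N & (ALL w:W. s w = t w)"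
  and L_surj: "!!z r. z : topspace T ==> r el R z ==> EX N s. L N s & z : N & s z = r"
begin

abbreviation "F == fun_space T R L"

lemma F_pts [simp]: "pts F = T" and F_res [simp]: "res F U V s = restrict s V"
 by (simp_all add: fun_space_def)

lemma F_sec:
 "s el sec F U <-> s : (\<Pi>\<^sub>E i\<in>U. carrier (R i)) &
  (ALL z:U. EX N s'. L N s' & z : N & N <= U & (ALL w:N. s w = s' w))"
 by (simp add: fun_space_def pi_ring_def)

lemma F_ops:
 "s +[sec F U] t = (\<lambda>i\<in>U. s i +[R i] t i)"
 "s *[sec F U] t = (\<lambda>i\<in>U. s i *[R i] t i)"
 "1[sec F U] = (\<lambda>i\<in>U. 1[R i])" "0[sec F U] = (\<lambda>i\<in>U. 0[R i])"
 by (simp_all add: fun_space_def pi_ring_def)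

lemma F_val: "s el sec F U ==> z : U ==> s z el R z"
 by (auto simp: F_sec)

lemma F_loc:
 assumes "s el sec F U" "z : U"
 obtains N s' where "L N s'" "z : N" "N <= U" "!!w. w : N ==> s w = s' w"
 using assms unfolding F_sec by blast

lemma F_secI:
 assumes "s : extensional U"
  "!!z. z : U ==> EX N s'. L N s' & z : N & N <= U & (ALL w:N. s w = s' w)"
 shows "s el sec F U"
 unfolding F_sec
proof (intro conjI PiE_I)
 fix z assume "z : U"
 then obtain N s' where "L N s'" "z : N" "ALL w:N. s w = s' w" using assms(2) by blast
 then show "s z el R z" using L_val by metis
qed (use assms in "auto simp: extensional_def")

lemma F_basic: "L N s ==> restrict s N el sec F N"
 by (rule F_secI) auto

lemma F_one: "openin T U ==> (\<lambda>i\<in>U. 1[R i]) el sec F U"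
 by (rule F_secI) (auto intro!: exI[of _ U] exI[of _ "%i. 1[R i]"] L_sub[OF L_one] dest: openin_subset)

lemma F_zero:
 assumes U: "openin T U"
 shows "(\<lambda>i\<in>U. 0[R i]) el sec F U"
proof (rule F_secI)
 let ?s = "%w. 1[R w] +[R w] -[R w] 1[R w]"
 have 1: "L U ?s" by (rule L_sub[OF L_add[OF L_one L_neg[OF L_one]] U openin_subset[OF U]])
 have 2: "?s w = 0[R w]" if "w : U" for w
 proof -
  interpret cring "R w" using R_cring openin_subset[OF U] that by blast
  show ?thesis by (simp add: r_neg)
 qed
 show "EX N s'. L N s' & z : N & N <= U & (ALL w:N. (\<lambda>i\<in>U. 0[R i]) w = s' w)" if "z : U" for z
  using that 1 2 by (intro exI[of _ U] exI[of _ ?s]) simp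
qed simp

lemma F_op:
 assumes s: "s el sec F U" and t: "t el sec F U" and p: "!!N s t. L N s ==> L N t ==> L N (%w. p w (s w) (t w))"
 shows "(\<lambda>i\<in>U. p i (s i) (t i)) el sec F U"
proof (rule F_secI)
 fix z assume z: "z : U"
 obtain N s' where N: "L N s'" "z : N" "N <= U" "!!w. w : N ==> s w = s' w" by (rule F_loc[OF s z]) blast
 obtain M t' where M: "L M t'" "z : M" "M <= U" "!!w. w : M ==> t w = t' w" by (rule F_loc[OF t z]) blast
 have o: "openin T (N Int M)" using L_open N M by auto
 show "EX N s'. L N s' & z : N & N <= U & (ALL w:N. (\<lambda>i\<in>U. p i (s i) (t i)) w = s' w)"
  using N M p[OF L_sub[OF N(1) o] L_sub[OF M(1) o]] by (intro exI[of _ "N Int M"] exI[of _ "%w. p w (s' w) (t' w)"]) (auto simp: subset_iff)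
qed simp

lemma F_neg:
 assumes s: "s el sec F U"
 shows "(\<lambda>i\<in>U. -[R i] s i) el sec F U"
proof (rule F_secI)
 fix z assume z: "z : U"
 obtain N s' where N: "L N s'" "z : N" "N <= U" "!!w. w : N ==> s w = s' w" by (rule F_loc[OF s z]) blast
 show "EX N s'. L N s' & z : N & N <= U & (ALL w:N. (\<lambda>i\<in>U. -[R i] s i) w = s' w)"
  using N L_neg[OF N(1)] by (intro exI[of _ N] exI[of _ "%w. -[R w] s' w"]) (auto simp: subset_iff)
qed simp

lemma F_eqI:
 assumes "s el sec F U" "t el sec F U" "!!z. z : U ==> s z = t z"
 shows "s = t"
 by (rule PiE_ext[of _ U "%i. carrier (R i)"]) (use assms F_sec in auto)

lemma F_cring:
 assumes U: "openin T U"
 shows "cring (sec F U)"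
proof -
 have c: "cring (R z)" if "z : U" for z using R_cring openin_subset[OF U] that by blast
 have r: "ring (R z)" "abelian_monoid (R z)" "abelian_group (R z)" "comm_monoid (R z)" "monoid (R z)" if "z : U" for z
  using c[OF that] by (simp_all add: cring_def ring_def abelian_group_def comm_monoid_def)
 note simps = abelian_monoid.a_assoc[OF r(2)] abelian_monoid.a_comm[OF r(2)] abelian_monoid.l_zero[OF r(2)]
  comm_monoid.m_comm[OF r(4)] monoid.m_assoc[OF r(5)] monoid.l_one[OF r(5)] ring.ring_simprules(13)[OF r(1)] abelian_group.l_neg[OF r(3)]
 show ?thesis
 proof (rule cringI')
  fix x y z assume x: "x el sec F U" and y: "y el sec F U" and z: "z el sec F U"
  note v = F_val[OF x] F_val[OF y] F_val[OF z]
  have "restrict x U = x" using x unfolding F_sec by (auto intro: extensional_restrict)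
  moreover have "0[sec F U] +[sec F U] x = restrict x U" "1[sec F U] *[sec F U] x = restrict x U"
   using v by (auto simp: F_ops simps intro!: restrict_ext)
  moreover have "x +[sec F U] y +[sec F U] z = x +[sec F U] (y +[sec F U] z)" "x +[sec F U] y = y +[sec F U] x"
   "x *[sec F U] y *[sec F U] z = x *[sec F U] (y *[sec F U] z)" "x *[sec F U] y = y *[sec F U] x"
   "(x +[sec F U] y) *[sec F U] z = x *[sec F U] z +[sec F U] y *[sec F U] z"
   using v by (auto simp: F_ops simps intro!: restrict_ext)
  moreover have "x +[sec F U] y el sec F U" "x *[sec F U] y el sec F U"
   unfolding F_ops by (rule F_op[OF x y L_add], assumption+, rule F_op[OF x y L_mult])
  ultimately show "x +[sec F U] y el sec F U & x *[sec F U] y el sec F U & x +[sec F U] y +[sec F U] z = x +[sec F U] (y +[sec F U] z)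
   & x +[sec F U] y = y +[sec F U] x & 0[sec F U] +[sec F U] x = x & x *[sec F U] y *[sec F U] z = x *[sec F U] (y *[sec F U] z)
   & x *[sec F U] y = y *[sec F U] x & 1[sec F U] *[sec F U] x = x & (x +[sec F U] y) *[sec F U] z = x *[sec F U] z +[sec F U] y *[sec F U] z"
   by simp
 next
  fix x assume x: "x el sec F U"
  show "EX y:carrier (sec F U). y +[sec F U] x = 0[sec F U]"
   using F_val[OF x] by (intro bexI[OF _ F_neg[OF x]]) (auto simp: F_ops simps intro!: restrict_ext)
 qed (use F_zero[OF U] F_one[OF U] in "simp_all add: F_ops")
qed

lemma F_hom:
 assumes U: "openin T U" and A: "cring A" and c: "!!a. a el A ==> f a el sec F U" and h: "!!z. z : U ==> (%a. f a z) : ring_hom A (R z)"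
 shows "f : ring_hom A (sec F U)"
proof -
 interpret A: cring A by fact
 interpret U: cring "sec F U" by (rule F_cring[OF U])
 show ?thesis
  by (intro ring_hom_memI F_eqI[of _ U])
   (simp_all add: c ring_hom_mult[OF h, simplified] ring_hom_add[OF h, simplified] ring_hom_one[OF h, simplified], simp_all add: F_ops ring_hom_mult[OF h] ring_hom_add[OF h] ring_hom_one[OF h])
qed

lemma F_restrict:
 assumes "s el sec F U" "openin T V" "V <= U"
 shows "restrict s V el sec F V"
proof (rule F_secI)
 fix z assume z: "z : V"
 then have "z : U" using assms(3) by blast
 then obtain N s' where N: "L N s'" "z : N" "N <= U" "!!w. w : N ==> s w = s' w" using F_loc[OF assms(1)] by metis
 have "L (N Int V) s'" by (rule L_sub[OF N(1)]) (use L_open[OF N(1)] assms in auto)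
 then show "EX N s'. L N s' & z : N & N <= V & (ALL w:N. restrict s V w = s' w)"
  using N z by (intro exI[of _ "N Int V"] exI[of _ s']) auto
qed simp

lemma F_presheaf: "presheaf F"
proof
 have h: "(%s. restrict s V) : ring_hom (sec F U) (sec F V)" if "openin T U" "openin T V" "V <= U" for U V
  using that F_restrict by (intro ring_hom_memI) (auto simp: F_ops intro!: restrict_ext simp: subset_iff restrict_def)
 have e: "restrict s U = s" if "s el sec F U" for s U
  using that unfolding F_sec by (auto intro: extensional_restrict)
 have rr: "restrict (restrict s V) W = restrict s W" if "W <= V" for s :: "'p => 'r" and V W
  using that by (auto simp: restrict_def fun_eq_iff)
 show "presheaf_of_rings F"
  unfolding presheaf_of_rings_def F_pts F_res by (intro conjI allI impI ballI) (simp_all only: F_cring h e rr)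
qed

lemma F_sheaf: "sheaf F"
proof (rule sheafI)
 have "EX! t. t el sec F (\<Union>UU) & (ALL U:UU. restrict t U = s U)"
  if h: "ALL U:UU. openin T U" "ALL U:UU. s U el sec F U"
   "ALL U:UU. ALL V:UU. restrict (s U) (U Int V) = restrict (s V) (U Int V)" for UU s
 proof -
  define c where "c z = (SOME U. U : UU & z : U)" for z
  have c: "c z : UU & z : c z" if "z : U" "U : UU" for z U
   unfolding c_def using that by (intro someI[of "%U. U : UU & z : U"]) simp
  define t where "t = (\<lambda>z\<in>\<Union>UU. s (c z) z)"
  have ag: "s U z = s V z" if "U : UU" "V : UU" "z : U" "z : V" for U V z
  proof -
   have "restrict (s U) (U Int V) = restrict (s V) (U Int V)" using h(3) that by blast
   then have "restrict (s U) (U Int V) z = restrict (s V) (U Int V) z" by (rule fun_cong)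
   then show ?thesis using that by simp
  qed
  have tv: "t z = s U z" if "z : U" "U : UU" for z U
   using c[OF that] ag[of "c z" U z] that by (auto simp: t_def)
  have te: "t : extensional (\<Union>UU)" by (simp add: t_def)
  have "t el sec F (\<Union>UU)"
  proof (rule F_secI[OF te])
   fix z assume "z : \<Union>UU"
   then obtain U where U: "U : UU" "z : U" by blast
   obtain N s' where N: "L N s'" "z : N" "N <= U" "!!w. w : N ==> s U w = s' w"
    by (rule F_loc[OF bspec[OF h(2) U(1)] U(2)]) blast
   show "EX N s'. L N s' & z : N & N <= \<Union>UU & (ALL w:N. t w = s' w)"
    using N U tv by (intro exI[of _ N] exI[of _ s']) (auto simp: subset_iff)
  qed
  moreover have "restrict t U = s U" if "U : UU" for U
  proof -
   have "s U : extensional U" using bspec[OF h(2) that] unfolding F_sec PiE_def by blast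
   then show ?thesis by (rule extensionalityI[rotated]) (use tv that in auto)
  qed
  moreover have "t' = t" if t': "t' el sec F (\<Union>UU)" "ALL U:UU. restrict t' U = s U" for t'
  proof (rule F_eqI[OF t'(1) \<open>t el sec F (\<Union>UU)\<close>])
   fix z assume "z : \<Union>UU"
   then obtain U where U: "U : UU" "z : U" by blast
   then have "restrict t' U z = s U z" using t'(2) by simp
   then show "t' z = t z" using tv[OF U(2,1)] U by simp
  qed
  ultimately show ?thesis by blast
 qed
 then show "sheaf_of_rings F"
  unfolding sheaf_of_rings_def F_pts F_res using F_presheaf by (simp add: presheaf_def)
qed

sublocale F: sheaf F by (rule F_sheaf)

lemma F_germ_eq_iff:
 assumes "openin T U" "s el sec F U" "openin T V" "t el sec F V" "z : U" "z : V"
 shows "germ F z U s = germ F z V t <-> s z = t z"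
proof
 assume "germ F z U s = germ F z V t"
 then obtain W where W: "opn F W" "z : W" "W <= U" "W <= V" "res F U W s = res F V W t"
  using F.germ_eqE[of z U s V t] assms by auto
 then have "restrict s W z = restrict t W z" by simp
 then show "s z = t z" using W by simp
next
 assume e: "s z = t z"
 obtain N s' where N: "L N s'" "z : N" "N <= U" "!!w. w : N ==> s w = s' w" by (rule F_loc[OF assms(2,5)]) blast
 obtain M t' where M: "L M t'" "z : M" "M <= V" "!!w. w : M ==> t w = t' w" by (rule F_loc[OF assms(4,6)]) blast
 have o: "openin T (N Int M)" using L_open N M by auto
 have "L (N Int M) s'" "L (N Int M) t'" using L_sub[OF N(1) o] L_sub[OF M(1) o] by auto
 moreover have "s' z = t' z" using e N M by metis
 ultimately obtain W where W: "openin T W" "z : W" "W <= N Int M" "ALL w:W. s' w = t' w"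
  using L_eq[of "N Int M" s' t' z] N M by blast
 have "s w = t w" if "w : W" for w using N(4)[of w] M(4)[of w] bspec[OF W(4) that] subsetD[OF W(3) that] by simp
 then have "res F U W s = res F V W t" by (auto intro!: restrict_ext)
 moreover have "W <= U" "W <= V" using W N M by auto
 ultimately show "germ F z U s = germ F z V t"
  using F.germ_eqI[of U V W z s t] assms W by simp
qed

lemma F_eval_hom: "openin T U ==> z : U ==> (%s. s z) : ring_hom (sec F U) (R z)"
 by (rule ring_hom_memI) (auto simp: F_ops F_val)

lemma F_stalk:
 assumes z: "z : topspace T"
 obtains h where "h : ring_hom (stalk F z) (R z)" "inj_on h (carrier (stalk F z))" "h ` carrier (stalk F z) = carrier (R z)"
  "!!U s. openin T U ==> z : U ==> s el sec F U ==> h (germ F z U s) = s z"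
proof -
 obtain h where h: "h : ring_hom (stalk F z) (R z)"
  "!!U s. opn F U ==> z : U ==> s el sec F U ==> h (germ F z U s) = s z"
  by (rule F.stalk_univ[of z "R z" "%U s. s z"]) (use z R_cring F_eval_hom in auto)
 have inj: "inj_on h (carrier (stalk F z))"
 proof (rule inj_onI)
  fix a b assume ab: "a el stalk F z" "b el stalk F z" "h a = h b"
  obtain U s t where U: "opn F U" "z : U" "s el sec F U" "a = germ F z U s" "t el sec F U" "b = germ F z U t"
   using F.stalkE2[OF ab(1,2)] .
  then show "a = b" using ab(3) h(2)[OF U(1-3)] h(2)[OF U(1,2,5)] F_germ_eq_iff[of U s U t z] by simp
 qed
 have surj: "h ` carrier (stalk F z) = carrier (R z)"
 proof
  show "h ` carrier (stalk F z) <= carrier (R z)" using hom_car[OF h(1)] by blast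
  show "carrier (R z) <= h ` carrier (stalk F z)"
  proof
   fix r assume "r el R z"
   then obtain N s where N: "L N s" "z : N" "s z = r" using L_surj[OF z] by blast
   then have "h (germ F z N (restrict s N)) = r" "germ F z N (restrict s N) el stalk F z"
    using h(2)[of N "restrict s N"] F_basic[OF N(1)] L_open[OF N(1)] F.germ_closed[of N z "restrict s N"] by auto
   then show "r : h ` carrier (stalk F z)" by blast
  qed
 qed
 show ?thesis by (rule that[OF h(1) inj surj]) (use h(2) in simp)
qed

lemma F_germ_unit_iff:
 assumes U: "openin T U" "z : U" "s el sec F U"
 shows "germ F z U s : Units (stalk F z) <-> s z : Units (R z)"
proof -
 have z: "z : topspace T" using U openin_subset by blast
 obtain h where h: "h : ring_hom (stalk F z) (R z)" "inj_on h (carrier (stalk F z))" "h ` carrier (stalk F z) = carrier (R z)"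
  "!!U s. openin T U ==> z : U ==> s el sec F U ==> h (germ F z U s) = s z"
  by (rule F_stalk[OF z]) blast
 have zp: "z : points F" using z by simp
 interpret S: cring "stalk F z" by (rule F.stalk_cring[OF zp])
 interpret R: cring "R z" by (rule R_cring[OF z])
 have g: "germ F z U s el stalk F z" using F.germ_closed U by simp
 show ?thesis
 proof
  assume "germ F z U s : Units (stalk F z)"
  then show "s z : Units (R z)" using ring_hom_Units[OF h(1)] h(4)[OF U] by metis
 next
  assume "s z : Units (R z)"
  then obtain r where r: "r el R z" "s z *[R z] r = 1[R z]" using R.Units_iff by blast
  then have "r : h ` carrier (stalk F z)" using h(3) by simp
  then obtain b where b: "b el stalk F z" "h b = r" by auto
  have "h (germ F z U s *[stalk F z] b) = h 1[stalk F z]"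
   using ring_hom_mult[OF h(1) g b(1)] ring_hom_one[OF h(1)] h(4)[OF U] b r by simp
  then have "germ F z U s *[stalk F z] b = 1[stalk F z]"
   using h(2) g b by (auto simp: inj_on_def)
  then show "germ F z U s : Units (stalk F z)" using S.Units_iff g b by blast
 qed
qed

lemma F_lrs:
 assumes "!!z. z : topspace T ==> local_ring (R z)"
 shows "locally_ringed_space F"
proof -
 have "local_ring (stalk F z)" if z: "z : topspace T" for z
  by (rule F.stalk_local_reflect[of z "R z" "%U s. s z"])
   (use z assms F_eval_hom F_germ_unit_iff in auto)
 then show ?thesis unfolding locally_ringed_space_def using F.sheaf by simp
qed

definition "fr_fun D N s <-> openin T N & (EX a d. L N a & L N d & (ALL z:N. d z : D z & s z = frac (R z) (D z) (a z) (d z)))"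

lemma fr_funI: "L N a ==> L N d ==> (!!z. z : N ==> d z : D z) ==> (!!z. z : N ==> s z = frac (R z) (D z) (a z) (d z)) ==> fr_fun D N s"
 unfolding fr_fun_def using L_open by blast

text \<open>The values of a sheaf of functions may be localised pointwise, provided that
  denominators remain denominators nearby, which is \<open>Do\<close>. Constant functions lead to
  \<open>Spec\<close>, germs of sections to the localisation along a system of primes.\<close>

lemma fraction_fun_data:
 assumes D: "!!z. z : topspace T ==> mult_set (R z) (D z)" and Do: "!!N g. L N g ==> openin T {w : N. g w : D w}"
 shows "fun_data T (%z. localisation (R z) (D z)) (fr_fun D)"
proof (rule fun_data.intro)
 let ?Lc = "%z. localisation (R z) (D z)"
 show "cring (?Lc z)" if "z : topspace T" for z by (rule mult_set.loc_cring[OF D[OF that]])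
 fix N s assume "fr_fun D N s"
 then obtain a d where s: "openin T N" "L N a" "L N d" "ALL z:N. d z : D z & s z = frac (R z) (D z) (a z) (d z)"
  unfolding fr_fun_def by blast
 have M: "mult_set (R z) (D z)" if "z : N" for z using D openin_subset[OF s(1)] that by blast
 show "openin T N" by fact
 show "fr_fun D N' s" if "openin T N'" "N' <= N" for N'
  using s(4) that by (intro fr_funI[OF L_sub[OF s(2) that] L_sub[OF s(3) that]]) auto
 show "s z el ?Lc z" if "z : N" for z
  using s(4) that mult_set.frac_closed[OF M L_val[OF s(2)]] by simp
 show "fr_fun D N (%w. -[?Lc w] s w)"
  using s(4) mult_set.loc_neg[OF M L_val[OF s(2)]] by (intro fr_funI[OF L_neg[OF s(2)] s(3)]) auto
 fix t assume "fr_fun D N t"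
 then obtain b e where t: "L N b" "L N e" "ALL z:N. e z : D z & t z = frac (R z) (D z) (b z) (e z)"
  unfolding fr_fun_def by blast
 note v = L_val[OF s(2)] L_val[OF t(1)] and de = mult_set.S_mult[OF M]
 show "fr_fun D N (%w. s w +[?Lc w] t w)"
  using s(4) t(3) de mult_set.loc_add[OF M v]
  by (intro fr_funI[OF L_add[OF L_mult[OF s(2) t(2)] L_mult[OF t(1) s(3)]] L_mult[OF s(3) t(2)]]) auto
 show "fr_fun D N (%w. s w *[?Lc w] t w)"
  using s(4) t(3) de mult_set.loc_mult[OF M v] by (intro fr_funI[OF L_mult[OF s(2) t(1)] L_mult[OF s(3) t(2)]]) auto
 show "EX W. openin T W & z : W & W <= N & (ALL w:W. s w = t w)" if z: "z : N" and e: "s z = t z" for z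
 proof -
  \<comment> \<open>Equality of two fractions at \<open>z\<close> is witnessed by one multiplier
    \<open>u\<close>. A basic section \<open>g\<close> with value \<open>u\<close> at
    \<open>z\<close> spreads the witness to those nearby points at which \<open>g\<close> still is a
    denominator.\<close>
  obtain u where u: "u : D z" "u *[R z] (a z *[R z] e z) = u *[R z] (b z *[R z] d z)"
   using e s(4) t(3) z mult_set.frac_eq_iff[OF M v] by (metis (no_types))
  obtain K g where g: "L K g" "z : K" "g z = u"
   using L_surj[of z u] mult_set.S_carr[OF M[OF z] u(1)] openin_subset[OF s(1)] z by blast
  note o = openin_Int[OF s(1) L_open[OF g(1)]]
  note r = L_sub[OF _ o Int_lower1] L_sub[OF g(1) o Int_lower2]
  obtain W where W: "openin T W" "z : W" "W <= N Int K" "ALL w:W. g w *[R w] (a w *[R w] e w) = g w *[R w] (b w *[R w] d w)"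
   using L_eq[OF L_mult[OF r(2) r(1)[OF L_mult[OF s(2) t(2)]]] L_mult[OF r(2) r(1)[OF L_mult[OF t(1) s(3)]]], of z] g(2,3) z u(2) by auto
  have "s w = t w" if w: "w : W" "g w : D w" for w
  proof -
   have wN: "w : N" using W w by blast
   then show ?thesis using s(4) t(3) mult_set.frac_eq_iff[OF M[OF wN] v(1)[OF wN] v(2)[OF wN]] w W(4) by metis
  qed
  then show ?thesis
   using openin_Int[OF W(1) Do[OF g(1)]] W g u(1) by (intro exI[of _ "W Int {w : K. g w : D w}"]) auto
 qed
next
 show "fr_fun D (topspace T) (%w. 1[localisation (R w) (D w)])"
  using mult_set.S_one[OF D] by (intro fr_funI[OF L_one L_one]) (simp_all add: localisation_def)
 fix z r assume z: "z : topspace T" and r: "r el localisation (R z) (D z)"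
 interpret M: mult_set "R z" "D z" by (rule D[OF z])
 obtain a d where ad: "a el R z" "d : D z" "r = frac (R z) (D z) a d" using r M.loc_carrier by auto
 obtain N f where f: "L N f" "z : N" "f z = a" using L_surj[OF z ad(1)] by blast
 obtain K g where g: "L K g" "z : K" "g z = d" using L_surj[OF z M.S_carr[OF ad(2)]] by blast
 let ?W = "N Int {w : K. g w : D w}"
 have o: "openin T ?W" by (rule openin_Int[OF L_open[OF f(1)] Do[OF g(1)]])
 have "L ?W f" "L ?W g" by (rule L_sub[OF f(1) o], blast, rule L_sub[OF g(1) o], blast)
 then have "fr_fun D ?W (%w. frac (R w) (D w) (f w) (g w))" unfolding fr_fun_def using o by blast
 then show "EX N s. fr_fun D N s & z : N & s z = r"
  using f g ad by (intro exI[of _ ?W] exI[of _ "%w. frac (R w) (D w) (f w) (g w)"]) simp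
qed

end

text \<open>Sections of \<open>X\<close> read as functions on a space \<open>T\<close> over
  \<open>X\<close>, after pushing their germs along \<open>ka\<close>. There are two instances:
  cosets modulo an ideal, where \<open>pj\<close> is the identity, and germs at pairs of a point and
  a prime, where \<open>ka\<close> is the identity.\<close>

definition germ_fun :: "('p, 'r) ringed_space => 'z topology => ('z => 'p) => ('z => ('p set \<times> 'r) set => 'b) => 'z set => ('z => 'b) => bool" where
 "germ_fun X T pj ka N s <-> openin T N & (EX W a. opn X W & a el sec X W & (ALL z:N. pj z : W & s z = ka z (germ X (pj z) W a)))"

lemma germ_funI: "openin T N ==> opn X W ==> a el sec X W ==> (!!z. z : N ==> pj z : W) ==>
  (!!z. z : N ==> s z = ka z (germ X (pj z) W a)) ==> germ_fun X T pj ka N s"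
 unfolding germ_fun_def by blast

context presheaf
begin

lemma germ_fun2E:
 assumes g: "germ_fun X T pj ka N g" and h: "germ_fun X T pj ka N h"
 obtains W a b where "opn X W" "a el sec X W" "b el sec X W" "openin T N" "!!z. z : N ==> pj z : W"
  "!!z. z : N ==> g z = ka z (germ X (pj z) W a)" "!!z. z : N ==> h z = ka z (germ X (pj z) W b)"
proof -
 obtain V a where V: "openin T N" "opn X V" "a el sec X V" "ALL z:N. pj z : V & g z = ka z (germ X (pj z) V a)" using g unfolding germ_fun_def by blast
 obtain W b where W: "opn X W" "b el sec X W" "ALL z:N. pj z : W & h z = ka z (germ X (pj z) W b)" using h unfolding germ_fun_def by blast
 have o: "opn X (V Int W)" using V W by blast
 show ?thesis
  by (rule that[OF o res_closed[OF V(2) o Int_lower1 V(3)] res_closed[OF W(1) o Int_lower2 W(2)] V(1)])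
   (use V(4) W(3) germ_res[OF V(2) o _ Int_lower1 V(3)] germ_res[OF W(1) o _ Int_lower2 W(2)] in auto)
qed

lemma germ_fun_data:
 assumes pj: "!!z. z : topspace T ==> pj z : points X" "!!W. opn X W ==> openin T {z : topspace T. pj z : W}"
  and R: "!!z. z : topspace T ==> cring (R z)" and ka: "!!z. z : topspace T ==> ka z : ring_hom (stalk X (pj z)) (R z)"
  and surj: "!!z r. z : topspace T ==> r el R z ==> EX a:carrier (stalk X (pj z)). r = ka z a"
  and eq: "!!z W a b. z : topspace T ==> opn X W ==> pj z : W ==> a el sec X W ==> b el sec X W ==>
   ka z (germ X (pj z) W a) = ka z (germ X (pj z) W b) ==> EX V. opn X V & pj z : V &
   (ALL w:topspace T. pj w : V Int W --> ka w (germ X (pj w) W a) = ka w (germ X (pj w) W b))"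
 shows "fun_data T R (germ_fun X T pj ka)"
proof (rule fun_data.intro)
 have P: "opn X (points X)" by simp
 interpret RP: cring "sec X (points X)" by (rule sec_cring[OF P])
 note H = hom_comp[OF germ_hom ka]
 show "cring (R z)" if "z : topspace T" for z by (rule R[OF that])
 show "germ_fun X T pj ka (topspace T) (%w. 1[R w])"
  by (rule germ_funI[OF openin_topspace P RP.one_closed]) (simp_all add: pj(1) ring_hom_one[OF H[OF P]])
 fix z r assume z: "z : topspace T" and r: "r el R z"
 obtain ga where g: "ga el stalk X (pj z)" "r = ka z ga" using surj[OF z r] by blast
 obtain U a where U: "opn X U" "pj z : U" "a el sec X U" "ga = germ X (pj z) U a" by (rule stalkE[OF g(1)])
 have "germ_fun X T pj ka {z : topspace T. pj z : U} (%z. ka z (germ X (pj z) U a))" by (rule germ_funI[OF pj(2)[OF U(1)] U(1,3)]) auto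
 then show "EX N s. germ_fun X T pj ka N s & z : N & s z = r" using U z g by (auto intro!: exI[of _ "{z : topspace T. pj z : U}"])
next
 fix N g assume g: "germ_fun X T pj ka N g"
 then obtain W a where W: "openin T N" "opn X W" "a el sec X W" "ALL z:N. pj z : W & g z = ka z (germ X (pj z) W a)"
  unfolding germ_fun_def by blast
 interpret RW: cring "sec X W" by (rule sec_cring[OF W(2)])
 note H = hom_comp[OF germ_hom ka] and top = subsetD[OF openin_subset[OF W(1)]]
 show "openin T N" by fact
 show "germ_fun X T pj ka N' g" if "openin T N'" "N' <= N" for N' using W(4) that by (intro germ_funI[OF that(1) W(2,3)]) auto
 show "g z el R z" if "z : N" for z using W that top hom_car[OF H[OF W(2)] W(3)] by simp
 show "germ_fun X T pj ka N (%w. -[R w] g w)"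
  using W(4) top ring_hom_cring.hom_a_inv[OF ring_hom_cring.intro[OF RW.cring_axioms R ring_hom_cring_axioms.intro[OF H[OF W(2)]]] W(3)]
  by (intro germ_funI[OF W(1,2) RW.a_inv_closed[OF W(3)]]) auto
 fix h assume h: "germ_fun X T pj ka N h"
 obtain W a b where W: "opn X W" "a el sec X W" "b el sec X W" "openin T N" "!!z. z : N ==> pj z : W"
  "!!z. z : N ==> g z = ka z (germ X (pj z) W a)" "!!z. z : N ==> h z = ka z (germ X (pj z) W b)" by (rule germ_fun2E[OF g h]) blast
 interpret R: cring "sec X W" by (rule sec_cring[OF W(1)])
 show "germ_fun X T pj ka N (%w. g w +[R w] h w)"
  by (rule germ_funI[OF W(4,1) R.a_closed[OF W(2,3)] W(5)]) (simp_all add: top W(5-7) ring_hom_add[OF H[OF W(1)] W(2,3)])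
 show "germ_fun X T pj ka N (%w. g w *[R w] h w)"
  by (rule germ_funI[OF W(4,1) R.m_closed[OF W(2,3)] W(5)]) (simp_all add: top W(5-7) ring_hom_mult[OF H[OF W(1)] W(2,3)])
 show "EX O'. openin T O' & z : O' & O' <= N & (ALL w:O'. g w = h w)" if z: "z : N" and e: "g z = h z" for z
 proof -
  have "ka z (germ X (pj z) W a) = ka z (germ X (pj z) W b)" using e W(6,7)[OF z] by simp
  from eq[OF top[OF z] W(1) W(5)[OF z] W(2,3) this] obtain V where V: "opn X V" "pj z : V"
   "ALL w:topspace T. pj w : V Int W --> ka w (germ X (pj w) W a) = ka w (germ X (pj w) W b)" by blast
  then show ?thesis using openin_Int[OF W(4) pj(2)[OF V(1)]] z top W(5-7)
   by (intro exI[of _ "N Int {z : topspace T. pj z : V}"]) auto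
 qed
qed

end

lemma openin_generated_basis:
 assumes "!!a b x. a : S ==> b : S ==> x : a Int b ==> EX c:S. x : c & c <= a Int b"
 shows "openin (topology_generated_by S) U <-> (ALL x:U. EX c:S. x : c & c <= U)"
proof
 assume "openin (topology_generated_by S) U"
 then have "generate_topology_on S U" by (rule openin_topology_generated_by)
 then show "ALL x:U. EX c:S. x : c & c <= U"
 proof induction
  case (Int a b)
  show ?case
  proof
   fix x assume x: "x : a Int b"
   obtain c d where c: "c : S" "x : c" "c <= a" "d : S" "x : d" "d <= b" using Int x by blast
   then obtain e where "e : S" "x : e" "e <= c Int d" using assms[of c d x] by blast
   then show "EX c:S. x : c & c <= a Int b" using c by blast
  qed
 next
  case (UN K)
  show ?case
  proof
   fix x assume "x : \<Union>K"
   then obtain k where k: "k : K" "x : k" by blast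
   then obtain c where "c : S" "x : c" "c <= k" using UN(2) by metis
   then show "EX c:S. x : c & c <= \<Union>K" using k(1) by (intro bexI[of _ c]) auto
  qed
 next
  case (Basis c)
  then show ?case by blast
 qed simp
next
 assume h: "ALL x:U. EX c:S. x : c & c <= U"
 have "U = \<Union>{c : S. c <= U}" using h by blast
 moreover have "openin (topology_generated_by S) (\<Union>{c : S. c <= U})"
  by (rule openin_Union) (auto intro: topology_generated_by_Basis)
 ultimately show "openin (topology_generated_by S) U" by metis
qed

subsection \<open>Affine charts\<close>

text \<open>The properties of an open subscheme \<open>V\<close> isomorphic to \<open>Spec A\<close> that determine morphisms to it.\<close>

locale chart =
 fixes X :: "('p, 'r) ringed_space" and V :: "'p set" and A :: "'a ring" and jj :: "'a => 'r"
 assumes lrs: "locally_ringed_space X" and V_open: "opn X V" and A_cring: "cring A"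
  and iota_hom: "jj : ring_hom A (sec X V)"
  and point_of_prime: "!!P. primeideal P A ==> EX x:V. ALL a:carrier A. germ X x V (jj a) : Units (stalk X x) <-> a ~: P"
  and point_inj: "!!x y. x : V ==> y : V ==> (!!a. a el A ==>
   germ X x V (jj a) : Units (stalk X x) <-> germ X y V (jj a) : Units (stalk X y)) ==> x = y"
  and basis: "!!W x. opn X W ==> W <= V ==> x : W ==> EX a:carrier A. germ X x V (jj a) : Units (stalk X x) &
   (ALL y:V. germ X y V (jj a) : Units (stalk X y) --> y : W)"
  and fraction: "!!x ga. x : V ==> ga el stalk X x ==> EX a:carrier A. EX d:carrier A.
   germ X x V (jj d) : Units (stalk X x) & ga *[stalk X x] germ X x V (jj d) = germ X x V (jj a)"
  and kernel: "!!x a. x : V ==> a el A ==> germ X x V (jj a) = 0[stalk X x] ==>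
   EX d:carrier A. germ X x V (jj d) : Units (stalk X x) & d *[A] a = 0[A]"

definition zariski :: "('a, 'b) ring_scheme => 'a set topology" where
 "zariski A = topology_generated_by {{pp. primeideal pp A & f ~: pp} | f. f el A}"

definition frac_fun :: "('a, 'b) ring_scheme => 'a set set => ('a set => ('a \<times> 'a) set) => bool" where
 "frac_fun A V s <-> openin (zariski A) V &
  (EX a:carrier A. EX f:carrier A. ALL qq:V. f ~: qq & s qq = frac A (carrier A - qq) a f)"

lemma frac_funI:
 "openin (zariski A) V ==> a el A ==> f el A ==> (!!qq. qq : V ==> f ~: qq) ==>
  (!!qq. qq : V ==> s qq = frac A (carrier A - qq) a f) ==> frac_fun A V s"
 unfolding frac_fun_def by blast

lemma Spec_fun_space: "Spec A = fun_space (zariski A) (%pp. localisation A (carrier A - pp)) (frac_fun A)"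
proof -
 have "(EX V. openin (zariski A) V & pp : V & V <= U & (EX a:carrier A. EX f:carrier A. ALL qq:V. f ~: qq & s qq = frac A (carrier A - qq) a f))
  <-> (EX N s'. frac_fun A N s' & pp : N & N <= U & (ALL w:N. s w = s' w))" (is "?l <-> ?r") for pp U and s :: "'a set => ('a \<times> 'a) set"
 proof
  assume ?l
  then obtain V where "openin (zariski A) V" "pp : V" "V <= U" "EX a:carrier A. EX f:carrier A. ALL qq:V. f ~: qq & s qq = frac A (carrier A - qq) a f" by blast
  then show ?r unfolding frac_fun_def by (intro exI[of _ V] exI[of _ s]) simp
 next
  assume ?r
  then obtain N s' a f where "openin (zariski A) N" "pp : N" "N <= U" "ALL w:N. s w = s' w" "a el A" "f el A"
   "ALL qq:N. f ~: qq & s' qq = frac A (carrier A - qq) a f" unfolding frac_fun_def by blast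
  then show ?l by (intro exI[of _ N] conjI bexI[of _ a] bexI[of _ f]) simp_all
 qed
 then show ?thesis unfolding Spec_def fun_space_def Let_def zariski_def[symmetric] by simp
qed

lemma zariski_iff:
 assumes "cring A"
 shows "openin (zariski A) U <-> (ALL pp:U. EX f:carrier A. primeideal pp A & f ~: pp & (ALL qq. primeideal qq A --> f ~: qq --> qq : U))"
proof -
 interpret cring A by fact
 let ?S = "{{pp. primeideal pp A & f ~: pp} | f. f el A}"
 have "openin (zariski A) U <-> (ALL x:U. EX c:?S. x : c & c <= U)"
  unfolding zariski_def
 proof (rule openin_generated_basis)
  fix a b x assume "a : ?S" "b : ?S" and x: "x : a Int b"
  then obtain f g where f: "f el A" "a = {pp. primeideal pp A & f ~: pp}" "g el A" "b = {pp. primeideal pp A & g ~: pp}"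
   by blast
  have e: "a Int b = {pp. primeideal pp A & f *[A] g ~: pp}"
  proof -
   have "f *[A] g : pp <-> f : pp | g : pp" if "primeideal pp A" for pp
   proof -
    interpret P: primeideal pp A by fact
    show ?thesis using P.I_prime[of f g] P.I_l_closed[of g f] P.I_r_closed[of f g] f by auto
   qed
   then show ?thesis unfolding f by auto
  qed
  have "a Int b : ?S" unfolding e using f by blast
  then show "EX c:?S. x : c & c <= a Int b" using x by blast
 qed
 also have "... <-> (ALL pp:U. EX f:carrier A. primeideal pp A & f ~: pp & (ALL qq. primeideal qq A --> f ~: qq --> qq : U))"
  by (rule ball_cong) auto
 finally show ?thesis .
qed

lemma zariski_D:
 assumes "cring A" "f el A"
 shows "openin (zariski A) {pp. primeideal pp A & f ~: pp}"
 unfolding zariski_iff[OF assms(1)] using assms(2) by blast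

lemma zariski_topspace:
 assumes "cring A"
 shows "topspace (zariski A) = {pp. primeideal pp A}"
proof -
 interpret cring A by fact
 have "pp : topspace (zariski A)" if "primeideal pp A" for pp
 proof -
  have "pp : {pp. primeideal pp A & 1[A] ~: pp}" using that primeideal_one by blast
  then show ?thesis using openin_subset[OF zariski_D[OF assms one_closed]] by blast
 qed
 moreover have "primeideal pp A" if "pp : topspace (zariski A)" for pp
  using that zariski_iff[OF assms, of "topspace (zariski A)"] by blast
 ultimately show ?thesis by blast
qed

context
 fixes A :: "'a ring"
 assumes A: "cring A"
begin

interpretation A: cring A by (rule A)

lemma zariski_prime: "openin (zariski A) U ==> pp : U ==> primeideal pp A"
 using openin_subset zariski_topspace[OF A] by blast

lemma Spec_fun_data: "fun_data (zariski A) (%pp. localisation A (carrier A - pp)) (frac_fun A)"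
proof -
 \<comment> \<open>The structure sheaf of \<open>Spec A\<close> arises from the constant functions
   with values in \<open>A\<close> by localising at the complements of the primes.\<close>
 let ?c = "%N g. openin (zariski A) N & (EX a:carrier A. ALL z:N. g z = a)"
 interpret c: fun_data "zariski A" "%_. A" ?c
 proof
  show "?c N (%w. s w +[A] t w)" "?c N (%w. s w *[A] t w)" if st: "?c N s" "?c N t" for N s t
  proof -
   obtain a b where "a el A" "b el A" "ALL z:N. s z = a" "ALL z:N. t z = b" using st by blast
   then show "?c N (%w. s w +[A] t w)" "?c N (%w. s w *[A] t w)" using st by auto
  qed
  show "EX N s. ?c N s & z : N & s z = r" if "z : topspace (zariski A)" "r el A" for z r
   by (rule exI[of _ "topspace (zariski A)"], rule exI[of _ "%_. r"]) (use that in auto)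
 qed (use A in "auto simp: subset_iff")
 have "fun_data (zariski A) (%pp. localisation A (carrier A - pp)) (c.fr_fun (%pp. carrier A - pp))"
 proof (rule c.fraction_fun_data)
  show "mult_set A (carrier A - z)" if "z : topspace (zariski A)" for z
   using that zariski_topspace[OF A] prime_mult_set by blast
  fix N g assume g: "?c N g"
  then obtain a where a: "a el A" "ALL z:N. g z = a" by blast
  have "{w : N. g w : carrier A - w} = N Int {pp. primeideal pp A & a ~: pp}"
   using a zariski_prime[of N] g by auto
  then show "openin (zariski A) {w : N. g w : carrier A - w}" using g zariski_D[OF A a(1)] by auto
 qed
 moreover have "c.fr_fun (%pp. carrier A - pp) = frac_fun A"
 proof (intro ext iffI)
  fix N s assume "c.fr_fun (%pp. carrier A - pp) N s"
  then show "frac_fun A N s" unfolding c.fr_fun_def frac_fun_def by (elim conjE exE bexE) auto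
 next
  fix N s assume "frac_fun A N s"
  then obtain a f where "openin (zariski A) N" "a el A" "f el A" "ALL qq:N. f ~: qq & s qq = frac A (carrier A - qq) a f"
   unfolding frac_fun_def by blast
  then show "c.fr_fun (%pp. carrier A - pp) N s"
   unfolding c.fr_fun_def by (intro conjI exI[of _ "%_. a"] exI[of _ "%_. f"]) auto
 qed
 ultimately show ?thesis by simp
qed

interpretation S: fun_data "zariski A" "%pp. localisation A (carrier A - pp)" "frac_fun A" by (rule Spec_fun_data)

definition Spec_elt :: "'a => 'a set => ('a \<times> 'a) set" where
 "Spec_elt a = (\<lambda>pp\<in>topspace (zariski A). frac A (carrier A - pp) a 1[A])"

lemma Spec_points: "points (Spec A) = {pp. primeideal pp A}"
 unfolding Spec_fun_space using zariski_topspace[OF A] by simp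

lemma Spec_lrs: "locally_ringed_space (Spec A)"
 unfolding Spec_fun_space by (rule S.F_lrs) (use zariski_topspace[OF A] loc_prime_local in blast)

lemma Spec_elt_hom: "Spec_elt : ring_hom A (sec (Spec A) (points (Spec A)))"
 unfolding Spec_fun_space S.F_pts
proof (rule S.F_hom[OF openin_topspace A])
 fix z assume z: "z : topspace (zariski A)"
 then have "mult_set A (carrier A - z)" using zariski_topspace[OF A] prime_mult_set by blast
 from mult_set.loc_hom[OF this] z show "(%a. Spec_elt a z) : ring_hom A (localisation A (carrier A - z))" by (simp add: Spec_elt_def)
next
 fix x assume x: "x el A"
 have "frac_fun A (topspace (zariski A)) (%pp. frac A (carrier A - pp) x 1[A])"
  using x primeideal_one[of _ A] zariski_topspace[OF A] by (intro frac_funI[of _ _ x "1[A]"] openin_topspace) auto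
 from S.F_basic[OF this] show "Spec_elt x el sec S.F (topspace (zariski A))" by (simp add: Spec_elt_def)
qed

lemma Spec_chart: "chart (Spec A) (points (Spec A)) A Spec_elt"
proof (rule chart.intro)
 show "locally_ringed_space (Spec A)" by (rule Spec_lrs)
 show "cring A" by (rule A)
 show "opn (Spec A) (points (Spec A))" by simp
 show "Spec_elt : ring_hom A (sec (Spec A) (points (Spec A)))" by (rule Spec_elt_hom)
 let ?X = "Spec A" let ?P = "points (Spec A)" let ?S = "stalk ?X" let ?g = "%x a. germ ?X x ?P (Spec_elt a)"
 have el: "Spec_elt a el sec ?X ?P" if "a el A" for a
  using hom_car[OF Spec_elt_hom that] .
 have u: "?g x a : Units (?S x) <-> a ~: x" if x: "x : ?P" and a: "a el A" for x a
 proof -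
  have xp: "primeideal x A" using x Spec_points by blast
  have xt: "x : topspace (zariski A)" using x unfolding Spec_fun_space by simp
  have "?g x a : Units (?S x) <-> Spec_elt a x : Units (localisation A (carrier A - x))"
   using S.F_germ_unit_iff[OF openin_topspace xt, of "Spec_elt a"] el[OF a] unfolding Spec_fun_space S.F_pts by simp
  also have "Spec_elt a x = frac A (carrier A - x) a 1[A]" using xt by (simp add: Spec_elt_def)
  also have "frac A (carrier A - x) a 1[A] : Units (localisation A (carrier A - x)) <-> a ~: x"
   by (rule loc_prime_unit_iff[OF xp a]) (use primeideal_one[OF xp] in simp)
  finally show ?thesis .
 qed
 show "EX x:?P. ALL a:carrier A. ?g x a : Units (?S x) <-> a ~: P" if "primeideal P A" for P
 proof (rule bexI[of _ P])
  show "P : ?P" using that Spec_points by blast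
  then show "ALL a:carrier A. ?g P a : Units (?S P) <-> a ~: P" using u by blast
 qed
 show "x = y" if h: "x : ?P" "y : ?P" "!!a. a el A ==>
   ?g x a : Units (?S x) <-> ?g y a : Units (?S y)" for x y
 proof -
  have "x <= carrier A" "y <= carrier A" using h Spec_points
   by (auto dest!: primeideal.axioms(1) ideal.axioms(1) additive_subgroup.a_subset)
  moreover have "a : x <-> a : y" if "a el A" for a using h(3)[OF that] u[OF h(1) that] u[OF h(2) that] by blast
  ultimately show ?thesis by blast
 qed
 show "EX a:carrier A. ?g x a : Units (?S x) &
   (ALL y:?P. ?g y a : Units (?S y) --> y : W)"
  if W: "opn ?X W" "W <= ?P" "x : W" for W x
 proof -
  have "openin (zariski A) W" using W(1) unfolding Spec_fun_space by simp
  then obtain f where f: "f el A" "f ~: x" "ALL qq. primeideal qq A --> f ~: qq --> qq : W"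
   using zariski_iff[OF A, of W] W(3) by blast
  have xP: "x : ?P" using W by blast
  show ?thesis
   by (rule bexI[OF _ f(1)]) (use f u[OF xP f(1)] u[OF _ f(1)] Spec_points in blast)
 qed
 fix x assume x: "x : ?P"
 have xp: "primeideal x A" using x Spec_points by blast
 have xt: "x : topspace (zariski A)" using x unfolding Spec_fun_space by simp
 interpret M: mult_set A "carrier A - x" by (rule prime_mult_set[OF xp])
 obtain h where h: "h : ring_hom (?S x) (localisation A (carrier A - x))" "inj_on h (carrier (?S x))"
  "!!U s. openin (zariski A) U ==> x : U ==> s el sec ?X U ==> h (germ ?X x U s) = s x"
  using S.F_stalk[OF xt] unfolding Spec_fun_space by metis
 have P: "openin (zariski A) ?P" unfolding Spec_fun_space by simp
 have hg: "h (?g x a) = frac A (carrier A - x) a 1[A]" if "a el A" for a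
  using h(3)[OF P x el[OF that]] xt by (simp add: Spec_elt_def)
 interpret X: presheaf ?X by (rule lrsD(3)[OF Spec_lrs])
 have gc: "?g x a el ?S x" if "a el A" for a
  using X.germ_closed[OF _ x el[OF that]] by simp
 interpret St: cring "?S x" by (rule X.stalk_cring[OF x])
 show "EX a:carrier A. EX d:carrier A. ?g x d : Units (?S x) &
  ga *[?S x] ?g x d = ?g x a" if g: "ga el ?S x" for ga
 proof -
  obtain a d where ad: "a el A" "d : carrier A - x" "h ga = frac A (carrier A - x) a d"
   using hom_car[OF h(1) g] M.loc_carrier by auto
  have d: "d el A" "d ~: x" using ad by auto
  have "h (ga *[?S x] ?g x d) = h (?g x a)"
   using ring_hom_mult[OF h(1) g gc[OF d(1)]] ad hg[OF d(1)] hg[OF ad(1)] M.loc_frac_eq_mult[OF ad(1,2)] by simp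
  then have "ga *[?S x] ?g x d = ?g x a"
   by (rule inj_onD[OF h(2)]) (use g gc ad d in auto)
  then show ?thesis using u[OF x d(1)] d ad by blast
 qed
 show "EX d:carrier A. ?g x d : Units (?S x) & d *[A] a = 0[A]"
  if a: "a el A" and z: "?g x a = 0[?S x]" for a
 proof -
  have "frac A (carrier A - x) a 1[A] = 0[localisation A (carrier A - x)]"
   using hg[OF a] z ring_hom_zero[OF h(1) St.ring_axioms cring.axioms(1)[OF M.loc_cring]] by simp
  then obtain d where "d : carrier A - x" "d *[A] a = 0[A]"
   using M.loc_eq_zero_iff[OF a M.S_one] by blast
  then show ?thesis using u[OF x] by blast
 qed
qed

end

section \<open>Functoriality of stalk maps and transport of charts\<close>

lemma stalk_map_comp:
 assumes f: "mor X Y f" and g: "mor Y Z g" and x: "x : points X" and a: "a el (stalk Z (pmap g (pmap f x)))"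
 shows "stalk_map X Z (comp_mor Y f g) x a = stalk_map X Y f x (stalk_map Y Z g (pmap f x) a)"
proof -
 interpret f: mor X Y f by fact
 interpret g: mor Y Z g by fact
 interpret h: mor X Z "comp_mor Y f g" by (rule mor_comp[OF f g])
 obtain V s where V: "opn Z V" "pmap g (pmap f x) : V" "s el sec Z V" "a = germ Z (pmap g (pmap f x)) V s"
  using g.Y.stalkE[OF a] .
 have y: "pmap f x : points Y" using f.pmap_in[OF x] .
 have V2: "pmap (comp_mor Y f g) x : V" using V by simp
 have "stalk_map X Z (comp_mor Y f g) x a = germ X x (preim X f (preim Y g V)) (smap f (preim Y g V) (smap g V s))"
  using h.stalk_map_germ[OF x V(1) V2 V(3)] V(4) by (simp add: preim_comp[OF f.premor_axioms])
 also have "... = stalk_map X Y f x (germ Y (pmap f x) (preim Y g V) (smap g V s))"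
  using f.stalk_map_germ[OF x g.preim_open[OF V(1)] _ g.smap_closed[OF V(1,3)]] y V by simp
 also have "... = stalk_map X Y f x (stalk_map Y Z g (pmap f x) a)"
  using g.stalk_map_germ[OF y V(1-3)] V(4) by simp
 finally show ?thesis .
qed

lemma stalk_map_cong:
 assumes f: "mor X Y f" and e: "mor_eq X Y f g" and x: "x : points X" and a: "a el stalk Y (pmap f x)"
 shows "stalk_map X Y g x a = stalk_map X Y f x a"
proof -
 interpret f: mor X Y f by fact
 interpret g: mor X Y g by (rule mor_eq_mor[OF e f])
 obtain V s where V: "opn Y V" "pmap f x : V" "s el sec Y V" "a = germ Y (pmap f x) V s"
  using f.Y.stalkE[OF a] .
 have p: "pmap g x = pmap f x" using mor_eq_pmap[OF e x] by simp
 show ?thesis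
  using f.stalk_map_germ[OF x V(1-3)] g.stalk_map_germ[OF x V(1) _ V(3)] p V mor_eq_smap[OF e V(1,3)] mor_eq_preim[OF e, of V]
  by simp
qed

lemma stalk_map_id:
 assumes "presheaf X" "x : points X" "a el stalk X x"
 shows "stalk_map X X id_mor x a = a"
proof -
 interpret m: mor X X id_mor by (rule mor_id[OF assms(1)])
 obtain V s where V: "opn X V" "x : V" "s el sec X V" "a = germ X x V s"
  using m.X.stalkE[OF assms(3)] .
 show ?thesis using m.stalk_map_germ[OF assms(2) V(1) _ V(3)] V preim_id[OF m.X.opn_sub[OF V(1)]] by simp
qed

lemma stalk_map_inverse:
 assumes f: "mor X Y f" and g: "mor Y X g" and fg: "mor_eq X X (comp_mor Y f g) id_mor" and x: "x : points X" and a: "a el stalk X x"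
 shows "stalk_map X Y f x (stalk_map Y X g (pmap f x) a) = a"
proof -
 have X: "presheaf X" using f unfolding mor_def premor_def by blast
 have gx: "pmap g (pmap f x) = x" using mor_eq_pmap[OF fg x] by simp
 have "stalk_map X X (comp_mor Y f g) x a = stalk_map X X id_mor x a"
  by (rule stalk_map_cong[OF mor_id[OF X] mor_eq_sym[OF fg] x]) (use a in simp)
 then show ?thesis using stalk_map_comp[OF f g x, of a] stalk_map_id[OF X x a] a gx by simp
qed

lemma chart_push:
 assumes X: "locally_ringed_space X" and V: "opn X V" and R: "chart Y (points Y) A jj" and g: "mor Y X g"
  and im: "pmap g ` points Y = V" and inj: "!!y. y : points Y ==> inj_on (stalk_map Y X g y) (carrier (stalk X (pmap g y)))"
  and j: "j : ring_hom A (sec X V)" "!!a. a el A ==> smap g V (j a) = jj a"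
 shows "chart X V A j"
proof -
 interpret R: chart Y "points Y" A jj by fact
 interpret g: mor Y X g by fact
 interpret A: cring A by (rule R.A_cring)
 note jc = hom_car[OF j(1)]
 have gV: "pmap g y : V" if "y : points Y" for y using im that by blast
 have pV: "preim Y g V = points Y" using gV by auto
 have ex: "EX y:points Y. x = pmap g y" if "x : V" for x using im that by blast
 let ?h = "%x a. germ X x V (j a)" let ?k = "%y a. germ Y y (points Y) (jj a)"
 have sg: "stalk_map Y X g y (?h (pmap g y) a) = ?k y a" if "y : points Y" "a el A" for y a
  using g.stalk_map_germ[OF that(1) V gV[OF that(1)] jc[OF that(2)]] j(2)[OF that(2)] pV by simp
 have u: "?h (pmap g y) a : Units (stalk X (pmap g y)) <-> ?k y a : Units (stalk Y y)" if "y : points Y" "a el A" for y a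
  using g.germ_unit_smap_iff[OF that(1) V gV[OF that(1)] jc[OF that(2)]] j(2)[OF that(2)] pV by simp
 show ?thesis
 proof (rule chart.intro)
  show "EX x:V. ALL a:carrier A. ?h x a : Units (stalk X x) <-> a ~: P" if "primeideal P A" for P
  proof -
   obtain y where y: "y : points Y" "ALL a:carrier A. ?k y a : Units (stalk Y y) <-> a ~: P" using R.point_of_prime[OF \<open>primeideal P A\<close>] by blast
   then show ?thesis using u[OF y(1)] by (intro bexI[OF _ gV[OF y(1)]]) simp
  qed
  show "x = x'" if h: "x : V" "x' : V" "!!a. a el A ==> ?h x a : Units (stalk X x) <-> ?h x' a : Units (stalk X x')" for x x'
  proof -
   obtain y y' where y: "y : points Y" "x = pmap g y" "y' : points Y" "x' = pmap g y'" using ex h(1,2) by metis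
   have "y = y'" by (rule R.point_inj) (use y u h(3) in simp_all)
   then show ?thesis using y by simp
  qed
  show "EX a:carrier A. ?h x a : Units (stalk X x) & (ALL z:V. ?h z a : Units (stalk X z) --> z : W)"
   if W: "opn X W" "W <= V" "x : W" for W x
  proof -
   obtain y where y: "y : points Y" "x = pmap g y" using ex W by blast
   have "preim Y g W <= points Y" "y : preim Y g W" using y W by auto
   from R.basis[OF g.preim_open[OF W(1)] this] obtain a where a: "a el A" "?k y a : Units (stalk Y y)"
    "ALL z:points Y. ?k z a : Units (stalk Y z) --> z : preim Y g W" by blast
   have "z : W" if "z : V" "?h z a : Units (stalk X z)" for z
    using ex[OF that(1)] that(2) u[OF _ a(1)] a(3) by auto
   then show ?thesis using a u[OF y(1) a(1)] y(2) by blast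
  qed
  fix x assume "x : V"
  then obtain y where y: "y : points Y" "x = pmap g y" using ex by blast
  interpret SX: cring "stalk X x" using g.Y.stalk_cring[OF g.pmap_in[OF y(1)]] unfolding y(2) .
  interpret SY: cring "stalk Y y" by (rule g.X.stalk_cring[OF y(1)])
  note H = g.stalk_map_hom[OF y(1), folded y(2)] and sg' = sg[OF y(1), folded y(2)] and u' = u[OF y(1), folded y(2)]
  have hc: "?h x a el stalk X x" if "a el A" for a using g.Y.germ_closed[OF V \<open>x : V\<close> jc[OF that]] .
  show "EX a:carrier A. EX d:carrier A. ?h x d : Units (stalk X x) & ga *[stalk X x] ?h x d = ?h x a" if c: "ga el stalk X x" for ga
  proof -
   obtain a d where ad: "a el A" "d el A" "?k y d : Units (stalk Y y)" "stalk_map Y X g y ga *[stalk Y y] ?k y d = ?k y a"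
    using R.fraction[OF y(1) hom_car[OF H c]] by blast
   have "ga *[stalk X x] ?h x d = ?h x a"
    by (rule inj_onD[OF inj[OF y(1), folded y(2)]]) (use c hc ad sg' ring_hom_mult[OF H c] in simp_all)
   then show ?thesis using ad u' by blast
  qed
  show "EX d:carrier A. ?h x d : Units (stalk X x) & d *[A] a = 0[A]" if a: "a el A" "?h x a = 0[stalk X x]" for a
   using R.kernel[OF y(1) a(1)] sg'[OF a(1)] a(2) ring_hom_zero[OF H SX.ring_axioms SY.ring_axioms] u' by auto
 qed (use X V A.cring_axioms j in simp_all)
qed

lemma chart_iso:
 assumes X: "locally_ringed_space X" and Y: "chart Y (points Y) A jj" and iso: "iso_mor X Y f"
 shows "chart X (points X) A (%a. smap f (points Y) (jj a))"
proof -
 interpret Y: chart Y "points Y" A jj by fact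
 obtain g where g: "morphism Y X g" and f: "morphism X Y f" and fg: "mor_eq X X (comp_mor Y f g) id_mor" and gf: "mor_eq Y Y (comp_mor X g f) id_mor"
  using iso unfolding iso_mor_def by blast
 note f' = lrs_mor[OF X Y.lrs f] and g' = lrs_mor[OF Y.lrs X g]
 interpret f: mor X Y f by (rule f')
 interpret g: mor Y X g by (rule g')
 have x: "pmap g (pmap f x) = x" if "x : points X" for x using mor_eq_pmap[OF fg that] by simp
 have y: "pmap f (pmap g y) = y" if "y : points Y" for y using mor_eq_pmap[OF gf that] by simp
 show ?thesis
 proof (rule chart_push[OF X openin_topspace Y g'])
  show "pmap g ` points Y = points X" using g.pmap_in f.pmap_in x by force
  show "inj_on (stalk_map Y X g z) (carrier (stalk X (pmap g z)))" if "z : points Y" for z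
   using stalk_map_inverse[OF f' g' fg g.pmap_in[OF that]] y[OF that] by (intro inj_on_inverseI[of _ "stalk_map X Y f (pmap g z)"]) simp
  show "(%a. smap f (points Y) (jj a)) : ring_hom A (sec X (points X))"
   using hom_comp[OF Y.iota_hom f.smap_hom[OF openin_topspace]] f.preim_points by simp
  show "smap g (points X) (smap f (points Y) (jj a)) = jj a" if "a el A" for a
   using mor_eq_smap[OF gf openin_topspace hom_car[OF Y.iota_hom that]] f.preim_points by simp
 qed
qed

text \<open>The open inclusion identifies stalks that are different sets; \<open>chart_push\<close>
  asks for injectivity of this identification, which is checked on representatives inside
  \<open>V\<close>.\<close>

lemma chart_restrict:
 assumes X: "locally_ringed_space X" and V: "opn X V" and R: "chart (restrict_space X V) V A jj"
 shows "chart X V A jj"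
proof -
 interpret R: chart "restrict_space X V" V A jj by fact
 note px = lrsD(3)[OF X]
 interpret g: mor "restrict_space X V" X "open_incl X V" by (rule mor_open_incl[OF px V])
 note ro = restrict_opn[OF V] and pt = restrict_points[OF V] and pre = preim_open_incl[OF V]
 show ?thesis
 proof (rule chart_push[OF X V _ g.mor_axioms])
  show "chart (restrict_space X V) (points (restrict_space X V)) A jj" unfolding pt by (rule R)
  show "pmap (open_incl X V) ` points (restrict_space X V) = V" unfolding pt by simp
  show "jj : ring_hom A (sec X V)" using R.iota_hom by simp
  show "smap (open_incl X V) V (jj a) = jj a" if "a el A" for a
   using g.Y.res_id[OF V] hom_car[OF R.iota_hom that] by simp
  fix y assume y: "y : points (restrict_space X V)"
  then have yV: "y : V" unfolding pt .
  show "inj_on (stalk_map (restrict_space X V) X (open_incl X V) y) (carrier (stalk X (pmap (open_incl X V) y)))"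
  proof (rule inj_onI)
   fix a b assume ab: "a el stalk X (pmap (open_incl X V) y)" "b el stalk X (pmap (open_incl X V) y)"
    and e: "stalk_map (restrict_space X V) X (open_incl X V) y a = stalk_map (restrict_space X V) X (open_incl X V) y b"
   obtain U s where U: "opn X U" "y : U" "U <= V" "s el sec X U" "a = germ X y U s" using g.Y.stalkE_in[OF ab(1)] V yV by auto
   obtain W t where W: "opn X W" "y : W" "W <= U" "t el sec X W" "b = germ X y W t" using g.Y.stalkE_in[OF ab(2)] U by auto
   have r: "V Int U = U" "V Int W = W" using U W by auto
   have "germ (restrict_space X V) y U s = germ (restrict_space X V) y W t"
    using e g.stalk_map_germ[OF y U(1) _ U(4)] g.stalk_map_germ[OF y W(1) _ W(4)] U W g.Y.res_id unfolding pre by (simp add: r)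
   then obtain O' where "opn (restrict_space X V) O'" "y : O'" "O' <= U" "O' <= W" "res (restrict_space X V) U O' s = res (restrict_space X V) W O' t"
    by (rule g.X.germ_eqE) (use U W in "auto simp add: ro simp del: restrict_simps(3)")
   then show "a = b" unfolding U(5) W(5) using U W by (intro g.Y.germ_eqI[of U W O']) (auto simp add: ro simp del: restrict_simps(3))
  qed
 qed
qed

lemma affine_open_chart0:
 assumes X: "locally_ringed_space X" and V: "affine_open X V"
 obtains A :: "'r ring" and jj where "chart (X :: ('p, 'r) ringed_space) V A jj"
proof -
 have o: "opn X V" using V by (simp add: affine_open_def)
 obtain A :: "'r ring" and f where A: "cring A" "iso_mor (restrict_space X V) (Spec A) f"
  using V unfolding affine_open_def affine_scheme_def by blast
 from chart_restrict[OF X o chart_iso[OF lrs_restrict[OF X o] Spec_chart[OF A(1)] A(2), unfolded restrict_points[OF o]]]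
 show ?thesis by (rule that)
qed

subsection \<open>Sections over a chart\<close>

lemma (in cring) unit_ideal_cancel:
 assumes "ideal I R" "a el R" "u : Units R" "a \<otimes> u : I"
 shows "a : I"
proof -
 interpret I: ideal I R by fact
 have "a \<otimes> u \<otimes> inv u : I" by (rule I.I_r_closed) (use assms in simp_all)
 moreover have "a \<otimes> u \<otimes> inv u = a"
  using m_assoc[OF assms(2) Units_closed[OF assms(3)] Units_inv_closed[OF assms(3)]] assms(2,3) by simp
 ultimately show ?thesis by simp
qed

context chart
begin

abbreviation nv :: "'p => 'a => bool" where
 "nv x a == germ X x V (jj a) : Units (stalk X x)"

abbreviation gi :: "'p => 'a => ('p set \<times> 'r) set" where
 "gi x a == germ X x V (jj a)"

sublocale sheaf X by (rule lrsD(1)[OF lrs])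

sublocale A: cring A by (rule A_cring)

lemma V_pts: "x : V ==> x : points X"
 using opn_sub[OF V_open] by blast

lemma io: "a el A ==> jj a el sec X V"
 by (rule hom_car[OF iota_hom])

lemma gi_hom: "x : V ==> gi x : ring_hom A (stalk X x)"
 by (rule hom_comp[OF iota_hom germ_hom[OF V_open]])

lemma gi_closed: "x : V ==> a el A ==> gi x a el stalk X x"
 by (rule hom_car[OF gi_hom])

lemma st_cring: "x : V ==> cring (stalk X x)"
 by (rule stalk_cring[OF V_pts])

lemma st_local: "x : V ==> local_ring (stalk X x)"
 by (rule lrsD(2)[OF lrs V_pts])

lemma gi_mult: "x : V ==> a el A ==> b el A ==> gi x (a *[A] b) = gi x a *[stalk X x] gi x b"
 by (rule ring_hom_mult[OF gi_hom])

lemma gi_add: "x : V ==> a el A ==> b el A ==> gi x (a +[A] b) = gi x a +[stalk X x] gi x b"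
 by (rule ring_hom_add[OF gi_hom])

lemma nv_mult: "x : V ==> a el A ==> b el A ==> nv x (a *[A] b) <-> nv x a & nv x b"
 using cring.Units_mult_iff[OF st_cring gi_closed gi_closed] by (simp add: gi_mult)

lemma nv_add: "x : V ==> a el A ==> b el A ==> nv x (a +[A] b) ==> nv x a | nv x b"
 using local_ringD(3)[OF st_local gi_closed gi_closed] by (simp add: gi_add)

lemma nv_one: "x : V ==> nv x 1[A]"
proof -
 assume x: "x : V"
 interpret S: cring "stalk X x" by (rule st_cring[OF x])
 show ?thesis using ring_hom_one[OF gi_hom[OF x]] by simp
qed

lemma gi_zero: "x : V ==> gi x 0[A] = 0[stalk X x]"
 by (rule ring_hom_zero[OF gi_hom A.ring_axioms]) (simp_all add: st_cring cring.axioms(1))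

lemma nv_zero: "x : V ==> ~ nv x 0[A]"
proof -
 assume x: "x : V"
 interpret S: cring "stalk X x" by (rule st_cring[OF x])
 show ?thesis using gi_zero[OF x] local_ringD(2)[OF st_local[OF x]] S.Units_iff by auto
qed

lemma gi_eqD:
 assumes x: "x : V" and a: "a el A" "b el A" and e: "gi x a = gi x b"
 obtains k where "k el A" "nv x k" "k *[A] a = k *[A] b"
proof -
 interpret S: cring "stalk X x" by (rule st_cring[OF x])
 have "gi x (a +[A] -[A] b) = gi x b +[stalk X x] gi x (-[A] b)" using a e by (simp add: gi_add[OF x])
 also have "... = 0[stalk X x]" using a gi_zero[OF x] by (simp add: A.r_neg flip: gi_add[OF x])
 finally obtain k where k: "k el A" "nv x k" "k *[A] (a +[A] -[A] b) = 0[A]" using kernel[OF x, of "a +[A] -[A] b"] a by auto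
 have "k *[A] a = k *[A] (a +[A] -[A] b) +[A] k *[A] b" using k(1) a by algebra
 then show ?thesis using that[OF k(1,2)] k a by simp
qed

lemma nv_pow: "x : V ==> a el A ==> nv x a ==> nv x (a ^[A] (n::nat))"
 by (induction n) (simp_all add: nv_one nv_mult)

lemma nv_nbhd:
 assumes "opn X W" "x : W" "x : V"
 obtains a where "a el A" "nv x a" "ALL y:V. nv y a --> y : W"
proof -
 have "opn X (W Int V)" using assms V_open by auto
 from basis[OF this, of x] assms that show ?thesis by auto
qed

lemma nv_open:
 assumes a: "a el A"
 shows "opn X {x : V. nv x a}"
proof (rule openin_subopen[THEN iffD2], intro ballI)
 fix x assume x: "x : {x : V. nv x a}"
 then have x: "x : V" "nv x a" by simp_all
 obtain W where "opn X W" "x : W" "W <= V" "ALL y:W. nv y a"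
  using germ_unit_nbhd[OF V_open x(1) io[OF a] x(2)] by metis
 then show "EX T. opn X T & x : T & T <= {x : V. nv x a}" by blast
qed

text \<open>Otherwise \<open>c\<close> lies in a prime ideal, and this prime is a point of
  \<open>V\<close> at which every element of \<open>c\<close> vanishes. The lemma plays the role of
  a partition of unity: to find a global object, let \<open>c\<close> collect the elements for which
  it exists.\<close>

lemma ideal_one:
 assumes "ideal c A" "!!x. x : V ==> EX a:c. nv x a"
 shows "1[A] : c"
proof (rule ccontr)
 assume "1[A] ~: c"
 then have "c Int {1[A]} = {}" by blast
 moreover have "mult_closed A {1[A]}" by (auto simp: mult_closed_def)
 ultimately obtain P where P: "primeideal P A" "c <= P"
  using A.prime_disjoint[OF assms(1)] by metis
 obtain x where x: "x : V" "ALL a:carrier A. nv x a <-> a ~: P" using point_of_prime[OF P(1)] by blast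
 obtain a where "a : c" "nv x a" using assms(2)[OF x(1)] by blast
 then show False using P(2) x(2) ideal.Icarr[OF assms(1)] by blast
qed

text \<open>Quasi-compactness: the elements on whose nonvanishing loci some \<open>Q n\<close> holds form an ideal that
 is contained in no prime.\<close>

lemma quasi_compact:
 fixes Q :: "nat => 'p => bool"
 assumes mono: "!!n m y. n <= m ==> Q n y ==> y : V ==> Q m y"
  and loc: "!!x. x : V ==> EX n W. opn X W & x : W & (ALL y:W Int V. Q n y)"
 obtains n where "!!y. y : V ==> Q n y"
proof -
 let ?c = "{a : carrier A. EX n. ALL y:V. nv y a --> Q n y}"
 have "1[A] : ?c"
 proof (rule ideal_one)
  show "ideal ?c A"
  proof (rule A.idealI')
   show "0[A] : ?c" using nv_zero by auto
   show "a +[A] b : ?c" if ab: "a : ?c" "b : ?c" for a b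
   proof -
    obtain n m where nm: "ALL y:V. nv y a --> Q n y" "ALL y:V. nv y b --> Q m y" using ab by blast
    have "Q (max n m) y" if y: "y : V" "nv y (a +[A] b)" for y
     using nv_add[OF y(1) _ _ y(2)] ab nm mono[of n "max n m" y] mono[of m "max n m" y] y(1) by auto
    then show ?thesis using ab by blast
   qed
   show "r *[A] a : ?c" if "r el A" "a : ?c" for r a
    using that nv_mult by auto
  qed blast
  fix x assume x: "x : V"
  obtain n W where W: "opn X W" "x : W" "ALL y:W Int V. Q n y" using loc[OF x] by blast
  obtain a where a: "a el A" "nv x a" "ALL y:V. nv y a --> y : W" using nv_nbhd[OF W(1,2) x] .
  then show "EX a:?c. nv x a" using W by blast
 qed
 then show ?thesis using that nv_one by blast
qed

abbreviation M :: "'a set => 'p => ('p set \<times> 'r) set set" where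
 "M aa x == genideal (stalk X x) (gi x ` aa)"

lemma M_ideal:
 assumes "x : V" "aa <= carrier A"
 shows "ideal (M aa x) (stalk X x)"
proof -
 interpret S: cring "stalk X x" by (rule st_cring[OF assms(1)])
 show ?thesis by (rule S.genideal_ideal) (use gi_closed assms in blast)
qed

lemma M_mem:
 assumes "x : V" "aa <= carrier A" "a : aa"
 shows "gi x a : M aa x"
proof -
 interpret S: cring "stalk X x" by (rule st_cring[OF assms(1)])
 have "gi x ` aa <= M aa x" by (rule S.genideal_self) (use gi_closed assms in blast)
 then show ?thesis using assms by blast
qed

lemma M_iff:
 assumes x: "x : V" and aa: "ideal aa A" and b: "b el A"
 shows "gi x b : M aa x <-> (EX h:carrier A. nv x h & h *[A] b : aa)"
proof
 interpret S: cring "stalk X x" by (rule st_cring[OF x])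
 interpret a: ideal aa A by fact
 have sub: "aa <= carrier A" by (rule a.a_subset)
 show "gi x b : M aa x" if hyp: "EX h:carrier A. nv x h & h *[A] b : aa"
 proof -
  obtain h where h: "h el A" "nv x h" "h *[A] b : aa" using hyp by blast
  have "gi x b *[stalk X x] gi x h : M aa x"
   using M_mem[OF x sub h(3)] gi_mult[OF x h(1) b] S.m_comm[OF gi_closed[OF x b] gi_closed[OF x h(1)]] by simp
  then show ?thesis using S.unit_ideal_cancel[OF M_ideal[OF x sub] gi_closed[OF x b] h(2)] by simp
 qed
 \<comment> \<open>The fractions with numerator in \<open>aa\<close> already form an ideal
   containing the generators, so the generated ideal has no other elements.\<close>
 let ?M = "{ga : carrier (stalk X x). EX a:aa. EX d:carrier A. nv x d & ga *[stalk X x] gi x d = gi x a}"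
 have "ideal ?M (stalk X x)"
 proof (rule S.idealI')
  show "0[stalk X x] : ?M"
  proof -
   have "0[stalk X x] *[stalk X x] gi x 1[A] = gi x 0[A]"
    using gi_zero[OF x] gi_closed[OF x A.one_closed] by simp
   then show ?thesis using a.zero_closed nv_one[OF x] A.one_closed S.zero_closed by blast
  qed
  show "ga +[stalk X x] de : ?M" if h: "ga : ?M" "de : ?M" for ga de
  proof -
   obtain a d a' d' where *: "a : aa" "d el A" "nv x d" "ga *[stalk X x] gi x d = gi x a"
    "a' : aa" "d' el A" "nv x d'" "de *[stalk X x] gi x d' = gi x a'" using h by blast
   have c: "ga el stalk X x" "de el stalk X x" "a el A" "a' el A" using h * sub by auto
   note g = gi_closed[OF x *(2)] gi_closed[OF x *(6)]
   have "(ga +[stalk X x] de) *[stalk X x] gi x (d *[A] d')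
    = (ga *[stalk X x] gi x d) *[stalk X x] gi x d' +[stalk X x] (de *[stalk X x] gi x d') *[stalk X x] gi x d"
    unfolding gi_mult[OF x *(2,6)] using c g by algebra
   also have "... = gi x (a *[A] d' +[A] a' *[A] d)"
    using * c by (simp add: gi_add[OF x] gi_mult[OF x])
   finally have "(ga +[stalk X x] de) *[stalk X x] gi x (d *[A] d') = gi x (a *[A] d' +[A] a' *[A] d)" .
   moreover have "a *[A] d' +[A] a' *[A] d : aa" "d *[A] d' el A" "nv x (d *[A] d')"
    using * by (simp_all add: a.I_r_closed nv_mult[OF x])
   ultimately show ?thesis using c by blast
  qed
  show "de *[stalk X x] ga : ?M" if h: "de el stalk X x" "ga : ?M" for ga de
  proof -
   obtain a d where *: "a : aa" "d el A" "nv x d" "ga *[stalk X x] gi x d = gi x a" using h by blast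
   obtain a' d' where **: "a' el A" "d' el A" "nv x d'" "de *[stalk X x] gi x d' = gi x a'"
    using fraction[OF x h(1)] by blast
   have c: "ga el stalk X x" "a el A" using h * sub by auto
   note g = gi_closed[OF x *(2)] gi_closed[OF x **(2)]
   have "(de *[stalk X x] ga) *[stalk X x] gi x (d' *[A] d) = (de *[stalk X x] gi x d') *[stalk X x] (ga *[stalk X x] gi x d)"
    unfolding gi_mult[OF x **(2) *(2)] using c h(1) g by algebra
   also have "... = gi x (a' *[A] a)" using * ** c by (simp add: gi_mult[OF x])
   finally have "(de *[stalk X x] ga) *[stalk X x] gi x (d' *[A] d) = gi x (a' *[A] a)" .
   moreover have "a' *[A] a : aa" "d' *[A] d el A" "nv x (d' *[A] d)" "de *[stalk X x] ga el stalk X x"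
    using * ** c h by (simp_all add: a.I_l_closed nv_mult[OF x])
   ultimately show ?thesis by blast
  qed
 qed blast
 moreover have "gi x ` aa <= ?M"
 proof
  fix ga assume "ga : gi x ` aa"
  then obtain a where a: "a : aa" "ga = gi x a" by blast
  have "a el A" using a sub by blast
  then have "gi x a *[stalk X x] gi x 1[A] = gi x a" using gi_mult[OF x _ A.one_closed, of a] by simp
  then show "ga : ?M" using a nv_one[OF x] gi_closed[OF x \<open>a el A\<close>] A.one_closed by blast
 qed
 ultimately have MM: "M aa x <= ?M" by (rule S.genideal_minimal)
 show "EX h:carrier A. nv x h & h *[A] b : aa" if hyp: "gi x b : M aa x"
 proof -
  obtain a d where *: "a : aa" "d el A" "nv x d" "gi x b *[stalk X x] gi x d = gi x a"
   using MM hyp by blast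
  have ac: "a el A" using * sub by blast
  obtain h where h: "h el A" "nv x h" "h *[A] (b *[A] d) = h *[A] a"
   by (rule gi_eqD[OF x _ ac, of "b *[A] d"]) (use * b in "simp_all add: gi_mult[OF x]")
  then have "(h *[A] d) *[A] b = h *[A] a" using b * by (simp add: A.m_ac)
  moreover have "h *[A] a : aa" using h * by (simp add: a.I_l_closed)
  moreover have "nv x (h *[A] d)" using h * nv_mult[OF x] by simp
  ultimately show ?thesis using h * by (intro bexI[of _ "h *[A] d"]) auto
 qed
qed

end

context chart
begin

lemma relation_nbhd:
 assumes N: "opn X N" "y : N" "y : V" and s: "s el sec X N" and d: "d el A" and b: "b el A"
  and e: "germ X y N s *[stalk X y] gi y d = gi y b"
 obtains W where "opn X W" "y : W" "W <= N" "W <= V"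
  "!!z. z : W ==> germ X z N s *[stalk X z] gi z d = gi z b"
proof -
 have o: "opn X (N Int V)" "N Int V <= N" "N Int V <= V" "y : N Int V" using N V_open by auto
 interpret C: cring "sec X (N Int V)" by (rule sec_cring[OF o(1)])
 have r: "res X N (N Int V) s el (sec X (N Int V))" "res X V (N Int V) (jj d) el (sec X (N Int V))"
  using res_closed[OF N(1) o(1,2) s] res_closed[OF V_open o(1,3) io[OF d]] by auto
 have g: "germ X z (N Int V) (res X N (N Int V) s *[sec X (N Int V)] res X V (N Int V) (jj d)) = germ X z N s *[stalk X z] gi z d"
  if "z : N Int V" for z
  using stalk_mult[OF o(1) that r] germ_res[OF N(1) o(1) that o(2) s] germ_res[OF V_open o(1) that o(3) io[OF d]] by simp
 have "germ X y (N Int V) (res X N (N Int V) s *[sec X (N Int V)] res X V (N Int V) (jj d)) = germ X y V (jj b)"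
  using g[OF o(4)] e by simp
 then obtain W where W: "opn X W" "y : W" "W <= N Int V" "W <= V"
  "res X (N Int V) W (res X N (N Int V) s *[sec X (N Int V)] res X V (N Int V) (jj d)) = res X V W (jj b)"
  by (rule germ_eqE[OF _ o(1,4) C.m_closed[OF r] V_open N(3) io[OF b]])
 have "germ X z N s *[stalk X z] gi z d = gi z b" if z: "z : W" for z
 proof -
  have "germ X z (N Int V) (res X N (N Int V) s *[sec X (N Int V)] res X V (N Int V) (jj d)) = germ X z V (jj b)"
   by (rule germ_eqI[OF o(1) V_open W(1) z W(3,4) C.m_closed[OF r] io[OF b] W(5)])
  then show ?thesis using g[of z] z W by auto
 qed
 then show ?thesis using that[OF W(1,2)] W(3) by blast
qed

text \<open>The loci on which an element of \<open>A\<close> does not vanish form a basis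
  (\<open>nv_nbhd\<close>). A point whose prime avoids every element that does not vanish at
  \<open>y\<close> therefore lies in all neighbourhoods of \<open>y\<close>.\<close>

lemma generization:
 assumes y: "y : V" and P: "primeideal P A" "!!a. a el A ==> nv y a ==> a ~: P"
 obtains z where "z : V" "ALL a:carrier A. nv z a <-> a ~: P" "ALL W. opn X W --> y : W --> z : W"
proof -
 obtain z where z: "z : V" "ALL a:carrier A. nv z a <-> a ~: P" using point_of_prime[OF P(1)] by blast
 have "z : W" if W: "opn X W" "y : W" for W
 proof -
  obtain a where a: "a el A" "nv y a" "ALL w:V. nv w a --> w : W" by (rule nv_nbhd[OF W y])
  then show ?thesis using P(2)[OF a(1,2)] z by blast
 qed
 then show ?thesis using that z by blast
qed

lemma gi_pow: "x : V ==> a el A ==> gi x (a ^[A] (n::nat)) = gi x a ^[stalk X x] n"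
proof -
 assume x: "x : V" and a: "a el A"
 interpret S: cring "stalk X x" by (rule st_cring[OF x])
 show ?thesis by (induction n) (simp_all add: gi_mult[OF x] a ring_hom_one[OF gi_hom[OF x]])
qed

text \<open>A section that lies in the ideal wherever \<open>f\<close> is invertible is multiplied into it by a power of
 \<open>f\<close>: otherwise some prime, i.e. some generization of \<open>y\<close>, would contain the conductor but not \<open>f\<close>.\<close>

lemma power_conductor:
 assumes y: "y : V" and aa: "ideal aa A" and N: "opn X N" "y : N" and s: "s el sec X N" and f: "f el sec X N"
  and h: "!!z. z : N ==> z : V ==> germ X z N f : Units (stalk X z) ==> germ X z N s : M aa z"
 shows "EX n::nat. germ X y N s *[stalk X y] germ X y N f ^[stalk X y] n : M aa y"
proof -
 interpret S: cring "stalk X y" by (rule st_cring[OF y])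
 interpret a: ideal aa A by fact
 have sub: "aa <= carrier A" by (rule a.a_subset)
 have gs: "germ X y N s el stalk X y" "germ X y N f el stalk X y"
  using germ_closed N s f by auto
 obtain b d where b: "b el A" "d el A" "nv y d" "germ X y N s *[stalk X y] gi y d = gi y b"
  using fraction[OF y gs(1)] by blast
 obtain f' d' where f': "f' el A" "d' el A" "nv y d'" "germ X y N f *[stalk X y] gi y d' = gi y f'"
  using fraction[OF y gs(2)] by blast
 \<comment> \<open>The multiplicative set generated by \<open>f'\<close> and by the elements that do
   not vanish at \<open>y\<close>. A prime avoiding it is a generization of \<open>y\<close> at
   which \<open>f\<close> is invertible.\<close>
 define T where "T = {e *[A] f' ^[A] n | e n. e el A & nv y e & n : (UNIV :: nat set)}"
 have TI: "e *[A] f' ^[A] (n::nat) : T" if "e el A" "nv y e" for e n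
  unfolding T_def using that by blast
 have mc: "mult_closed A T"
  unfolding mult_closed_def
 proof (intro conjI ballI)
  show "T <= carrier A" unfolding T_def using f' by auto
  show "1[A] : T" using TI[OF A.one_closed nv_one[OF y], of 0] by simp
  fix u v assume "u : T" "v : T"
  then obtain e n e' n' where u: "u = e *[A] f' ^[A] (n::nat)" "e el A" "nv y e"
   and v: "v = e' *[A] f' ^[A] (n'::nat)" "e' el A" "nv y e'" unfolding T_def by blast
  have "u *[A] v = (e *[A] e') *[A] (f' ^[A] n *[A] f' ^[A] n')"
   using u(1,2) v(1,2) f'(1) by (simp add: A.m_ac)
  also have "... = (e *[A] e') *[A] f' ^[A] (n + n')" using f'(1) by (simp add: A.nat_pow_mult)
  finally show "u *[A] v : T" using TI[of "e *[A] e'" "n + n'"] u v nv_mult[OF y] by simp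
 qed
 \<comment> \<open>The conductor of the numerator \<open>b\<close> into \<open>aa\<close>. By
   \<open>M_iff\<close> it has an element not vanishing at \<open>z\<close> as soon as the germ of
   \<open>b\<close> at \<open>z\<close> lies in the extended ideal, so it cannot be contained in the
   prime found below.\<close>
 let ?c = "{k : carrier A. k *[A] b : aa}"
 have c: "ideal ?c A"
 proof (rule A.idealI')
  show "0[A] : ?c" using b a.zero_closed by simp
  show "u +[A] v : ?c" if "u : ?c" "v : ?c" for u v using that b a.a_closed by (simp add: A.l_distr)
  show "u *[A] v : ?c" if "u el A" "v : ?c" for u v
   using that b a.I_l_closed[of "v *[A] b" u] by (simp add: A.m_assoc)
 qed blast
 have "?c Int T ~= {}"
 proof
  assume "?c Int T = {}"
  then obtain P where P: "primeideal P A" "?c <= P" "P Int T = {}" using A.prime_disjoint[OF c mc] by metis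
  have nP: "e ~: P" if "e el A" "nv y e" for e
   using TI[OF that, of 0] that P(3) by auto
  have fP: "f' ~: P" using TI[OF A.one_closed nv_one[OF y], of 1] f'(1) P(3) by auto
  obtain z where z: "z : V" "ALL a:carrier A. nv z a <-> a ~: P" "ALL W. opn X W --> y : W --> z : W"
   using generization[OF y P(1) nP] by metis
  interpret Z: cring "stalk X z" by (rule st_cring[OF z(1)])
  obtain W1 where W1: "opn X W1" "y : W1" "ALL z:W1. germ X z N s *[stalk X z] gi z d = gi z b"
   using relation_nbhd[OF N y s b(2,1,4)] by metis
  obtain W2 where W2: "opn X W2" "y : W2" "ALL z:W2. germ X z N f *[stalk X z] gi z d' = gi z f'"
   using relation_nbhd[OF N y f f'(2,1,4)] by metis
  have zN: "z : N" using z(3) N by blast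
  have gz: "germ X z N s el stalk X z" "germ X z N f el stalk X z"
   using germ_closed N s f zN by auto
  have e1: "germ X z N s *[stalk X z] gi z d = gi z b" using W1 z(3) by blast
  have e2: "germ X z N f *[stalk X z] gi z d' = gi z f'" using W2 z(3) by blast
  have "nv z f'" using z(2) f'(1) fP by blast
  then have "germ X z N f : Units (stalk X z)"
   using Z.Units_mult_iff[OF gz(2) gi_closed[OF z(1) f'(2)]] e2 by simp
  then have "germ X z N s : M aa z" using h[OF zN z(1)] by simp
  then have "gi z b : M aa z"
   using ideal.I_r_closed[OF M_ideal[OF z(1) sub] _ gi_closed[OF z(1) b(2)]] e1 by metis
  then obtain k where k: "k el A" "nv z k" "k *[A] b : aa"
   using M_iff[OF z(1) aa b(1)] by blast
  then have "k : P" using P(2) by blast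
  then show False using k z(2) by blast
 qed
 then obtain k where "k : ?c" "k : T" by blast
 then obtain e n where e: "e el A" "nv y e" "e *[A] f' ^[A] (n::nat) *[A] b : aa"
  unfolding T_def by blast
 have "gi y (e *[A] f' ^[A] n *[A] b) : M aa y" by (rule M_mem[OF y sub e(3)])
 \<comment> \<open>Up to a unit formed from \<open>e\<close>, \<open>d\<close> and a power of
   \<open>d'\<close>, the element of \<open>aa\<close> just found is the section times a power of
   \<open>f\<close>.\<close>
 moreover have "gi y (e *[A] f' ^[A] n *[A] b) = (germ X y N s *[stalk X y] germ X y N f ^[stalk X y] n) *[stalk X y]
  (gi y e *[stalk X y] (gi y d' ^[stalk X y] n *[stalk X y] gi y d))"
 proof -
  have "gi y (e *[A] f' ^[A] n *[A] b) = gi y e *[stalk X y] gi y f' ^[stalk X y] n *[stalk X y] gi y b"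
   using e(1) f'(1) b(1) by (simp add: gi_mult[OF y] gi_pow[OF y])
  also have "gi y f' ^[stalk X y] n = germ X y N f ^[stalk X y] n *[stalk X y] gi y d' ^[stalk X y] n"
   unfolding f'(4)[symmetric] by (rule S.nat_pow_distrib[OF gs(2) gi_closed[OF y f'(2)]])
  also have "gi y b = germ X y N s *[stalk X y] gi y d" using b(4) by simp
  finally show ?thesis
   using gs gi_closed[OF y e(1)] gi_closed[OF y f'(2)] gi_closed[OF y b(2)] by (simp add: S.m_ac)
 qed
 moreover have "gi y e *[stalk X y] (gi y d' ^[stalk X y] n *[stalk X y] gi y d) : Units (stalk X y)"
  using e(2) b(3) nv_pow[OF y f'(2,3), of n] by (simp add: gi_pow[OF y f'(2)])
 ultimately have "germ X y N s *[stalk X y] germ X y N f ^[stalk X y] n : M aa y"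
  using S.unit_ideal_cancel[OF M_ideal[OF y sub], of "germ X y N s *[stalk X y] germ X y N f ^[stalk X y] n"] gs by simp
 then show ?thesis by blast
qed

lemma iota_zero:
 assumes "a el A" "jj a = 0[sec X V]"
 shows "a = 0[A]"
proof -
 have "1[A] : {d : carrier A. d *[A] a = 0[A]}"
 proof (rule ideal_one)
  show "ideal {d : carrier A. d *[A] a = 0[A]} A"
   by (rule A.idealI') (use assms in "auto simp: A.l_distr A.m_assoc")
  show "EX d:{d : carrier A. d *[A] a = 0[A]}. nv x d" if x: "x : V" for x
   using kernel[OF x assms(1)] assms(2) germ_zero[OF V_open x] by auto
 qed
 then show ?thesis using assms by simp
qed

lemma iota_inj: "inj_on jj (carrier A)"
proof (rule inj_onI)
 interpret C: cring "sec X V" by (rule sec_cring[OF V_open])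
 interpret h: ring_hom_ring A "sec X V" jj
  using iota_hom A.ring_axioms C.ring_axioms by (simp add: ring_hom_ringI2)
 fix a b assume ab: "a el A" "b el A" "jj a = jj b"
 then have "jj (a -[A] b) = 0[sec X V]" by (simp add: A.minus_eq C.r_neg)
 then have "a -[A] b = 0[A]" using iota_zero ab by simp
 then have "a -[A] b +[A] b = b" using ab by simp
 moreover have "a -[A] b +[A] b = a" using ab by (simp add: A.minus_eq A.a_assoc A.l_neg)
 ultimately show "a = b" by simp
qed

lemma M_zero: "x : V ==> M {0[A]} x = {0[stalk X x]}"
 using ring.genideal_zero[OF cring.axioms(1)[OF st_cring]] gi_zero by simp

text \<open>The denominators of \<open>s\<close> form an ideal of \<open>A\<close>, and
  \<open>ideal_one\<close> reduces the claim to finding, for each \<open>x\<close>, one that does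
  not vanish there. It is the denominator \<open>d\<close> of the germ at \<open>x\<close>,
  multiplied by a power of an element \<open>e\<close> whose nonvanishing locus lies where
  \<open>s\<close> is this fraction.\<close>

lemma iota_surj:
 assumes s: "s el sec X V"
 shows "s : jj ` carrier A"
proof -
 interpret C: cring "sec X V" by (rule sec_cring[OF V_open])
 interpret H: ring_hom_ring A "sec X V" jj
  using iota_hom A.ring_axioms C.ring_axioms by (simp add: ring_hom_ringI2)
 let ?c = "{d : carrier A. EX b:carrier A. jj d *[sec X V] s = jj b}"
 have "1[A] : ?c"
 proof (rule ideal_one)
  show "ideal ?c A"
  proof (rule A.idealI')
   show "0[A] : ?c" using s by (auto intro!: bexI[of _ "0[A]"])
   show "u +[A] v : ?c" if h: "u : ?c" "v : ?c" for u v
   proof -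
    obtain b b' where b: "b el A" "jj u *[sec X V] s = jj b" "b' el A" "jj v *[sec X V] s = jj b'"
     using h by blast
    have "jj (u +[A] v) *[sec X V] s = jj (b +[A] b')"
     using h b s by (simp add: C.l_distr)
    then show ?thesis using h b by blast
   qed
   show "u *[A] v : ?c" if h: "u el A" "v : ?c" for u v
   proof -
    obtain b where b: "b el A" "jj v *[sec X V] s = jj b" using h by blast
    have "jj (u *[A] v) *[sec X V] s = jj (u *[A] b)"
     using h b s by (simp add: C.m_assoc)
    then show ?thesis using h b by blast
   qed
  qed blast
  fix x assume x: "x : V"
  obtain b d where b: "b el A" "d el A" "nv x d" "germ X x V s *[stalk X x] gi x d = gi x b"
   using fraction[OF x germ_closed[OF V_open x s]] by blast
  obtain W where W: "opn X W" "x : W" "ALL z:W. germ X z V s *[stalk X z] gi z d = gi z b"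
   using relation_nbhd[OF V_open x x s b(2,1,4)] by metis
  obtain e where e: "e el A" "nv x e" "ALL y:V. nv y e --> y : W" by (rule nv_nbhd[OF W(1,2) x])
  \<comment> \<open>The error of the fraction. It vanishes wherever \<open>e\<close> does not, so
    \<open>power_conductor\<close> with the zero ideal gives a power of \<open>e\<close> that kills
    it near each point, and quasi-compactness makes the exponent uniform.\<close>
  define t where "t = s *[sec X V] jj d -[sec X V] jj b"
  have t: "t el sec X V" unfolding t_def using s b by simp
  have gt: "germ X y V t = germ X y V s *[stalk X y] gi y d -[stalk X y] gi y b" if y: "y : V" for y
  proof -
   interpret S: cring "stalk X y" by (rule st_cring[OF y])
   interpret G: ring_hom_ring "sec X V" "stalk X y" "germ X y V"
    using germ_hom[OF V_open y] S.ring_axioms C.ring_axioms by (simp add: ring_hom_ringI2)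
   show ?thesis unfolding t_def using s b by (simp add: C.minus_eq S.minus_eq)
  qed
  have z: "germ X y V t : M {0[A]} y" if y: "y : V" "nv y e" for y
  proof -
   interpret S: cring "stalk X y" by (rule st_cring[OF y(1)])
   have "germ X y V s *[stalk X y] gi y d = gi y b" using W(3) e(3) y by blast
   then have "germ X y V t = 0[stalk X y]"
    using gt[OF y(1)] gi_closed[OF y(1) b(1)] by (simp add: S.minus_eq S.r_neg)
   then show ?thesis using M_zero[OF y(1)] by simp
  qed
  have ec: "jj e el sec X V" using io e by simp
  define Q where "Q n y <-> germ X y V t *[stalk X y] gi y e ^[stalk X y] n = 0[stalk X y]" for n :: nat and y
  have Qg: "Q n y <-> germ X y V (t *[sec X V] jj (e ^[A] n)) = germ X y V 0[sec X V]" if y: "y : V" for n y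
   using stalk_mult[OF V_open y t io[of "e ^[A] n"]] e gi_pow[OF y e(1), of n] germ_zero[OF V_open y] unfolding Q_def by simp
  obtain n where n: "!!y. y : V ==> Q n y"
  proof (rule quasi_compact[of Q])
   show "Q m y" if h: "n <= m" "Q n y" "y : V" for n m y
   proof -
    interpret S: cring "stalk X y" by (rule st_cring[OF h(3)])
    have c: "germ X y V t el stalk X y" "gi y e el stalk X y"
     using germ_closed[OF V_open h(3) t] gi_closed[OF h(3) e(1)] by auto
    have "gi y e ^[stalk X y] m = gi y e ^[stalk X y] n *[stalk X y] gi y e ^[stalk X y] (m - n)"
     using S.nat_pow_mult[OF c(2), of n "m - n"] h(1) by simp
    then have "germ X y V t *[stalk X y] gi y e ^[stalk X y] m = (germ X y V t *[stalk X y] gi y e ^[stalk X y] n) *[stalk X y] gi y e ^[stalk X y] (m - n)"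
     using c by (simp add: S.m_assoc)
    then show ?thesis using h(2) c unfolding Q_def by simp
   qed
   fix y assume y: "y : V"
   obtain n where "germ X y V t *[stalk X y] germ X y V (jj e) ^[stalk X y] (n::nat) : M {0[A]} y"
    using power_conductor[OF y A.zeroideal V_open y t ec] z by blast
   then have "Q n y" using M_zero[OF y] unfolding Q_def by simp
   then have ge: "germ X y V (t *[sec X V] jj (e ^[A] n)) = germ X y V 0[sec X V]" using Qg[OF y] by simp
   have tc: "t *[sec X V] jj (e ^[A] n) el sec X V" using t e by simp
   obtain W where W: "opn X W" "y : W" "W <= V" "res X V W (t *[sec X V] jj (e ^[A] n)) = res X V W 0[sec X V]"
    by (rule germ_eqE[OF ge V_open y tc V_open y C.zero_closed])
   have "Q n w" if w: "w : W Int V" for w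
    using germ_eqI[OF V_open V_open W(1) _ W(3,3) tc C.zero_closed W(4), of w] w Qg[of w n] by simp
   then show "EX n W. opn X W & y : W & (ALL y:W Int V. Q n y)" using W by blast
  qed blast
  have "t *[sec X V] jj (e ^[A] n) = 0[sec X V]"
   by (rule sec_eqI[OF V_open]) (use t e Qg n in simp_all)
  moreover have "s *[sec X V] jj d = t +[sec X V] jj b"
   unfolding t_def using s b by (simp add: C.minus_eq C.a_assoc C.l_neg)
  ultimately have "s *[sec X V] jj d *[sec X V] jj (e ^[A] n) = jj b *[sec X V] jj (e ^[A] n)"
   using t b e by (simp add: C.l_distr)
  then have "jj (d *[A] e ^[A] n) *[sec X V] s = jj (b *[A] e ^[A] n)"
   using s b e by (simp add: C.m_ac)
  moreover have "nv x (d *[A] e ^[A] n)" using nv_mult[OF x b(2)] b(3) nv_pow[OF x e(1,2)] e(1) by simp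
  moreover have "d *[A] e ^[A] n el A" "b *[A] e ^[A] n el A" using b e by simp_all
  ultimately show "EX a:?c. nv x a" by blast
 qed
 then obtain b where "b el A" "jj b = s" using s by auto
 then show ?thesis by blast
qed

text \<open>Since \<open>jj\<close> is bijective, the ring of sections over \<open>V\<close> can
  take the place of \<open>A\<close>. Charts of affine opens then carry no auxiliary ring.\<close>

lemma chart_sections: "chart X V (sec X V) (%s. s)"
proof -
 interpret C: cring "sec X V" by (rule sec_cring[OF V_open])
 have ex: "EX a:carrier A. s = jj a" if "s el sec X V" for s using iota_surj[OF that] by blast
 show ?thesis
 proof (rule chart.intro)
  show "locally_ringed_space X" "opn X V" "cring (sec X V)" "(%s. s) : ring_hom (sec X V) (sec X V)"
   using lrs V_open C.cring_axioms by (auto simp: ring_hom_def)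
  show "EX x:V. ALL a:carrier (sec X V). germ X x V a : Units (stalk X x) <-> a ~: P" if P: "primeideal P (sec X V)" for P
  proof -
   interpret P: primeideal P "sec X V" by fact
   have "1[A] ~: {a : carrier A. jj a : P}" using primeideal_one[OF P] ring_hom_one[OF iota_hom] by simp
   then have "carrier A ~= {a : carrier A. jj a : P}" using A.one_closed by metis
   then have pr: "primeideal {a : carrier A. jj a : P} A"
    by (rule primeidealI[OF cring_vimage_ideal[OF iota_hom A_cring C.cring_axioms P.is_ideal] A_cring])
     (use P.I_prime[OF io io] in "simp add: ring_hom_mult[OF iota_hom]")
   then obtain x where x: "x : V" "ALL a:carrier A. nv x a <-> a ~: {a : carrier A. jj a : P}"
    using point_of_prime[OF pr] by blast
   have "germ X x V s : Units (stalk X x) <-> s ~: P" if s: "s el sec X V" for s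
   proof -
    obtain a where "a el A" "s = jj a" using ex[OF s] by metis
    then show ?thesis using x by simp
   qed
   then show ?thesis using x by blast
  qed
  show "x = y" if h: "x : V" "y : V" "!!a. a el sec X V ==>
   germ X x V a : Units (stalk X x) <-> germ X y V a : Units (stalk X y)" for x y
   by (rule point_inj[OF h(1,2)]) (use h(3) io in simp)
  show "EX a:carrier (sec X V). germ X x V a : Units (stalk X x) &
   (ALL y:V. germ X y V a : Units (stalk X y) --> y : W)" if W: "opn X W" "W <= V" "x : W" for W x
   using basis[OF W] io by metis
  fix x assume x: "x : V"
  show "EX a:carrier (sec X V). EX d:carrier (sec X V). germ X x V d : Units (stalk X x) &
   ga *[stalk X x] germ X x V d = germ X x V a" if "ga el stalk X x" for ga
   using fraction[OF x that] io by metis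
  show "EX d:carrier (sec X V). germ X x V d : Units (stalk X x) & d *[sec X V] a = 0[sec X V]"
   if h: "a el sec X V" "germ X x V a = 0[stalk X x]" for a
  proof -
   obtain b where b: "b el A" "a = jj b" using ex[OF h(1)] by metis
   obtain d where d: "d el A" "nv x d" "d *[A] b = 0[A]" using kernel[OF x b(1)] h b by metis
   have "jj d *[sec X V] a = 0[sec X V]"
    using ring_hom_mult[OF iota_hom d(1) b(1)] d b ring_hom_zero[OF iota_hom A.ring_axioms C.ring_axioms] by simp
   then show ?thesis using d io by blast
  qed
 qed
qed

end

lemma affine_chart:
 assumes "locally_ringed_space X" "affine_open X V"
 shows "chart X V (sec X V) (%s. s)"
 using affine_open_chart0[OF assms] chart.chart_sections by metis

subsection \<open>Morphisms to a chart\<close>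

context chart
begin

lemma fraction_map:
 assumes x: "x : V" and E: "cring E" and ps: "ps : ring_hom A E" and u: "!!a. a el A ==> nv x a ==> ps a : Units E"
 obtains th where "th : ring_hom (stalk X x) E"
  "!!ga a d. ga el stalk X x ==> a el A ==> d el A ==> nv x d ==> ga *[stalk X x] gi x d = gi x a ==> th ga *[E] ps d = ps a"
proof (rule fraction_hom[OF A_cring st_cring[OF x] E gi_hom[OF x] ps, of "{d : carrier A. nv x d}"])
 interpret E: cring E by fact
 show "EX a:carrier A. EX d:{d : carrier A. nv x d}. ga *[stalk X x] gi x d = gi x a" if "ga el stalk X x" for ga
  using fraction[OF x that] by blast
 show "ps a = ps b" if ab: "a el A" "b el A" "gi x a = gi x b" for a b
 proof -
  obtain k where k: "k el A" "nv x k" "k *[A] a = k *[A] b" by (rule gi_eqD[OF x ab])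
  then have "ps k *[E] ps a = ps k *[E] ps b" using ab by (simp flip: ring_hom_mult[OF ps])
  then show ?thesis using u[OF k(1,2)] ab hom_car[OF ps] by simp
 qed
qed (use x u nv_one nv_mult that in auto)

text \<open>A point \<open>q\<close> goes to the point of \<open>V\<close> whose prime consists of
  the elements with noninvertible germ at \<open>q\<close>. The stalk maps are then dictated by
  \<open>fraction_map\<close>, and they glue because a section near a point of \<open>V\<close> is a
  fraction with one numerator and denominator.\<close>

lemma morphism_to_chart:
 fixes Q :: "('q, 's) ringed_space"
 assumes Q: "locally_ringed_space Q" and ph: "ph : ring_hom A (sec Q (points Q))"
 obtains u where "mor Q X u" "!!q. q : points Q ==> pmap u q : V" "!!a. a el A ==> smap u V (jj a) = ph a"
proof -
 interpret Q: sheaf Q by (rule lrsD(1)[OF Q])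
 have pQ: "opn Q (points Q)" by simp
 define ps where "ps q a = germ Q q (points Q) (ph a)" for q a
 have ps: "ps q : ring_hom A (stalk Q q)" if "q : points Q" for q
  unfolding ps_def by (rule hom_comp[OF ph Q.germ_hom[OF pQ that]])
 note phc = hom_car[OF ph]
 have "EX x:V. ALL a:carrier A. nv x a <-> ps q a : Units (stalk Q q)" if q: "q : points Q" for q
  using point_of_prime[OF nonunit_prime[OF A_cring lrsD(2)[OF Q q] ps[OF q]]] by auto
 then obtain f where f: "!!q. q : points Q ==> f q : V & (ALL a:carrier A. nv (f q) a <-> ps q a : Units (stalk Q q))" by metis
 note fV = conjunct1[OF f] and fnv = bspec[OF conjunct2[OF f]]
 have Du: "opn Q {q : points Q. ps q a : Units (stalk Q q)}" if a: "a el A" for a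
 proof (rule openin_subopen[THEN iffD2], intro ballI)
  fix q assume "q : {q : points Q. ps q a : Units (stalk Q q)}"
  then have q: "q : points Q" "germ Q q (points Q) (ph a) : Units (stalk Q q)" by (auto simp: ps_def)
  obtain W where "opn Q W" "q : W" "W <= points Q" "ALL y:W. germ Q y (points Q) (ph a) : Units (stalk Q y)"
   using Q.germ_unit_nbhd[OF pQ q(1) phc[OF a] q(2)] by metis
  then show "EX T. opn Q T & q : T & T <= {q : points Q. ps q a : Units (stalk Q q)}" unfolding ps_def by blast
 qed
 have cont: "continuous_map (pts Q) (pts X) f"
  unfolding continuous_map_def
 proof (intro conjI allI impI)
  show "f : points Q \<rightarrow> points X" using fV V_pts by blast
  fix W assume W: "opn X W"
  show "opn Q {q : points Q. f q : W}"
  proof (rule openin_subopen[THEN iffD2], intro ballI)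
   fix q assume "q : {q : points Q. f q : W}"
   then have q: "q : points Q" "f q : W" by auto
   obtain a where a: "a el A" "nv (f q) a" "ALL y:V. nv y a --> y : W" by (rule nv_nbhd[OF W q(2) fV[OF q(1)]])
   show "EX T. opn Q T & q : T & T <= {q : points Q. f q : W}"
    by (rule exI[of _ "{q : points Q. ps q a : Units (stalk Q q)}"])
     (use Du[OF a(1)] a fnv[OF _ a(1)] fV q in auto)
  qed
 qed
 have "EX th. th : ring_hom (stalk X (f q)) (stalk Q q) & (ALL ga:carrier (stalk X (f q)). ALL a:carrier A. ALL d:carrier A.
  nv (f q) d --> ga *[stalk X (f q)] gi (f q) d = gi (f q) a --> th ga *[stalk Q q] ps q d = ps q a)" if q: "q : points Q" for q
  by (rule fraction_map[OF fV[OF q] Q.stalk_cring[OF q] ps[OF q]]) (use fnv[OF q] in auto)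
 then obtain th where thh: "!!q. q : points Q ==> th q : ring_hom (stalk X (f q)) (stalk Q q)"
  and th: "!!q ga a d. q : points Q ==> ga el stalk X (f q) ==> a el A ==> d el A ==>
   nv (f q) d ==> ga *[stalk X (f q)] gi (f q) d = gi (f q) a ==> th q ga *[stalk Q q] ps q d = ps q a"
  by metis
 have thi: "th q (gi (f q) a) = ps q a" if q: "q : points Q" and a: "a el A" for q a
 proof -
  interpret S: cring "stalk Q q" by (rule Q.stalk_cring[OF q])
  interpret T: cring "stalk X (f q)" by (rule st_cring[OF fV[OF q]])
  note gc = gi_closed[OF fV[OF q] a]
  show ?thesis
   using th[OF q gc a A.one_closed nv_one[OF fV[OF q]]] ring_hom_one[OF gi_hom[OF fV[OF q]]] ring_hom_one[OF ps[OF q]] gc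
    hom_car[OF thh[OF q] gc] by simp
 qed
 obtain h where h: "mor Q X h" "pmap h = f"
  and hg: "!!q W s. q : points Q ==> opn X W ==> f q : W ==> s el sec X W ==>
   germ Q q (preim Q h W) (smap h W s) = th q (germ X (f q) W s)"
 proof (rule morphism_from_germs[OF Q.sheaf_axioms presheaf_axioms cont, of "%q W s. th q (germ X (f q) W s)"])
  fix q W assume q: "q : points Q" and W: "opn X W" "f q : W"
  show "(%s. th q (germ X (f q) W s)) : ring_hom (sec X W) (stalk Q q)"
   by (rule hom_comp[OF germ_hom[OF W] thh[OF q]])
  fix s assume s: "s el sec X W"
  note gs = germ_closed[OF W s]
  obtain a d where ad: "a el A" "d el A" "nv (f q) d" "germ X (f q) W s *[stalk X (f q)] gi (f q) d = gi (f q) a"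
   using fraction[OF fV[OF q] gs] by blast
  interpret S: cring "stalk Q q" by (rule Q.stalk_cring[OF q])
  interpret T: cring "stalk X (f q)" by (rule st_cring[OF fV[OF q]])
  have un: "ps q d : Units (stalk Q q)" using fnv[OF q ad(2)] ad(3) by simp
  show "germ X (f q) W s : Units (stalk X (f q))" if u: "th q (germ X (f q) W s) : Units (stalk Q q)"
  proof -
   have "ps q a : Units (stalk Q q)" using th[OF q gs ad] u un by (metis S.Units_m_closed)
   then have "nv (f q) a" using fnv[OF q ad(1)] by simp
   then show ?thesis using T.Units_mult_iff[OF gs gi_closed[OF fV[OF q] ad(2)]] ad(4) by simp
  qed
  obtain W' where W': "opn X W'" "f q : W'" "W' <= W" "W' <= V" "ALL z:W'. germ X z W s *[stalk X z] gi z d = gi z a"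
   using relation_nbhd[OF W fV[OF q] s ad(2,1,4)] by metis
  define N where "N = {q : points Q. f q : W'} Int {q : points Q. ps q d : Units (stalk Q q)}"
  have N: "opn Q N" unfolding N_def using cont W'(1) Du[OF ad(2)] by (auto simp: continuous_map_def)
  have Np: "N <= points Q" by (auto simp: N_def)
  have rg: "germ Q y N (res Q (points Q) N (ph b)) = ps y b" if "y : N" "b el A" for y b
   using Q.germ_res[OF pQ N that(1) Np phc[OF that(2)]] unfolding ps_def by simp
  let ?r = "res Q (points Q) N"
  have e: "th y (germ X (f y) W s) el stalk Q y & th y (germ X (f y) W s) *[stalk Q y] germ Q y N (?r (ph d)) = germ Q y N (?r (ph a))"
   and u: "germ Q y N (?r (ph d)) : Units (stalk Q y)" if y: "y : N" for y
  proof -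
   have yp: "y : points Q" "f y : W'" "ps y d : Units (stalk Q y)" using y by (auto simp: N_def)
   have "germ X (f y) W s el stalk X (f y)" by (rule germ_closed[OF W(1) _ s]) (use yp W' in blast)
   then show "th y (germ X (f y) W s) el stalk Q y & th y (germ X (f y) W s) *[stalk Q y] germ Q y N (?r (ph d)) = germ Q y N (?r (ph a))"
    using th[OF yp(1) _ ad(1,2)] fnv[OF yp(1) ad(2)] yp W'(5) hom_car[OF thh[OF yp(1)]] rg[OF y] ad by simp
   show "germ Q y N (?r (ph d)) : Units (stalk Q y)" using rg[OF y ad(2)] yp by simp
  qed
  obtain t where "t el sec Q N" "!!y. y : N ==> germ Q y N t = th y (germ X (f y) W s)"
   by (rule Q.sec_fraction[OF N Q.res_closed[OF pQ N Np phc[OF ad(1)]] Q.res_closed[OF pQ N Np phc[OF ad(2)]] u e]) blast+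
  moreover have "q : N" "ALL y:N. f y : W" using q W' un by (auto simp: N_def)
  ultimately show "EX N t. opn Q N & q : N & (ALL y:N. f y : W) & t el sec Q N & (ALL y:N. germ Q y N t = th y (germ X (f y) W s))"
   using N by blast
 next
  fix q U W s assume "q : points Q" "opn X U" "opn X W" "f q : W" "W <= U" "s el sec X U"
  then show "th q (germ X (f q) W (res X U W s)) = th q (germ X (f q) U s)" using germ_res by simp
 qed blast
 interpret h: mor Q X h by (rule h(1))
 have pre: "preim Q h V = points Q" using fV h(2) by (auto simp: preim_def)
 have "smap h V (jj a) = ph a" if a: "a el A" for a
  by (rule Q.sec_eqI[OF pQ])
   (use h.smap_closed[OF V_open io[OF a]] phc[OF a] hg[OF _ V_open fV io[OF a]] thi[OF _ a] pre in "simp_all add: ps_def")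
 then show ?thesis using that[OF h(1)] h(2) fV by simp
qed

text \<open>Images of points agree because a point of \<open>V\<close> is determined by the elements
  that do not vanish at it. Stalk maps agree because germs are fractions of elements of
  \<open>A\<close>.\<close>

lemma morphisms_to_chart_eq:
 fixes Q :: "('q, 's) ringed_space"
 assumes Q: "sheaf Q" and u: "mor Q X u" and v: "mor Q X v"
  and uV: "!!q. q : points Q ==> pmap u q : V" and vV: "!!q. q : points Q ==> pmap v q : V"
  and eq: "!!a. a el A ==> smap u V (jj a) = smap v V (jj a)"
 shows "mor_eq Q X u v"
proof -
 interpret Q: sheaf Q by fact
 interpret u: mor Q X u by fact
 interpret v: mor Q X v by fact
 have pu: "preim Q u V = points Q" "preim Q v V = points Q" using uV vV by (auto simp: preim_def)
 have p: "pmap u q = pmap v q" if q: "q : points Q" for q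
  by (rule point_inj[OF uV[OF q] vV[OF q]])
   (use u.germ_unit_smap_iff[OF q V_open uV[OF q] io] v.germ_unit_smap_iff[OF q V_open vV[OF q] io] eq pu in simp)
 show ?thesis
 proof (rule mor_eqI[OF Q u v p])
  fix q W s assume q: "q : points Q" and W: "opn X W" "pmap u q : W" "s el sec X W"
  let ?x = "pmap u q"
  note gs = germ_closed[OF W]
  obtain a d where ad: "a el A" "d el A" "nv ?x d" "germ X ?x W s *[stalk X ?x] gi ?x d = gi ?x a"
   using fraction[OF uV[OF q] gs] by blast
  have px: "pmap v q = ?x" using p[OF q] by simp
  note hu = u.stalk_map_hom[OF q] and hv = v.stalk_map_hom[OF q, unfolded px]
  have ui: "stalk_map Q X u q (gi ?x a) = stalk_map Q X v q (gi ?x a)" if "a el A" for a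
   using u.stalk_map_germ[OF q V_open uV[OF q] io[OF that]] v.stalk_map_germ[OF q V_open vV[OF q] io[OF that]] px pu eq[OF that] by simp
  have "stalk_map Q X u q (germ X ?x W s) = stalk_map Q X v q (germ X ?x W s)"
   by (rule hom_eq_on_fraction[OF Q.stalk_cring[OF q] hu hv gs gi_closed[OF uV[OF q] ad(2)] ring_hom_Units[OF hu ad(3)] ui[OF ad(2)]])
    (simp add: ad(4) ui[OF ad(1)])
  then show "germ Q q (preim Q u W) (smap u W s) = germ Q q (preim Q v W) (smap v W s)"
   using u.stalk_map_germ[OF q W] v.stalk_map_germ[OF q W(1) _ W(3)] W(2) px by simp
 qed
qed

end

subsection \<open>A criterion for affineness\<close>

text \<open>If the canonical morphism from \<open>U\<close> to the spectrum of its ring of sections has a left inverse,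
 then it is an isomorphism, because it is bijective on global sections.\<close>

lemma affine_openI:
 fixes P :: "('p, 'r) ringed_space"
 assumes P: "locally_ringed_space P" and U: "opn P U" and l: "mor (Spec (sec P U)) P l"
  and lU: "!!q. q : points (Spec (sec P U)) ==> pmap l q : U"
  and inv: "!!k. mor (restrict_space P U) (Spec (sec P U)) k ==>
   (!!a. a el sec P U ==> smap k (points (Spec (sec P U))) (Spec_elt (sec P U) a) = a) ==>
   mor_eq (restrict_space P U) P (comp_mor (Spec (sec P U)) k l) (open_incl P U)"
 shows "affine_open P U"
proof -
 let ?G = "sec P U" let ?S = "restrict_space P U" let ?X = "Spec ?G" let ?p = "points ?X"
 interpret P: sheaf P by (rule lrsD(1)[OF P])
 interpret G: cring ?G by (rule P.sec_cring[OF U])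
 interpret C: chart ?X ?p ?G "Spec_elt ?G" by (rule Spec_chart[OF G.cring_axioms])
 have S: "locally_ringed_space ?S" by (rule lrs_restrict[OF P U])
 interpret S: sheaf ?S by (rule lrsD(1)[OF S])
 have Sp: "points ?S = U" by (rule restrict_points[OF U])
 have "(%s. s) : ring_hom ?G (sec ?S (points ?S))" unfolding Sp by (auto simp: ring_hom_def)
 then obtain k where k: "mor ?S ?X k" "!!a. a el ?G ==> smap k ?p (Spec_elt ?G a) = a"
  by (rule C.morphism_to_chart[OF S]) blast
 have l': "mor ?X ?S l" by (rule mor_into_restrict[OF l U lU])
 interpret k: mor ?S ?X k by (rule k(1))
 interpret l: mor ?X P l by (rule l)
 have pl: "preim ?X l U = ?p" using lU by (auto simp: preim_def)
 have eqP: "mor_eq ?S P (comp_mor ?X k l) (open_incl P U)" by (rule inv[OF k])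
 have eq1: "mor_eq ?S ?S (comp_mor ?X k l) id_mor"
  unfolding mor_eq_def
 proof (intro conjI ballI allI impI)
  fix x assume "x : points ?S"
  then show "pmap (comp_mor ?X k l) x = pmap id_mor x" using mor_eq_pmap[OF eqP] by simp
 next
  fix V s assume "opn ?S V" and s: "s el sec ?S V"
  then have V: "opn P V" "V <= U" using restrict_opn[OF U] by auto
  then have UV: "U Int V = V" by blast
  show "smap (comp_mor ?X k l) V s = smap id_mor V s"
   using mor_eq_smap[OF eqP V(1)] s P.res_id[OF V(1)] UV by simp
 qed
 \<comment> \<open>A global section of the spectrum is some \<open>Spec_elt ?G b\<close>. Pulling it
   back along \<open>k\<close> returns \<open>b\<close>, and the left inverse property says that the
   result is \<open>a\<close>.\<close>
 have la: "smap l U a = Spec_elt ?G a" if a: "a el ?G" for a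
 proof -
  have "smap l U a el sec ?X ?p" using l.smap_closed[OF U a] pl by simp
  then obtain b where b: "b el ?G" "smap l U a = Spec_elt ?G b" using C.iota_surj by blast
  have "b = smap k ?p (smap l U a)" using k(2)[OF b(1)] b(2) by simp
  also have "... = smap (comp_mor ?X k l) U a" by (simp add: pl)
  also have "... = a" using mor_eq_smap[OF eqP U a] P.res_id[OF U a] by simp
  finally show ?thesis using b by simp
 qed
 have pk: "preim ?S k ?p = U" using k.preim_points Sp by simp
 have eq2: "mor_eq ?X ?X (comp_mor ?S l k) id_mor"
 proof (rule C.morphisms_to_chart_eq)
  show "sheaf ?X" by (rule C.sheaf_axioms)
  show "mor ?X ?X (comp_mor ?S l k)" by (rule mor_comp[OF l' k(1)])
  show "mor ?X ?X id_mor" by (rule mor_id[OF C.presheaf_axioms])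
  show "pmap (comp_mor ?S l k) q : ?p" if "q : ?p" for q
   unfolding comp_simps by (rule k.pmap_in) (unfold Sp, rule lU[OF that])
  show "smap (comp_mor ?S l k) ?p (Spec_elt ?G a) = smap id_mor ?p (Spec_elt ?G a)" if "a el ?G" for a
   using k(2)[OF that] la[OF that] by (simp add: pk)
 qed simp
 have "iso_mor ?S ?X k"
  unfolding iso_mor_def using mor_morphism[OF k(1)] mor_morphism[OF l'] eq1 eq2 by blast
 then show ?thesis
  unfolding affine_open_def affine_scheme_def using U S G.cring_axioms by blast
qed

text \<open>Once the canonical morphism \<open>l\<close> to the chart lands in \<open>U\<close>, it
  is the left inverse that \<open>affine_openI\<close> asks for, because morphisms to a chart are
  determined by their effect on \<open>A\<close>.\<close>

lemma (in chart) sub_affine_open: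
 assumes U: "opn X U" "U <= V"
  and img: "!!l. mor (Spec (sec X U)) X l ==> (!!q. q : points (Spec (sec X U)) ==> pmap l q : V) ==>
   (!!a. a el A ==> smap l V (jj a) = Spec_elt (sec X U) (res X V U (jj a))) ==>
   (!!q. q : points (Spec (sec X U)) ==> pmap l q : U)"
 shows "affine_open X U"
proof -
 let ?G = "sec X U" let ?Y = "Spec ?G" let ?p = "points ?Y"
 interpret G: cring ?G by (rule sec_cring[OF U(1)])
 interpret C: chart ?Y ?p ?G "Spec_elt ?G" by (rule Spec_chart[OF G.cring_axioms])
 have "(%a. res X V U (jj a)) : ring_hom A ?G"
  by (rule hom_comp[OF iota_hom res_hom[OF V_open U]])
 then have "(%a. Spec_elt ?G (res X V U (jj a))) : ring_hom A (sec ?Y ?p)"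
  by (rule hom_comp[OF _ C.iota_hom])
 then obtain l where l: "mor ?Y X l" "!!q. q : ?p ==> pmap l q : V"
  "!!a. a el A ==> smap l V (jj a) = Spec_elt ?G (res X V U (jj a))"
  by (rule morphism_to_chart[OF C.lrs]) blast
 have pl: "preim ?Y l V = ?p" using l(2) by (auto simp: preim_def)
 show ?thesis
 proof (rule affine_openI[OF lrs U(1) l(1)])
  show "pmap l q : U" if "q : ?p" for q by (rule img[OF l that])
  fix k assume k: "mor (restrict_space X U) ?Y k" "!!a. a el ?G ==> smap k ?p (Spec_elt ?G a) = a"
  interpret k: mor "restrict_space X U" ?Y k by (rule k(1))
  have UV: "U Int V = U" using U by blast
  show "mor_eq (restrict_space X U) X (comp_mor ?Y k l) (open_incl X U)"
  proof (rule morphisms_to_chart_eq[OF sheaf_restrict[OF sheaf_axioms U(1)] mor_comp[OF k(1) l(1)] mor_open_incl[OF presheaf_axioms U(1)]])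
   fix q assume q: "q : points (restrict_space X U)"
   show "pmap (comp_mor ?Y k l) q : V" using l(2)[OF k.pmap_in[OF q]] by simp
   show "pmap (open_incl X U) q : V" using q U restrict_points[OF U(1)] by auto
  next
   fix a assume a: "a el A"
   show "smap (comp_mor ?Y k l) V (jj a) = smap (open_incl X U) V (jj a)"
    using l(3)[OF a] k(2)[of "res X V U (jj a)"] res_closed[OF V_open U io[OF a]] by (simp add: pl UV)
  qed
 qed
qed

lemma (in chart) chart_affine_open: "affine_open X V"
 by (rule sub_affine_open[OF V_open]) auto

text \<open>Over its nonvanishing locus \<open>f\<close> is an invertible section, hence it is
  invertible on the spectrum of the sections there. The canonical morphism from this spectrum thus
  meets only points at which \<open>f\<close> does not vanish.\<close>

lemma (in chart) nv_affine_open: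
 assumes f: "f el A"
 shows "affine_open X {x : V. nv x f}"
proof (rule sub_affine_open[OF nv_open[OF f]])
 let ?U = "{x : V. nv x f}" let ?Y = "Spec (sec X ?U)"
 note U = nv_open[OF f]
 interpret G: cring "sec X ?U" by (rule sec_cring[OF U])
 interpret C: chart ?Y "points ?Y" "sec X ?U" "Spec_elt (sec X ?U)" by (rule Spec_chart[OF G.cring_axioms])
 fix l q assume l: "mor ?Y X l" "!!q. q : points ?Y ==> pmap l q : V"
  "!!a. a el A ==> smap l V (jj a) = Spec_elt (sec X ?U) (res X V ?U (jj a))" and q: "q : points ?Y"
 interpret l: mor ?Y X l by (rule l(1))
 have pl: "preim ?Y l V = points ?Y" using l(2) by (auto simp: preim_def)
 have r: "res X V ?U (jj f) el sec X ?U" using res_closed[OF V_open U _ io[OF f]] by blast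
 have "res X V ?U (jj f) : Units (sec X ?U)"
  by (rule sec_unitI[OF U r]) (use germ_res[OF V_open U _ _ io[OF f]] in auto)
 then have "Spec_elt (sec X ?U) (res X V ?U (jj f)) : Units (sec ?Y (points ?Y))"
  by (rule ring_hom_Units[OF C.iota_hom])
 then have "germ ?Y q (points ?Y) (smap l V (jj f)) : Units (stalk ?Y q)"
  using ring_hom_Units[OF C.germ_hom[OF C.V_open q]] l(3)[OF f] by simp
 then have "nv (pmap l q) f"
  using l.germ_unit_smap_iff[OF q V_open l(2)[OF q] io[OF f]] pl by simp
 then show "pmap l q : ?U" using l(2)[OF q] by simp
qed blast

lemma scheme_lrs: "scheme X ==> locally_ringed_space X"
 by (simp add: scheme_def)

lemma affine_basis:
 assumes X: "scheme X" and W: "opn X W" "x : W"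
 obtains V where "affine_open X V" "x : V" "V <= W"
proof -
 have "x : points X" using W openin_subset by blast
 then obtain U where U: "x : U" "affine_open X U" using X unfolding scheme_def by blast
 interpret C: chart X U "sec X U" "%s. s" by (rule affine_chart[OF scheme_lrs[OF X] U(2)])
 obtain f where f: "f el sec X U" "C.nv x f" "ALL y:U. C.nv y f --> y : W" by (rule C.nv_nbhd[OF W U(1)])
 show ?thesis
  by (rule that[OF C.nv_affine_open[OF f(1)]]) (use f U in auto)
qed

lemma scheme_Spec:
 assumes "cring A"
 shows "scheme (Spec (A :: 'a ring))"
 unfolding scheme_def
 by (intro conjI ballI exI[of _ "points (Spec A)"] Spec_lrs[OF assms] chart.chart_affine_open[OF Spec_chart[OF assms]])

subsection \<open>Morphisms from a local ring\<close>

text \<open>This stands for the composite through the spectrum of the stalk, without that spectrum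
  being formed. A chart around \<open>t\<close> yields \<open>v\<close>; elements that do not vanish
  at \<open>t\<close> are invertible in the stalk, which forces the image into every neighbourhood
  \<open>N\<close> of \<open>t\<close>, and the formula over \<open>N\<close> follows by writing the
  germ as a fraction.\<close>

lemma morphism_from_stalk:
 fixes T :: "('t, 'rt) ringed_space" and Q :: "('q, 's) ringed_space"
 assumes T: "scheme T" and t: "t : points T" and Q: "locally_ringed_space Q" and ph: "ph : ring_hom (stalk T t) (sec Q (points Q))"
 obtains v where "mor Q T v" "!!N q. opn T N ==> t : N ==> q : points Q ==> pmap v q : N"
  "!!N c. opn T N ==> t : N ==> c el sec T N ==> smap v N c = ph (germ T t N c)"
proof -
 obtain V where V: "t : V" "affine_open T V" using T t unfolding scheme_def by blast
 interpret C: chart T V "sec T V" "%s. s" by (rule affine_chart[OF scheme_lrs[OF T] V(2)])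
 interpret Q: sheaf Q by (rule lrsD(1)[OF Q])
 have pQ: "opn Q (points Q)" by simp
 interpret G: cring "sec Q (points Q)" by (rule Q.sec_cring[OF pQ])
 interpret St: cring "stalk T t" by (rule C.st_cring[OF V(1)])
 have "(%s. ph (germ T t V s)) : ring_hom (sec T V) (sec Q (points Q))"
  by (rule hom_comp[OF C.germ_hom[OF C.V_open V(1)] ph])
 then obtain v where v: "mor Q T v" "!!q. q : points Q ==> pmap v q : V"
  "!!s. s el sec T V ==> smap v V s = ph (germ T t V s)"
  by (rule C.morphism_to_chart[OF Q]) blast
 interpret v: mor Q T v by (rule v(1))
 have pv: "preim Q v V = points Q" using v(2) by (auto simp: preim_def)
 have img: "pmap v q : N" if N: "opn T N" "t : N" and q: "q : points Q" for N q
 proof -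
  obtain a where a: "a el sec T V" "C.nv t a" "ALL y:V. C.nv y a --> y : N" by (rule C.nv_nbhd[OF N V(1)])
  have "ph (germ T t V a) : Units (sec Q (points Q))" by (rule ring_hom_Units[OF ph a(2)])
  then have "germ Q q (points Q) (smap v V a) : Units (stalk Q q)"
   using ring_hom_Units[OF Q.germ_hom[OF pQ q]] v(3)[OF a(1)] by simp
  then have "C.nv (pmap v q) a" using v.germ_unit_smap_iff[OF q C.V_open v(2)[OF q] a(1)] pv by simp
  then show ?thesis using a v(2)[OF q] by blast
 qed
 have "smap v N c = ph (germ T t N c)" if N: "opn T N" "t : N" and c: "c el sec T N" for N c
 proof -
  have pN: "preim Q v N = points Q" using img[OF N] by (auto simp: preim_def)
  have gc: "germ T t N c el stalk T t" using C.germ_closed[OF N c] .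
  obtain b d where bd: "b el sec T V" "d el sec T V" "C.nv t d"
   "germ T t N c *[stalk T t] germ T t V d = germ T t V b" using C.fraction[OF V(1) gc] by blast
  obtain W where W: "opn T W" "t : W" "ALL z:W. germ T z N c *[stalk T z] germ T z V d = germ T z V b"
   using C.relation_nbhd[OF N V(1) c bd(2,1,4)] by metis
  have vc: "smap v N c el sec Q (points Q)" using v.smap_closed[OF N(1) c] pN by simp
  have gd: "germ T t V d el stalk T t" using bd(3) by blast
  have pc: "ph (germ T t N c) el sec Q (points Q)" "ph (germ T t V d) el sec Q (points Q)"
   "ph (germ T t V b) el sec Q (points Q)"
   using hom_car[OF ph] gc gd C.gi_closed[OF V(1) bd(1)] by auto
  have "smap v N c *[sec Q (points Q)] ph (germ T t V d) = ph (germ T t V b)"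
  proof (rule Q.sec_eqI[OF pQ])
   fix q assume q: "q : points Q"
   let ?z = "pmap v q"
   have z: "?z : W" "?z : V" "?z : N" using img[OF W(1,2) q] v(2)[OF q] img[OF N q] by auto
   have e: "germ T ?z N c *[stalk T ?z] germ T ?z V d = germ T ?z V b" using W z by blast
   have "germ Q q (points Q) (smap v N c) *[stalk Q q] germ Q q (points Q) (smap v V d) = germ Q q (points Q) (smap v V b)"
    using ring_hom_mult[OF v.stalk_map_hom[OF q] C.germ_closed[OF N(1) z(3) c] C.germ_closed[OF C.V_open z(2) bd(2)]] e
     v.stalk_map_germ[OF q N(1) z(3) c] v.stalk_map_germ[OF q C.V_open z(2) bd(2)] v.stalk_map_germ[OF q C.V_open z(2) bd(1)] pv pN by simp
   then show "germ Q q (points Q) (smap v N c *[sec Q (points Q)] ph (germ T t V d)) = germ Q q (points Q) (ph (germ T t V b))"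
    using Q.stalk_mult[OF pQ q vc pc(2)] v(3)[OF bd(2)] v(3)[OF bd(1)] by simp
  qed (use vc pc in simp_all)
  also have "... = ph (germ T t N c) *[sec Q (points Q)] ph (germ T t V d)"
   using ring_hom_mult[OF ph gc gd] bd(4) by simp
  finally have eq: "smap v N c *[sec Q (points Q)] ph (germ T t V d) = ph (germ T t N c) *[sec Q (points Q)] ph (germ T t V d)" .
  then have "ph (germ T t V d) *[sec Q (points Q)] smap v N c = ph (germ T t V d) *[sec Q (points Q)] ph (germ T t N c)"
   using vc pc by (simp add: G.m_comm)
  then show ?thesis using G.Units_l_cancel[OF ring_hom_Units[OF ph bd(3)] vc pc(1)] by simp
 qed
 then show ?thesis using that[OF v(1)] img by blast
qed

subsection \<open>Quasi-coherent ideals\<close>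

locale ideal_sh = presheaf X for X :: "('p, 'r) ringed_space" +
 fixes I
 assumes ideal_sheaf: "ideal_sheaf X I"
begin

lemma I_ideal: "opn X U ==> ideal (I U) (sec X U)"
 using ideal_sheaf unfolding ideal_sheaf_def by blast

lemma I_carr: "opn X U ==> s : I U ==> s el sec X U"
 using ideal.Icarr[OF I_ideal] .

lemma I_res: "opn X U ==> opn X V ==> V <= U ==> s : I U ==> res X U V s : I V"
 using ideal_sheaf unfolding ideal_sheaf_def by blast

lemma I_glue: "(!!U. U : UU ==> opn X U) ==> s el sec X (\<Union>UU) ==>
  (!!U. U : UU ==> res X (\<Union>UU) U s : I U) ==> s : I (\<Union>UU)"
 using ideal_sheaf unfolding ideal_sheaf_def by (elim conjE) simp

lemma ideal_stalkI: "opn X U ==> x : U ==> s : I U ==> germ X x U s : ideal_stalk X I x"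
 unfolding ideal_stalk_def by blast

lemma ideal_stalkE:
 assumes "ga : ideal_stalk X I x"
 obtains U s where "opn X U" "x : U" "s : I U" "ga = germ X x U s"
 using assms unfolding ideal_stalk_def by blast

lemma germ_in_ideal_stalk_iff:
 assumes U: "opn X U" "x : U" "s el sec X U"
 shows "germ X x U s : ideal_stalk X I x <-> (EX W. opn X W & x : W & W <= U & res X U W s : I W)"
proof
 assume "germ X x U s : ideal_stalk X I x"
 then obtain V t where V: "opn X V" "x : V" "t : I V" and e: "germ X x U s = germ X x V t" by (rule ideal_stalkE)
 obtain W where W: "opn X W" "x : W" "W <= U" "W <= V" "res X U W s = res X V W t"
  by (rule germ_eqE[OF e U V(1,2) I_carr[OF V(1,3)]])
 then show "EX W. opn X W & x : W & W <= U & res X U W s : I W" using I_res[OF V(1) W(1,4) V(3)] by auto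
next
 assume "EX W. opn X W & x : W & W <= U & res X U W s : I W"
 then obtain W where W: "opn X W" "x : W" "W <= U" "res X U W s : I W" by blast
 then show "germ X x U s : ideal_stalk X I x" using ideal_stalkI[OF W(1,2,4)] germ_res[OF U(1) W(1-3) U(3)] by simp
qed

lemma germ_in_ideal_stalk_nbhd:
 assumes U: "opn X U" "x : U" "s el sec X U" and g: "germ X x U s : ideal_stalk X I x"
 obtains W where "opn X W" "x : W" "W <= U" "ALL y:W. germ X y U s : ideal_stalk X I y" "res X U W s : I W"
proof -
 obtain W where W: "opn X W" "x : W" "W <= U" "res X U W s : I W" using g germ_in_ideal_stalk_iff[OF U] by blast
 have "germ X y U s : ideal_stalk X I y" if y: "y : W" for y
  using ideal_stalkI[OF W(1) y W(4)] germ_res[OF U(1) W(1) y W(3) U(3)] by simp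
 then show ?thesis using that W by blast
qed

lemma ideal_sheaf_mem_iff:
 assumes U: "opn X U" "s el sec X U"
 shows "s : I U <-> (ALL x:U. germ X x U s : ideal_stalk X I x)"
proof
 assume "s : I U" then show "ALL x:U. germ X x U s : ideal_stalk X I x" using ideal_stalkI[OF U(1)] by blast
next
 assume h: "ALL x:U. germ X x U s : ideal_stalk X I x"
 let ?U = "{W. opn X W & W <= U & res X U W s : I W}"
 have un: "\<Union>?U = U"
 proof
  show "U <= \<Union>?U"
  proof
   fix x assume x: "x : U"
   then show "x : \<Union>?U" using h germ_in_ideal_stalk_iff[OF U(1) x U(2)] by blast
  qed
 qed blast
 have "s : I (\<Union>?U)" by (rule I_glue) (use U un in auto)
 then show "s : I U" using un by simp
qed

lemma ideal_stalk_ideal: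
 assumes x: "x : points X"
 shows "ideal (ideal_stalk X I x) (stalk X x)"
proof -
 interpret S: cring "stalk X x" by (rule stalk_cring[OF x])
 show ?thesis
 proof (rule S.idealI')
  show "ideal_stalk X I x <= carrier (stalk X x)"
  proof
   fix ga assume "ga : ideal_stalk X I x"
   then obtain U s where "opn X U" "x : U" "s : I U" "ga = germ X x U s" by (rule ideal_stalkE)
   then show "ga el stalk X x" using germ_closed I_carr by simp
  qed
  have P: "opn X (points X)" by simp
  show "0[stalk X x] : ideal_stalk X I x" using ideal_stalkI[OF P x additive_subgroup.zero_closed[OF ideal.axioms(1)[OF I_ideal[OF P]]]] germ_zero[OF P x] by simp
  show "a +[stalk X x] b : ideal_stalk X I x" if h: "a : ideal_stalk X I x" "b : ideal_stalk X I x" for a b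
  proof -
   obtain U s where U: "opn X U" "x : U" "s : I U" "a = germ X x U s" by (rule ideal_stalkE[OF h(1)])
   obtain V t where V: "opn X V" "x : V" "t : I V" "b = germ X x V t" by (rule ideal_stalkE[OF h(2)])
   have o: "opn X (U Int V)" "U Int V <= U" "U Int V <= V" "x : U Int V" using U V by auto
   interpret W: ideal "I (U Int V)" "sec X (U Int V)" by (rule I_ideal[OF o(1)])
   note r = I_res[OF U(1) o(1,2) U(3)] I_res[OF V(1) o(1,3) V(3)]
   have "a +[stalk X x] b = germ X x (U Int V) (res X U (U Int V) s +[sec X (U Int V)] res X V (U Int V) t)"
    using stalk_add[OF o(1,4) I_carr[OF o(1) r(1)] I_carr[OF o(1) r(2)]] germ_res[OF U(1) o(1,4,2) I_carr[OF U(1,3)]]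
     germ_res[OF V(1) o(1,4,3) I_carr[OF V(1,3)]] U V by simp
   then show ?thesis using ideal_stalkI[OF o(1,4) additive_subgroup.a_closed[OF ideal.axioms(1)[OF I_ideal[OF o(1)]] r]] by simp
  qed
  show "a *[stalk X x] b : ideal_stalk X I x" if h: "a el stalk X x" "b : ideal_stalk X I x" for a b
  proof -
   obtain V t where V: "opn X V" "x : V" "t : I V" "b = germ X x V t" by (rule ideal_stalkE[OF h(2)])
   obtain U s where U: "opn X U" "x : U" "U <= V" "s el sec X U" "a = germ X x U s" by (rule stalkE_in[OF h(1) V(1,2)])
   interpret W: ideal "I U" "sec X U" by (rule I_ideal[OF U(1)])
   note r = I_res[OF V(1) U(1,3) V(3)]
   have "a *[stalk X x] b = germ X x U (s *[sec X U] res X V U t)"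
    using stalk_mult[OF U(1,2,4) I_carr[OF U(1) r]] germ_res[OF V(1) U(1-3) I_carr[OF V(1,3)]] U V by simp
   then show ?thesis using ideal_stalkI[OF U(1,2) W.I_l_closed[OF r U(4)]] by simp
  qed
 qed
qed

end

lemma qc_ideal_sh:
 assumes "presheaf X" "quasi_coherent_ideal X I"
 shows "ideal_sh X I"
 using assms by (simp add: ideal_sh_def ideal_sh_axioms_def quasi_coherent_ideal_def)

lemma qc_local:
 assumes X: "presheaf X" and I: "quasi_coherent_ideal X I" and x: "x : points X"
 obtains U aa where "x : U" "affine_open X U" "ideal aa (sec X U)"
  "!!y. y : U ==> ideal_stalk X I y = genideal (stalk X y) (germ X y U ` aa)"
proof -
 interpret ideal_sh X I by (rule qc_ideal_sh[OF X I])
 obtain U aa where U: "x : U" "affine_open X U" "ideal aa (sec X U)"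
  and IV: "!!V. opn X V ==> V <= U ==> I V = {s : carrier (sec X V). ALL y:V. germ X y V s : genideal (stalk X y) (germ X y U ` aa)}"
 proof -
  have "ALL x:points X. EX U. x : U & affine_open X U & (EX aa. ideal aa (sec X U) & (ALL V. opn X V --> V <= U -->
   I V = {s : carrier (sec X V). ALL y:V. germ X y V s : genideal (stalk X y) (germ X y U ` aa)}))"
   using I unfolding quasi_coherent_ideal_def by (rule conjunct2)
  from bspec[OF this x] show ?thesis using that by (elim exE conjE) simp
 qed
 have o: "opn X U" using U(2) by (simp add: affine_open_def)
 interpret a: ideal aa "sec X U" by (rule U(3))
 have "ideal_stalk X I y = genideal (stalk X y) (germ X y U ` aa)" if y: "y : U" for y
 proof
  have yp: "y : points X" using y opn_sub[OF o] by blast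
  interpret S: cring "stalk X y" by (rule stalk_cring[OF yp])
  have sub: "germ X z U ` aa <= carrier (stalk X z)" if "z : U" for z using germ_closed[OF o that] a.Icarr by blast
  have self: "germ X z U ` aa <= genideal (stalk X z) (germ X z U ` aa)" if "z : U" for z
  proof -
   interpret Z: cring "stalk X z" by (rule stalk_cring) (use that opn_sub[OF o] in blast)
   show ?thesis by (rule Z.genideal_self[OF sub[OF that]])
  qed
  have "aa <= I U" using IV[OF o subset_refl] self a.Icarr by blast
  then have "germ X y U ` aa <= ideal_stalk X I y" using ideal_stalkI[OF o y] by blast
  then show "genideal (stalk X y) (germ X y U ` aa) <= ideal_stalk X I y"
   by (rule S.genideal_minimal[OF ideal_stalk_ideal[OF yp]])
  show "ideal_stalk X I y <= genideal (stalk X y) (germ X y U ` aa)"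
  proof
   fix ga assume "ga : ideal_stalk X I y"
   then obtain W s where W: "opn X W" "y : W" "s : I W" "ga = germ X y W s" by (rule ideal_stalkE)
   have oW: "opn X (W Int U)" "W Int U <= U" "W Int U <= W" "y : W Int U" using W o y by auto
   have "res X W (W Int U) s : I (W Int U)" by (rule I_res[OF W(1) oW(1,3) W(3)])
   then have "germ X y (W Int U) (res X W (W Int U) s) : genideal (stalk X y) (germ X y U ` aa)"
    using IV[OF oW(1,2)] oW(4) by blast
   then show "ga : genideal (stalk X y) (germ X y U ` aa)"
    using germ_res[OF W(1) oW(1,4,3) I_carr[OF W(1,3)]] W(4) by simp
  qed
 qed
 then show ?thesis using that U by blast
qed

text \<open>The definition of quasi-coherence supplies some affine neighbourhood of each point,
  whereas here the affine open set is prescribed. A germ in the ideal is, up to a unit, the germ of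
  a section \<open>b\<close> over \<open>V\<close> that lies in the ideal near \<open>x\<close>;
  multiplying \<open>b\<close> by a power of an element supported there puts it into the ideal over
  all of \<open>V\<close>.\<close>

lemma qc_stalk_generated:
 assumes X: "locally_ringed_space X" and I: "quasi_coherent_ideal X I" and V: "affine_open X V" and x: "x : V"
 shows "ideal_stalk X I x = genideal (stalk X x) (germ X x V ` I V)"
proof
 interpret C: chart X V "sec X V" "%s. s" by (rule affine_chart[OF X V])
 interpret ideal_sh X I by (rule qc_ideal_sh[OF C.presheaf_axioms I])
 note Vo = C.V_open
 interpret S: cring "stalk X x" by (rule C.st_cring[OF x])
 have IVc: "I V <= carrier (sec X V)" using I_carr[OF Vo] by blast
 have sub: "germ X x V ` I V <= ideal_stalk X I x" using ideal_stalkI[OF Vo x] by blast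
 then show "genideal (stalk X x) (germ X x V ` I V) <= ideal_stalk X I x"
  by (rule S.genideal_minimal[OF ideal_stalk_ideal[OF C.V_pts[OF x]]])
 show "ideal_stalk X I x <= genideal (stalk X x) (germ X x V ` I V)"
 proof
  fix ga assume g: "ga : ideal_stalk X I x"
  interpret Ix: ideal "ideal_stalk X I x" "stalk X x" by (rule ideal_stalk_ideal[OF C.V_pts[OF x]])
  have gc: "ga el stalk X x" by (rule Ix.Icarr[OF g])
  obtain b d where bd: "b el sec X V" "d el sec X V" "C.nv x d" "ga *[stalk X x] germ X x V d = germ X x V b"
   using C.fraction[OF x gc] by blast
  have "germ X x V b : ideal_stalk X I x" using Ix.I_r_closed[OF g C.gi_closed[OF x bd(2)]] bd(4) by simp
  then obtain W where W: "opn X W" "x : W" "W <= V" "ALL y:W. germ X y V b : ideal_stalk X I y"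
   by (rule germ_in_ideal_stalk_nbhd[OF Vo x bd(1)])
  obtain e where e: "e el sec X V" "C.nv x e" "ALL y:V. C.nv y e --> y : W" by (rule C.nv_nbhd[OF W(1,2) x])
  define s where "s n = b *[sec X V] e ^[sec X V] n" for n :: nat
  have sc: "s n el sec X V" for n unfolding s_def using bd e by simp
  have gs: "germ X y V (s n) = germ X y V b *[stalk X y] germ X y V e ^[stalk X y] n" if y: "y : V" for y n
   unfolding s_def using C.gi_mult[OF y bd(1), of "e ^[sec X V] n"] C.gi_pow[OF y e(1), of n] e(1) by simp
  obtain n where n: "!!y. y : V ==> germ X y V (s n) : ideal_stalk X I y"
  proof (rule C.quasi_compact[of "%n y. germ X y V (s n) : ideal_stalk X I y"])
   show "germ X y V (s m) : ideal_stalk X I y" if h: "n <= m" "germ X y V (s n) : ideal_stalk X I y" "y : V" for n m y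
   proof -
    interpret Iy: ideal "ideal_stalk X I y" "stalk X y" by (rule ideal_stalk_ideal[OF C.V_pts[OF h(3)]])
    have "s m = s n *[sec X V] e ^[sec X V] (m - n)"
     unfolding s_def using bd e C.A.nat_pow_mult[OF e(1), of n "m - n"] h(1) by (simp add: C.A.m_assoc)
    then have "germ X y V (s m) = germ X y V (s n) *[stalk X y] germ X y V (e ^[sec X V] (m - n))"
     using C.gi_mult[OF h(3) sc[of n], of "e ^[sec X V] (m - n)"] e(1) by simp
    then show ?thesis using Iy.I_r_closed[OF h(2) C.gi_closed[OF h(3)]] e(1) by simp
   qed
   fix y assume y: "y : V"
   obtain U aa where U: "y : U" "affine_open X U" "ideal aa (sec X U)"
    and M: "!!z. z : U ==> ideal_stalk X I z = genideal (stalk X z) (germ X z U ` aa)"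
    by (rule qc_local[OF C.presheaf_axioms I C.V_pts[OF y]]) blast
   interpret D: chart X U "sec X U" "%s. s" by (rule affine_chart[OF X U(2)])
   \<comment> \<open>The chart is the one that quasi-coherence provides around \<open>y\<close>, in
     which the stalks of the ideal are extended from \<open>aa\<close>. The section \<open>b\<close>
     lies in them wherever \<open>e\<close> does not vanish.\<close>
   have "EX n::nat. germ X y V b *[stalk X y] germ X y V e ^[stalk X y] n : D.M aa y"
   proof (rule D.power_conductor[OF U(1,3) Vo y bd(1) e(1)])
    fix z assume z: "z : V" "z : U" "germ X z V e : Units (stalk X z)"
    then show "germ X z V b : D.M aa z" using W(4) e(3) M[OF z(2)] by auto
   qed
   then obtain n where "germ X y V b *[stalk X y] germ X y V e ^[stalk X y] (n::nat) : D.M aa y" by blast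
   then have "germ X y V (s n) : ideal_stalk X I y" using gs[OF y] M[OF U(1)] by simp
   then obtain W' where "opn X W'" "y : W'" "W' <= V" "ALL z:W'. germ X z V (s n) : ideal_stalk X I z"
    by (rule germ_in_ideal_stalk_nbhd[OF Vo y sc])
   then show "EX n W. opn X W & y : W & (ALL y:W Int V. germ X y V (s n) : ideal_stalk X I y)" by blast
  qed blast
  have "s n : I V" using ideal_sheaf_mem_iff[OF Vo sc] n by blast
  have sI: "germ X x V ` I V <= carrier (stalk X x)" using C.gi_closed[OF x] IVc by blast
  note gid = S.genideal_ideal[OF sI]
  have "germ X x V (s n) : genideal (stalk X x) (germ X x V ` I V)"
   using S.genideal_self[OF sI] \<open>s n : I V\<close> by blast
  moreover have "germ X x V (s n) = ga *[stalk X x] (germ X x V d *[stalk X x] germ X x V e ^[stalk X x] n)"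
   unfolding gs[OF x] bd(4)[symmetric] using gc C.gi_closed[OF x bd(2)] C.gi_closed[OF x e(1)] by (simp add: S.m_assoc)
  moreover have "germ X x V d *[stalk X x] germ X x V e ^[stalk X x] n : Units (stalk X x)"
   using bd(3) C.nv_pow[OF x e(1,2), of n] C.gi_pow[OF x e(1), of n] by simp
  ultimately show "ga : genideal (stalk X x) (germ X x V ` I V)"
   using S.unit_ideal_cancel[OF gid gc] by simp
 qed
qed

subsection \<open>Closed subschemes\<close>

context
 fixes R (structure) and I
 assumes R: "cring R" and I: "ideal I R"
begin

interpretation cring R by (rule R)
interpretation I: ideal I R by (rule I)

lemma Quot_cring: "cring (R Quot I)"
 by (rule I.quotient_is_cring[OF R])

lemma Quot_hom: "(+>) I : ring_hom R (R Quot I)"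
 by (rule I.rcos_ring_hom)

lemma Quot_elt: "C el (R Quot I) ==> EX a:carrier R. C = I +> a"
 by (auto simp: FactRing_simps)

lemma Quot_eq_iff: "a el R ==> b el R ==> I +> a = I +> b <-> a \<ominus> b : I"
 using quotient_eq_iff_same_a_r_cos[OF I] by simp

lemma Quot_zero_iff: "a el R ==> I +> a = 0[R Quot I] <-> a : I"
 using Quot_eq_iff[of a "\<zero>"] ring_hom_zero[OF Quot_hom ring_axioms cring.axioms(1)[OF Quot_cring]]
 by (simp add: minus_eq)

lemma Quot_univ:
 assumes E: "cring E" and h: "h : ring_hom R E" and k: "!!i. i : I ==> h i = 0[E]"
 obtains g where "g : ring_hom (R Quot I) E" "!!a. a el R ==> g (I +> a) = h a"
proof -
 interpret E: cring E by fact
 interpret h: ring_hom_ring R E h using h ring_axioms E.ring_axioms by (simp add: ring_hom_ringI2)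
 define g where "g C = h (SOME a. a el R & C = I +> a)" for C
 have g: "g (I +> a) = h a" if a: "a el R" for a
 proof -
  let ?b = "SOME b. b el R & I +> a = I +> b"
  have "?b el R & I +> a = I +> ?b" by (rule someI[of _ a]) (use a in simp)
  then have b: "?b el R" "I +> a = I +> ?b" by blast+
  have "h (a \<ominus> ?b) = 0[E]" using Quot_eq_iff[OF a b(1)] b(2) k by blast
  moreover have "a = a \<ominus> ?b \<oplus> ?b" using a b(1) by (simp add: minus_eq a_assoc l_neg)
  moreover have "h (a \<ominus> ?b \<oplus> ?b) = h (a \<ominus> ?b) +[E] h ?b" using a b(1) by (intro h.hom_add) auto
  ultimately have "h a = h ?b" using b(1) by simp
  then show ?thesis unfolding g_def by simp
 qed
 have "g : ring_hom (R Quot I) E"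
 proof (rule ring_hom_memI)
  fix C assume "C el (R Quot I)"
  then obtain a where a: "a el R" "C = I +> a" using Quot_elt by blast
  then show "g C el E" using g by simp
  fix D assume "D el (R Quot I)"
  then obtain b where b: "b el R" "D = I +> b" using Quot_elt by blast
  show "g (C *[R Quot I] D) = g C *[E] g D" "g (C +[R Quot I] D) = g C +[E] g D"
   using a b g ring_hom_mult[OF Quot_hom a(1) b(1)] ring_hom_add[OF Quot_hom a(1) b(1)] g[of "a \<otimes> b"] g[of "a \<oplus> b"] by simp_all
 next
  show "g 1[R Quot I] = 1[E]" using g[of \<one>] ring_hom_one[OF Quot_hom] by simp
 qed
 then show ?thesis using that g by blast
qed

context
 assumes l: "local_ring R" and proper: "I ~= carrier R"
begin

lemma proper_no_unit: "i : I ==> i ~: Units R"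
proof
 assume i: "i : I" "i : Units R"
 then have "\<one> : I" using I.I_l_closed[OF i(1), of "inv i"] by simp
 then show False using I.one_imp_carrier proper by blast
qed

text \<open>If \<open>a \<otimes> b\<close> is congruent to 1, then 1 is the sum of
  \<open>a \<otimes> b\<close> and an element of \<open>I\<close>. One of the two is a unit, and a
  proper ideal contains none.\<close>

lemma Quot_unit_iff:
 assumes a: "a el R"
 shows "I +> a : Units (R Quot I) <-> a : Units R"
proof
 interpret Q: cring "R Quot I" by (rule Quot_cring)
 assume "I +> a : Units (R Quot I)"
 then obtain D where D: "D el (R Quot I)" "(I +> a) *[R Quot I] D = 1[R Quot I]" using Q.Units_iff by blast
 then obtain b where b: "b el R" "D = I +> b" using Quot_elt by blast
 have "I +> (a \<otimes> b) = I +> \<one>" using D b ring_hom_mult[OF Quot_hom a b(1)] ring_hom_one[OF Quot_hom] by simp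
 then have i: "a \<otimes> b \<ominus> \<one> : I" using Quot_eq_iff[of "a \<otimes> b" \<one>] a b by simp
 have "a \<otimes> b \<oplus> \<ominus> (a \<otimes> b \<ominus> \<one>) = \<one>" using a b by algebra
 then have "a \<otimes> b : Units R | \<ominus> (a \<otimes> b \<ominus> \<one>) : Units R"
  using local_ringD(3)[OF l, of "a \<otimes> b" "\<ominus> (a \<otimes> b \<ominus> \<one>)"] a b by simp
 moreover have "\<ominus> (a \<otimes> b \<ominus> \<one>) : I" using i additive_subgroup.a_inv_closed[OF ideal.axioms(1)[OF I]] by simp
 ultimately have "a \<otimes> b : Units R" using proper_no_unit by blast
 then show "a : Units R" using Units_mult_iff a b by simp
qed (rule ring_hom_Units[OF Quot_hom])

lemma Quot_local: "local_ring (R Quot I)"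
proof (rule local_ringI)
 interpret Q: cring "R Quot I" by (rule Quot_cring)
 show "cring (R Quot I)" by (rule Quot_cring)
 show "1[R Quot I] ~= 0[R Quot I]"
  using Quot_zero_iff[of \<one>] ring_hom_one[OF Quot_hom] proper_no_unit[of \<one>] by auto
 fix C D assume CD: "C el (R Quot I)" "D el (R Quot I)" "C +[R Quot I] D : Units (R Quot I)"
 obtain a b where ab: "a el R" "C = I +> a" "b el R" "D = I +> b" using Quot_elt CD by metis
 then have "I +> (a \<oplus> b) : Units (R Quot I)" using CD(3) ring_hom_add[OF Quot_hom ab(1,3)] by simp
 then have "a \<oplus> b : Units R" using Quot_unit_iff ab by simp
 then show "C : Units (R Quot I) | D : Units (R Quot I)" using local_ringD(3)[OF l ab(1,3)] Quot_unit_iff ab by simp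
qed

end

end

definition coset_fun :: "('p, 'r) ringed_space => ('p set => 'r set) => 'p set => ('p => ('p set \<times> 'r) set set) => bool" where
 "coset_fun X I = germ_fun X (subtopology (pts X) (ideal_support X I)) (%x. x) (%x. (+>\<^bsub>stalk X x\<^esub>) (ideal_stalk X I x))"

text \<open>The spaces \<open>subscheme\<close> and \<open>fun_space\<close> are shown to have the
  same sections over open sets only; elsewhere the local conditions may differ, so equality of
  records is not claimed. Germs and stalks look at open sets alone and are therefore equal.\<close>

definition agree :: "('p, 'r) ringed_space => ('p, 'r) ringed_space => bool" where
 "agree X Y <-> pts X = pts Y & (ALL U. opn Y U --> sec X U = sec Y U) & res X = res Y"

lemma agree_germ: "agree X Y ==> germ X x U s = germ Y x U s"
 unfolding agree_def germ_def by auto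

lemma agree_stalk: "agree X Y ==> stalk X x = stalk Y x"
proof -
 assume a: "agree X Y"
 have s: "pts X = pts Y" "!!U. opn Y U ==> sec X U = sec Y U" using a by (auto simp: agree_def)
 show ?thesis unfolding stalk_def agree_germ[OF a] using s by (simp cong: conj_cong)
qed

lemma agree_sheaf:
 assumes a: "agree X Y" and Y: "sheaf Y"
 shows "sheaf X"
proof (rule sheafI)
 have s: "pts X = pts Y" "!!U. opn Y U ==> sec X U = sec Y U" "res X = res Y" using a by (auto simp: agree_def)
 interpret sheaf Y by (rule Y)
 have p: "presheaf_of_rings X"
  using presheaf unfolding presheaf_of_rings_def s(1,3) by (simp add: s(2))
 show "sheaf_of_rings X"
  unfolding sheaf_of_rings_def
 proof (intro conjI p allI impI)
  fix UU and t :: "'a set => 'b" assume h: "ALL U:UU. opn X U" "ALL U:UU. t U el sec X U"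
   "ALL U:UU. ALL V:UU. res X U (U Int V) (t U) = res X V (U Int V) (t V)"
  have o: "ALL U:UU. opn Y U" "opn Y (\<Union>UU)" using h(1) unfolding s(1) by auto
  have c: "ALL U:UU. t U el sec Y U" using h(2) o(1) s(2) by simp
  show "EX! r. r el sec X (\<Union>UU) & (ALL U:UU. res X (\<Union>UU) U r = t U)"
   unfolding s(2)[OF o(2)] s(3) by (rule glue) (use o c h(3) s(3) in auto)
 qed
qed

lemma agree_lrs: "agree X Y ==> locally_ringed_space Y ==> locally_ringed_space X"
proof -
 assume a: "agree X Y" and Y: "locally_ringed_space Y"
 have s: "sheaf_of_rings X" using sheaf.sheaf[OF agree_sheaf[OF a lrsD(1)[OF Y]]] .
 have "points X = points Y" using a by (simp add: agree_def)
 then show ?thesis unfolding locally_ringed_space_def using s agree_stalk[OF a] lrsD(2)[OF Y] by simp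
qed

context ideal_sh
begin

abbreviation "supp == ideal_support X I"
abbreviation "subT == subtopology (pts X) supp"
abbreviation "quot == %x. stalk X x Quot ideal_stalk X I x"
abbreviation "co == %x. (+>\<^bsub>stalk X x\<^esub>) (ideal_stalk X I x)"

lemma supp_pts: "x : supp ==> x : points X"
 by (simp add: ideal_support_def)

lemma supp_proper: "x : supp ==> ideal_stalk X I x ~= carrier (stalk X x)"
 by (simp add: ideal_support_def)

lemma topspace_sub: "topspace subT = supp"
 using supp_pts by auto

lemma sub_opn: "openin subT U <-> (EX N. opn X N & U = N Int supp)"
 by (auto simp: openin_subtopology)

lemma stq: assumes "x : supp" shows "cring (stalk X x)" "ideal (ideal_stalk X I x) (stalk X x)"
 using stalk_cring ideal_stalk_ideal supp_pts[OF assms] by auto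

lemma sub_open_pt: "openin subT U ==> x : U ==> x : supp"
 using openin_subset topspace_sub by blast

lemma coset_funI:
 "openin subT U ==> opn X N ==> U <= N ==> a el sec X N ==> (!!z. z : U ==> s z = co z (germ X z N a)) ==> coset_fun X I U s"
 unfolding coset_fun_def by (rule germ_funI) auto

lemma coset_funE:
 assumes "coset_fun X I U s"
 obtains N a where "openin subT U" "opn X N" "U <= N" "a el sec X N" "ALL z:U. s z = co z (germ X z N a)"
 using assms unfolding coset_fun_def germ_fun_def by blast

abbreviation "Z == subscheme X I"

lemma subscheme_agree: "agree Z (fun_space subT quot (coset_fun X I))"
proof -
 have pw: "(EX N. opn X N & x : N & N Int supp <= U & (EX a:carrier (sec X N). ALL z:N Int supp. s z = co z (germ X z N a)))
  <-> (EX N s'. coset_fun X I N s' & x : N & N <= U & (ALL w:N. s w = s' w))" (is "?l <-> ?r")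
  if h: "x : U" "s el pi_ring U quot" "U <= supp" for x U and s :: "'p => ('p set \<times> 'r) set set"
 proof
  assume ?l
  then obtain N a where N: "opn X N" "x : N" "N Int supp <= U" "a el sec X N" "ALL z:N Int supp. s z = co z (germ X z N a)" by blast
  have "coset_fun X I (N Int supp) s"
   by (rule coset_funI[of _ N a]) (use N sub_opn in auto)
  then show ?r using N h by (intro exI[of _ "N Int supp"] exI[of _ s]) auto
 next
  assume ?r
  then obtain N s' where N: "coset_fun X I N s'" "x : N" "N <= U" "ALL w:N. s w = s' w" by blast
  obtain M a where M: "openin subT N" "opn X M" "N <= M" "a el sec X M" "ALL z:N. s' z = co z (germ X z M a)"
   by (rule coset_funE[OF N(1)])
  obtain N' where N': "opn X N'" "N = N' Int supp" using M(1) sub_opn by blast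
  have o: "opn X (N' Int M)" using N' M by auto
  have "s z = co z (germ X z (N' Int M) (res X M (N' Int M) a))" if "z : N' Int M Int supp" for z
   using that N' N(4) M(5) germ_res[OF M(2) o _ _ M(4), of z] by auto
  moreover have "res X M (N' Int M) a el (sec X (N' Int M))" using res_closed[OF M(2) o _ M(4)] by simp
  moreover have "x : N' Int M" "N' Int M Int supp <= U" using N N' M by auto
  ultimately show ?l using o by blast
 qed
 have e: "(ALL x:U. EX N. opn X N & x : N & N Int supp <= U & (EX a:carrier (sec X N). ALL z:N Int supp. s z = co z (germ X z N a)))
  <-> (ALL x:U. EX N s'. coset_fun X I N s' & x : N & N <= U & (ALL w:N. s w = s' w))"
  if "s el pi_ring U quot" "U <= supp" for U and s :: "'p => ('p set \<times> 'r) set set" by (intro ball_cong refl pw that)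
 have "{s : carrier (pi_ring U quot). ALL x:U. EX N. opn X N & x : N & N Int supp <= U & (EX a:carrier (sec X N). ALL z:N Int supp. s z = co z (germ X z N a))}
  = {s : carrier (pi_ring U quot). ALL x:U. EX N s'. coset_fun X I N s' & x : N & N <= U & (ALL w:N. s w = s' w)}"
  if "openin subT U" for U
 proof (rule Collect_cong, rule conj_cong[OF refl], rule e)
  show "U <= supp" using sub_open_pt[OF that] by blast
 qed
 then show ?thesis
  unfolding agree_def subscheme_def fun_space_def Let_def by simp
qed

lemma subscheme_fun_data: "fun_data subT quot (coset_fun X I)"
 unfolding coset_fun_def
proof (rule germ_fun_data)
 fix z assume z: "z : topspace subT"
 then have zs: "z : supp" unfolding topspace_sub .
 show "z : points X" by (rule supp_pts[OF zs])
 show "cring (quot z)" by (rule Quot_cring[OF stq[OF zs]])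
 show "co z : ring_hom (stalk X z) (quot z)" by (rule Quot_hom[OF stq[OF zs]])
 show "EX a:carrier (stalk X z). r = co z a" if "r el quot z" for r using Quot_elt[OF stq[OF zs] that] by blast
 fix M a b assume M: "opn X M" "z : M" "a el sec X M" "b el sec X M" and e: "co z (germ X z M a) = co z (germ X z M b)"
 interpret MM: cring "sec X M" by (rule sec_cring[OF M(1)])
 have iff: "co w (germ X w M a) = co w (germ X w M b) <-> germ X w M (a -[sec X M] b) : ideal_stalk X I w" if w: "w : supp" "w : M" for w
 proof -
  interpret S: cring "stalk X w" by (rule stq(1)[OF w(1)])
  interpret G: ring_hom_ring "sec X M" "stalk X w" "germ X w M"
   using germ_hom[OF M(1) w(2)] MM.ring_axioms S.ring_axioms by (simp add: ring_hom_ringI2)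
  show ?thesis using Quot_eq_iff[OF stq[OF w(1)]] M(3,4) germ_closed[OF M(1) w(2)] by (simp add: MM.minus_eq S.minus_eq)
 qed
 obtain W where W: "opn X W" "z : W" "W <= M" "ALL y:W. germ X y M (a -[sec X M] b) : ideal_stalk X I y"
  by (rule germ_in_ideal_stalk_nbhd[OF M(1,2) MM.minus_closed[OF M(3,4)]]) (use e iff[OF zs M(2)] in blast)+
 then show "EX V. opn X V & z : V & (ALL w:topspace subT. w : V Int M --> co w (germ X w M a) = co w (germ X w M b))"
  using iff unfolding topspace_sub by blast
next
 show "openin subT {z : topspace subT. z : W}" if "opn X W" for W
  unfolding topspace_sub sub_opn using that by (intro exI[of _ W]) auto
qed

end

text \<open>The pullback of the ideal to \<open>Q\<close> vanishes: the ideal-theoretic form of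
  factoring through the closed subscheme, see \<open>factors_through_iff_kills\<close>.\<close>

definition kills :: "('p, 'r) ringed_space => ('p set => 'r set) => ('q, 's) ringed_space => ('q, 's, 'p, 'r) ringed_map => bool" where
 "kills X I Q u <-> (ALL V s. opn X V --> s : I V --> smap u V s = 0[sec Q (preim Q u V)])"

lemma (in ideal_sh) kills_iff:
 assumes Q: "sheaf Q" and u: "mor Q X u"
 shows "kills X I Q u <-> (ALL q:points Q. ALL ga:ideal_stalk X I (pmap u q). stalk_map Q X u q ga = 0[stalk Q q])"
proof
 interpret Q: sheaf Q by fact
 interpret u: mor Q X u by fact
 show "ALL q:points Q. ALL ga:ideal_stalk X I (pmap u q). stalk_map Q X u q ga = 0[stalk Q q]" if k: "kills X I Q u"
 proof (intro ballI)
  fix q ga assume q: "q : points Q" and g: "ga : ideal_stalk X I (pmap u q)"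
  obtain V s where V: "opn X V" "pmap u q : V" "s : I V" "ga = germ X (pmap u q) V s" by (rule ideal_stalkE[OF g])
  have "stalk_map Q X u q ga = germ Q q (preim Q u V) (smap u V s)"
   using u.stalk_map_germ[OF q V(1,2) I_carr[OF V(1,3)]] V(4) by simp
  also have "... = germ Q q (preim Q u V) 0[sec Q (preim Q u V)]" using k V(1,3) unfolding kills_def by simp
  also have "... = 0[stalk Q q]" by (rule Q.germ_zero[OF u.preim_open[OF V(1)]]) (use q V in simp)
  finally show "stalk_map Q X u q ga = 0[stalk Q q]" .
 qed
 show "kills X I Q u" if h: "ALL q:points Q. ALL ga:ideal_stalk X I (pmap u q). stalk_map Q X u q ga = 0[stalk Q q]"
  unfolding kills_def
 proof (intro allI impI)
  fix V s assume V: "opn X V" "s : I V"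
  note o = u.preim_open[OF V(1)] and sc = I_carr[OF V]
  interpret C: cring "sec Q (preim Q u V)" by (rule Q.sec_cring[OF o])
  show "smap u V s = 0[sec Q (preim Q u V)]"
  proof (rule Q.sec_eqI[OF o u.smap_closed[OF V(1) sc] C.zero_closed])
   fix q assume q: "q : preim Q u V"
   then have qp: "q : points Q" "pmap u q : V" by auto
   show "germ Q q (preim Q u V) (smap u V s) = germ Q q (preim Q u V) 0[sec Q (preim Q u V)]"
    using h qp ideal_stalkI[OF V(1) qp(2) V(2)] u.stalk_map_germ[OF qp(1) V(1) qp(2) sc] Q.germ_zero[OF o q] by simp
  qed
 qed
qed

lemma genideal_zero_on:
 assumes R: "cring R" and E: "cring E" and h: "h : ring_hom R E" and S: "S <= carrier R"
  and z: "!!s. s : S ==> h s = 0[E]" and x: "x : genideal R S"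
 shows "h x = 0[E]"
proof -
 interpret R: cring R by fact
 interpret E: cring E by fact
 have "ideal {r : carrier R. h r : {0[E]}} R" by (rule cring_vimage_ideal[OF h R E E.zeroideal])
 moreover have "S <= {r : carrier R. h r : {0[E]}}" using S z by auto
 ultimately have "genideal R S <= {r : carrier R. h r : {0[E]}}" by (rule R.genideal_minimal)
 then show ?thesis using x by blast
qed

text \<open>Over an affine open set the stalks of a quasi-coherent ideal are generated by its
  sections there, so these sections are a sufficient test when the image lies in
  \<open>V\<close>.\<close>

lemma kills_affineI:
 assumes X: "locally_ringed_space X" and I: "quasi_coherent_ideal X I" and V: "affine_open X V"
  and Q: "sheaf Q" and u: "mor Q X u" and uV: "!!q. q : points Q ==> pmap u q : V"
  and z: "!!s. s : I V ==> smap u V s = 0[sec Q (points Q)]"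
 shows "kills X I Q u"
proof -
 interpret C: chart X V "sec X V" "%s. s" by (rule affine_chart[OF X V])
 interpret ideal_sh X I by (rule qc_ideal_sh[OF C.presheaf_axioms I])
 interpret Q: sheaf Q by fact
 interpret u: mor Q X u by fact
 have pu: "preim Q u V = points Q" using uV by (auto simp: preim_def)
 show ?thesis
  unfolding kills_iff[OF Q u]
 proof (intro ballI)
  fix q ga assume q: "q : points Q" and g: "ga : ideal_stalk X I (pmap u q)"
  note xV = uV[OF q]
  show "stalk_map Q X u q ga = 0[stalk Q q]"
  proof (rule genideal_zero_on[OF C.st_cring[OF xV] Q.stalk_cring[OF q] u.stalk_map_hom[OF q]])
   show "ga : genideal (stalk X (pmap u q)) (germ X (pmap u q) V ` I V)"
    using g qc_stalk_generated[OF X I V xV] by simp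
   show "germ X (pmap u q) V ` I V <= carrier (stalk X (pmap u q))"
    using C.gi_closed[OF xV] I_carr[OF C.V_open] by blast
   fix de assume "de : germ X (pmap u q) V ` I V"
   then obtain s where s: "s : I V" "de = germ X (pmap u q) V s" by blast
   show "stalk_map Q X u q de = 0[stalk Q q]"
    using u.stalk_map_germ[OF q C.V_open xV I_carr[OF C.V_open s(1)]] s z[OF s(1)] pu Q.germ_zero[of "points Q" q] q by simp
  qed
 qed
qed

locale closed_sub = ideal_sh X I for X :: "('p, 'r) ringed_space" and I +
 assumes X_lrs: "locally_ringed_space X"
begin

sublocale sheaf X by (rule lrsD(1)[OF X_lrs])

sublocale D: fun_data subT quot "coset_fun X I" by (rule subscheme_fun_data)

abbreviation "incl == inclusion X I"

lemma Z_agree: "agree Z D.F"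
 by (rule subscheme_agree)

lemma Z_points: "points Z = supp"
 using Z_agree topspace_sub by (simp add: agree_def)

lemma Z_opn: "opn Z U <-> openin subT U"
 using Z_agree by (simp add: agree_def)

lemma Z_sec: "openin subT U ==> sec Z U = sec D.F U"
 using Z_agree by (simp add: agree_def)

lemma Z_res: "res Z = res D.F"
 using Z_agree by (simp add: agree_def)

lemma Z_germ: "germ Z x U s = germ D.F x U s"
 by (rule agree_germ[OF Z_agree])

lemma Z_stalk: "stalk Z x = stalk D.F x"
 by (rule agree_stalk[OF Z_agree])

lemma Z_lrs: "locally_ringed_space Z"
proof (rule agree_lrs[OF Z_agree], rule D.F_lrs)
 fix z assume "z : topspace subT"
 then have z: "z : supp" unfolding topspace_sub .
 show "local_ring (quot z)"
  by (rule Quot_local[OF stq[OF z] lrsD(2)[OF X_lrs supp_pts[OF z]] supp_proper[OF z]])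
qed

sublocale Z: sheaf Z by (rule lrsD(1)[OF Z_lrs])

lemma co_hom: "z : supp ==> co z : ring_hom (stalk X z) (quot z)"
 by (rule Quot_hom[OF stq])

lemma incl_smap: "smap incl V s = (\<lambda>x\<in>V Int supp. co x (germ X x V s))"
 by (simp add: inclusion_def)

lemma incl_pmap [simp]: "pmap incl x = x"
 by (simp add: inclusion_def)

lemma preim_incl: "preim Z incl V = V Int supp"
 by (auto simp: preim_def Z_points)

lemma V_supp_open: "opn X V ==> openin subT (V Int supp)"
 using sub_opn by blast

lemma incl_sec: "opn X V ==> s el sec X V ==> smap incl V s el (sec D.F (V Int supp))"
proof -
 assume V: "opn X V" and s: "s el sec X V"
 have "coset_fun X I (V Int supp) (%x. co x (germ X x V s))"
  by (rule coset_funI[OF V_supp_open[OF V] V _ s]) auto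
 from D.F_basic[OF this] show ?thesis unfolding incl_smap .
qed

lemma incl_mor: "mor Z X incl"
proof unfold_locales
 have ptsZ: "pts Z = subT" using Z_agree by (simp add: agree_def)
 show "continuous_map (pts Z) (pts X) (pmap incl)"
  unfolding ptsZ by (simp add: inclusion_def continuous_map_from_subtopology flip: id_def)
 show "smap incl V : ring_hom (sec X V) (sec Z (preim Z incl V))" if V: "opn X V" for V
  unfolding preim_incl Z_sec[OF V_supp_open[OF V]]
 proof (rule D.F_hom[OF V_supp_open[OF V] sec_cring[OF V] incl_sec[OF V]], assumption)
  fix z assume z: "z : V Int supp"
  then have "(%s. co z (germ X z V s)) : ring_hom (sec X V) (quot z)" by (intro hom_comp[OF germ_hom[OF V] co_hom]) auto
  then show "(%s. smap incl V s z) : ring_hom (sec X V) (quot z)" unfolding incl_smap using z by simp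
 qed
 show "smap incl V (res X U V s) = res Z (preim Z incl U) (preim Z incl V) (smap incl U s)"
  if "opn X U" "opn X V" "V <= U" "s el sec X U" for U V s
  unfolding preim_incl Z_res incl_smap D.F_res using that germ_res[OF that(1,2) _ that(3,4)]
  by (auto simp: restrict_def fun_eq_iff)
 show "reflects_units Z X incl"
  unfolding reflects_units_def preim_incl
 proof (intro ballI allI impI)
  fix x V s assume x: "x : points Z" and V: "opn X V" "pmap incl x : V" "s el sec X V"
   and u: "germ Z x (V Int supp) (smap incl V s) : Units (stalk Z x)"
  have xs: "x : V Int supp" using x V Z_points by simp
  then have xx: "x : supp" "x : V" by auto
  have "smap incl V s x : Units (quot x)"
   using D.F_germ_unit_iff[OF V_supp_open[OF V(1)] xs incl_sec[OF V(1,3)]] u unfolding Z_germ Z_stalk by simp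
  then have "co x (germ X x V s) : Units (quot x)" using xs by (simp add: incl_smap)
  then show "germ X (pmap incl x) V s : Units (stalk X (pmap incl x))"
   using Quot_unit_iff[OF stq[OF xx(1)] lrsD(2)[OF X_lrs supp_pts[OF xx(1)]] supp_proper[OF xx(1)] germ_closed[OF V(1) xx(2) V(3)]] by simp
 qed
qed

sublocale incl: mor Z X incl by (rule incl_mor)

lemma Z_zero: "openin subT U ==> 0[sec Z U] = (\<lambda>i\<in>U. 0[quot i])"
 using Z_sec D.F_ops(4) by simp

lemma incl_kills: "kills X I Z incl"
 unfolding kills_def
proof (intro allI impI)
 fix V s assume V: "opn X V" "s : I V"
 show "smap incl V s = 0[sec Z (preim Z incl V)]"
  unfolding preim_incl Z_zero[OF V_supp_open[OF V(1)]] incl_smap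
 proof (rule restrict_ext)
  fix x assume x: "x : V Int supp"
  then show "co x (germ X x V s) = 0[quot x]"
   using Quot_zero_iff[OF stq[of x] germ_closed[OF V(1) _ I_carr[OF V]]] ideal_stalkI[OF V(1) _ V(2)] by simp
 qed
qed

lemma incl_stalk_surj:
 assumes z: "z : supp" and d: "de el stalk Z z"
 obtains ga where "ga el stalk X z" "de = stalk_map Z X incl z ga"
proof -
 have zp: "z : points Z" using z Z_points by simp
 obtain U s where U: "opn Z U" "z : U" "s el sec Z U" "de = germ Z z U s" by (rule Z.stalkE[OF d])
 have oU: "openin subT U" using U(1) Z_opn by simp
 have s: "s el sec D.F U" using U(3) Z_sec[OF oU] by simp
 have "s z el quot z" by (rule D.F_val[OF s U(2)])
 then obtain ga where g: "ga el stalk X z" "s z = co z ga" using Quot_elt[OF stq[OF z]] by blast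
 obtain V a where V: "opn X V" "z : V" "a el sec X V" "ga = germ X z V a" by (rule stalkE[OF g(1)])
 have "germ D.F z U s = germ D.F z (V Int supp) (smap incl V a)"
  using D.F_germ_eq_iff[OF oU s V_supp_open[OF V(1)] incl_sec[OF V(1,3)] U(2)] V z g by (simp add: incl_smap)
 then have "de = stalk_map Z X incl z ga"
  using incl.stalk_map_germ[OF zp V(1) _ V(3)] V U(4) by (simp add: preim_incl Z_germ)
 then show ?thesis using that g(1) by blast
qed

text \<open>The stalk maps of the inclusion are surjective, so the stalk maps of a morphism to
  \<open>Z\<close> can be read off after composing with it.\<close>

lemma incl_mono:
 assumes Q: "sheaf Q" and w: "mor Q Z w" "mor Q Z w'" and e: "mor_eq Q X (comp_mor Z w incl) (comp_mor Z w' incl)"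
 shows "mor_eq Q Z w w'"
proof -
 interpret Q: sheaf Q by fact
 interpret w: mor Q Z w by (rule w(1))
 interpret w': mor Q Z w' by (rule w(2))
 have p: "pmap w q = pmap w' q" if "q : points Q" for q using mor_eq_pmap[OF e that] by simp
 show ?thesis
 proof (rule mor_eqI[OF Q w p])
  fix q V s assume q: "q : points Q" and V: "opn Z V" "pmap w q : V" "s el sec Z V"
  let ?z = "pmap w q"
  have z: "?z : supp" using w.pmap_in[OF q] Z_points by simp
  have pz: "pmap w' q = ?z" using p[OF q] by simp
  obtain ga where g: "ga el stalk X ?z" "germ Z ?z V s = stalk_map Z X incl ?z ga"
   by (rule incl_stalk_surj[OF z Z.germ_closed[OF V]])
  have c: "mor Q X (comp_mor Z w incl)" by (rule mor_comp[OF w(1) incl_mor])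
  have "stalk_map Q Z w q (germ Z ?z V s) = stalk_map Q X (comp_mor Z w incl) q ga"
   using stalk_map_comp[OF w(1) incl_mor q, of ga] g by simp
  also have "... = stalk_map Q X (comp_mor Z w' incl) q ga"
   using stalk_map_cong[OF c e q, of ga] g(1) by simp
  also have "... = stalk_map Q Z w' q (germ Z ?z V s)"
   using stalk_map_comp[OF w(2) incl_mor q, of ga] g pz by simp
  finally show "germ Q q (preim Q w V) (smap w V s) = germ Q q (preim Q w' V) (smap w' V s)"
   using w.stalk_map_germ[OF q V] w'.stalk_map_germ[OF q V(1) _ V(3)] V(2) pz by simp
 qed
qed

text \<open>The stalk maps of \<open>u\<close> kill the stalks of the ideal and pass to the
  quotients. They assemble to a morphism because a section of \<open>Z\<close> is locally the coset
  of a section of \<open>X\<close>, whose pullback along \<open>u\<close> is available.\<close>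

lemma factor:
 fixes Q :: "('q, 's) ringed_space"
 assumes Q: "locally_ringed_space Q" and u: "mor Q X u" and k: "kills X I Q u"
 obtains h where "mor Q Z h" "mor_eq Q X u (comp_mor Z h incl)"
proof -
 interpret Q: sheaf Q by (rule lrsD(1)[OF Q])
 interpret u: mor Q X u by (rule u)
 have k0: "stalk_map Q X u q ga = 0[stalk Q q]" if "q : points Q" "ga : ideal_stalk X I (pmap u q)" for q ga
  using k that unfolding kills_iff[OF Q.sheaf_axioms u] by blast
 \<comment> \<open>Outside the support the ideal contains 1, which would have to vanish in the stalk
   of \<open>Q\<close>, a local ring.\<close>
 have us: "pmap u q : supp" if q: "q : points Q" for q
 proof (rule ccontr)
  assume "pmap u q ~: supp"
  then have e: "ideal_stalk X I (pmap u q) = carrier (stalk X (pmap u q))" using u.pmap_in[OF q] by (simp add: ideal_support_def)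
  interpret S: cring "stalk X (pmap u q)" by (rule stalk_cring[OF u.pmap_in[OF q]])
  have "1[stalk Q q] = 0[stalk Q q]" using k0[OF q, of "1[stalk X (pmap u q)]"] e ring_hom_one[OF u.stalk_map_hom[OF q]] by simp
  then show False using local_ringD(2)[OF lrsD(2)[OF Q q]] by simp
 qed
 have "EX g. g : ring_hom (quot (pmap u q)) (stalk Q q) & (ALL a:carrier (stalk X (pmap u q)). g (co (pmap u q) a) = stalk_map Q X u q a)"
  if q: "q : points Q" for q
 proof -
  obtain g where "g : ring_hom (quot (pmap u q)) (stalk Q q)" "!!a. a el stalk X (pmap u q) ==> g (co (pmap u q) a) = stalk_map Q X u q a"
   using Quot_univ[OF stq[OF us[OF q]] Q.stalk_cring[OF q] u.stalk_map_hom[OF q] k0[OF q]] by blast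
  then show ?thesis by blast
 qed
 then obtain g where g: "!!q. q : points Q ==> g q : ring_hom (quot (pmap u q)) (stalk Q q)"
  and gco: "!!q a. q : points Q ==> a el stalk X (pmap u q) ==> g q (co (pmap u q) a) = stalk_map Q X u q a"
  by metis
 have ptsZ: "pts Z = subT" using Z_agree by (simp add: agree_def)
 have cont: "continuous_map (pts Q) (pts Z) (pmap u)"
  unfolding ptsZ using u.cont us by (auto simp: continuous_map_in_subtopology)
 have sD: "s el sec D.F V" "openin subT V" if "opn Z V" "s el sec Z V" for V s
  using that Z_sec[of V] Z_opn by auto
 obtain h where h: "mor Q Z h" "pmap h = pmap u"
  and hg: "!!q V s. q : points Q ==> opn Z V ==> pmap u q : V ==> s el sec Z V ==>
   germ Q q (preim Q h V) (smap h V s) = g q (s (pmap u q))"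
 proof (rule morphism_from_germs[OF Q.sheaf_axioms Z.presheaf_axioms cont, of "%q V s. g q (s (pmap u q))"])
  fix q V assume q: "q : points Q" and V: "opn Z V" "pmap u q : V"
  have oV: "openin subT V" using V(1) Z_opn by simp
  let ?z = "pmap u q"
  show "(%s. g q (s ?z)) : ring_hom (sec Z V) (stalk Q q)"
   unfolding Z_sec[OF oV] by (rule hom_comp[OF D.F_eval_hom[OF oV V(2)] g[OF q]])
  fix s assume s: "s el sec Z V"
  note sc = sD(1)[OF V(1) s]
  obtain ga where gm: "ga el stalk X ?z" "s ?z = co ?z ga"
   using Quot_elt[OF stq[OF us[OF q]] D.F_val[OF sc V(2)]] by blast
  show "germ Z ?z V s : Units (stalk Z ?z)" if un: "g q (s ?z) : Units (stalk Q q)"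
  proof -
   have "ga : Units (stalk X ?z)" using un gco[OF q gm(1)] gm u.stalk_map_unit_iff[OF q gm(1)] by simp
   then have "s ?z : Units (quot ?z)" using ring_hom_Units[OF co_hom[OF us[OF q]]] gm(2) by simp
   then show ?thesis unfolding Z_germ Z_stalk using D.F_germ_unit_iff[OF oV V(2) sc] by simp
  qed
  obtain N s' where N: "coset_fun X I N s'" "?z : N" "N <= V" "ALL w:N. s w = s' w" using D.F_loc[OF sc V(2)] by metis
  obtain M a where M: "openin subT N" "opn X M" "N <= M" "a el sec X M" "ALL z:N. s' z = co z (germ X z M a)"
   by (rule coset_funE[OF N(1)])
  obtain N' where N': "opn X N'" "N = N' Int supp" using M(1) sub_opn by blast
  have oM: "opn X (N' Int M)" using N' M by auto
  define P where "P = preim Q u (N' Int M)"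
  have P: "opn Q P" unfolding P_def by (rule u.preim_open[OF oM])
  have Pq: "y : points Q" "pmap u y : N" "pmap u y : N' Int M" if "y : P" for y using that us N' by (auto simp: P_def)
  have rc: "res X M (N' Int M) a el (sec X (N' Int M))" by (rule res_closed[OF M(2) oM _ M(4)]) simp
  have "germ Q y P (smap u (N' Int M) (res X M (N' Int M) a)) = g y (s (pmap u y))" if y: "y : P" for y
  proof -
   note yy = Pq[OF y]
   have gc: "germ X (pmap u y) M a el stalk X (pmap u y)" using germ_closed[OF M(2) _ M(4)] yy(3) by simp
   have "germ Q y P (smap u (N' Int M) (res X M (N' Int M) a)) = stalk_map Q X u y (germ X (pmap u y) M a)"
    using u.stalk_map_germ[OF yy(1) oM yy(3) rc] germ_res[OF M(2) oM yy(3) _ M(4)] by (simp add: P_def)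
   also have "... = g y (co (pmap u y) (germ X (pmap u y) M a))" using gco[OF yy(1) gc] by simp
   also have "... = g y (s (pmap u y))" using N(4) M(5) yy(2) by simp
   finally show ?thesis .
  qed
  moreover have "q : P" "ALL y:P. pmap u y : V" using q N M N' Pq by (auto simp: P_def)
  moreover have "smap u (N' Int M) (res X M (N' Int M) a) el sec Q P" unfolding P_def by (rule u.smap_closed[OF oM rc])
  ultimately show "EX N t. opn Q N & q : N & (ALL y:N. pmap u y : V) & t el sec Q N & (ALL y:N. germ Q y N t = g y (s (pmap u y)))"
   using P by blast
 next
  fix q U V s assume "q : points Q" "opn Z U" "opn Z V" "pmap u q : V" "V <= U" "s el sec Z U"
  then show "g q (res Z U V s (pmap u q)) = g q (s (pmap u q))" unfolding Z_res D.F_res by simp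
 qed blast
 have c: "mor Q X (comp_mor Z h incl)" by (rule mor_comp[OF h(1) incl_mor])
 have "mor_eq Q X u (comp_mor Z h incl)"
 proof (rule mor_eqI[OF Q.sheaf_axioms u c])
  show "pmap u q = pmap (comp_mor Z h incl) q" for q using h(2) by simp
  fix q V s assume q: "q : points Q" and V: "opn X V" "pmap u q : V" "s el sec X V"
  have o: "opn Z (V Int supp)" using V_supp_open[OF V(1)] Z_opn by simp
  have sc: "smap incl V s el (sec Z (V Int supp))" using incl_sec[OF V(1,3)] Z_sec[OF V_supp_open[OF V(1)]] by simp
  have "germ Q q (preim Q h (V Int supp)) (smap h (V Int supp) (smap incl V s)) = g q (smap incl V s (pmap u q))"
   by (rule hg[OF q o _ sc]) (use V us q in simp)
  also have "... = g q (co (pmap u q) (germ X (pmap u q) V s))" using V us[OF q] by (simp add: incl_smap)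
  also have "... = germ Q q (preim Q u V) (smap u V s)"
   using gco[OF q germ_closed[OF V]] u.stalk_map_germ[OF q V] by simp
  finally show "germ Q q (preim Q u V) (smap u V s) = germ Q q (preim Q (comp_mor Z h incl) V) (smap (comp_mor Z h incl) V s)"
   by (simp add: preim_comp[OF mor.axioms(1)[OF h(1)]] preim_incl)
 qed
 then show ?thesis using that[OF h(1)] by blast
qed

lemma factors_kills:
 assumes Q: "sheaf Q" and h: "mor Q Z h"
 shows "kills X I Q (comp_mor Z h incl)"
 unfolding kills_def
proof (intro allI impI)
 interpret Q: sheaf Q by fact
 interpret h: mor Q Z h by (rule h)
 fix V s assume V: "opn X V" "s : I V"
 have o: "opn Z (V Int supp)" using V_supp_open[OF V(1)] Z_opn by simp
 have "smap incl V s = 0[sec Z (V Int supp)]" using incl_kills V unfolding kills_def preim_incl by blast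
 then show "smap (comp_mor Z h incl) V s = 0[sec Q (preim Q (comp_mor Z h incl) V)]"
  using ring_hom_zero[OF h.smap_hom[OF o] Z.sec_ring[OF o] Q.sec_ring[OF h.preim_open[OF o]]]
  by (simp add: preim_comp[OF mor.axioms(1)[OF h]] preim_incl)
qed

end

lemma kills_cong:
 assumes "mor_eq Q X u v" "presheaf X" "ideal_sheaf X I" "kills X I Q v"
 shows "kills X I Q u"
proof -
 interpret ideal_sh X I using assms by (simp add: ideal_sh_def ideal_sh_axioms_def)
 show ?thesis using assms(4) mor_eq_smap[OF assms(1)] mor_eq_preim[OF assms(1)] I_carr unfolding kills_def by simp
qed

lemma closed_subI: "locally_ringed_space X ==> quasi_coherent_ideal X I ==> closed_sub X I"
 using qc_ideal_sh[OF lrsD(3)] by (simp add: closed_sub_def closed_sub_axioms_def)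

lemma factors_through_iff_kills:
 assumes X: "locally_ringed_space X" and I: "quasi_coherent_ideal X I" and T: "locally_ringed_space T" and g: "mor T X g"
 shows "factors_through T X I g <-> kills X I T g"
proof -
 interpret closed_sub X I by (rule closed_subI[OF X I])
 show ?thesis
 proof
  assume "factors_through T X I g"
  then obtain h where h: "morphism T Z h" "mor_eq T X g (comp_mor Z h incl)" unfolding factors_through_def by blast
  show "kills X I T g"
   by (rule kills_cong[OF h(2) presheaf_axioms ideal_sheaf factors_kills[OF lrsD(1)[OF T] lrs_mor[OF T Z_lrs h(1)]]])
 next
  assume "kills X I T g"
  then obtain h where "mor T Z h" "mor_eq T X g (comp_mor Z h incl)" using factor[OF T g] by blast
  then show "factors_through T X I g" unfolding factors_through_def using mor_morphism by blast
 qed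
qed

text \<open>For affine \<open>V\<close>, the canonical morphism from the spectrum of the sections
  over \<open>V Int supp\<close> to \<open>X\<close> kills the ideal and so factors through
  \<open>Z\<close>. The factor is the left inverse demanded by \<open>affine_openI\<close>; equality
  of morphisms to \<open>Z\<close> is tested in \<open>X\<close> by
  \<open>incl_mono\<close>.\<close>

lemma scheme_subscheme:
 assumes X: "scheme X" and I: "quasi_coherent_ideal X I"
 shows "scheme (subscheme X I)"
proof -
 note Xl = scheme_lrs[OF X]
 interpret closed_sub X I by (rule closed_subI[OF Xl I])
 have "EX U. x : U & affine_open Z U" if x: "x : points Z" for x
 proof -
  have xs: "x : supp" using x Z_points by simp
  then obtain V where V: "x : V" "affine_open X V" using X supp_pts[OF xs] unfolding scheme_def by blast
  interpret C: chart X V "sec X V" "%s. s" by (rule affine_chart[OF Xl V(2)])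
  let ?U = "V Int supp"
  have oU: "opn Z ?U" using V_supp_open[OF C.V_open] Z_opn by simp
  let ?G = "sec Z ?U" let ?Y = "Spec ?G" let ?p = "points ?Y"
  interpret G: cring ?G by (rule Z.sec_cring[OF oU])
  interpret S: chart ?Y ?p ?G "Spec_elt ?G" by (rule Spec_chart[OF G.cring_axioms])
  have ih: "smap incl V : ring_hom (sec X V) ?G" using incl.smap_hom[OF C.V_open] by (simp add: preim_incl)
  then have "(%s. Spec_elt ?G (smap incl V s)) : ring_hom (sec X V) (sec ?Y ?p)"
   by (rule hom_comp[OF _ S.iota_hom])
  then obtain l where l: "mor ?Y X l" "!!q. q : ?p ==> pmap l q : V"
   "!!s. s el sec X V ==> smap l V s = Spec_elt ?G (smap incl V s)"
   by (rule C.morphism_to_chart[OF S.lrs]) blast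
  have pl: "preim ?Y l V = ?p" using l(2) by (auto simp: preim_def)
  have "kills X I ?Y l"
  proof (rule kills_affineI[OF Xl I V(2) S.sheaf_axioms l(1,2)])
   fix s assume s: "s : I V"
   have "smap incl V s = 0[?G]" using incl_kills C.V_open s unfolding kills_def preim_incl by blast
   then show "smap l V s = 0[sec ?Y ?p]"
    using l(3)[OF I_carr[OF C.V_open s]] ring_hom_zero[OF S.iota_hom G.ring_axioms S.sec_ring[OF S.V_open]] by simp
  qed
  then obtain l' where l': "mor ?Y Z l'" "mor_eq ?Y X l (comp_mor Z l' incl)" by (rule factor[OF S.lrs l(1)])
  interpret l': mor ?Y Z l' by (rule l'(1))
  have l'U: "pmap l' q : ?U" if q: "q : ?p" for q
   using mor_eq_pmap[OF l'(2) q] l(2)[OF q] l'.pmap_in[OF q] Z_points by simp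
  have "affine_open Z ?U"
  proof (rule affine_openI[OF Z_lrs oU l'(1) l'U])
   let ?R = "restrict_space Z ?U"
   fix k assume k: "mor ?R ?Y k" "!!a. a el ?G ==> smap k ?p (Spec_elt ?G a) = a"
   interpret k: mor ?R ?Y k by (rule k(1))
   have R: "sheaf ?R" by (rule sheaf_restrict[OF Z.sheaf_axioms oU])
   have Rp: "points ?R = ?U" by (rule restrict_points[OF oU])
   have kl: "mor ?R Z (comp_mor ?Y k l')" by (rule mor_comp[OF k(1) l'(1)])
   have oi: "mor ?R Z (open_incl Z ?U)" by (rule mor_open_incl[OF Z.presheaf_axioms oU])
   show "mor_eq ?R Z (comp_mor ?Y k l') (open_incl Z ?U)"
   proof (rule incl_mono[OF R kl oi])
    have "mor_eq ?R X (comp_mor Z (comp_mor ?Y k l') incl) (comp_mor ?Y k (comp_mor Z l' incl))"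
     by (rule comp_assoc[OF l'(1)])
    moreover have "mor_eq ?R X (comp_mor ?Y k (comp_mor Z l' incl)) (comp_mor ?Y k l)"
     by (rule mor_eq_comp_right[OF mor_eq_sym[OF l'(2)] k(1) mor_comp[OF l'(1) incl_mor]])
    moreover have "mor_eq ?R X (comp_mor ?Y k l) (comp_mor Z (open_incl Z ?U) incl)"
    proof (rule C.morphisms_to_chart_eq[OF R mor_comp[OF k(1) l(1)] mor_comp[OF oi incl_mor]])
     fix q assume q: "q : points ?R"
     show "pmap (comp_mor ?Y k l) q : V" using l(2)[OF k.pmap_in[OF q]] by simp
     show "pmap (comp_mor Z (open_incl Z ?U) incl) q : V" using q Rp by simp
    next
     fix s assume s: "s el sec X V"
     have sc: "smap incl V s el ?G" by (rule hom_car[OF ih s])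
     show "smap (comp_mor ?Y k l) V s = smap (comp_mor Z (open_incl Z ?U) incl) V s"
      using l(3)[OF s] k(2)[OF sc] Z.res_id[OF oU sc] by (simp add: pl preim_incl)
    qed
    ultimately show "mor_eq ?R X (comp_mor Z (comp_mor ?Y k l') incl) (comp_mor Z (open_incl Z ?U) incl)"
     using mor_trans by blast
   qed
  qed
  then show ?thesis using V xs by blast
 qed
 then show ?thesis unfolding scheme_def using Z_lrs by blast
qed

section \<open>Fibre products\<close>

subsection \<open>Tensor products of rings\<close>

context cring
begin

text \<open>The guard makes the step function commute with itself on all values of the type, also
  outside the carrier, as folding over a multiset demands.\<close>

definition msum :: "'a multiset => 'a" where
 "msum M = fold_mset (%x s. if x el R & s el R then x \<oplus> s else s) \<zero> M"

lemma msum_empty [simp]: "msum {#} = \<zero>"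
 by (simp add: msum_def)

lemma msum_add: "x el R ==> set_mset M <= carrier R ==> msum (add_mset x M) = x \<oplus> msum M"
 and msum_closed: "set_mset M <= carrier R ==> msum M el R"
proof -
 interpret comp_fun_commute "%x s. if x el R & s el R then x \<oplus> s else s"
  by unfold_locales (auto simp: fun_eq_iff a_lcomm)
 have e: "msum (add_mset x M) = (if x el R & msum M el R then x \<oplus> msum M else msum M)" for x M
  by (simp add: msum_def)
 show c: "set_mset M <= carrier R ==> msum M el R" for M
  by (induction M) (simp_all add: e)
 show "x el R ==> set_mset M <= carrier R ==> msum (add_mset x M) = x \<oplus> msum M"
  using e c by simp
qed

lemma msum_plus: "set_mset M <= carrier R ==> set_mset N <= carrier R ==> msum (M + N) = msum M \<oplus> msum N"
 by (induction M) (simp_all add: msum_add msum_closed a_assoc)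

end

text \<open>The congruence on formal sums of pure tensors whose classes form the tensor product.
  Formal sums are multisets and cannot be cancelled, hence the two rules for zero. The pairs in
  \<open>Rl\<close> are the elements to be identified; no base ring is fixed, because in the
  application they come from sections of \<open>Y\<close> over varying open sets.\<close>

inductive teq :: "('b, 'x) ring_scheme => ('c, 'y) ring_scheme => ('b \<times> 'c) set => ('b \<times> 'c) multiset => ('b \<times> 'c) multiset => bool"
 for B C Rl where
 teq_refl: "set_mset M <= carrier B \<times> carrier C ==> teq B C Rl M M"
| teq_sym: "teq B C Rl M N ==> teq B C Rl N M"
| teq_trans: "teq B C Rl M N ==> teq B C Rl N K ==> teq B C Rl M K"
| teq_plus: "teq B C Rl M N ==> teq B C Rl M' N' ==> teq B C Rl (M + M') (N + N')"
| teq_left: "b el B ==> b' el B ==> c el C ==> teq B C Rl {#(b +[B] b', c)#} {#(b, c), (b', c)#}"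
| teq_right: "b el B ==> c el C ==> c' el C ==> teq B C Rl {#(b, c +[C] c')#} {#(b, c), (b, c')#}"
| teq_left_zero: "c el C ==> teq B C Rl {#(0[B], c)#} {#}"
| teq_right_zero: "b el B ==> teq B C Rl {#(b, 0[C])#} {#}"
| teq_balance: "b el B ==> c el C ==> (r, r') : Rl ==> teq B C Rl {#(b *[B] r, c)#} {#(b, r' *[C] c)#}"

definition tmul :: "('b, 'x) ring_scheme => ('c, 'y) ring_scheme => ('b \<times> 'c) multiset => ('b \<times> 'c) multiset => ('b \<times> 'c) multiset" where
 "tmul B C M N = sum_mset (image_mset (%(b, c). image_mset (%(b', c'). (b *[B] b', c *[C] c')) N) M)"

definition tcl :: "('b, 'x) ring_scheme => ('c, 'y) ring_scheme => ('b \<times> 'c) set => ('b \<times> 'c) multiset => ('b \<times> 'c) multiset set" where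
 "tcl B C Rl M = {N. teq B C Rl M N}"

definition tens :: "('b, 'x) ring_scheme => ('c, 'y) ring_scheme => ('b \<times> 'c) set => ('b \<times> 'c) multiset set ring" where
 "tens B C Rl =
  (|carrier = {tcl B C Rl M | M. set_mset M <= carrier B \<times> carrier C},
   mult = (%x y. {K. EX M:x. EX N:y. teq B C Rl (tmul B C M N) K}),
   one = tcl B C Rl {#(1[B], 1[C])#},
   zero = tcl B C Rl {#},
   add = (%x y. {K. EX M:x. EX N:y. teq B C Rl (M + N) K})|)"

locale tens_ring = B: cring B + C: cring C for B (structure) and C (structure) +
 fixes Rl
 assumes Rl: "Rl <= carrier B \<times> carrier C"
begin

abbreviation "BC == carrier B \<times> carrier C"
abbreviation "mm == tmul B C"
abbreviation "cl == tcl B C Rl"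
abbreviation "D == tens B C Rl"
abbreviation te (infix "=t=" 50) where "M =t= N == teq B C Rl M N"

lemma mm_simps [simp]:
 "mm {#} N = {#}" "mm (add_mset (b, c) M) N = image_mset (%(b', c'). (b *[B] b', c *[C] c')) N + mm M N"
 "mm (M + M') N = mm M N + mm M' N"
 by (simp_all add: tmul_def)

lemma mm_empty_right [simp]: "mm M {#} = {#}"
 by (induction M) auto

lemma mm_add_right: "mm M (N + N') = mm M N + mm M N'"
 by (induction M) auto

lemma mm_carr: "set_mset M <= BC ==> set_mset N <= BC ==> set_mset (mm M N) <= BC"
proof (induction M)
 case (add x M)
 then show ?case by (cases x) (auto dest: subsetD[OF add.prems(2)] subsetD[OF add.IH])
qed simp

lemma mm_comm: "set_mset M <= BC ==> set_mset N <= BC ==> mm M N = mm N M"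
proof (induction M)
 case (add x M)
 obtain b c where x: "x = (b, c)" "b el B" "c el C" using add.prems(1) by (cases x) auto
 have "set_mset N <= BC ==> mm N {#(b, c)#} = image_mset (%(b', c'). (b *[B] b', c *[C] c')) N" for N
  using x by (induction N) (auto simp: B.m_comm C.m_comm)
 then show ?case using add mm_add_right[of N "{#x#}" M] x(1) by simp
qed simp

lemma mm_assoc: "set_mset M <= BC ==> set_mset N <= BC ==> set_mset K <= BC ==> mm (mm M N) K = mm M (mm N K)"
proof (induction M)
 case (add x M)
 obtain b c where x: "x = (b, c)" "b el B" "c el C" using add.prems(1) by (cases x) auto
 have 1: "set_mset K <= BC ==> b' el B ==> c' el C ==>
   image_mset (%(b'', c''). (b *[B] b' *[B] b'', c *[C] c' *[C] c'')) K =
   image_mset (%(b', c'). (b *[B] b', c *[C] c')) (image_mset (%(b'', c''). (b' *[B] b'', c' *[C] c'')) K)" for b' c'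
  using x by (induction K) (auto simp: B.m_assoc C.m_assoc)
 have "set_mset N <= BC ==> mm (image_mset (%(b', c'). (b *[B] b', c *[C] c')) N) K =
   image_mset (%(b', c'). (b *[B] b', c *[C] c')) (mm N K)" for N
  using 1[OF add.prems(3)] by (induction N) auto
 then show ?case using add x(1) by simp
qed simp

lemma te_carr: "M =t= N ==> set_mset M <= BC & set_mset N <= BC"
 by (induction rule: teq.induct) (use Rl in auto)

lemma te_mm1: "M =t= N ==> n : BC ==> mm M {#n#} =t= mm N {#n#}"
proof (induction rule: teq.induct)
 case (teq_refl M)
 then show ?case by (intro teq.teq_refl mm_carr) auto
next
 case (teq_balance b c r r')
 then obtain b' c' where n: "n = (b', c')" "b' el B" "c' el C" by blast
 have r: "r el B" "r' el C" using Rl teq_balance by auto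
 have "b *[B] r *[B] b' = b *[B] b' *[B] r" using teq_balance n r by (simp add: B.m_assoc B.m_comm[of r])
 moreover have "r' *[C] c *[C] c' = r' *[C] (c *[C] c')" using teq_balance n r by (simp add: C.m_assoc)
 ultimately show ?case using teq.teq_balance[of "b *[B] b'" B "c *[C] c'" C r r' Rl] teq_balance.hyps n by simp
next
 case (teq_trans M N K)
 then show ?case using teq.teq_trans by blast
next
 case (teq_left b b' c)
 then obtain x y where n: "n = (x, y)" "x el B" "y el C" by blast
 show ?case using teq.teq_left[of "b *[B] x" B "b' *[B] x" "c *[C] y" C Rl] teq_left.hyps n by (simp add: B.l_distr add_mset_commute)
next
 case (teq_right b c c')
 then obtain x y where n: "n = (x, y)" "x el B" "y el C" by blast
 show ?case using teq.teq_right[of "b *[B] x" B "c *[C] y" C "c' *[C] y" Rl] teq_right.hyps n by (simp add: C.l_distr add_mset_commute)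
next
 case (teq_sym M N)
 then show ?case using teq.teq_sym by blast
qed (auto simp: teq_left_zero teq_right_zero teq_plus)

lemma te_mm_right: "M =t= N ==> set_mset K <= BC ==> mm M K =t= mm N K"
proof (induction K)
 case (add x K)
 then show ?case using teq_plus[OF te_mm1[OF add.prems(1), of x] add.IH] mm_add_right[of M "{#x#}" K] mm_add_right[of N "{#x#}" K] by simp
qed (auto intro: teq_refl)

lemma te_mm: "M =t= M' ==> N =t= N' ==> mm M N =t= mm M' N'"
 using te_mm_right[of M M' N] te_mm_right[of N N' M'] te_carr[of M M'] te_carr[of N N'] mm_comm[of N M'] mm_comm[of N' M']
  teq_trans[of B C Rl "mm M N" "mm M' N" "mm M' N'"] by simp

lemma cl_eq_iff: "set_mset M <= BC ==> (cl M = cl N) = (M =t= N)"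
proof
 assume M: "set_mset M <= BC" and "cl M = cl N"
 then have "N =t= M" using teq_refl[OF M, of Rl] unfolding tcl_def by blast
 then show "M =t= N" by (rule teq_sym)
next
 assume e: "M =t= N"
 have "M =t= K <-> N =t= K" for K using teq_trans[OF e, of K] teq_trans[OF teq_sym[OF e], of K] by metis
 then show "cl M = cl N" unfolding tcl_def by (intro Collect_cong)
qed

lemma D_carrier: "x el D <-> (EX M. set_mset M <= BC & x = cl M)"
 by (auto simp: tens_def)

lemma cl_op:
 assumes "!!M' N'. M =t= M' ==> N =t= N' ==> f M N =t= f M' N'" "set_mset M <= BC" "set_mset N <= BC"
 shows "{K. EX M':cl M. EX N':cl N. f M' N' =t= K} = cl (f M N)"
proof -
 have "(EX M':cl M. EX N':cl N. f M' N' =t= K) <-> f M N =t= K" for K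
  using assms(1) teq_trans[of B C Rl "f M N" _ K] teq_refl[OF assms(2), of Rl] teq_refl[OF assms(3), of Rl] by (auto simp: tcl_def)
 then show ?thesis unfolding tcl_def by (intro Collect_cong)
qed

lemma cl_add: "set_mset M <= BC ==> set_mset N <= BC ==> cl M +[D] cl N = cl (M + N)"
 unfolding tens_def ring.simps by (rule cl_op) (rule teq_plus)

lemma cl_mult: "set_mset M <= BC ==> set_mset N <= BC ==> cl M *[D] cl N = cl (mm M N)"
 unfolding tens_def monoid.simps by (rule cl_op) (rule te_mm)

lemma D_one: "1[D] = cl {#(1[B], 1[C])#}" and D_zero: "0[D] = cl {#}"
 by (simp_all add: tens_def)

lemma mm_one: "set_mset M <= BC ==> mm {#(1[B], 1[C])#} M = M"
 by (induction M) auto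

text \<open>Multisets have no negatives; the pair \<open>(-[B] b, c)\<close> represents the negative
  of \<open>(b, c)\<close>.\<close>

lemma te_neg: "set_mset M <= BC ==> EX N. set_mset N <= BC & N + M =t= {#}"
proof (induction M)
 case empty
 show ?case by (rule exI[of _ "{#}"]) (simp add: teq_refl)
next
 case (add x M)
 obtain b c where x: "x = (b, c)" "b el B" "c el C" using add.prems(1) by (cases x) auto
 obtain N where N: "set_mset N <= BC" "N + M =t= {#}" using add by auto
 have "{#(0[B], c)#} =t= {#(-[B] b, c), (b, c)#}"
  using teq_left[of "-[B] b" B b c C Rl] x by (simp add: B.l_neg)
 then have "{#(-[B] b, c), (b, c)#} =t= {#}" by (rule teq_trans[OF teq_sym teq_left_zero[OF x(3)]])
 from teq_plus[OF this N(2)] show ?case using N(1) x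
  by (intro exI[of _ "add_mset (-[B] b, c) N"]) (simp add: add_mset_commute)
qed

lemma cl_closed: "set_mset M <= BC ==> cl M el D"
 unfolding D_carrier by blast

lemma D_E: assumes "x el D" obtains M where "set_mset M <= BC" "x = cl M"
 using assms unfolding D_carrier by blast

lemma D_cring: "cring D"
proof (rule cringI)
 show "abelian_group D"
 proof (rule abelian_groupI)
  show "EX y:carrier D. y +[D] x = 0[D]" if x: "x el D" for x
  proof -
   obtain M where M: "set_mset M <= BC" "x = cl M" by (rule D_E[OF x])
   then obtain N where "set_mset N <= BC" "N + M =t= {#}" using te_neg[OF M(1)] by blast
   then show ?thesis using M cl_closed cl_add D_zero cl_eq_iff[of "N + M" "{#}"] by (intro bexI[of _ "cl N"]) simp_all
  qed
 qed ((elim D_E)?, simp add: cl_add cl_closed D_zero ac_simps)+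
 show "Group.comm_monoid D"
  by (rule comm_monoidI; (elim D_E)?; simp add: cl_mult cl_closed mm_carr mm_assoc mm_one D_one del: mm_simps)
   (auto simp: cl_mult mm_comm elim!: D_E)
 show "(x +[D] y) *[D] z = x *[D] z +[D] y *[D] z" if "x el D" "y el D" "z el D" for x y z
  using that by (elim D_E) (simp add: cl_mult cl_add mm_carr)
qed

sublocale D: cring D by (rule D_cring)

definition "in1 b = cl {#(b, 1[C])#}"
definition "in2 c = cl {#(1[B], c)#}"

lemma in1_hom: "in1 : ring_hom B D"
proof (rule ring_hom_memI)
 show "in1 b el D" if "b el B" for b
  unfolding in1_def using that by (intro cl_closed) simp
qed (auto simp: in1_def D_one cl_add cl_mult cl_eq_iff teq_left add_mset_commute)

lemma in2_hom: "in2 : ring_hom C D"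
proof (rule ring_hom_memI)
 show "in2 c el D" if "c el C" for c
  unfolding in2_def using that by (intro cl_closed) simp
qed (auto simp: in2_def D_one cl_add cl_mult cl_eq_iff teq_right add_mset_commute)

lemma in_closed [simp]: "b el B ==> in1 b el D" "c el C ==> in2 c el D"
 using hom_car[OF in1_hom] hom_car[OF in2_hom] by auto

lemma in_balance: "(r, r') : Rl ==> in1 r = in2 r'"
proof -
 assume r: "(r, r') : Rl"
 then have c: "r el B" "r' el C" using Rl by auto
 show ?thesis unfolding in1_def in2_def
  using teq_balance[of "1[B]" B "1[C]" C r r' Rl] r c by (simp add: cl_eq_iff)
qed

lemma cl_add_mset: "b el B ==> c el C ==> set_mset M <= BC ==> cl (add_mset (b, c) M) = in1 b *[D] in2 c +[D] cl M"
 by (simp add: in1_def in2_def cl_mult cl_add)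

lemma D_induct [consumes 1, case_names zero add]:
 assumes x: "x el D" and z: "P 0[D]"
  and a: "!!b c x. b el B ==> c el C ==> x el D ==> P x ==> P (in1 b *[D] in2 c +[D] x)"
 shows "P x"
proof -
 obtain M where M: "set_mset M <= BC" "x = cl M" by (rule D_E[OF x])
 have "set_mset M <= BC ==> P (cl M)" for M
 proof (induction M)
  case (add x M)
  then obtain b c where "x = (b, c)" "b el B" "c el C" by (cases x) auto
  then show ?case using add a[of b c "cl M"] cl_add_mset cl_closed by simp
 qed (use z D_zero in simp)
 then show ?thesis using M by simp
qed

lemma D_hom_eq:
 assumes E: "ring E" and f: "f : ring_hom D E" and g: "g : ring_hom D E"
  and e: "!!b. b el B ==> f (in1 b) = g (in1 b)" "!!c. c el C ==> f (in2 c) = g (in2 c)"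
  and x: "x el D"
 shows "f x = g x"
 using x
proof (induction rule: D_induct)
 case zero
 then show ?case using ring_hom_zero[OF f D.ring_axioms E] ring_hom_zero[OF g D.ring_axioms E] by simp
next
 case (add b c x)
 then show ?case using e ring_hom_add[OF f] ring_hom_add[OF g] ring_hom_mult[OF f] ring_hom_mult[OF g] by simp
qed

definition "ext E be ga = (SOME h. h : ring_hom D E & (ALL b:carrier B. h (in1 b) = be b) & (ALL c:carrier C. h (in2 c) = ga c))"

text \<open>The evaluation \<open>ev\<close> of a formal sum in \<open>E\<close> respects every rule
  of \<open>teq\<close>, the last one by \<open>bal\<close>. It therefore has the same value on all
  members of a class.\<close>

lemma ext:
 assumes E: "cring E" and b: "be : ring_hom B E" and g: "ga : ring_hom C E"
  and bal: "!!r r'. (r, r') : Rl ==> be r = ga r'"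
 shows "ext E be ga : ring_hom D E" "b el B ==> ext E be ga (in1 b) = be b" "c el C ==> ext E be ga (in2 c) = ga c"
proof -
 interpret E: cring E by fact
 note [simp] = hom_car[OF b] hom_car[OF g] ring_hom_one[OF b] ring_hom_one[OF g]
  ring_hom_mult[OF b] ring_hom_mult[OF g] ring_hom_add[OF b] ring_hom_add[OF g]
  ring_hom_zero[OF b B.ring_axioms E.ring_axioms] ring_hom_zero[OF g C.ring_axioms E.ring_axioms]
 define f where "f = (%(b, c). be b *[E] ga c)"
 define ev where "ev M = E.msum (image_mset f M)" for M
 have fc: "x : BC ==> f x el E" for x by (auto simp: f_def)
 have ev: "ev {#} = 0[E]" "x : BC ==> set_mset M <= BC ==> ev (add_mset x M) = f x +[E] ev M"
  "set_mset M <= BC ==> ev M el E" for x M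
  unfolding ev_def image_mset_add_mset using fc by (auto simp: subset_iff intro!: E.msum_add E.msum_closed)
 have evp: "set_mset M <= BC ==> set_mset N <= BC ==> ev (M + N) = ev M +[E] ev N" for M N
  unfolding ev_def image_mset_union by (rule E.msum_plus) (use fc in "auto simp: subset_iff")
 have e: "M =t= N ==> ev M = ev N" for M N
 proof (induction rule: teq.induct)
  case (teq_plus M N M' N')
  then show ?case using evp te_carr by simp
 next
  case (teq_balance b c r r')
  moreover have "r el B" "r' el C" using Rl teq_balance by auto
  ultimately show ?case using bal[of r r'] by (simp add: ev f_def E.m_assoc)
 qed (auto simp: ev f_def E.l_distr E.r_distr)
 define h where "h x = ev (SOME M. M : x)" for x
 have h: "h (cl M) = ev M" if M: "set_mset M <= BC" for M
 proof -
  have "(SOME N. N : cl M) : cl M" by (rule someI[of _ M]) (simp add: tcl_def teq_refl[OF M])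
  then show ?thesis using e unfolding h_def tcl_def by fastforce
 qed
 have evm: "ev (mm M N) = ev M *[E] ev N" if "set_mset M <= BC" "set_mset N <= BC" for M N
  using that(1)
 proof (induction M)
  case (add x M)
  then obtain b c where x: "x = (b, c)" "b el B" "c el C" by (cases x) auto
  have "set_mset N <= BC ==> ev (image_mset (%(b', c'). (b *[B] b', c *[C] c')) N) = f (b, c) *[E] ev N" for N
  proof (induction N)
   case (add y N)
   then obtain b' c' where y: "y = (b', c')" "b' el B" "c' el C" by (cases y) auto
   have "f (b *[B] b', c *[C] c') = f (b, c) *[E] f (b', c')" using x y by (simp add: f_def E.m_assoc E.m_lcomm)
   moreover have "set_mset (image_mset (%(b', c'). (b *[B] b', c *[C] c')) N) <= BC" using add.prems x by auto
   ultimately show ?case using add x y ev fc[of "(b, c)"] fc[of "(b', c')"] by (simp add: E.r_distr)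
  qed (use x ev in "simp add: f_def")
  moreover have "set_mset (image_mset (%(b', c'). (b *[B] b', c *[C] c')) N) <= BC" using that x by auto
  ultimately show ?case using add x that ev fc[of x] by (simp add: evp mm_carr E.l_distr)
 qed (use ev that in simp)
 have "h : ring_hom D E"
 proof (rule ring_hom_memI)
  show "h x el E" if "x el D" for x using that by (elim D_E) (simp add: h ev)
  show "h (x *[D] y) = h x *[E] h y" "h (x +[D] y) = h x +[E] h y" if "x el D" "y el D" for x y
   using that by (elim D_E, simp add: cl_mult cl_add h mm_carr evm evp)+
  show "h 1[D] = 1[E]" by (simp add: D_one h ev f_def)
 qed
 moreover have "h (in1 b) = be b" if "b el B" for b using that by (simp add: in1_def h ev f_def)
 moreover have "h (in2 c) = ga c" if "c el C" for c using that by (simp add: in2_def h ev f_def)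
 ultimately have "EX h. h : ring_hom D E & (ALL b:carrier B. h (in1 b) = be b) & (ALL c:carrier C. h (in2 c) = ga c)" by blast
 from someI_ex[OF this, folded ext_def]
 show "ext E be ga : ring_hom D E" "b el B ==> ext E be ga (in1 b) = be b" "c el C ==> ext E be ga (in2 c) = ga c" by blast+
qed

end

lemma tens_ringI: "cring B ==> cring C ==> Rl <= carrier B \<times> carrier C ==> tens_ring B C Rl"
 by (simp add: tens_ring_def tens_ring_axioms_def)

subsection \<open>Localisation at a system of prime ideals\<close>

text \<open>The ideal \<open>q\<close> of the stalk of \<open>S\<close> receives the maximal ideal
  of the stalk of \<open>Z\<close>. As a prime ideal contains no image of a unit, a prime
  \<open>q\<close> with this property contracts exactly to the maximal ideal.\<close>

definition "contracts S Z r z q <-> (ALL V s. opn Z V --> pmap r z : V --> s el sec Z V -->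
 germ Z (pmap r z) V s ~: Units (stalk Z (pmap r z)) --> germ S z (preim S r V) (smap r V s) : q)"

text \<open>The composite \<open>u\<close> is local, so a nonunit at the image point remains a
  nonunit at \<open>q\<close>, although \<open>w\<close> itself need not be local.\<close>

lemma contracts_nonunit:
 assumes w: "premor Q S w" and r: "premor S Z r" and u: "mor Q Z u" and e: "mor_eq Q Z (comp_mor S w r) u" and q: "q : points Q"
 shows "contracts S Z r (pmap w q) {ga : carrier (stalk S (pmap w q)). stalk_map Q S w q ga ~: Units (stalk Q q)}"
 unfolding contracts_def
proof (intro allI impI)
 interpret w: premor Q S w by fact
 interpret r: premor S Z r by fact
 fix V s assume V: "opn Z V" "pmap r (pmap w q) : V" "s el sec Z V" and n: "germ Z (pmap r (pmap w q)) V s ~: Units (stalk Z (pmap r (pmap w q)))"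
 note o = r.preim_open[OF V(1)] and sc = r.smap_closed[OF V(1,3)]
 have wi: "pmap w q : preim S r V" using w.pmap_in[OF q] V(2) by simp
 have pr: "preim Q w (preim S r V) = preim Q u V" using mor_eq_preim[OF e, of V] unfolding preim_comp[OF w] .
 have "stalk_map Q S w q (germ S (pmap w q) (preim S r V) (smap r V s)) = germ Q q (preim Q u V) (smap u V s)"
  using w.stalk_map_germ[OF q o wi sc] mor_eq_smap[OF e V(1,3)] pr by simp
 then show "germ S (pmap w q) (preim S r V) (smap r V s) : {ga : carrier (stalk S (pmap w q)). stalk_map Q S w q ga ~: Units (stalk Q q)}"
  using w.Y.germ_closed[OF o wi sc] n mor.germ_unit_reflect[OF u q V(1) _ V(3)] mor_eq_pmap[OF e q] V(2) by auto
qed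

text \<open>Localisation of a presheaf of rings along chosen primes of its stalks. Points of the new
  space are pairs of a point and a chosen prime, with the localised stalk as local ring; the basic
  opens are nonvanishing loci as in a spectrum. It is universal for maps to \<open>S\<close> under
  which the maximal ideals pull back to chosen primes (\<open>univ\<close>,
  \<open>uniq\<close>).\<close>

locale prime_system = S: presheaf S for S :: "('s, 'r) ringed_space" +
 fixes M :: "'s => ('s set \<times> 'r) set set set"
 assumes M_prime: "!!x q. x : points S ==> q : M x ==> primeideal q (stalk S x)"
begin

abbreviation "St z == stalk S (fst z)"
abbreviation "den z == carrier (St z) - snd z"
abbreviation "gm z == germ S (fst z)"
abbreviation "fr z == frac (St z) (den z)"
abbreviation "Rz z == localisation (St z) (den z)"

definition "Pt = {z. fst z : points S & snd z : M (fst z)}"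
definition "nz W d = {z : Pt. fst z : W & gm z W d ~: snd z}"
definition "Tp = topology_generated_by {nz W d | W d. opn S W & d el sec S W}"
abbreviation "Gf == germ_fun S Tp fst (%z a. a)"
abbreviation "LF == fun_data.fr_fun Tp St Gf den"

lemma Pt_prime: "z : Pt ==> primeideal (snd z) (St z)"
 unfolding Pt_def using M_prime by simp

lemma Pt_mult: "z : Pt ==> mult_set (St z) (den z)"
 by (rule prime_mult_set[OF Pt_prime])

lemma Pt_cring: "z : Pt ==> cring (St z)"
 unfolding Pt_def using S.stalk_cring by simp

lemma nz_Int:
 assumes "opn S W" "d el sec S W" "opn S W'" "d' el sec S W'"
 shows "nz W d Int nz W' d' = nz (W Int W') (res S W (W Int W') d *[sec S (W Int W')] res S W' (W Int W') d')"
proof -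
 have o: "opn S (W Int W')" using assms by blast
 have "gm z (W Int W') (res S W (W Int W') d *[sec S (W Int W')] res S W' (W Int W') d') : snd z <-> gm z W d : snd z | gm z W' d' : snd z"
  if z: "z : Pt" "fst z : W" "fst z : W'" for z
 proof -
  interpret P: primeideal "snd z" "St z" by (rule Pt_prime[OF z(1)])
  note c = S.germ_closed[OF assms(1) z(2) assms(2)] S.germ_closed[OF assms(3) z(3) assms(4)]
  have "gm z (W Int W') (res S W (W Int W') d *[sec S (W Int W')] res S W' (W Int W') d') = gm z W d *[St z] gm z W' d'"
   using S.germ_res[OF assms(1) o _ _ assms(2), of "fst z"] S.germ_res[OF assms(3) o _ _ assms(4), of "fst z"] z(2,3)
    S.stalk_mult[OF o _ S.res_closed[OF assms(1) o _ assms(2)] S.res_closed[OF assms(3) o _ assms(4)], of "fst z"] by simp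
  then show ?thesis using P.I_prime[OF c] P.I_l_closed[OF _ c(1)] P.I_r_closed[OF _ c(2)] c by auto
 qed
 then show ?thesis unfolding nz_def by auto
qed

lemma Tp_iff: "openin Tp U <-> (ALL z:U. EX W d. opn S W & d el sec S W & z : nz W d & nz W d <= U)"
proof -
 let ?B = "{nz W d | W d. opn S W & d el sec S W}"
 have "openin Tp U <-> (ALL x:U. EX c:?B. x : c & c <= U)"
  unfolding Tp_def
 proof (rule openin_generated_basis)
  fix a b z assume "a : ?B" "b : ?B" and z: "z : a Int b"
  then obtain W d W' d' where w: "opn S W" "d el sec S W" "a = nz W d" "opn S W'" "d' el sec S W'" "b = nz W' d'" by blast
  have o: "opn S (W Int W')" using w by blast
  interpret R: cring "sec S (W Int W')" by (rule S.sec_cring[OF o])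
  have "a Int b : ?B" unfolding w nz_Int[OF w(1,2,4,5)]
   using o R.m_closed[OF S.res_closed[OF w(1) o _ w(2)] S.res_closed[OF w(4) o _ w(5)]] by blast
  then show "EX c:?B. z : c & c <= a Int b" using z by blast
 qed
 also have "... <-> (ALL z:U. EX W d. opn S W & d el sec S W & z : nz W d & nz W d <= U)"
  by (rule ball_cong) auto
 finally show ?thesis .
qed

lemma nz_open: "opn S W ==> d el sec S W ==> openin Tp (nz W d)"
 unfolding Tp_iff by blast

lemma nz_one: "opn S W ==> nz W 1[sec S W] = {z : Pt. fst z : W}"
 using primeideal_one[OF Pt_prime] S.germ_one unfolding nz_def by auto

lemma Tp_over: "opn S W ==> openin Tp {z : Pt. fst z : W}"
 using nz_open[of W "1[sec S W]"] nz_one[of W] ring.ring_simprules(6)[OF S.sec_ring] by simp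

lemma Tp_top: "topspace Tp = Pt"
proof
 show "Pt <= topspace Tp" using openin_subset[OF Tp_over[of "points S"]] unfolding Pt_def by auto
 show "topspace Tp <= Pt" using openin_topspace[of Tp] unfolding Tp_iff nz_def by blast
qed

lemma nzD: "z : nz W d ==> z : Pt" "z : nz W d ==> fst z : W" "z : nz W d ==> gm z W d ~: snd z"
 unfolding nz_def by auto

lemma nz_den: "opn S W ==> d el sec S W ==> z : nz W d ==> gm z W d : den z"
 using nzD[of z W d] S.germ_closed[of W "fst z" d] by blast

lemma G_fun_data: "fun_data Tp St Gf"
proof (rule S.germ_fun_data)
 show "openin Tp {z : topspace Tp. fst z : W}" if "opn S W" for W using Tp_over[OF that] unfolding Tp_top .
 fix z W a b assume W: "opn S W" "fst z : W" "a el sec S W" "b el sec S W" and e: "gm z W a = gm z W b"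
 obtain V where V: "opn S V" "fst z : V" "V <= W" "res S W V a = res S W V b" by (rule S.germ_eqE[OF e W(1-3,1,2,4)])
 then show "EX V. opn S V & fst z : V & (ALL w:topspace Tp. fst w : V Int W --> gm w W a = gm w W b)"
  using S.germ_eqI[OF W(1,1) V(1) _ V(3,3) W(3,4) V(4)] by (intro exI[of _ V]) auto
qed (use Pt_cring Tp_top in "auto simp: Pt_def ring_hom_def")

text \<open>Numerator and denominator have representatives over one common open set, by restricting
  both to the intersection of their domains (\<open>germ_fun2E\<close>).\<close>

lemma LFE:
 assumes "LF N s"
 obtains W a d where "opn S W" "a el sec S W" "d el sec S W" "N <= nz W d"
  "ALL z:N. s z = fr z (gm z W a) (gm z W d)" "openin Tp N"
proof -
 obtain a d where a: "Gf N a" "Gf N d" "ALL z:N. d z : den z & s z = fr z (a z) (d z)"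
  using assms unfolding fun_data.fr_fun_def[OF G_fun_data] by blast
 obtain W b e where W: "opn S W" "b el sec S W" "e el sec S W" "openin Tp N" "!!z. z : N ==> fst z : W"
  "!!z. z : N ==> a z = gm z W b" "!!z. z : N ==> d z = gm z W e" by (rule S.germ_fun2E[OF a(1,2)]) blast
 show ?thesis
  by (rule that[OF W(1-3) _ _ W(4)]) (use a(3) W(5-7) openin_subset[OF W(4)] Tp_top in "auto simp: nz_def")
qed

lemma P_fun_data: "fun_data Tp Rz LF"
proof (rule fun_data.fraction_fun_data[OF G_fun_data])
 show "mult_set (St z) (den z)" if "z : topspace Tp" for z using that Pt_mult Tp_top by blast
 fix N g assume "Gf N g"
 then obtain W a where W: "openin Tp N" "opn S W" "a el sec S W" "ALL z:N. fst z : W & g z = gm z W a" unfolding germ_fun_def by blast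
 have "{w : N. g w : den w} = N Int nz W a"
  using W(4) openin_subset[OF W(1)] Tp_top S.germ_closed[OF W(2) _ W(3)] unfolding nz_def by auto
 then show "openin Tp {w : N. g w : den w}" using openin_Int[OF W(1) nz_open[OF W(2,3)]] by simp
qed

sublocale P: fun_data Tp Rz LF by (rule P_fun_data)

lemma P_lrs: "locally_ringed_space P.F"
 by (rule P.F_lrs) (use Tp_top Pt_prime loc_prime_local in blast)

definition proj :: "('s \<times> ('s set \<times> 'r) set set, (('s \<times> ('s set \<times> 'r) set set) => (('s set \<times> 'r) set \<times> ('s set \<times> 'r) set) set), 's, 'r) ringed_map" where
 "proj = (|pmap = fst, smap = (%W s. \<lambda>z\<in>{z : Pt. fst z : W}. fr z (gm z W s) 1[St z])|)"

lemma proj_simps [simp]: "pmap proj z = fst z" "smap proj W s = (\<lambda>z\<in>{z : Pt. fst z : W}. fr z (gm z W s) 1[St z])"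
 by (simp_all add: proj_def)

lemma preim_proj: "preim P.F proj W = {z : Pt. fst z : W}"
 by (auto simp: preim_def Tp_top)

lemma proj_sec:
 assumes W: "opn S W" "s el sec S W"
 shows "smap proj W s el (sec P.F {z : Pt. fst z : W})"
proof -
 let ?N = "{z : Pt. fst z : W}"
 interpret R: cring "sec S W" by (rule S.sec_cring[OF W(1)])
 have "Gf ?N (%z. gm z W s)" "Gf ?N (%z. 1[St z])"
  by (rule germ_funI[OF Tp_over[OF W(1)] W], simp_all, rule germ_funI[OF Tp_over[OF W(1)] W(1) R.one_closed]) (simp_all add: S.germ_one[OF W(1)])
 then have "LF ?N (%z. fr z (gm z W s) 1[St z])"
  by (rule fun_data.fr_funI[OF G_fun_data]) (use mult_set.S_one[OF Pt_mult] in auto)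
 from P.F_basic[OF this] show ?thesis by simp
qed

lemma proj_premor: "premor P.F S proj"
proof unfold_locales
 show "continuous_map (pts P.F) (pts S) (pmap proj)"
  unfolding continuous_map_def using Tp_over by (auto simp: Tp_top Pt_def)
 have h: "(%s. fr z (gm z W s) 1[St z]) : ring_hom (sec S W) (Rz z)" if "opn S W" "z : Pt" "fst z : W" for z W
  by (rule hom_comp[OF S.germ_hom[OF that(1,3)] mult_set.loc_hom[OF Pt_mult[OF that(2)]]])
 show "smap proj W : ring_hom (sec S W) (sec P.F (preim P.F proj W))" if W: "opn S W" for W
  unfolding preim_proj by (rule P.F_hom[OF Tp_over[OF W] S.sec_cring[OF W] proj_sec[OF W]]) (use h[OF W] in auto)
 show "smap proj V (res S U V s) = res P.F (preim P.F proj U) (preim P.F proj V) (smap proj U s)"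
  if "opn S U" "opn S V" "V <= U" "s el sec S U" for U V s
  unfolding preim_proj using that S.germ_res[OF that(1,2) _ that(3,4)] by (auto simp: restrict_def fun_eq_iff)
qed

sublocale proj: premor P.F S proj by (rule proj_premor)

lemma proj_unit_iff:
 assumes z: "z : Pt" "fst z : W" and W: "opn S W" "s el sec S W"
 shows "germ P.F z (preim P.F proj W) (smap proj W s) : Units (stalk P.F z) <-> gm z W s ~: snd z"
proof -
 interpret St: cring "St z" by (rule Pt_cring[OF z(1)])
 have "germ P.F z (preim P.F proj W) (smap proj W s) : Units (stalk P.F z) <-> fr z (gm z W s) 1[St z] : Units (Rz z)"
  unfolding preim_proj using P.F_germ_unit_iff[OF Tp_over[OF W(1)] _ proj_sec[OF W], of z] z by simp
 also have "... <-> gm z W s ~: snd z"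
  by (rule loc_prime_unit_iff[OF Pt_prime[OF z(1)] S.germ_closed[OF W(1) z(2) W(2)]]) (use primeideal_one[OF Pt_prime[OF z(1)]] in simp)
 finally show ?thesis .
qed

text \<open>The projection to \<open>S\<close> forgets the prime and need not be local. After
  composition with \<open>r\<close> it is, since the chosen primes contain the images of the
  nonunits of \<open>Z\<close>.\<close>

lemma comp_proj_mor:
 assumes r: "premor S Z r" and c: "!!z. z : Pt ==> contracts S Z r (fst z) (snd z)"
 shows "mor P.F Z (comp_mor S proj r)"
proof (rule mor.intro[OF premor_comp[OF proj_premor r] mor_axioms.intro], unfold reflects_units_def preim_comp[OF proj_premor] comp_simps, intro ballI allI impI)
 interpret r: premor S Z r by fact
 fix z V s assume z: "z : points P.F" and V: "opn Z V" "pmap r (pmap proj z) : V" "s el sec Z V"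
  and u: "germ P.F z (preim P.F proj (preim S r V)) (smap proj (preim S r V) (smap r V s)) : Units (stalk P.F z)"
 have zP: "z : Pt" using z Tp_top by simp
 have "gm z (preim S r V) (smap r V s) ~: snd z"
  using proj_unit_iff[OF zP _ r.preim_open[OF V(1)] r.smap_closed[OF V(1,3)]] u zP V(2) by (simp add: Pt_def del: proj_simps(2))
 then show "germ Z (pmap r (pmap proj z)) V s : Units (stalk Z (pmap r (pmap proj z)))" using c[OF zP] V unfolding contracts_def proj_simps by blast
qed

lemma univ:
 fixes Q :: "('q, 't) ringed_space"
 assumes Q: "sheaf Q" and u: "premor Q S u"
  and c: "!!q. q : points Q ==> {ga : carrier (stalk S (pmap u q)). stalk_map Q S u q ga ~: Units (stalk Q q)} : M (pmap u q)"
 obtains h where "mor Q P.F h" "mor_eq Q S (comp_mor P.F h proj) u"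
proof -
 interpret Q: sheaf Q by fact
 interpret u: premor Q S u by fact
 \<comment> \<open>The prime is forced: a local map has to pull back the maximal ideal at
   \<open>q\<close> to the maximal ideal of the localisation at this prime.\<close>
 define f where "f q = (pmap u q, {ga : carrier (stalk S (pmap u q)). stalk_map Q S u q ga ~: Units (stalk Q q)})" for q
 have f1 [simp]: "fst (f q) = pmap u q" for q by (simp add: f_def)
 have fP: "f q : Pt" if "q : points Q" for q using c[OF that] u.pmap_in[OF that] by (simp add: Pt_def f_def)
 have fnu: "ga ~: snd (f q) <-> stalk_map Q S u q ga : Units (stalk Q q)" if "ga el stalk S (pmap u q)" for ga q
  using that by (simp add: f_def)
 have "EX l. l : ring_hom (Rz (f q)) (stalk Q q) & (ALL \<alpha>:carrier (St (f q)). ALL de:den (f q).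
  l (fr (f q) \<alpha> de) *[stalk Q q] stalk_map Q S u q de = stalk_map Q S u q \<alpha>)" if q: "q : points Q" for q
  by (rule mult_set.lift[OF Pt_mult[OF fP[OF q]] Q.stalk_cring[OF q] u.stalk_map_hom[OF q, folded f1[of q]]]) (use fnu in auto)
 then obtain l where l: "!!q. q : points Q ==> l q : ring_hom (Rz (f q)) (stalk Q q)"
  "!!q \<alpha> de. q : points Q ==> \<alpha> el St (f q) ==> de : den (f q) ==> l q (fr (f q) \<alpha> de) *[stalk Q q] stalk_map Q S u q de = stalk_map Q S u q \<alpha>"
  by metis
 have smg: "stalk_map Q S u q (gm (f q) W d) = germ Q q (preim Q u W) (smap u W d)"
  if "q : points Q" "opn S W" "pmap u q : W" "d el sec S W" for q W d
  using u.stalk_map_germ[OF that] by simp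
 have inz: "f q : nz W d <-> pmap u q : W & germ Q q (preim Q u W) (smap u W d) : Units (stalk Q q)"
  if "q : points Q" "opn S W" "d el sec S W" for q W d
  using that fP[OF that(1)] fnu[OF S.germ_closed[OF that(2) _ that(3)], of q] smg[OF that(1,2) _ that(3)] unfolding nz_def by auto
 have onz: "opn Q {q : points Q. f q : nz W d}" if W: "opn S W" "d el sec S W" for W d
  unfolding openin_subopen[of "pts Q" "{q : points Q. f q : nz W d}"]
 proof
  fix q assume "q : {q : points Q. f q : nz W d}"
  then have q: "q : points Q" "pmap u q : W" "germ Q q (preim Q u W) (smap u W d) : Units (stalk Q q)" using inz W by auto
  obtain N where N: "opn Q N" "q : N" "N <= preim Q u W" "!!y. y : N ==> germ Q y (preim Q u W) (smap u W d) : Units (stalk Q y)"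
   by (rule Q.germ_unit_nbhd[OF u.preim_open[OF W(1)] _ u.smap_closed[OF W] q(3)]) (use q in auto)
  have "N <= {q : points Q. f q : nz W d}" using N(3,4) inz[OF _ W] by (auto simp: subset_iff)
  then show "EX T. opn Q T & q : T & T <= {q : points Q. f q : nz W d}" using N by blast
 qed
 have fop: "opn Q {q : points Q. f q : N}" if N: "openin Tp N" for N
  unfolding openin_subopen[of "pts Q" "{q : points Q. f q : N}"]
 proof
  fix q assume q: "q : {q : points Q. f q : N}"
  then obtain W d where "opn S W" "d el sec S W" "f q : nz W d" "nz W d <= N" using N unfolding Tp_iff by blast
  then show "EX T. opn Q T & q : T & T <= {q : points Q. f q : N}"
   using onz q by (intro exI[of _ "{q : points Q. f q : nz W d}"]) auto
 qed
 have cont: "continuous_map (pts Q) (pts P.F) f"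
  unfolding continuous_map_def using fop fP Tp_top by auto
 obtain h where h: "mor Q P.F h" "pmap h = f" and hg: "!!q V s. q : points Q ==> opn P.F V ==> f q : V ==> s el sec P.F V ==>
   germ Q q (preim Q h V) (smap h V s) = l q (s (f q))"
 proof (rule morphism_from_germs[OF Q P.F.presheaf_axioms cont, of "%q V s. l q (s (f q))"])
  fix q V assume q: "q : points Q" and V: "opn P.F V" "f q : V"
  have oV: "openin Tp V" using V by simp
  show "(%s. l q (s (f q))) : ring_hom (sec P.F V) (stalk Q q)" by (rule hom_comp[OF P.F_eval_hom[OF oV V(2)] l(1)[OF q]])
  fix s assume s: "s el sec P.F V"
  obtain N s' where N: "LF N s'" "f q : N" "N <= V" "!!w. w : N ==> s w = s' w" by (rule P.F_loc[OF s V(2)]) blast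
  obtain W a d where W: "opn S W" "a el sec S W" "d el sec S W" "N <= nz W d"
   "ALL z:N. s' z = fr z (gm z W a) (gm z W d)" "openin Tp N" by (rule LFE[OF N(1)])
  define O' where "O' = {q : points Q. f q : N}"
  have O': "opn Q O'" "q : O'" "O' <= preim Q u W" using fop[OF W(6)] q N(2) by (auto simp: O'_def dest!: subsetD[OF W(4)] nzD(2))
  note op = u.preim_open[OF W(1)] and sc = u.smap_closed[OF W(1,2)] u.smap_closed[OF W(1,3)]
  note gr = Q.germ_res[OF op O'(1) _ O'(3)]
  let ?a = "res Q (preim Q u W) O' (smap u W a)" and ?d = "res Q (preim Q u W) O' (smap u W d)"
  have val: "l y (s (f y)) el stalk Q y & l y (s (f y)) *[stalk Q y] germ Q y O' ?d = germ Q y O' ?a"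
   "germ Q y O' ?d : Units (stalk Q y)" if y: "y : O'" for y
  proof -
   have y': "y : points Q" "f y : N" using y O'_def by auto
   have yn: "f y : nz W d" using y' W(4) by blast
   have yW: "pmap u y : W" using nzD(2)[OF yn] by simp
   show "germ Q y O' ?d : Units (stalk Q y)" using inz[OF y'(1) W(1,3)] yn gr[OF y sc(2)] by simp
   have c: "gm (f y) W a el St (f y)" using S.germ_closed[OF W(1) _ W(2)] yW by simp
   have "s (f y) = fr (f y) (gm (f y) W a) (gm (f y) W d)" using N(4) W(5) y'(2) by simp
   then show "l y (s (f y)) el stalk Q y & l y (s (f y)) *[stalk Q y] germ Q y O' ?d = germ Q y O' ?a"
    using l(2)[OF y'(1) c nz_den[OF W(1,3) yn]] hom_car[OF l(1)[OF y'(1)] mult_set.frac_closed[OF Pt_mult[OF fP[OF y'(1)]] c nz_den[OF W(1,3) yn]]]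
     smg[OF y'(1) W(1) yW] W(2,3) gr[OF y] sc by simp
  qed
  obtain t where "t el sec Q O'" "!!y. y : O' ==> germ Q y O' t = l y (s (f y))"
   by (rule Q.sec_fraction[OF O'(1) Q.res_closed[OF op O'(1,3) sc(1)] Q.res_closed[OF op O'(1,3) sc(2)] val(2,1)]) blast+
  moreover have "ALL y:O'. f y : V" using N(3) O'_def by blast
  ultimately show "EX N t. opn Q N & q : N & (ALL y:N. f y : V) & t el sec Q N & (ALL y:N. germ Q y N t = l y (s (f y)))"
   using O' by blast
  show "germ P.F (f q) V s : Units (stalk P.F (f q))" if un: "l q (s (f q)) : Units (stalk Q q)"
  proof -
   interpret Sq: cring "stalk Q q" by (rule Q.stalk_cring[OF q])
   have fn: "f q : nz W d" and fW: "pmap u q : W" using N(2) W(4) nzD(2)[of "f q" W d] by auto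
   have "germ Q q (preim Q u W) (smap u W a) : Units (stalk Q q)"
    using Sq.Units_m_closed[OF un val(2)[OF O'(2)]] val(1)[OF O'(2)] gr[OF O'(2) sc(1)] by simp
   then have "gm (f q) W a ~: snd (f q)" using fnu[of "gm (f q) W a" q] S.germ_closed[OF W(1) _ W(2)] fW smg[OF q W(1) fW W(2)] by simp
   then have "fr (f q) (gm (f q) W a) (gm (f q) W d) : Units (Rz (f q))"
    using loc_prime_unit_iff[OF Pt_prime[OF fP[OF q]] S.germ_closed[OF W(1) _ W(2)] nz_den[OF W(1,3) fn]] fW by simp
   then show ?thesis using P.F_germ_unit_iff[OF oV V(2) s] N(2,4) W(5) by simp
  qed
 qed auto
 have "mor_eq Q S (comp_mor P.F h proj) u"
  unfolding mor_eq_def comp_simps preim_proj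
 proof (intro conjI ballI allI impI)
  show "pmap proj (pmap h q) = pmap u q" for q using h(2) by simp
  fix W s assume W: "opn S W" "s el sec S W"
  let ?N = "{z : Pt. fst z : W}"
  interpret h: mor Q P.F h by (rule h(1))
  have pre: "preim Q h ?N = preim Q u W" using fP h(2) by (auto simp: preim_def)
  have o: "opn P.F ?N" using Tp_over[OF W(1)] by simp
  show "smap h ?N (smap proj W s) = smap u W s"
  proof (rule Q.sec_eqI[OF u.preim_open[OF W(1)] _ u.smap_closed[OF W]])
   show "smap h ?N (smap proj W s) el sec Q (preim Q u W)" using h.smap_closed[OF o proj_sec[OF W]] pre by simp
   fix q assume "q : preim Q u W"
   then have q: "q : points Q" "pmap u q : W" by auto
   interpret m: mult_set "St (f q)" "den (f q)" by (rule Pt_mult[OF fP[OF q(1)]])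
   have "germ Q q (preim Q u W) (smap h ?N (smap proj W s)) = l q (smap proj W s (f q))"
    using hg[OF q(1) o _ proj_sec[OF W]] pre fP[OF q(1)] q by simp
   also have "... = l q (fr (f q) (gm (f q) W s) 1[St (f q)])" using fP[OF q(1)] q by simp
   also have "... = stalk_map Q S u q (gm (f q) W s)"
   proof -
    have c: "gm (f q) W s el St (f q)" using S.germ_closed[OF W(1) _ W(2)] q(2) by simp
    note lc = hom_car[OF l(1)[OF q(1)] m.frac_closed[OF c m.S_one]]
    show ?thesis
     using l(2)[OF q(1) c m.S_one] lc ring_hom_one[OF u.stalk_map_hom[OF q(1)]] monoid.r_one[OF ring.is_monoid[OF cring.axioms(1)[OF Q.stalk_cring[OF q(1)]]] lc] by simp
   qed
   also have "... = germ Q q (preim Q u W) (smap u W s)" by (rule smg[OF q(1) W(1) q(2) W(2)])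
   finally show "germ Q q (preim Q u W) (smap h ?N (smap proj W s)) = germ Q q (preim Q u W) (smap u W s)" .
  qed
 qed
 then show ?thesis using that h(1) by blast
qed

text \<open>The prime at an image point is recovered from the sections of \<open>S\<close> that
  become units at \<open>q\<close>; this settles points. Sections are locally fractions of sections
  pulled back from \<open>S\<close>, and this settles the stalk maps.\<close>

lemma uniq:
 fixes Q :: "('q, 't) ringed_space"
 assumes Q: "sheaf Q" and h: "mor Q P.F h" and h': "mor Q P.F h'"
  and e: "mor_eq Q S (comp_mor P.F h proj) (comp_mor P.F h' proj)"
 shows "mor_eq Q P.F h h'"
proof -
 interpret Q: sheaf Q by fact
 interpret h: mor Q P.F h by fact
 interpret h': mor Q P.F h' by fact
 have e1: "fst (pmap h q) = fst (pmap h' q)" if "q : points Q" for q using mor_eq_pmap[OF e that] by simp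
 have e2: "smap h (preim P.F proj W) (smap proj W s) = smap h' (preim P.F proj W) (smap proj W s)" if "opn S W" "s el sec S W" for W s
  using mor_eq_smap[OF e that] by simp
 have e3: "preim Q h (preim P.F proj W) = preim Q h' (preim P.F proj W)" for W
  using e1 h.pmap_in h'.pmap_in by (auto simp: preim_def)
 have inP: "pmap h q : Pt" "pmap h' q : Pt" if "q : points Q" for q
  using h.pmap_in[OF that] h'.pmap_in[OF that] Tp_top by auto
 have pm: "pmap h q = pmap h' q" if q: "q : points Q" for q
 proof -
  let ?z = "pmap h q" let ?z' = "pmap h' q"
  have "ga : snd ?z <-> ga : snd ?z'" if g: "ga el St ?z" for ga
  proof -
   obtain W s where W: "opn S W" "fst ?z : W" "s el sec S W" "ga = gm ?z W s" by (rule S.stalkE[OF g])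
   have o: "opn P.F (preim P.F proj W)" by (rule proj.preim_open[OF W(1)])
   have sc: "smap proj W s el sec P.F (preim P.F proj W)" by (rule proj.smap_closed[OF W(1,3)])
   have zi: "?z : preim P.F proj W" "?z' : preim P.F proj W" using inP[OF q] W(2) e1[OF q] unfolding preim_proj by auto
   have "ga ~: snd ?z <-> germ Q q (preim Q h (preim P.F proj W)) (smap h (preim P.F proj W) (smap proj W s)) : Units (stalk Q q)"
    using proj_unit_iff[OF inP(1)[OF q] W(2,1,3)] h.germ_unit_smap_iff[OF q o zi(1) sc] W(4) by simp
   moreover have "ga ~: snd ?z' <-> germ Q q (preim Q h (preim P.F proj W)) (smap h (preim P.F proj W) (smap proj W s)) : Units (stalk Q q)"
    using proj_unit_iff[OF inP(2)[OF q] _ W(1,3)] h'.germ_unit_smap_iff[OF q o zi(2) sc] W(2,4) e1[OF q] e2[OF W(1,3)] e3 by simp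
   ultimately show ?thesis by blast
  qed
  moreover have "snd ?z <= carrier (St ?z)" "snd ?z' <= carrier (St ?z)"
   using Pt_prime[OF inP(1)[OF q]] Pt_prime[OF inP(2)[OF q]] e1[OF q] by (auto dest!: primeideal.axioms(1) ideal.axioms(1) additive_subgroup.a_subset)
  ultimately have "snd ?z = snd ?z'" by blast
  then show ?thesis using e1[OF q] by (simp add: prod_eq_iff)
 qed
 show ?thesis
 proof (rule mor_eqI[OF Q h h' pm])
  fix q V s assume q: "q : points Q" and V: "opn P.F V" "pmap h q : V" and s: "s el sec P.F V"
  let ?z = "pmap h q"
  have oV: "openin Tp V" using V by simp
  have zp: "?z : points P.F" using h.pmap_in[OF q] .
  obtain N s' where N: "LF N s'" "?z : N" "N <= V" "!!w. w : N ==> s w = s' w" by (rule P.F_loc[OF s V(2)]) blast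
  obtain W a d where W: "opn S W" "a el sec S W" "d el sec S W" "N <= nz W d"
   "ALL z:N. s' z = fr z (gm z W a) (gm z W d)" "openin Tp N" by (rule LFE[OF N(1)])
  have zn: "?z : nz W d" using N(2) W(4) by blast
  note zW = nzD(2)[OF zn]
  let ?p = "preim P.F proj W"
  have op: "opn P.F ?p" by (rule proj.preim_open[OF W(1)])
  have zi: "?z : ?p" using zp zW by simp
  note pc = proj.smap_closed[OF W(1,2)] proj.smap_closed[OF W(1,3)]
  interpret K: cring "stalk P.F ?z" by (rule P.F.stalk_cring[OF zp])
  note gc = P.F.germ_closed[OF V s] P.F.germ_closed[OF op zi pc(1)] P.F.germ_closed[OF op zi pc(2)]
  obtain e where ev: "e : ring_hom (stalk P.F ?z) (Rz ?z)" "inj_on e (carrier (stalk P.F ?z))"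
   "!!U s. openin Tp U ==> ?z : U ==> s el sec P.F U ==> e (germ P.F ?z U s) = s ?z"
   by (rule P.F_stalk[of ?z]) (use inP[OF q] Tp_top in auto)
  interpret m: mult_set "St ?z" "den ?z" by (rule Pt_mult[OF inP(1)[OF q]])
  have den: "gm ?z W d : den ?z" "gm ?z W a el St ?z" using nz_den[OF W(1,3) zn] S.germ_closed[OF W(1) zW W(2)] by auto
  have "e (germ P.F ?z V s *[stalk P.F ?z] germ P.F ?z ?p (smap proj W d)) = e (germ P.F ?z ?p (smap proj W a))"
   using ring_hom_mult[OF ev(1) gc(1,3)] ev(3)[OF oV V(2) s] ev(3)[OF _ zi] op pc N(2,4) W(5) inP(1)[OF q] zW m.loc_frac_eq_mult[OF den(2,1)]
   by simp
  then have eq: "germ P.F ?z V s *[stalk P.F ?z] germ P.F ?z ?p (smap proj W d) = germ P.F ?z ?p (smap proj W a)"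
   using ev(2) gc by (simp add: inj_on_def)
  have pz: "pmap h' q = ?z" using pm[OF q] by simp
  note H = h.stalk_map_hom[OF q] and H' = h'.stalk_map_hom[OF q, unfolded pz]
  have hh: "stalk_map Q P.F h q (germ P.F ?z ?p (smap proj W b)) = stalk_map Q P.F h' q (germ P.F ?z ?p (smap proj W b))"
   if "b el sec S W" for b
   using h.stalk_map_germ[OF q op zi proj.smap_closed[OF W(1) that]] h'.stalk_map_germ[OF q op _ proj.smap_closed[OF W(1) that]] zi e2[OF W(1) that] e3[of W]
   unfolding pz by simp
  have u: "stalk_map Q P.F h q (germ P.F ?z ?p (smap proj W d)) : Units (stalk Q q)"
   by (rule ring_hom_Units[OF H]) (use proj_unit_iff[OF inP(1)[OF q] zW W(1,3)] nzD(3)[OF zn] in blast)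
  have "stalk_map Q P.F h q (germ P.F ?z V s) = stalk_map Q P.F h' q (germ P.F ?z V s)"
   by (rule hom_eq_on_fraction[OF Q.stalk_cring[OF q] H H' gc(1,3), OF u hh[OF W(3)]]) (unfold eq, rule hh[OF W(2)])
  then show "germ Q q (preim Q h V) (smap h V s) = germ Q q (preim Q h' V) (smap h' V s)"
   using h.stalk_map_germ[OF q V s] h'.stalk_map_germ[OF q V(1) _ s] V(2) pm[OF q] by simp
 qed
qed

end

subsection \<open>The product of two ringed spaces\<close>

text \<open>The projections of a product are open, so \<open>f\<close>
  W\<open>is an open set of\<close>Z\<open>and its sections can be used directly over\<close>W\<open>.
  For a map that is not open, the inverse image would involve a colimit over the neighbourhoods
  of\<close>f \<open>W\<close>.\<close>

locale open_proj = S: presheaf S + Z: presheaf Z for S :: "('s, 'a) ringed_space" and Z :: "('z, 'b) ringed_space" +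
 fixes f and i
 assumes f_cont: "continuous_map (pts S) (pts Z) f" and f_open: "open_map (pts S) (pts Z) f"
  and i_hom: "!!W. opn S W ==> i W : ring_hom (sec Z (f ` W)) (sec S W)"
  and i_res: "!!W W' b. opn S W ==> opn S W' ==> W' <= W ==> b el sec Z (f ` W) ==> res S W W' (i W b) = i W' (res Z (f ` W) (f ` W') b)"
begin

definition "pr = (let W = (%N. {z : points S. f z : N}) in (|pmap = f, smap = (%N s. i (W N) (res Z N (f ` W N) s))|))"

lemma pr_pmap [simp]: "pmap pr = f" and pr_smap: "smap pr N s = i (preim S pr N) (res Z N (f ` preim S pr N) s)"
 by (simp_all add: pr_def Let_def preim_def)

lemma img_open: "opn S W ==> opn Z (f ` W)"
 using f_open by (simp add: open_map_def)

lemma img_sub: "f ` preim S pr N <= N"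
 by auto

lemma pr_premor: "premor S Z pr"
proof unfold_locales
 show "continuous_map (pts S) (pts Z) (pmap pr)" using f_cont by simp
 have o: "opn S (preim S pr V)" if "opn Z V" for V
  using f_cont that unfolding preim_def by (simp add: continuous_map_def)
 show "smap pr V : ring_hom (sec Z V) (sec S (preim S pr V))" if V: "opn Z V" for V
  using hom_comp[OF Z.res_hom[OF V img_open[OF o[OF V]] img_sub] i_hom[OF o[OF V]]]
  by (rule ring_hom_cong) (simp_all add: pr_smap Z.sec_ring[OF V])
 show "smap pr V (res Z U V s) = res S (preim S pr U) (preim S pr V) (smap pr U s)"
  if V: "opn Z U" "opn Z V" "V <= U" "s el sec Z U" for U V s
 proof -
  have i: "preim S pr V <= preim S pr U" "f ` preim S pr V <= f ` preim S pr U"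
   by (intro image_mono preim_mono V(3))+
  note po = img_open[OF o[OF V(1)]] img_open[OF o[OF V(2)]]
  show ?thesis unfolding pr_smap using i_res[OF o[OF V(1)] o[OF V(2)] i(1) Z.res_closed[OF V(1) po(1) img_sub V(4)]]
    Z.res_res[OF V(1) po i(2) img_sub V(4)] Z.res_res[OF V(1,2) po(2) img_sub V(3,4)] by simp
 qed
qed

sublocale premor S Z pr by (rule pr_premor)

lemma sub_preim: "opn S W ==> W <= preim S pr (f ` W)"
 using openin_subset by fastforce

lemma res_pr:
 assumes W: "opn S W" "W <= preim S pr V" and V: "opn Z V" and s: "s el sec Z V"
 shows "res S (preim S pr V) W (smap pr V s) = i W (res Z V (f ` W) s)"
proof -
 note o = preim_open[OF V]
 show ?thesis unfolding pr_smap i_res[OF o W Z.res_closed[OF V img_open[OF o] img_sub s]]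
   Z.res_res[OF V img_open[OF o] img_open[OF W(1)] image_mono[OF W(2)] img_sub s] ..
qed

lemma i_eq: "opn S W ==> b el sec Z (f ` W) ==> i W b = res S (preim S pr (f ` W)) W (smap pr (f ` W) b)"
 by (simp add: res_pr sub_preim img_open Z.res_id)

lemma germ_i:
 assumes W: "opn S W" "z : W" and b: "b el sec Z (f ` W)"
 shows "germ S z W (i W b) = stalk_map S Z pr z (germ Z (f z) (f ` W) b)"
proof -
 note o = img_open[OF W(1)]
 have z: "z : points S" using openin_subset[OF W(1)] W(2) by blast
 show ?thesis unfolding i_eq[OF W(1) b] S.germ_res[OF preim_open[OF o] W sub_preim[OF W(1)] smap_closed[OF o b]]
  using stalk_map_germ[OF z o _ b] W(2) by simp
qed

lemma agree:
 assumes k: "premor Q S k" "premor Q S k'" and e: "mor_eq Q Z (comp_mor S k pr) (comp_mor S k' pr)"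
  and W: "opn S W" and p: "preim Q k W = preim Q k' W" and b: "b el sec Z (f ` W)"
 shows "smap k W (i W b) = smap k' W (i W b)"
proof -
 interpret k: premor Q S k by fact
 interpret k': premor Q S k' by fact
 note o = img_open[OF W]
 show ?thesis
  unfolding i_eq[OF W b] k.smap_res[OF preim_open[OF o] W sub_preim[OF W] smap_closed[OF o b]]
   k'.smap_res[OF preim_open[OF o] W sub_preim[OF W] smap_closed[OF o b]] p
  using mor_eq_smap[OF e o b] mor_eq_preim[OF e, of "f ` W", unfolded preim_comp[OF k(1)] preim_comp[OF k(2)]] by simp
qed

lemma comp_pr:
 assumes w: "premor Q S w" and u: "premor Q Z u" and p: "!!q. q : points Q ==> f (pmap w q) = pmap u q"
  and e: "!!W b. opn S W ==> b el sec Z (f ` W) ==> smap w W (i W b) = res Q (preim Q u (f ` W)) (preim Q w W) (smap u (f ` W) b)"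
 shows "mor_eq Q Z (comp_mor S w pr) u"
 unfolding mor_eq_def comp_simps pr_pmap
proof (intro conjI ballI allI impI p)
 interpret w: premor Q S w by fact
 interpret u: premor Q Z u by fact
 fix V s assume V: "opn Z V" "s el sec Z V"
 let ?W = "preim S pr V"
 note o = preim_open[OF V(1)]
 note o1 = img_open[OF o] and oV = u.preim_open[OF V(1)]
 have pw: "preim Q w ?W = preim Q u V" using w.pmap_in p by (auto simp: preim_def)
 have s: "preim Q u V <= preim Q u (f ` ?W)" using p w.pmap_in by (force simp: preim_def)
 show "smap w ?W (smap pr V s) = smap u V s"
  unfolding pr_smap e[OF o Z.res_closed[OF V(1) o1 img_sub V(2)]] u.smap_res[OF V(1) o1 img_sub V(2)] pw
   w.X.res_res[OF oV u.preim_open[OF o1] oV s preim_mono[OF img_sub] u.smap_closed[OF V]] by (rule w.X.res_id[OF oV u.smap_closed[OF V]])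
qed

end

locale fibre = p: mor X Y p + g: mor T Y g
 for X :: "('x, 'rx) ringed_space" and T :: "('t, 'rt) ringed_space" and Y :: "('y, 'ry) ringed_space"
  and p :: "('x, 'rx, 'y, 'ry) ringed_map" and g :: "('t, 'rt, 'y, 'ry) ringed_map"
begin

text \<open>The two images of one section of \<open>Y\<close>, over any \<open>U\<close> that
  contains the images of both projections of \<open>W\<close>. The set \<open>U\<close> varies
  because different \<open>W\<close> lie over different parts of \<open>Y\<close>.\<close>

definition "Rl W = {(res X (preim X p U) (fst ` W) (smap p U r), res T (preim T g U) (snd ` W) (smap g U r)) | U r.
 opn Y U & r el sec Y U & fst ` W <= preim X p U & snd ` W <= preim T g U}"

abbreviation "XW W == sec X (fst ` W)"
abbreviation "TW W == sec T (snd ` W)"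
abbreviation "DW W == tens (XW W) (TW W) (Rl W)"
abbreviation "i1 W == tens_ring.in1 (XW W) (TW W) (Rl W)"
abbreviation "i2 W == tens_ring.in2 (XW W) (TW W) (Rl W)"

definition "rho W W' = tens_ring.ext (XW W) (TW W) (Rl W) (DW W') (%b. i1 W' (res X (fst ` W) (fst ` W') b)) (%c. i2 W' (res T (snd ` W) (snd ` W') c))"

definition "S = (|pts = prod_topology (pts X) (pts T), sec = DW, res = rho|)"

lemma S_simps [simp]: "pts S = prod_topology (pts X) (pts T)" "sec S = DW" "res S = rho"
 by (simp_all add: S_def)

lemma prj_open:
 assumes "opn S W"
 shows "opn X (fst ` W)" "opn T (snd ` W)"
 using assms open_map_fst[of "pts X" "pts T"] open_map_snd[of "pts X" "pts T"] by (simp_all add: open_map_def)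

lemma tr: "opn S W ==> tens_ring (XW W) (TW W) (Rl W)"
proof (rule tens_ringI)
 assume W: "opn S W"
 note o = prj_open[OF W]
 show "cring (XW W)" "cring (TW W)" using p.X.sec_cring g.X.sec_cring o by auto
 show "Rl W <= carrier (XW W) \<times> carrier (TW W)"
  unfolding Rl_def by clarify (intro conjI p.X.res_closed[OF p.preim_open o(1) _ p.smap_closed] g.X.res_closed[OF g.preim_open o(2) _ g.smap_closed])
qed

lemma DW_cring: "opn S W ==> cring (DW W)"
 by (rule tens_ring.D_cring[OF tr])

lemma Rl_I: "opn Y U ==> r el sec Y U ==> fst ` W <= preim X p U ==> snd ` W <= preim T g U ==>
  (res X (preim X p U) (fst ` W) (smap p U r), res T (preim T g U) (snd ` W) (smap g U r)) : Rl W"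
 unfolding Rl_def by blast

lemma RlE:
 assumes "(r, r') : Rl W"
 obtains U k where "opn Y U" "k el sec Y U" "fst ` W <= preim X p U" "snd ` W <= preim T g U"
  "r = res X (preim X p U) (fst ` W) (smap p U k)" "r' = res T (preim T g U) (snd ` W) (smap g U k)"
 using assms unfolding Rl_def by blast

lemma rho:
 assumes W: "opn S W" "opn S W'" "W' <= W"
 shows "rho W W' : ring_hom (DW W) (DW W')"
  "b el XW W ==> rho W W' (i1 W b) = i1 W' (res X (fst ` W) (fst ` W') b)"
  "c el TW W ==> rho W W' (i2 W c) = i2 W' (res T (snd ` W) (snd ` W') c)"
proof -
 note o = prj_open[OF W(1)] prj_open[OF W(2)]
 have s: "fst ` W' <= fst ` W" "snd ` W' <= snd ` W" using W(3) by auto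
 interpret t': tens_ring "XW W'" "TW W'" "Rl W'" by (rule tr[OF W(2)])
 have h: "(%b. i1 W' (res X (fst ` W) (fst ` W') b)) : ring_hom (XW W) (DW W')"
  "(%c. i2 W' (res T (snd ` W) (snd ` W') c)) : ring_hom (TW W) (DW W')"
  by (rule hom_comp[OF p.X.res_hom[OF o(1,3) s(1)] t'.in1_hom] hom_comp[OF g.X.res_hom[OF o(2,4) s(2)] t'.in2_hom])+
 have bal: "i1 W' (res X (fst ` W) (fst ` W') r) = i2 W' (res T (snd ` W) (snd ` W') r')" if "(r, r') : Rl W" for r r'
 proof -
  from that obtain U k where U: "opn Y U" "k el sec Y U" "fst ` W <= preim X p U" "snd ` W <= preim T g U"
   "r = res X (preim X p U) (fst ` W) (smap p U k)" "r' = res T (preim T g U) (snd ` W) (smap g U k)" by (rule RlE)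
  show ?thesis
   unfolding U(5,6) p.X.res_res[OF p.preim_open[OF U(1)] o(1,3) s(1) U(3) p.smap_closed[OF U(1,2)]]
    g.X.res_res[OF g.preim_open[OF U(1)] o(2,4) s(2) U(4) g.smap_closed[OF U(1,2)]]
   by (rule t'.in_balance, rule Rl_I[OF U(1,2)]) (use U s in auto)
 qed
 show "rho W W' : ring_hom (DW W) (DW W')"
  "b el XW W ==> rho W W' (i1 W b) = i1 W' (res X (fst ` W) (fst ` W') b)"
  "c el TW W ==> rho W W' (i2 W c) = i2 W' (res T (snd ` W) (snd ` W') c)"
  unfolding rho_def by (rule tens_ring.ext[OF tr[OF W(1)] t'.D_cring h bal]; assumption)+
qed

lemma S_presheaf: "presheaf S"
proof (rule presheaf.intro, unfold presheaf_of_rings_def, intro conjI allI impI ballI)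
 show "cring (sec S U)" if "opn S U" for U using DW_cring[OF that] by simp
 show "res S U V : ring_hom (sec S U) (sec S V)" if "opn S U" "opn S V" "V <= U" for U V using rho(1)[OF that] by simp
 show "res S U U s = s" if U: "opn S U" and s: "s el sec S U" for U s
 proof -
  interpret t: tens_ring "XW U" "TW U" "Rl U" by (rule tr[OF U])
  have "rho U U s = id s"
   by (rule t.D_hom_eq[OF t.D.ring_axioms rho(1)[OF U U] id_ring_hom])
    (use s rho(2,3)[OF U U] p.X.res_id g.X.res_id prj_open[OF U] in auto)
  then show ?thesis by simp
 qed
 show "res S V W (res S U V s) = res S U W s" if o: "opn S U" "opn S V" "opn S W" "W <= V" "V <= U" and s: "s el sec S U" for U V W s
 proof -
  interpret t: tens_ring "XW U" "TW U" "Rl U" by (rule tr[OF o(1)])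
  interpret tW: tens_ring "XW W" "TW W" "Rl W" by (rule tr[OF o(3)])
  have i: "fst ` V <= fst ` U" "fst ` W <= fst ` V" "snd ` V <= snd ` U" "snd ` W <= snd ` V" using o by auto
  have UW: "W <= U" using o by blast
  note po = prj_open[OF o(1)] prj_open[OF o(2)] prj_open[OF o(3)]
  note r = rho[OF o(1,2,5)] rho[OF o(2,3,4)] rho[OF o(1,3) UW]
  have "rho V W (rho U V s) = rho U W s"
  proof (rule t.D_hom_eq[OF tW.D.ring_axioms hom_comp[OF r(1,4)] r(7)])
   show "rho V W (rho U V (i1 U b)) = rho U W (i1 U b)" if b: "b el XW U" for b
    using r(2,8)[OF b] r(5)[OF p.X.res_closed[OF po(1,3) i(1) b]] p.X.res_res[OF po(1,3,5) i(2,1) b] by simp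
   show "rho V W (rho U V (i2 U c)) = rho U W (i2 U c)" if c: "c el TW U" for c
    using r(3,9)[OF c] r(6)[OF g.X.res_closed[OF po(2,4) i(3) c]] g.X.res_res[OF po(2,4,6) i(4,3) c] by simp
  qed (use s in simp)
  then show ?thesis by simp
 qed
qed

sublocale S: presheaf S by (rule S_presheaf)

sublocale pr1: open_proj S X fst i1
 by unfold_locales (use rho(2) tens_ring.in1_hom[OF tr] in "simp_all add: continuous_map_fst open_map_fst")
sublocale pr2: open_proj S T snd i2
 by unfold_locales (use rho(3) tens_ring.in2_hom[OF tr] in "simp_all add: continuous_map_snd open_map_snd")

text \<open>The prime ideals of the stalk at \<open>(x, t)\<close> that contract to the maximal ideals of \<open>\<O>\<^sub>x\<close> and \<open>\<O>\<^sub>t\<close>.\<close>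

definition "MM z = {q. primeideal q (stalk S z) & pmap p (fst z) = pmap g (snd z) & contracts S X pr1.pr z q & contracts S T pr2.pr z q}"

sublocale I: prime_system S MM
 by (rule prime_system.intro[OF S_presheaf prime_system_axioms.intro]) (simp add: MM_def)

abbreviation "P == I.P.F"
definition "pa = comp_mor S I.proj pr1.pr"
definition "pb = comp_mor S I.proj pr2.pr"

lemma I_PtD: "z : I.Pt ==> fst z : points X \<times> points T" "z : I.Pt ==> snd z : MM (fst z)"
 unfolding I.Pt_def by simp_all

lemma pa_mor: "mor P X pa" and pb_mor: "mor P T pb"
 unfolding pa_def pb_def using I_PtD(2) by (auto simp: MM_def intro!: I.comp_proj_mor pr1.pr_premor pr2.pr_premor)

lemma square: "mor_eq P Y (comp_mor X pa p) (comp_mor T pb g)"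
 unfolding mor_eq_def comp_simps pa_def pb_def
proof (intro conjI ballI allI impI)
 show "pmap p (pmap pr1.pr (pmap I.proj z)) = pmap g (pmap pr2.pr (pmap I.proj z))" if "z : points P" for z
  using that I_PtD(2)[of z] I.Tp_top by (simp add: MM_def)
 fix U r assume U: "opn Y U" "r el sec Y U"
 \<comment> \<open>The two pullbacks of \<open>r\<close> are sections over different open sets of
   \<open>S\<close>. They agree on the intersection by \<open>in_balance\<close>, and over points of
   \<open>P\<close> both sets coincide, since \<open>MM\<close> demands the same image in
   \<open>Y\<close>.\<close>
 let ?A = "preim S pr1.pr (preim X p U)" let ?B = "preim S pr2.pr (preim T g U)"
 note a = p.preim_open[OF U(1)] p.smap_closed[OF U] and b = g.preim_open[OF U(1)] g.smap_closed[OF U]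
 note oA = pr1.preim_open[OF a(1)] and oB = pr2.preim_open[OF b(1)]
 have oW: "opn S (?A Int ?B)" using oA oB by (rule openin_Int)
 have sub: "fst ` (?A Int ?B) <= preim X p U" "snd ` (?A Int ?B) <= preim T g U" by auto
 have e: "res S ?A (?A Int ?B) (smap pr1.pr (preim X p U) (smap p U r)) = res S ?B (?A Int ?B) (smap pr2.pr (preim T g U) (smap g U r))"
  unfolding pr1.res_pr[OF oW Int_lower1 a] pr2.res_pr[OF oW Int_lower2 b] by (rule tens_ring.in_balance[OF tr[OF oW] Rl_I[OF U sub]])
 have mem: "fst z : ?A <-> fst z : ?B" if "z : I.Pt" for z
  using I_PtD[OF that] by (auto simp: MM_def mem_Times_iff)
 have G: "germ S (fst z) ?A (smap pr1.pr (preim X p U) (smap p U r)) = germ S (fst z) ?B (smap pr2.pr (preim T g U) (smap g U r))"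
  if "z : I.Pt" "fst z : ?A" for z
  by (rule S.germ_eqI[OF oA oB oW _ Int_lower1 Int_lower2 pr1.smap_closed[OF a] pr2.smap_closed[OF b] e]) (use that mem[OF that(1)] in blast)
 have AB: "{z : I.Pt. fst z : ?A} = {z : I.Pt. fst z : ?B}" using mem by blast
 show "smap I.proj (preim S pr1.pr (preim X p U)) (smap pr1.pr (preim X p U) (smap p U r)) = smap I.proj (preim S pr2.pr (preim T g U)) (smap pr2.pr (preim T g U) (smap g U r))"
  unfolding I.proj_simps AB[symmetric] by (rule restrict_ext) (use G in simp)
qed

text \<open>The universal property of the tensor product over each open set \<open>W\<close> turns
  \<open>u\<close> and \<open>v\<close> into a map \<open>w\<close> to the presheaf product. Its
  preimages of maximal ideals satisfy the conditions in \<open>MM\<close>, because \<open>u\<close>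
  and \<open>v\<close> are local, so that \<open>I.univ\<close> lifts \<open>w\<close> to
  \<open>P\<close>.\<close>

lemma pair_univ:
 fixes Q :: "('q, 's) ringed_space"
 assumes Q: "locally_ringed_space Q" and u: "mor Q X u" and v: "mor Q T v"
  and uv: "mor_eq Q Y (comp_mor X u p) (comp_mor T v g)"
 obtains h where "mor Q P h" "mor_eq Q X (comp_mor P h pa) u" "mor_eq Q T (comp_mor P h pb) v"
proof -
 interpret Q: sheaf Q by (rule lrsD(1)[OF Q])
 interpret u: mor Q X u by fact
 interpret v: mor Q T v by fact
 define pre where "pre W = {q : points Q. (pmap u q, pmap v q) : W}" for W
 define a where "a W = (%b. res Q (preim Q u (fst ` W)) (pre W) (smap u (fst ` W) b))" for W
 define b where "b W = (%c. res Q (preim Q v (snd ` W)) (pre W) (smap v (snd ` W) c))" for W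
 define sm where "sm W = tens_ring.ext (XW W) (TW W) (Rl W) (sec Q (pre W)) (a W) (b W)" for W
 have ct: "continuous_map (pts Q) (pts S) (%q. (pmap u q, pmap v q))"
  using u.cont v.cont by (simp add: continuous_map_paired)
 have pre_open: "opn Q (pre W)" if "opn S W" for W
  using ct that unfolding continuous_map_def pre_def by blast
 have pre_sub: "pre W <= preim Q u (fst ` W)" "pre W <= preim Q v (snd ` W)" for W
  unfolding pre_def by (force simp: image_iff)+
 have sm: "sm W : ring_hom (DW W) (sec Q (pre W)) & (be el XW W --> sm W (i1 W be) = a W be) & (ga el TW W --> sm W (i2 W ga) = b W ga)" if W: "opn S W" for W be ga
 proof -
  note o = prj_open[OF W] and oQ = pre_open[OF W]
  note ou = u.preim_open[OF o(1)] and ov = v.preim_open[OF o(2)]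
  have h: "a W : ring_hom (XW W) (sec Q (pre W))" "b W : ring_hom (TW W) (sec Q (pre W))"
   unfolding a_def b_def
   by (rule hom_comp[OF u.smap_hom[OF o(1)] Q.res_hom[OF ou oQ pre_sub(1)]] hom_comp[OF v.smap_hom[OF o(2)] Q.res_hom[OF ov oQ pre_sub(2)]])+
  have bal: "a W r = b W r'" if "(r, r') : Rl W" for r r'
  proof -
   from that obtain U k where U: "opn Y U" "k el sec Y U" "fst ` W <= preim X p U" "snd ` W <= preim T g U"
    "r = res X (preim X p U) (fst ` W) (smap p U k)" "r' = res T (preim T g U) (snd ` W) (smap g U k)" by (rule RlE)
   note pU = p.preim_open[OF U(1)] p.smap_closed[OF U(1,2)] and gU = g.preim_open[OF U(1)] g.smap_closed[OF U(1,2)]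
   have pp: "preim Q u (preim X p U) = preim Q v (preim T g U)"
    using mor_eq_preim[OF uv, of U] preim_comp[OF mor.axioms(1)[OF u], of p U] preim_comp[OF mor.axioms(1)[OF v], of g U] by simp
   have "a W r = res Q (preim Q u (preim X p U)) (pre W) (smap u (preim X p U) (smap p U k))"
    unfolding a_def U(5) u.smap_res[OF pU(1) o(1) U(3) pU(2)]
    by (rule Q.res_res[OF u.preim_open[OF pU(1)] ou oQ pre_sub(1) preim_mono[OF U(3)] u.smap_closed[OF pU]])
   also have "... = res Q (preim Q v (preim T g U)) (pre W) (smap v (preim T g U) (smap g U k))"
    using mor_eq_smap[OF uv U(1,2)] pp by simp
   also have "... = b W r'"
    unfolding b_def U(6) v.smap_res[OF gU(1) o(2) U(4) gU(2)]
    by (rule Q.res_res[OF v.preim_open[OF gU(1)] ov oQ pre_sub(2) preim_mono[OF U(4)] v.smap_closed[OF gU], symmetric])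
   finally show ?thesis .
  qed
  show ?thesis unfolding sm_def using tens_ring.ext[OF tr[OF W] Q.sec_cring[OF oQ] h bal] by blast
 qed
 define w where "w = (|pmap = (%q. (pmap u q, pmap v q)), smap = sm|)"
 have w_simps: "pmap w q = (pmap u q, pmap v q)" "smap w = sm" "preim Q w W = pre W" for q W
  by (auto simp: w_def preim_def pre_def)
 have w: "premor Q S w"
 proof unfold_locales
  show "continuous_map (pts Q) (pts S) (pmap w)" using ct by (simp add: w_def)
  show "smap w W : ring_hom (sec S W) (sec Q (preim Q w W))" if "opn S W" for W
   using sm[OF that] by (simp add: w_simps)
  show "smap w W' (res S W W' s) = res Q (preim Q w W) (preim Q w W') (smap w W s)"
   if W: "opn S W" "opn S W'" "W' <= W" and s: "s el sec S W" for W W' s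
  proof -
   have i: "fst ` W' <= fst ` W" "snd ` W' <= snd ` W" "pre W' <= pre W" using W(3) by (auto simp: pre_def)
   note o = prj_open[OF W(1)] prj_open[OF W(2)] and oQ = pre_open[OF W(1)] pre_open[OF W(2)]
   have "sm W' (rho W W' s) = res Q (pre W) (pre W') (sm W s)"
   proof (rule tens_ring.D_hom_eq[OF tr[OF W(1)] Q.sec_ring[OF oQ(2)] hom_comp[OF rho(1)[OF W] conjunct1[OF sm[OF W(2)]]]
     hom_comp[OF conjunct1[OF sm[OF W(1)]] Q.res_hom[OF oQ i(3)]]])
    show "sm W' (rho W W' (i1 W b)) = res Q (pre W) (pre W') (sm W (i1 W b))" if b: "b el XW W" for b
     using rho(2)[OF W b] sm[OF W(2)] p.X.res_closed[OF o(1,3) i(1) b] sm[OF W(1)] b u.smap_res[OF o(1,3) i(1) b]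
      Q.res_res[OF u.preim_open[OF o(1)] u.preim_open[OF o(3)] oQ(2) pre_sub(1) preim_mono[OF i(1)] u.smap_closed[OF o(1) b]]
      Q.res_res[OF u.preim_open[OF o(1)] oQ i(3) pre_sub(1) u.smap_closed[OF o(1) b]] by (simp add: a_def)
    show "sm W' (rho W W' (i2 W c)) = res Q (pre W) (pre W') (sm W (i2 W c))" if c: "c el TW W" for c
     using rho(3)[OF W c] sm[OF W(2)] g.X.res_closed[OF o(2,4) i(2) c] sm[OF W(1)] c v.smap_res[OF o(2,4) i(2) c]
      Q.res_res[OF v.preim_open[OF o(2)] v.preim_open[OF o(4)] oQ(2) pre_sub(2) preim_mono[OF i(2)] v.smap_closed[OF o(2) c]]
      Q.res_res[OF v.preim_open[OF o(2)] oQ i(3) pre_sub(2) v.smap_closed[OF o(2) c]] by (simp add: b_def)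
   qed (use s in simp)
   then show ?thesis by (simp add: w_simps)
  qed
 qed
 interpret w: premor Q S w by (rule w)
 have w1: "mor_eq Q X (comp_mor S w pr1.pr) u"
  by (rule pr1.comp_pr[OF w u.premor_axioms]) (use sm in "simp_all add: w_simps a_def")
 have w2: "mor_eq Q T (comp_mor S w pr2.pr) v"
  by (rule pr2.comp_pr[OF w v.premor_axioms]) (use sm in "simp_all add: w_simps b_def")
 obtain h where h: "mor Q P h" "mor_eq Q S (comp_mor P h I.proj) w"
 proof (rule I.univ[OF Q.sheaf_axioms w])
  show "{ga : carrier (stalk S (pmap w q)). stalk_map Q S w q ga ~: Units (stalk Q q)} : MM (pmap w q)" if q: "q : points Q" for q
   unfolding MM_def using mor_eq_pmap[OF uv q] nonunit_prime[OF S.stalk_cring[OF w.pmap_in[OF q]] lrsD(2)[OF Q q] w.stalk_map_hom[OF q]]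
    contracts_nonunit[OF w pr1.pr_premor u w1 q] contracts_nonunit[OF w pr2.pr_premor v w2 q] by (simp add: w_simps(1))
 qed blast
 have k: "mor_eq Q Z (comp_mor P h (comp_mor S I.proj r)) t" if "mor_eq Q Z (comp_mor S w r) t" "premor S Z r" for Z :: "('z, 'rz) ringed_space" and r t
  using that(1) h(2) premor.preim_open[OF that(2)] premor.smap_closed[OF that(2)] by (simp add: mor_eq_def preim_comp[OF I.proj_premor] del: I.proj_simps(2))
 show ?thesis
  by (rule that[OF h(1)]) (unfold pa_def pb_def, (rule k[OF w1 pr1.pr_premor] k[OF w2 pr2.pr_premor])+)
qed

text \<open>Sections of the presheaf product are generated by those of the two factors, so the
  composites with the projections determine the map to \<open>S\<close>; \<open>I.uniq\<close>
  passes from there to \<open>P\<close>.\<close>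

lemma pair_uniq:
 fixes Q :: "('q, 's) ringed_space"
 assumes Q: "sheaf Q" and h: "mor Q P h" and h': "mor Q P h'"
  and ea: "mor_eq Q X (comp_mor P h pa) (comp_mor P h' pa)" and eb: "mor_eq Q T (comp_mor P h pb) (comp_mor P h' pb)"
 shows "mor_eq Q P h h'"
proof (rule I.uniq[OF Q h h'])
 interpret Q: sheaf Q by fact
 let ?k = "comp_mor P h I.proj" and ?k' = "comp_mor P h' I.proj"
 have k: "premor Q S ?k" "premor Q S ?k'" using premor_comp[OF mor.axioms(1) I.proj_premor] h h' by auto
 interpret k: premor Q S ?k by (rule k(1))
 interpret k': premor Q S ?k' by (rule k(2))
 have a: "mor_eq Q X (comp_mor S ?k pr1.pr) (comp_mor S ?k' pr1.pr)" and b: "mor_eq Q T (comp_mor S ?k pr2.pr) (comp_mor S ?k' pr2.pr)"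
  using ea eb unfolding pa_def pb_def mor_eq_def by (simp_all add: preim_comp[OF I.proj_premor] del: I.proj_simps(2))
 have pm: "pmap ?k q = pmap ?k' q" if "q : points Q" for q
  using mor_eq_pmap[OF a that] mor_eq_pmap[OF b that] by (simp add: prod_eq_iff)
 have pre: "preim Q ?k W = preim Q ?k' W" for W
  using pm by (auto simp: preim_def)
 show "mor_eq Q S ?k ?k'"
  unfolding mor_eq_def
 proof (intro conjI ballI allI impI pm)
  fix W s assume W: "opn S W" and s: "s el sec S W"
  show "smap ?k W s = smap ?k' W s"
   by (rule tens_ring.D_hom_eq[OF tr[OF W] Q.sec_ring[OF k.preim_open[OF W]] k.smap_hom[OF W, unfolded S_simps(2)]
    k'.smap_hom[OF W, folded pre, unfolded S_simps(2)] pr1.agree[OF k a W pre] pr2.agree[OF k b W pre]]) (use s in auto)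
 qed
qed

end

text \<open>Prepares \<open>affine_openI\<close> for an open set \<open>N\<close> lying over an
  affine \<open>V\<close>. The last conclusion says that any \<open>l\<close> with the right
  composite to \<open>X\<close> is a left inverse as far as \<open>X\<close> can see; if
  \<open>c\<close>, or several such maps jointly, detect equality, this proves \<open>N\<close>
  affine.\<close>

lemma morphism_from_open_Spec:
 fixes P :: "('p, 'r) ringed_space" and X :: "('x, 'rx) ringed_space"
 assumes P: "locally_ringed_space P" and O: "opn P N" and c: "mor P X c" and X: "locally_ringed_space X" and V: "affine_open X V"
  and NV: "N <= preim P c V"
 obtains u where "mor (Spec (sec P N)) X u" "!!q. q : points (Spec (sec P N)) ==> pmap u q : V"
  "!!W s. opn X W ==> V <= W ==> s el sec X W ==>
   smap u W s = Spec_elt (sec P N) (res P (preim P c W) N (smap c W s))"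
  "!!l k. mor (Spec (sec P N)) P l ==> mor_eq (Spec (sec P N)) X (comp_mor P l c) u ==> mor (restrict_space P N) (Spec (sec P N)) k ==>
   (!!a. a el sec P N ==> smap k (points (Spec (sec P N))) (Spec_elt (sec P N) a) = a) ==>
   mor_eq (restrict_space P N) X (comp_mor P (comp_mor (Spec (sec P N)) k l) c) (comp_mor P (open_incl P N) c)"
proof -
 interpret P: sheaf P by (rule lrsD(1)[OF P])
 interpret c: mor P X c by fact
 interpret C: chart X V "sec X V" "%s. s" by (rule affine_chart[OF X V])
 let ?G = "sec P N" let ?Q = "Spec ?G" let ?e = "Spec_elt ?G" let ?p = "points ?Q" let ?R = "restrict_space P N"
 interpret G: cring ?G by (rule P.sec_cring[OF O])
 interpret Sc: chart ?Q ?p ?G ?e by (rule Spec_chart[OF G.cring_axioms])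
 note oV = c.preim_open[OF C.V_open]
 define ph where "ph = (%s. ?e (res P (preim P c V) N (smap c V s)))"
 have "ph : ring_hom (sec X V) (sec ?Q ?p)"
  unfolding ph_def by (rule hom_comp[OF hom_comp[OF c.smap_hom[OF C.V_open] P.res_hom[OF oV O NV]] Sc.iota_hom])
 then obtain u where u: "mor ?Q X u" "!!q. q : ?p ==> pmap u q : V" "!!s. s el sec X V ==> smap u V s = ph s"
  by (rule C.morphism_to_chart[OF Sc.lrs]) blast
 interpret u: mor ?Q X u by (rule u(1))
 have s: "smap u W s = ?e (res P (preim P c W) N (smap c W s))" if W: "opn X W" "V <= W" and s: "s el sec X W" for W s
 proof -
  have pu: "preim ?Q u V = ?p" "preim ?Q u W = ?p" using u(2) W(2) by (auto simp: preim_def)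
  have "smap u W s = smap u V (res X W V s)"
   using u.smap_res[OF W(1) C.V_open W(2) s] Sc.res_id[OF Sc.V_open] u.smap_closed[OF W(1) s] unfolding pu by simp
  also have "... = ?e (res P (preim P c W) N (smap c W s))"
   unfolding u(3)[OF c.Y.res_closed[OF W(1) C.V_open W(2) s]] ph_def c.smap_res[OF W(1) C.V_open W(2) s]
    P.res_res[OF c.preim_open[OF W(1)] oV O NV preim_mono[OF W(2)] c.smap_closed[OF W(1) s]] ..
  finally show ?thesis .
 qed
 show ?thesis
 proof (rule that[OF u(1,2) s])
  fix l k assume l: "mor ?Q P l" "mor_eq ?Q X (comp_mor P l c) u" and k: "mor ?R ?Q k" "!!a. a el ?G ==> smap k ?p (?e a) = a"
  interpret k: mor ?R ?Q k by (rule k(1))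
  have oi: "mor ?R P (open_incl P N)" by (rule mor_open_incl[OF P.presheaf_axioms O])
  have R: "sheaf ?R" by (rule sheaf_restrict[OF P.sheaf_axioms O])
  have "mor_eq ?R X (comp_mor P (comp_mor ?Q k l) c) (comp_mor ?Q k (comp_mor P l c))" by (rule comp_assoc[OF l(1)])
  moreover have "mor_eq ?R X (comp_mor ?Q k (comp_mor P l c)) (comp_mor ?Q k u)" by (rule mor_eq_comp_right[OF l(2) k(1) mor_comp[OF l(1) c]])
  moreover have "mor_eq ?R X (comp_mor ?Q k u) (comp_mor P (open_incl P N) c)"
  proof (rule C.morphisms_to_chart_eq[OF R mor_comp[OF k(1) u(1)] mor_comp[OF oi c]])
   fix q assume q: "q : points ?R"
   show "pmap (comp_mor ?Q k u) q : V" using u(2)[OF k.pmap_in[OF q]] by simp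
   show "pmap (comp_mor P (open_incl P N) c) q : V" using q NV unfolding restrict_points[OF O] by auto
  next
   fix s assume sc: "s el sec X V"
   have "preim ?Q u V = ?p" using u(2) by (auto simp: preim_def)
   moreover have "N Int preim P c V = N" using NV by blast
   ultimately show "smap (comp_mor ?Q k u) V s = smap (comp_mor P (open_incl P N) c) V s"
    using s[OF C.V_open _ sc] k(2)[OF P.res_closed[OF oV O NV c.smap_closed[OF C.V_open sc]]] by simp
  qed
  ultimately show "mor_eq ?R X (comp_mor P (comp_mor ?Q k l) c) (comp_mor P (open_incl P N) c)"
   using mor_trans by blast
 qed
qed

text \<open>Around a point of \<open>P\<close> choose affine \<open>V\<close> and \<open>B\<close>
  lying over one affine \<open>U\<close> of \<open>Y\<close>. The canonical morphisms from the
  spectrum of the sections over \<open>?N\<close> to \<open>X\<close> and \<open>T\<close> agree in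
  \<open>Y\<close>, hence give a morphism \<open>l\<close> to \<open>P\<close>, and
  \<open>pair_uniq\<close> recognises it as the left inverse in \<open>affine_openI\<close>. The
  sections over \<open>?N\<close> are never computed.\<close>

lemma (in fibre) P_scheme:
 assumes X: "scheme X" and T: "scheme T" and Y: "scheme Y"
 shows "scheme P"
proof -
 note Xl = scheme_lrs[OF X] and Tl = scheme_lrs[OF T] and Yl = scheme_lrs[OF Y]
 interpret pa: mor P X pa by (rule pa_mor)
 interpret pb: mor P T pb by (rule pb_mor)
 have "EX N. z : N & affine_open P N" if z: "z : points P" for z
 proof -
  have pz: "pmap p (pmap pa z) = pmap g (pmap pb z)" using mor_eq_pmap[OF square z] by simp
  obtain U where U: "pmap p (pmap pa z) : U" "affine_open Y U"
   using Y p.pmap_in[OF pa.pmap_in[OF z]] unfolding scheme_def by blast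
  interpret CU: chart Y U "sec Y U" "%s. s" by (rule affine_chart[OF Yl U(2)])
  obtain V where V: "affine_open X V" "pmap pa z : V" "V <= preim X p U"
   by (rule affine_basis[OF X p.preim_open[OF CU.V_open], of "pmap pa z"]) (use U pa.pmap_in[OF z] in auto)
  obtain B where B: "affine_open T B" "pmap pb z : B" "B <= preim T g U"
   by (rule affine_basis[OF T g.preim_open[OF CU.V_open], of "pmap pb z"]) (use U pb.pmap_in[OF z] pz in auto)
  have oV: "opn X V" and oB: "opn T B" using V B by (auto simp: affine_open_def)
  let ?N = "preim P pa V Int preim P pb B"
  have oN: "opn P ?N" using pa.preim_open[OF oV] pb.preim_open[OF oB] by (rule openin_Int)
  let ?Q = "Spec (sec P ?N)" let ?e = "Spec_elt (sec P ?N)"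
  interpret G: cring "sec P ?N" by (rule I.P.F.sec_cring[OF oN])
  note Ql = Spec_lrs[OF G.cring_axioms]
  obtain u where u: "mor ?Q X u" "!!q. q : points ?Q ==> pmap u q : V"
   "!!W s. opn X W ==> V <= W ==> s el sec X W ==> smap u W s = ?e (res P (preim P pa W) ?N (smap pa W s))"
   "!!l k. mor ?Q P l ==> mor_eq ?Q X (comp_mor P l pa) u ==> mor (restrict_space P ?N) ?Q k ==>
    (!!a. a el sec P ?N ==> smap k (points ?Q) (?e a) = a) ==>
    mor_eq (restrict_space P ?N) X (comp_mor P (comp_mor ?Q k l) pa) (comp_mor P (open_incl P ?N) pa)"
   by (rule morphism_from_open_Spec[OF I.P_lrs oN pa_mor Xl V(1) Int_lower1]) blast
  obtain v where v: "mor ?Q T v" "!!q. q : points ?Q ==> pmap v q : B"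
   "!!W s. opn T W ==> B <= W ==> s el sec T W ==> smap v W s = ?e (res P (preim P pb W) ?N (smap pb W s))"
   "!!l k. mor ?Q P l ==> mor_eq ?Q T (comp_mor P l pb) v ==> mor (restrict_space P ?N) ?Q k ==>
    (!!a. a el sec P ?N ==> smap k (points ?Q) (?e a) = a) ==>
    mor_eq (restrict_space P ?N) T (comp_mor P (comp_mor ?Q k l) pb) (comp_mor P (open_incl P ?N) pb)"
   by (rule morphism_from_open_Spec[OF I.P_lrs oN pb_mor Tl B(1) Int_lower2]) blast
  have "mor_eq ?Q Y (comp_mor X u p) (comp_mor T v g)"
  proof (rule CU.morphisms_to_chart_eq[OF lrsD(1)[OF Ql] mor_comp[OF u(1) p.mor_axioms] mor_comp[OF v(1) g.mor_axioms]])
   show "pmap (comp_mor X u p) q : U" "pmap (comp_mor T v g) q : U" if "q : points ?Q" for q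
    using u(2)[OF that] v(2)[OF that] V(3) B(3) by auto
   fix r assume r: "r el sec Y U"
   show "smap (comp_mor X u p) U r = smap (comp_mor T v g) U r"
    using u(3)[OF p.preim_open[OF CU.V_open] V(3) p.smap_closed[OF CU.V_open r]]
     v(3)[OF g.preim_open[OF CU.V_open] B(3) g.smap_closed[OF CU.V_open r]]
     mor_eq_smap[OF square CU.V_open r] mor_eq_preim[OF square, of U] preim_comp[OF mor.axioms(1)[OF pa_mor], of p U] preim_comp[OF mor.axioms(1)[OF pb_mor], of g U] by simp
  qed
  then obtain l where l: "mor ?Q P l" "mor_eq ?Q X (comp_mor P l pa) u" "mor_eq ?Q T (comp_mor P l pb) v"
   by (rule pair_univ[OF Ql u(1) v(1)])
  interpret l: mor ?Q P l by (rule l(1))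
  have "affine_open P ?N"
  proof (rule affine_openI[OF I.P_lrs oN l(1)])
   show "pmap l q : ?N" if "q : points ?Q" for q
    using u(2)[OF that] v(2)[OF that] mor_eq_pmap[OF l(2) that] mor_eq_pmap[OF l(3) that] l.pmap_in[OF that] by simp
   fix k assume k: "mor (restrict_space P ?N) ?Q k" "!!a. a el sec P ?N ==> smap k (points ?Q) (?e a) = a"
   show "mor_eq (restrict_space P ?N) P (comp_mor ?Q k l) (open_incl P ?N)"
    by (rule pair_uniq[OF sheaf_restrict[OF I.P.F.sheaf_axioms oN] mor_comp[OF k(1) l(1)] mor_open_incl[OF I.P.F.presheaf_axioms oN]
     u(4)[OF l(1,2) k] v(4)[OF l(1,3) k]])
  qed
  then show ?thesis using z V(2) B(2) by (intro exI[of _ ?N]) simp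
 qed
 then show ?thesis unfolding scheme_def using I.P_lrs by blast
qed

section \<open>Copies of a scheme in other types\<close>

lemma inverse_reflects_units:
 assumes f: "premor X Y f" and g: "premor Y X g" and fg: "mor_eq X X (comp_mor Y f g) id_mor" and gf: "mor_eq Y Y (comp_mor X g f) id_mor"
 shows "reflects_units X Y f"
 unfolding reflects_units_def
proof (intro ballI allI impI)
 interpret f: premor X Y f by fact
 interpret g: premor Y X g by fact
 fix x V s assume x: "x : points X" and V: "opn Y V" "pmap f x : V" "s el sec Y V"
  and u: "germ X x (preim X f V) (smap f V s) : Units (stalk X x)"
 let ?y = "pmap f x"
 have gx: "pmap g ?y = x" using mor_eq_pmap[OF fg x] by simp
 have y: "?y : points Y" by (rule f.pmap_in[OF x])
 have "stalk_map Y X g ?y (germ X (pmap g ?y) (preim X f V) (smap f V s)) = germ Y ?y (preim Y g (preim X f V)) (smap g (preim X f V) (smap f V s))"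
  by (rule g.stalk_map_germ[OF y f.preim_open[OF V(1)] _ f.smap_closed[OF V(1,3)]]) (use gx x V in simp)
 moreover have "preim Y g (preim X f V) = V"
  using mor_eq_pmap[OF gf] g.pmap_in openin_subset[OF V(1)] by (auto simp: preim_def)
 moreover have "smap g (preim X f V) (smap f V s) = s" using mor_eq_smap[OF gf V(1,3)] by simp
 ultimately show "germ Y ?y V s : Units (stalk Y ?y)"
  using ring_hom_Units[OF g.stalk_map_hom[OF y], of "germ X x (preim X f V) (smap f V s)"] u gx by simp
qed

text \<open>Copies \<open>P\<close> along injections into other types, since the universal property in \<open>fibre_product\<close> only
 speaks about spaces over the type \<open>fp\<close>.\<close>

locale transport = sheaf P for P :: "('p, 'r) ringed_space" +
 fixes i :: "'p => 'k" and j :: "'p set => 'r => 'l"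
 assumes i_inj: "inj_on i (points P)" and j_inj: "!!U. opn P U ==> inj_on (j U) (carrier (sec P U))"
begin

definition "pre U = {x : points P. i x : U}"
definition "opn' U <-> U <= i ` points P & opn P (pre U)"
definition "dec U = inv_into (carrier (sec P (pre U))) (j (pre U))"
definition "P' = (|pts = topology opn', sec = (%U. image_ring (j (pre U)) (sec P (pre U))),
 res = (%U V r. j (pre V) (res P (pre U) (pre V) (dec U r)))|)"
definition "to_P = (|pmap = inv_into (points P) i, smap = j|)"
definition "of_P = (|pmap = i, smap = dec|)"

lemma pre_Union: "pre (\<Union>K) = \<Union>(pre ` K)" and pre_Int: "pre (U Int V) = pre U Int pre V"
 by (auto simp: pre_def)

lemma img_pre: "U <= i ` points P ==> i ` pre U = U"
 by (auto simp: pre_def)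

lemma pre_img: "U <= points P ==> pre (i ` U) = U"
 using i_inj by (auto simp: pre_def inj_on_def)

lemma opn_P': "opn P' U <-> opn' U"
proof -
 have "istopology opn'"
  unfolding istopology_def opn'_def pre_Union pre_Int by auto
 then show ?thesis unfolding P'_def by (simp add: topology_inverse')
qed

lemma pre_open: "opn P' U ==> opn P (pre U)" and opn_sub': "opn P' U ==> U <= i ` points P"
 unfolding opn_P' opn'_def by auto

lemma img_open: "opn P U ==> opn P' (i ` U)"
 unfolding opn_P' opn'_def using pre_img[OF opn_sub] image_mono[OF opn_sub] by simp

lemma points_P': "points P' = i ` points P"
 using opn_sub'[OF openin_topspace] openin_subset[OF img_open[OF openin_topspace]] by blast

lemma P'_simps: "sec P' U = image_ring (j (pre U)) (sec P (pre U))"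
 "res P' U V r = j (pre V) (res P (pre U) (pre V) (dec U r))"
 by (simp_all add: P'_def)

lemma j_hom: "opn P' U ==> j (pre U) : ring_hom (sec P (pre U)) (sec P' U)"
 unfolding P'_simps using inj_imp_image_ring_iso[OF j_inj[OF pre_open]] by (simp add: ring_iso_def)

lemma dec_j: "opn P' U ==> s el sec P (pre U) ==> dec U (j (pre U) s) = s"
 unfolding dec_def by (rule inv_into_f_f[OF j_inj[OF pre_open]])

lemma secE:
 assumes "opn P' U" "r el sec P' U"
 obtains s where "s el sec P (pre U)" "r = j (pre U) s" "dec U r = s"
 using assms dec_j[OF assms(1)] unfolding P'_simps image_ring_carrier by blast

lemma cring_P': "opn P' U ==> cring (sec P' U)"
 unfolding P'_simps using cring.ring_iso_imp_img_cring[OF sec_cring[OF pre_open] inj_imp_image_ring_iso[OF j_inj[OF pre_open]]]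
 by (simp add: image_ring_zero flip: image_ring_zero)

lemma dec_hom: "opn P' U ==> dec U : ring_hom (sec P' U) (sec P (pre U))"
proof -
 assume U: "opn P' U"
 interpret R: cring "sec P (pre U)" by (rule sec_cring[OF pre_open[OF U]])
 note [simp] = ring_hom_mult[OF j_hom[OF U], symmetric] ring_hom_add[OF j_hom[OF U], symmetric] ring_hom_one[OF j_hom[OF U], symmetric] dec_j[OF U]
 show ?thesis by (rule ring_hom_memI; (elim secE[OF U])?; simp)
qed

lemma P'_presheaf: "presheaf P'"
proof (rule presheaf.intro, unfold presheaf_of_rings_def, intro conjI allI impI ballI)
 show "cring (sec P' U)" if "opn P' U" for U by (rule cring_P'[OF that])
 have m: "V <= U ==> pre V <= pre U" for U V by (auto simp: pre_def)
 show "res P' U V : ring_hom (sec P' U) (sec P' V)" if "opn P' U" "opn P' V" "V <= U" for U V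
  using hom_comp[OF hom_comp[OF dec_hom[OF that(1)] res_hom[OF pre_open[OF that(1)] pre_open[OF that(2)] m[OF that(3)]]] j_hom[OF that(2)]]
  by (rule ring_hom_cong) (simp_all add: P'_simps(2) cring.axioms(1)[OF cring_P'[OF that(1)]])
 show "res P' U U s = s" if "opn P' U" "s el sec P' U" for U s
  by (rule secE[OF that]) (simp add: P'_simps(2) res_id[OF pre_open[OF that(1)]])
 show "res P' V W (res P' U V s) = res P' U W s" if o: "opn P' U" "opn P' V" "opn P' W" "W <= V" "V <= U" and s: "s el sec P' U" for U V W s
  by (rule secE[OF o(1) s])
   (simp add: P'_simps(2) dec_j[OF o(2)] res_closed[OF pre_open[OF o(1)] pre_open[OF o(2)] m[OF o(5)]]
    res_res[OF pre_open[OF o(1)] pre_open[OF o(2)] pre_open[OF o(3)] m[OF o(4)] m[OF o(5)]])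
qed

sublocale P': presheaf P' by (rule P'_presheaf)

lemma P'_sheaf: "sheaf P'"
proof (rule sheafI, unfold sheaf_of_rings_def, intro conjI allI impI)
 show "presheaf_of_rings P'" by (rule P'.presheaf)
 fix UU s assume U: "ALL U:UU. opn P' U" and s: "ALL U:UU. s U el sec P' U"
  and c: "ALL U:UU. ALL V:UU. res P' U (U Int V) (s U) = res P' V (U Int V) (s V)"
 have im: "i ` pre U = U" if "U : UU" for U using img_pre[OF opn_sub'] U that by blast
 define t where "t U = dec (i ` U) (s (i ` U))" for U
 have t: "t (pre U) el sec P (pre U)" "s U = j (pre U) (t (pre U))" if "U : UU" for U
  using that U s im[OF that] by (auto simp: t_def elim!: secE[of U "s U"])
 have oU: "opn P' (\<Union>UU)" using U by blast
 have ex: "EX! r. r el (sec P (\<Union>(pre ` UU))) & (ALL V:pre ` UU. res P (\<Union>(pre ` UU)) V r = t V)"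
 proof (rule glue)
  show "opn P V" if "V : pre ` UU" for V using that U pre_open by blast
  show "t V el sec P V" if "V : pre ` UU" for V using that t by blast
  fix A B assume "A : pre ` UU" "B : pre ` UU"
  then obtain V W where V: "V : UU" "A = pre V" and W: "W : UU" "B = pre W" by blast
  have o: "opn P' V" "opn P' W" "opn P' (V Int W)" using U V W by auto
  have "j (pre (V Int W)) (res P (pre V) (pre (V Int W)) (t (pre V))) = j (pre (V Int W)) (res P (pre W) (pre (V Int W)) (t (pre W)))"
   using bspec[OF bspec[OF c V(1)] W(1)] t[OF V(1)] t[OF W(1)] dec_j[OF o(1)] dec_j[OF o(2)] unfolding P'_simps(2) by simp
  then have "res P (pre V) (pre (V Int W)) (t (pre V)) = res P (pre W) (pre (V Int W)) (t (pre W))"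
   by (rule inj_onD[OF j_inj[OF pre_open[OF o(3)]]]) (use t V W pre_open o in "auto intro!: res_closed simp: pre_Int")
  then show "res P A (A Int B) (t A) = res P B (A Int B) (t B)" unfolding V W pre_Int .
 qed
 have eq: "(ALL U:UU. res P' (\<Union>UU) U (j (pre (\<Union>UU)) r) = s U) <-> (ALL V:pre ` UU. res P (\<Union>(pre ` UU)) V r = t V)"
  if r: "r el (sec P (pre (\<Union>UU)))" for r
 proof -
  have "res P' (\<Union>UU) V (j (pre (\<Union>UU)) r) = s V <-> res P (pre (\<Union>UU)) (pre V) r = t (pre V)" if V: "V : UU" for V
  proof -
   have o: "opn P' V" using U V by blast
   have "pre V <= pre (\<Union>UU)" using V by (auto simp: pre_def)
   then have "res P (pre (\<Union>UU)) (pre V) r el sec P (pre V)" by (rule res_closed[OF pre_open[OF oU] pre_open[OF o] _ r])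
   then show ?thesis unfolding P'_simps(2) dec_j[OF oU r] t(2)[OF V] by (rule inj_on_eq_iff[OF j_inj[OF pre_open[OF o]] _ t(1)[OF V]])
  qed
  then show ?thesis unfolding pre_Union[symmetric] by blast
 qed
 define G where "G r <-> r el (sec P (pre (\<Union>UU))) & (ALL V:pre ` UU. res P (\<Union>(pre ` UU)) V r = t V)" for r
 have "EX! r. G r" using ex unfolding G_def pre_Union .
 then obtain r where Gr: "G r" and un: "ALL r'. G r' --> r' = r" by (rule ex1E)
 have r: "r el (sec P (pre (\<Union>UU)))" using Gr G_def by blast
 show "EX! r. r el sec P' (\<Union>UU) & (ALL U:UU. res P' (\<Union>UU) U r = s U)"
 proof (rule ex1I[of _ "j (pre (\<Union>UU)) r"])
  show "j (pre (\<Union>UU)) r el sec P' (\<Union>UU) & (ALL U:UU. res P' (\<Union>UU) U (j (pre (\<Union>UU)) r) = s U)"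
   using hom_car[OF j_hom[OF oU] r] eq[OF r] Gr unfolding G_def by blast
  fix r' assume h: "r' el sec P' (\<Union>UU) & (ALL U:UU. res P' (\<Union>UU) U r' = s U)"
  obtain r0 where r0: "r0 el (sec P (pre (\<Union>UU)))" "r' = j (pre (\<Union>UU)) r0"
   using secE[OF oU conjunct1[OF h]] by metis
  have "G r0" using eq[OF r0(1)] conjunct2[OF h] r0 unfolding G_def by metis
  then show "r' = j (pre (\<Union>UU)) r" using un r0(2) by metis
 qed
qed

lemma preim_to: "U <= points P ==> preim P' to_P U = i ` U"
 unfolding preim_def points_P' to_P_def using i_inj by (auto simp: inv_into_f_f subset_iff image_iff)

lemma preim_of: "preim P of_P U = pre U"
 by (simp add: preim_def of_P_def pre_def)

lemma to_P: "premor P' P to_P"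
proof unfold_locales
 show "continuous_map (pts P') (pts P) (pmap to_P)"
  unfolding continuous_map_def
 proof (intro conjI allI impI)
  show "pmap to_P : points P' \<rightarrow> points P" unfolding points_P' to_P_def by (auto intro: inv_into_into)
  fix U assume "opn P U"
  then show "opn P' {x : points P'. pmap to_P x : U}"
   using preim_to[OF opn_sub] img_open unfolding preim_def by simp
 qed
 show "smap to_P U : ring_hom (sec P U) (sec P' (preim P' to_P U))" if "opn P U" for U
  using j_hom[OF img_open[OF that]] preim_to[OF opn_sub[OF that]] pre_img[OF opn_sub[OF that]] by (simp add: to_P_def)
 show "smap to_P V (res P U V s) = res P' (preim P' to_P U) (preim P' to_P V) (smap to_P U s)"
  if "opn P U" "opn P V" "V <= U" "s el sec P U" for U V s
  using that preim_to[OF opn_sub] pre_img[OF opn_sub] dec_j[OF img_open, of U s] by (simp add: to_P_def P'_simps(2))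
qed

lemma of_P: "premor P P' of_P"
proof unfold_locales
 show "continuous_map (pts P) (pts P') (pmap of_P)"
  unfolding continuous_map_def points_P' using pre_open by (auto simp: of_P_def pre_def)
 show "smap of_P U : ring_hom (sec P' U) (sec P (preim P of_P U))" if "opn P' U" for U
  using dec_hom[OF that] unfolding preim_of by (simp add: of_P_def)
 show "smap of_P V (res P' U V s) = res P (preim P of_P U) (preim P of_P V) (smap of_P U s)"
  if o: "opn P' U" "opn P' V" "V <= U" and s: "s el sec P' U" for U V s
 proof -
  have "pre V <= pre U" using o(3) by (auto simp: pre_def)
  then show ?thesis unfolding preim_of
   by (rule_tac secE[OF o(1) s]) (simp add: of_P_def P'_simps(2) dec_j[OF o(2)] res_closed[OF pre_open[OF o(1)] pre_open[OF o(2)]])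
 qed
qed

lemma to_of: "mor_eq P' P' (comp_mor P to_P of_P) id_mor" and of_to: "mor_eq P P (comp_mor P' of_P to_P) id_mor"
proof -
 show "mor_eq P' P' (comp_mor P to_P of_P) id_mor"
  unfolding mor_eq_def comp_simps preim_of points_P'
 proof (intro conjI ballI allI impI)
  show "pmap of_P (pmap to_P x) = x" if "x : i ` points P" for x using that by (simp add: of_P_def to_P_def f_inv_into_f)
  show "smap to_P (pre V) (smap of_P V s) = s" if "opn P' V" "s el sec P' V" for V s
   by (rule secE[OF that]) (simp add: to_P_def of_P_def)
 qed
 show "mor_eq P P (comp_mor P' of_P to_P) id_mor"
  unfolding mor_eq_def comp_simps
 proof (intro conjI ballI allI impI)
  show "pmap to_P (pmap of_P x) = x" if "x : points P" for x using that i_inj by (simp add: of_P_def to_P_def)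
  show "smap of_P (preim P' to_P V) (smap to_P V s) = s" if "opn P V" "s el sec P V" for V s
   using dec_j[OF img_open[OF that(1)]] pre_img[OF opn_sub[OF that(1)]] that(2) unfolding preim_to[OF opn_sub[OF that(1)]] by (simp add: to_P_def of_P_def)
 qed
qed

lemma to_P_mor: "mor P' P to_P"
 by (rule mor.intro[OF to_P mor_axioms.intro[OF inverse_reflects_units[OF to_P of_P to_of of_to]]])

lemma of_P_mor: "mor P P' of_P"
 by (rule mor.intro[OF of_P mor_axioms.intro[OF inverse_reflects_units[OF of_P to_P of_to to_of]]])

lemma of_P_to_P: "mor Q P h ==> mor_eq Q P (comp_mor P' (comp_mor P h of_P) to_P) h"
 by (rule mor_trans[OF comp_assoc[OF of_P_mor] mor_trans[OF mor_eq_comp_right[OF of_to _ mor_comp[OF of_P_mor to_P_mor]] comp_id_right[OF presheaf_axioms]]])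

lemma to_P_cancel:
 assumes a: "mor Q P' a" "mor Q P' b" and e: "mor_eq Q P (comp_mor P' a to_P) (comp_mor P' b to_P)"
 shows "mor_eq Q P' a b"
proof -
 have c: "mor_eq Q P' (comp_mor P (comp_mor P' c to_P) of_P) c" if "mor Q P' c" for c
  by (rule mor_trans[OF comp_assoc[OF to_P_mor] mor_trans[OF mor_eq_comp_right[OF to_of that mor_comp[OF to_P_mor of_P_mor]] comp_id_right[OF P'_presheaf]]])
 show ?thesis
  by (rule mor_trans[OF mor_eq_sym[OF c[OF a(1)]] mor_trans[OF mor_eq_comp_left[OF e mor_comp[OF a(1) to_P_mor] of_P_mor] c[OF a(2)]]])
qed

lemma P'_scheme:
 assumes P: "scheme P"
 shows "scheme P'"
proof -
 note Pl = scheme_lrs[OF P]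
 interpret f: mor P' P to_P by (rule to_P_mor)
 interpret h: mor P P' of_P by (rule of_P_mor)
 have "local_ring (stalk P' x)" if x: "x : points P'" for x
 proof -
  have y: "pmap to_P x : points P" and hy: "pmap of_P (pmap to_P x) = x"
   using f.pmap_in[OF x] mor_eq_pmap[OF to_of x] by auto
  show ?thesis
   by (rule local_ring_reflect[OF P'.stalk_cring[OF x] lrsD(2)[OF Pl y] h.stalk_map_hom[OF y, unfolded hy]])
    (use h.stalk_map_unit_iff[OF y] hy in simp)
 qed
 then have lrs: "locally_ringed_space P'" unfolding locally_ringed_space_def using sheaf.sheaf[OF P'_sheaf] by blast
 have "EX U. x : U & affine_open P' U" if x: "x : points P'" for x
 proof -
  obtain V where V: "pmap to_P x : V" "affine_open P V" using P f.pmap_in[OF x] unfolding scheme_def by blast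
  let ?N = "preim P' to_P V" let ?Q = "Spec (sec P' ?N)" let ?R = "restrict_space P' ?N"
  have oN: "opn P' ?N" using f.preim_open V(2) by (simp add: affine_open_def)
  obtain u where u: "mor ?Q P u" "!!q. q : points ?Q ==> pmap u q : V"
   "!!l k. mor ?Q P' l ==> mor_eq ?Q P (comp_mor P' l to_P) u ==> mor ?R ?Q k ==>
    (!!a. a el sec P' ?N ==> smap k (points ?Q) (Spec_elt (sec P' ?N) a) = a) ==>
    mor_eq ?R P (comp_mor P' (comp_mor ?Q k l) to_P) (comp_mor P' (open_incl P' ?N) to_P)"
   by (rule morphism_from_open_Spec[OF lrs oN to_P_mor Pl V(2) order_refl]) blast
  interpret u: mor ?Q P u by (rule u(1))
  let ?l = "comp_mor P u of_P"
  have l: "mor ?Q P' ?l" by (rule mor_comp[OF u(1) of_P_mor])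
  have "affine_open P' ?N"
  proof (rule affine_openI[OF lrs oN l])
   show "pmap ?l q : ?N" if q: "q : points ?Q" for q
    using u(2)[OF q] u.pmap_in[OF q] h.pmap_in mor_eq_pmap[OF of_to, of "pmap u q"] by simp
   fix k assume k: "mor ?R ?Q k" "!!a. a el sec P' ?N ==> smap k (points ?Q) (Spec_elt (sec P' ?N) a) = a"
   show "mor_eq ?R P' (comp_mor ?Q k ?l) (open_incl P' ?N)"
    by (rule to_P_cancel[OF mor_comp[OF k(1) l] mor_open_incl[OF P'_presheaf oN] u(3)[OF l of_P_to_P[OF u(1)] k]])
  qed
  then show ?thesis using V(1) x by (intro exI[of _ ?N]) simp
 qed
 then show ?thesis unfolding scheme_def using lrs by blast
qed

end

type_synonym ('x, 'rx, 't, 'rt) fpe = "'x + 'rx + 't + 'rt + nat"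
type_synonym ('x, 'rx, 't, 'rt) fp_space = "(('x, 'rx, 't, 'rt) fp, ('x, 'rx, 't, 'rt) fp) ringed_space"

text \<open>The summand \<open>nat\<close> makes the type infinite, and an infinite type is
  equipotent with the type of lists over it.\<close>

lemma list_code: obtains c :: "('x, 'rx, 't, 'rt) fpe list => ('x, 'rx, 't, 'rt) fpe" where "inj c"
 using lists_infinite_bij_betw_types[where 'a = "('x, 'rx, 't, 'rt) fpe"] by (auto simp: finite_Plus_UNIV_iff intro: bij_is_inj)

subsection \<open>Cardinality\<close>

context
 fixes c :: "'k list => 'k"
 assumes c: "inj c"
begin

lemma c_eq [simp]: "c l = c l' <-> l = l'"
 using c by (simp add: inj_eq)

lemma inj_pair_lists:
 fixes f :: "'a => 'k" and g :: "'b => 'k"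
 assumes f: "inj_on f A" and g: "inj_on g B"
 obtains e :: "('a \<times> 'b) list => 'k" where "inj_on e (lists (A \<times> B))"
proof -
 have "inj_on (map (%(a, b). c [f a, g b])) (lists (A \<times> B))"
  by (rule inj_on_mapI, rule inj_on_subset[of _ "A \<times> B"]) (use f g in "auto simp: inj_on_def")
 then have "inj_on (c \<circ> map (%(a, b). c [f a, g b])) (lists (A \<times> B))" by (rule comp_inj_on) (use c in "auto intro: inj_on_subset")
 then show ?thesis by (rule that)
qed

text \<open>A set that is the image of lists over two small sets is small: choose one list for each
  element and code it. Localisations, stalks and tensor products are bounded in this way.\<close>

lemma inj_of_lists:
 fixes f :: "'a => 'k" and g :: "'b => 'k"
 assumes f: "inj_on f A" and g: "inj_on g B" and s: "!!x. x : D ==> EX l:lists (A \<times> B). x = s l"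
 obtains e :: "'d => 'k" where "inj_on e D"
proof -
 obtain e :: "('a \<times> 'b) list => 'k" where e: "inj_on e (lists (A \<times> B))" by (rule inj_pair_lists[OF f g])
 define r where "r x = (SOME l. l : lists (A \<times> B) & x = s l)" for x
 have r: "r x : lists (A \<times> B)" "x = s (r x)" if "x : D" for x
  using someI_ex[of "%l. l : lists (A \<times> B) & x = s l"] s[OF that] unfolding r_def by blast+
 have "inj_on (%x. e (r x)) D"
 proof (rule inj_onI)
  fix x y assume h: "x : D" "y : D" "e (r x) = e (r y)"
  have "r x = r y" by (rule inj_onD[OF e h(3) r(1)[OF h(1)] r(1)[OF h(2)]])
  then show "x = y" using r(2)[OF h(1)] r(2)[OF h(2)] by metis
 qed
 then show ?thesis by (rule that)
qed

lemma inj_localisation: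
 fixes f :: "'a => 'k"
 assumes m: "mult_set R S" and f: "inj_on f (carrier R)"
 obtains e :: "('a \<times> 'a) set => 'k" where "inj_on e (carrier (localisation R S))"
proof -
 interpret mult_set R S by fact
 show ?thesis
 proof (rule inj_of_lists[OF f f, of "carrier (localisation R S)" "%l. frac R S (fst (hd l)) (snd (hd l))"])
  fix x assume "x el localisation R S"
  then obtain a s where "a el R" "s : S" "x = frac R S a s" unfolding loc_carrier by blast
  then show "EX l:lists (carrier R \<times> carrier R). x = frac R S (fst (hd l)) (snd (hd l))" using S_carr by (intro bexI[of _ "[(a, s)]"]) auto
 qed (rule that)
qed

lemma inj_scheme_stalk:
 fixes X :: "('x, 'rx) ringed_space"
 assumes X: "scheme X" and x: "x : points X" and f: "inj (f :: 'rx => 'k)"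
 obtains e :: "('x set \<times> 'rx) set => 'k" where "inj_on e (carrier (stalk X x))"
proof -
 obtain V where V: "x : V" "affine_open X V" using X x unfolding scheme_def by blast
 interpret C: chart X V "sec X V" "%s. s" by (rule affine_chart[OF scheme_lrs[OF X] V(2)])
 interpret R: cring "stalk X x" by (rule C.st_cring[OF V(1)])
 let ?s = "%l :: ('rx \<times> 'rx) list. C.gi x (fst (hd l)) *[stalk X x] inv[stalk X x] C.gi x (snd (hd l))"
 show ?thesis
 proof (rule inj_of_lists[OF f f, of "carrier (stalk X x)" ?s])
  fix ga assume g: "ga el stalk X x"
  obtain a d where ad: "a el sec X V" "d el sec X V" "C.gi x d : Units (stalk X x)" "ga *[stalk X x] C.gi x d = C.gi x a"
   using C.fraction[OF V(1) g] by blast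
  have "?s [(a, d)] = ga"
   unfolding list.sel fst_conv snd_conv ad(4)[symmetric] R.m_assoc[OF g R.Units_closed[OF ad(3)] R.Units_inv_closed[OF ad(3)]]
    R.Units_r_inv[OF ad(3)] R.r_one[OF g] ..
  then show "EX l:lists (UNIV \<times> UNIV). ga = ?s l" by (intro bexI[of _ "[(a, d)]"]) auto
 qed (rule that)
qed

lemma fun_transport:
 fixes e :: "'p => 'k set" and R :: "'p => 'r ring"
 assumes F: "fun_data T R L" and e: "inj_on e (topspace T)" "!!z. z : topspace T ==> e z ~= {}"
  and l: "!!z. z : topspace T ==> EX l :: 'r => 'k. inj_on l (carrier (R z))"
 obtains i :: "'p => 'k set set" and j :: "'p set => ('p => 'r) => 'k set set" where "transport (fun_space T R L) i j"
proof -
 interpret fun_data T R L by fact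
 obtain l :: "'p => 'r => 'k" where l: "!!z. z : topspace T ==> inj_on (l z) (carrier (R z))" using l by metis
 \<comment> \<open>The value of \<open>s\<close> at \<open>z\<close> is tagged with every element of
   \<open>e z\<close>. From the resulting set both \<open>e z\<close>, hence \<open>z\<close>, and
   the value can be read off, which is where \<open>e z\<close> has to be nonempty. A section is
   then coded by the set of these codes.\<close>
 define A where "A s z = (%k. c [k, l z (s z)]) ` e z" for s z
 have "transport F (%z. {e z}) (%U s. A s ` U)"
 proof (rule transport.intro[OF F_sheaf transport_axioms.intro])
  show "inj_on (%z. {e z}) (points F)" using e(1) by (simp add: inj_on_def)
  fix U assume "opn F U"
  then have U: "z : topspace T" if "z : U" for z using openin_subset that by force
  show "inj_on (%s. A s ` U) (carrier (sec F U))"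
  proof (rule inj_onI, rule F_eqI)
   fix s t z assume s: "s el sec F U" and t: "t el sec F U" and eq: "A s ` U = A t ` U" and z: "z : U"
   obtain w where w: "w : U" "A s z = A t w" using eq z by (metis imageE imageI)
   have "k : e z <-> (EX m. c [k, m] : A s z)" for k by (auto simp: A_def)
   moreover have "k : e w <-> (EX m. c [k, m] : A t w)" for k by (auto simp: A_def)
   ultimately have "e z = e w" using w(2) by auto
   then have zw: "w = z" using e(1) U z w(1) by (auto simp: inj_on_def)
   obtain k where "k : e z" using e(2)[OF U[OF z]] by blast
   then have "c [k, l z (s z)] : A t z" using w(2) unfolding zw by (auto simp: A_def)
   then have "l z (s z) = l z (t z)" by (auto simp: A_def)
   then show "s z = t z" using inj_onD[OF l[OF U[OF z]]] F_val[OF s z] F_val[OF t z] by blast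
  qed
 qed
 then show ?thesis by (rule that)
qed

lemma Spec_transport:
 fixes A :: "'a ring" and f :: "'a => 'k"
 assumes A: "cring A" and f: "inj_on f (carrier A)"
 obtains i :: "'a set => 'k set set" and j :: "'a set set => _ => 'k set set" where "transport (Spec A) i j"
proof -
 interpret A: cring A by fact
 have p: "primeideal z A" if "z : topspace (zariski A)" for z using that zariski_topspace[OF A] by blast
 have sub: "z <= carrier A" "0[A] : z" if "z : topspace (zariski A)" for z
  using p[OF that] by (auto dest!: primeideal.axioms(1) ideal.axioms(1) dest: additive_subgroup.a_subset additive_subgroup.zero_closed)
 show ?thesis
 proof (rule fun_transport[OF Spec_fun_data[OF A], of "%z. f ` z", folded Spec_fun_space])
  show "inj_on (%z. f ` z) (topspace (zariski A))" using inj_on_image_eq_iff[OF f] sub(1) by (auto simp: inj_on_def)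
  show "EX l :: _ => 'k. inj_on l (carrier (localisation A (carrier A - z)))" if "z : topspace (zariski A)" for z
   by (rule inj_localisation[OF prime_mult_set[OF p[OF that]] f]) blast
 qed (use sub that in auto)
qed

end

text \<open>For the cardinality bound: an element of a stalk of the presheaf product is determined
  by a finite list of pairs of germs of the two factors.\<close>

lemma (in fibre) S_stalk_gen:
 assumes z: "z : points S" and d: "de el stalk S z"
 shows "EX l:lists (carrier (stalk X (fst z)) \<times> carrier (stalk T (snd z))).
  de = foldr (%(be, ga) y. stalk_map S X pr1.pr z be *[stalk S z] stalk_map S T pr2.pr z ga +[stalk S z] y) l 0[stalk S z]"
proof -
 obtain W s where W: "opn S W" "z : W" "s el DW W" "de = germ S z W s"
  using S.stalkE[OF d] by (metis S_simps(2))
 interpret t: tens_ring "XW W" "TW W" "Rl W" by (rule tr[OF W(1)])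
 note g = pr1.germ_i[OF W(1,2)] pr2.germ_i[OF W(1,2)]
 note h = S.germ_hom[OF W(1,2), unfolded S_simps(2)]
 have "EX l:lists (carrier (stalk X (fst z)) \<times> carrier (stalk T (snd z))).
  germ S z W s = foldr (%(be, ga) y. stalk_map S X pr1.pr z be *[stalk S z] stalk_map S T pr2.pr z ga +[stalk S z] y) l 0[stalk S z]"
  using W(3)
 proof (induction rule: t.D_induct)
  case zero
  show ?case using ring_hom_zero[OF h t.D.ring_axioms cring.axioms(1)[OF S.stalk_cring[OF z]]] by (intro bexI[of _ "[]"]) auto
 next
  case (add b c x)
  then obtain l where l: "l : lists (carrier (stalk X (fst z)) \<times> carrier (stalk T (snd z)))"
   "germ S z W x = foldr (%(be, ga) y. stalk_map S X pr1.pr z be *[stalk S z] stalk_map S T pr2.pr z ga +[stalk S z] y) l 0[stalk S z]" by blast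
  have "germ X (fst z) (fst ` W) b el stalk X (fst z)" "germ T (snd z) (snd ` W) c el stalk T (snd z)"
   using p.X.germ_closed[OF prj_open(1)[OF W(1)] _ add(1)] g.X.germ_closed[OF prj_open(2)[OF W(1)] _ add(2)] W(2) by auto
  then show ?case using l add ring_hom_add[OF h] ring_hom_mult[OF h] g
   by (intro bexI[of _ "(germ X (fst z) (fst ` W) b, germ T (snd z) (snd ` W) c) # l"]) auto
 qed
 then show ?thesis unfolding W(4) .
qed

lemma fibre_product_exists:
 fixes X :: "('x, 'rx) ringed_space" and T :: "('t, 'rt) ringed_space" and Y :: "('y, 'ry) ringed_space"
 assumes X: "scheme X" and T: "scheme T" and Y: "scheme Y" and p: "morphism X Y p" and g: "morphism T Y g"
 obtains P :: "('x, 'rx, 't, 'rt) fp_space" and a b where "fibre_product X T Y p g P a b"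
proof -
 interpret fibre X T Y p g
  by (intro fibre.intro lrs_mor scheme_lrs X T Y p g)
 obtain c :: "('x, 'rx, 't, 'rt) fpe list => ('x, 'rx, 't, 'rt) fpe" where c: "inj c" by (rule list_code)
 have "EX ka :: _ => ('x, 'rx, 't, 'rt) fpe. inj_on ka (carrier (stalk S z))" if z: "z : points S" for z
 proof -
  have z': "fst z : points X" "snd z : points T" using z by auto
  obtain e1 :: "_ => ('x, 'rx, 't, 'rt) fpe" where e1: "inj_on e1 (carrier (stalk X (fst z)))"
   by (rule inj_scheme_stalk[OF c X z'(1), of "%r. Inr (Inl r)"]) (simp_all add: inj_def)
  obtain e2 :: "_ => ('x, 'rx, 't, 'rt) fpe" where e2: "inj_on e2 (carrier (stalk T (snd z)))"
   by (rule inj_scheme_stalk[OF c T z'(2), of "%r. Inr (Inr (Inr (Inl r)))"]) (simp_all add: inj_def)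
  show ?thesis by (rule inj_of_lists[OF c e1 e2 S_stalk_gen[OF z]]) blast+
 qed
 then obtain ka :: "_ => _ => ('x, 'rx, 't, 'rt) fpe" where ka: "!!z. z : points S ==> inj_on (ka z) (carrier (stalk S z))" by metis
 \<comment> \<open>A point of \<open>P\<close> is a pair of points together with a prime. Each
   element of the prime is tagged with both points; as the prime contains 0, the code is nonempty
   and the two points can be recovered.\<close>
 define e where "e z = (%r. c [Inl (fst (fst z)), Inr (Inr (Inl (snd (fst z)))), ka (fst z) r]) ` snd z" for z
 have sub: "snd z <= carrier (stalk S (fst z))" "0[stalk S (fst z)] : snd z" "fst z : points S" if "z : I.Pt" for z
  using I.Pt_prime[OF that] I_PtD(1)[OF that] by (auto dest!: primeideal.axioms(1) ideal.axioms(1) dest: additive_subgroup.a_subset additive_subgroup.zero_closed)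
 have e0: "e z ~= {}" if "z : topspace I.Tp" for z using sub(2)[of z] that I.Tp_top by (auto simp: e_def)
 have ei: "inj_on e (topspace I.Tp)"
 proof (rule inj_onI)
  fix z w assume z: "z : topspace I.Tp" and w: "w : topspace I.Tp" and eq: "e z = e w"
  obtain r where "r : snd z" using sub(2)[of z] z I.Tp_top by blast
  then have "c [Inl (fst (fst z)), Inr (Inr (Inl (snd (fst z)))), ka (fst z) r] : e w" unfolding eq[symmetric] by (simp add: e_def)
  then have f: "fst z = fst w" using c_eq[OF c] by (auto simp: e_def prod_eq_iff)
  have "ka (fst z) ` snd z = ka (fst z) ` snd w"
  proof -
   have "ka (fst z) ` snd v = {k. c [Inl (fst (fst z)), Inr (Inr (Inl (snd (fst z)))), k] : e v}" if "fst v = fst z" for v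
    unfolding e_def that using c_eq[OF c] by auto
   then show ?thesis using eq f by metis
  qed
  then have "snd z = snd w" using inj_on_image_eq_iff[OF ka[of "fst z"] sub(1)[of z]] sub[of w] sub[of z] z w I.Tp_top f by auto
  then show "z = w" using f by (simp add: prod_eq_iff)
 qed
 obtain i :: "_ => ('x, 'rx, 't, 'rt) fp" and j :: "_ => _ => ('x, 'rx, 't, 'rt) fp" where "transport P i j"
 proof (rule fun_transport[OF c I.P_fun_data ei e0])
  show "EX l :: _ => ('x, 'rx, 't, 'rt) fpe. inj_on l (carrier (I.Rz z))" if "z : topspace I.Tp" for z
   by (rule inj_localisation[OF c I.Pt_mult ka[OF sub(3)]]) (use that I.Tp_top in auto)
 qed auto
 then interpret tp: transport P i j .
 have sch: "scheme tp.P'" by (rule tp.P'_scheme[OF P_scheme[OF X T Y]])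
 note to = tp.to_P_mor and fr = tp.of_P_mor
 let ?a = "comp_mor P tp.to_P pa" and ?b = "comp_mor P tp.to_P pb"
 have "fibre_product X T Y p g tp.P' ?a ?b"
  unfolding fibre_product_def
 proof (intro conjI allI impI)
  show "scheme tp.P'" by (rule sch)
  show "morphism tp.P' X ?a" "morphism tp.P' T ?b" by (intro mor_morphism mor_comp[OF to] pa_mor pb_mor)+
  show "mor_eq tp.P' Y (comp_mor X ?a p) (comp_mor T ?b g)"
   by (rule mor_trans[OF comp_assoc[OF pa_mor] mor_trans[OF mor_eq_comp_right[OF square to mor_comp[OF pa_mor p.mor_axioms]] mor_eq_sym[OF comp_assoc[OF pb_mor]]]])
  fix Q :: "('x, 'rx, 't, 'rt) fp_space" and u v
  assume Q: "scheme Q" and u: "morphism Q X u" and v: "morphism Q T v" and e: "mor_eq Q Y (comp_mor X u p) (comp_mor T v g)"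
  note Ql = scheme_lrs[OF Q]
  obtain h where h: "mor Q P h" "mor_eq Q X (comp_mor P h pa) u" "mor_eq Q T (comp_mor P h pb) v"
   by (rule pair_univ[OF Ql lrs_mor[OF Ql scheme_lrs[OF X] u] lrs_mor[OF Ql scheme_lrs[OF T] v] e])
  let ?h = "comp_mor P h tp.of_P"
  have hm: "mor Q tp.P' ?h" by (rule mor_comp[OF h(1) fr])
  note ht = tp.of_P_to_P[OF h(1)]
  have ha: "mor_eq Q X (comp_mor tp.P' ?h ?a) u" "mor_eq Q T (comp_mor tp.P' ?h ?b) v"
   by (rule mor_trans[OF mor_eq_sym[OF comp_assoc[OF to]] mor_trans[OF mor_eq_comp_left[OF ht mor_comp[OF hm to]]]], rule pa_mor, rule h(2))
    (rule mor_trans[OF mor_eq_sym[OF comp_assoc[OF to]] mor_trans[OF mor_eq_comp_left[OF ht mor_comp[OF hm to]]]], rule pb_mor, rule h(3))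
  have "mor_eq Q tp.P' ?h h'" if k: "morphism Q tp.P' h'" "mor_eq Q X (comp_mor tp.P' h' ?a) u" "mor_eq Q T (comp_mor tp.P' h' ?b) v" for h'
  proof -
   note km = lrs_mor[OF Ql scheme_lrs[OF sch] k(1)]
   show ?thesis
   proof (rule tp.to_P_cancel[OF hm km], rule pair_uniq[OF lrsD(1)[OF Ql] mor_comp[OF hm to] mor_comp[OF km to]])
    show "mor_eq Q X (comp_mor P (comp_mor tp.P' ?h tp.to_P) pa) (comp_mor P (comp_mor tp.P' h' tp.to_P) pa)"
     by (rule mor_trans[OF comp_assoc[OF to] mor_trans[OF ha(1) mor_trans[OF mor_eq_sym[OF k(2)] mor_eq_sym[OF comp_assoc[OF to]]]]])
    show "mor_eq Q T (comp_mor P (comp_mor tp.P' ?h tp.to_P) pb) (comp_mor P (comp_mor tp.P' h' tp.to_P) pb)"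
     by (rule mor_trans[OF comp_assoc[OF to] mor_trans[OF ha(2) mor_trans[OF mor_eq_sym[OF k(3)] mor_eq_sym[OF comp_assoc[OF to]]]]])
   qed
  qed
  then show "EX h. morphism Q tp.P' h & mor_eq Q X (comp_mor tp.P' h ?a) u & mor_eq Q T (comp_mor tp.P' h ?b) v &
   (ALL h'. morphism Q tp.P' h' --> mor_eq Q X (comp_mor tp.P' h' ?a) u --> mor_eq Q T (comp_mor tp.P' h' ?b) v --> mor_eq Q tp.P' h h')"
   using mor_morphism[OF hm] ha by blast
 qed
 then show ?thesis by (rule that)
qed

section \<open>Flat and Mittag-Leffler modules\<close>

abbreviation rel_gens :: "('a, 'c) ring_scheme => ('a, 'm, 'd) module_scheme => ('a, 'n, 'e) module_scheme => ('m \<times> 'n \<Rightarrow>\<^sub>0 int) set" where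
 "rel_gens R M N == {frag_of (x +[M] x', y) - frag_of (x, y) - frag_of (x', y) | x x' y.
    x el M & x' el M & y el N} \<union>
   {frag_of (x, y +[N] y') - frag_of (x, y) - frag_of (x, y') | x y y'.
    x el M & y el N & y' el N} \<union>
   {frag_of (r .[M] x, y) - frag_of (x, r .[N] y) | r x y.
    r el R & x el M & y el N}"

locale two_modules = M: module R M + N: module R N for R :: "('a, 'c) ring_scheme" and M :: "('a, 'm, 'd) module_scheme" and N :: "('a, 'n, 'e) module_scheme"
begin

abbreviation "Rel == tensor_relations R M N"

lemma free_diff: "x el tensor_free M N ==> y el tensor_free M N ==> x - y el tensor_free M N"
 using keys_diff[of x y] by auto

lemma free_of: "x el M ==> y el N ==> frag_of (x, y) el tensor_free M N"
 by simp

lemma gens_carrier: "rel_gens R M N <= carrier (tensor_free M N)"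
 by (auto simp del: carrier_free_Abelian_group_iff intro!: free_diff free_of)

lemma rel_subgroup: "subgroup Rel (tensor_free M N)"
 unfolding tensor_relations_def by (rule group.generate_is_subgroup[OF group_free_Abelian_group gens_carrier])

lemma rel_left: "x el M ==> x' el M ==> y el N ==> frag_of (x +[M] x', y) - frag_of (x, y) - frag_of (x', y) : Rel"
 and rel_right: "x el M ==> y el N ==> y' el N ==> frag_of (x, y +[N] y') - frag_of (x, y) - frag_of (x, y') : Rel"
 and rel_bal: "r el R ==> x el M ==> y el N ==> frag_of (r .[M] x, y) - frag_of (x, r .[N] y) : Rel"
 unfolding tensor_relations_def by (rule generate.incl, blast)+

lemma rel_carrier: "x : Rel ==> x el tensor_free M N"
 using rel_subgroup by (rule subgroup.mem_carrier)

lemma rel_add: "x : Rel ==> y : Rel ==> x + y : Rel"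
 and rel_zero: "0 : Rel"
 using subgroup.m_closed[OF rel_subgroup] subgroup.one_closed[OF rel_subgroup] by simp_all

lemma rel_minus: "x : Rel ==> - x : Rel"
 using subgroup.m_inv_closed[OF rel_subgroup, of x] rel_carrier[of x] by simp

lemma rel_induct [consumes 1, case_names zero plus minus left right bal]:
 assumes x: "x : Rel" and z: "P 0" and p: "!!x y. P x ==> P y ==> P (x + y)" and m: "!!x. P x ==> P (- x)"
  and l: "!!x x' y. x el M ==> x' el M ==> y el N ==> P (frag_of (x +[M] x', y) - frag_of (x, y) - frag_of (x', y))"
  and r: "!!x y y'. x el M ==> y el N ==> y' el N ==> P (frag_of (x, y +[N] y') - frag_of (x, y) - frag_of (x, y'))"
  and b: "!!r x y. r el R ==> x el M ==> y el N ==> P (frag_of (r .[M] x, y) - frag_of (x, r .[N] y))"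
 shows "P x"
proof -
 have g: "P x" if "x : rel_gens R M N" for x using that by (auto intro!: l r b)
 show ?thesis
  using x unfolding tensor_relations_def
 proof (induction rule: generate.induct)
  case (inv h)
  then show ?case using m[OF g[OF inv]] subsetD[OF gens_carrier inv] by simp
 qed (use z p g in auto)
qed

lemma pure_zero_iff:
 assumes "x el M" "y el N"
 shows "pure_tensor R M N x y = 1[tensor R M N] <-> frag_of (x, y) : Rel"
proof -
 interpret G: group "tensor_free M N" by simp
 have c: "frag_of (x, y) el tensor_free M N" using assms by simp
 show ?thesis
  unfolding pure_tensor_def tensor_def FactGroup_def monoid.simps
  using G.coset_join1[OF _ c rel_subgroup] G.coset_join2[OF c rel_subgroup] by blast
qed

lemma pure_closed: "x el M ==> y el N ==> pure_tensor R M N x y el tensor R M N"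
 unfolding pure_tensor_def tensor_def FactGroup_def by (auto simp: RCOSETS_def)

lemma tensor_group: "group (tensor R M N)"
 unfolding tensor_def
 by (intro normal.factorgroup_is_group comm_group.normal_iff_subgroup[THEN iffD2] abelian_free_Abelian_group rel_subgroup)

text \<open>A balanced biadditive map extends to the free abelian group and kills all generators of
  the relations. It is the tool for extracting information from the vanishing of a pure
  tensor.\<close>

lemma rel_hom:
 assumes G: "comm_group G" and f: "!!x y. x el M ==> y el N ==> f x y el G"
  and l: "!!x x' y. x el M ==> x' el M ==> y el N ==> f (x +[M] x') y = f x y *[G] f x' y"
  and r: "!!x y y'. x el M ==> y el N ==> y' el N ==> f x (y +[N] y') = f x y *[G] f x y'"
  and b: "!!r x y. r el R ==> x el M ==> y el N ==> f (r .[M] x) y = f x (r .[N] y)"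
  and xy: "x el M" "y el N" "frag_of (x, y) : Rel"
 shows "f x y = 1[G]"
proof -
 interpret G: comm_group G by fact
 interpret Fr: group "tensor_free M N" by simp
 obtain h where h: "h : hom (tensor_free M N) G" "!!z. z : carrier M \<times> carrier N ==> h (frag_of z) = (%(x, y). f x y) z"
  by (rule G.free_Abelian_group_universal[of "%(x, y). f x y" "carrier M \<times> carrier N"]) (use f in auto)
 interpret h: group_hom "tensor_free M N" G h by unfold_locales (rule h(1))
 have hf: "h (frag_of (x, y)) = f x y" if "x el M" "y el N" for x y using h(2) that by simp
 have hd: "h (x - y) = h x *[G] inv[G] h y" if "x el tensor_free M N" "y el tensor_free M N" for x y
  using h.hom_mult[OF that(1) Fr.inv_closed[OF that(2)]] h.hom_inv[OF that(2)] that by simp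
 note fc = free_of and dc = free_diff
 have "frag_of (x, y) el tensor_free M N & h (frag_of (x, y)) = 1[G]"
  using xy(3)
 proof (induction rule: rel_induct)
  case (left x x' y)
  then show ?case using hd[OF dc fc] hd[OF fc fc] fc dc f hf l by (simp del: carrier_free_Abelian_group_iff add: G.m_ac G.inv_mult)
 next
  case (right x y y')
  then show ?case using hd[OF dc fc] hd[OF fc fc] fc dc f hf r by (simp del: carrier_free_Abelian_group_iff add: G.m_ac G.inv_mult)
 next
  case (bal r x y)
  then show ?case using hd[OF fc fc] fc dc f hf b by (simp del: carrier_free_Abelian_group_iff)
 next
  case (plus x y)
  then show ?case using h.hom_mult[of x y] Fr.m_closed[of x y] by simp
 next
  case (minus x)
  then show ?case using h.hom_inv[of x] Fr.inv_closed[of x] by simp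
 qed (use h.hom_one in simp)
 then show ?thesis using hf[OF xy(1,2)] by simp
qed

end

lemma two_modulesI: "module R M ==> module R N ==> two_modules R M N"
 by (simp add: two_modules_def)

text \<open>Flatness is only tested on modules over the type \<open>test\<close>, hence finitely generated submodules have to
 be copied into that type.\<close>

definition img_mod :: "('n => 'k) => ('a, 'n, 'e) module_scheme => ('a, 'k) module" where
 "img_mod k N = (|carrier = k ` carrier N, mult = undefined, one = undefined, zero = k 0[N],
  add = (%x y. k (inv_into (carrier N) k x +[N] inv_into (carrier N) k y)),
  smult = (%r x. k (r .[N] inv_into (carrier N) k x))|)"

abbreviation "sub_img k N H == img_mod k (N(|carrier := H|))"

lemma img_mod_simps:
 assumes "inj_on k (carrier N)"
 shows "carrier (img_mod k N) = k ` carrier N" "0[img_mod k N] = k 0[N]"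
  "x el N ==> y el N ==> k x +[img_mod k N] k y = k (x +[N] y)"
  "x el N ==> r .[img_mod k N] k x = k (r .[N] x)"
 using assms by (simp_all add: img_mod_def)

lemma img_module:
 assumes N: "module R N" and k: "inj_on k (carrier N)"
 shows "module R (img_mod k N)"
proof -
 interpret N: module R N by fact
 note [simp] = img_mod_simps[OF k]
 show ?thesis
 proof (rule moduleI)
  show "abelian_group (img_mod k N)"
  proof (rule abelian_groupI)
   show "EX y:carrier (img_mod k N). y +[img_mod k N] x = 0[img_mod k N]" if x: "x el img_mod k N" for x
   proof -
    obtain z where z: "x = k z" "z el N" using x unfolding img_mod_simps(1)[OF k] by (rule imageE)
    show ?thesis by (rule bexI[of _ "k (-[N] z)"]) (use z in "simp_all add: N.M.l_neg")
   qed
  qed (auto simp: N.M.a_assoc intro: arg_cong[OF N.M.a_comm])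
 qed (auto simp: N.R.cring_axioms N.smult_l_distr N.smult_r_distr N.smult_assoc1 N.R.is_cring)
qed

lemma sub_module:
 assumes N: "module R N" and H: "submodule H R N"
 shows "module R (N(|carrier := H|))"
 by (rule submodule.submodule_is_module[OF H N])

text \<open>A relation is derived in finitely many steps, and these involve only finitely many
  elements of \<open>N\<close>. The same derivation works over every submodule \<open>H\<close>
  containing them, also after \<open>H\<close> has been renamed by \<open>k\<close>.\<close>

lemma rel_restrict:
 assumes M: "module R M" and N: "module R N" and x: "x : tensor_relations R M N"
 shows "EX F. finite F & F <= carrier N & (ALL H (k :: 'n => 'k). F <= H --> submodule H R N --> inj_on k H -->
  frag_extend (%(m, n). frag_of (m, k n)) x : tensor_relations R M (img_mod k ((N :: ('a, 'n, 'e) module_scheme)(|carrier := H|))))"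
  (is "EX F. ?Q F x")
proof -
 interpret MN: two_modules R M N by (rule two_modulesI[OF M N])
 interpret N: module R N by fact
 have T: "two_modules R M (sub_img k N H)" if "submodule H R N" "inj_on k H" for H and k :: "'n => 'k"
  by (rule two_modulesI[OF M img_module[OF sub_module[OF N that(1)]]]) (use that(2) in simp)
 have s: "carrier (sub_img k N H) = k ` H"
  "u : H ==> v : H ==> k u +[sub_img k N H] k v = k (u +[N] v)"
  "u : H ==> r .[sub_img k N H] k u = k (r .[N] u)" if "inj_on k H" for H u v r and k :: "'n => 'k"
  using img_mod_simps[of k "N(|carrier := H|)"] that by simp_all
 show ?thesis
  using x
 proof (induction rule: MN.rel_induct)
  case zero
  show ?case by (rule exI[of _ "{}"]) (auto simp: two_modules.rel_zero[OF T])
 next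
  case (plus x y)
  then obtain F G where "?Q F x" "?Q G y" by blast
  then have "?Q (F Un G) (x + y)" by (auto simp: frag_extend_add two_modules.rel_add[OF T])
  then show ?case by blast
 next
  case (minus x)
  then obtain F where "?Q F x" by blast
  then have "?Q F (- x)" by (auto simp: frag_extend_minus two_modules.rel_minus[OF T])
  then show ?case by blast
 next
  case (left x x' y)
  have "?Q {y} (frag_of (x +[M] x', y) - frag_of (x, y) - frag_of (x', y))"
   unfolding frag_extend_diff frag_extend_of prod.case using left s by (auto intro!: two_modules.rel_left[OF T])
  then show ?case by blast
 next
  case (right x y y')
  have "?Q {y, y'} (frag_of (x, y +[N] y') - frag_of (x, y) - frag_of (x, y'))"
   unfolding frag_extend_diff frag_extend_of prod.case
  proof (intro conjI allI impI)
   fix H and k :: "'n => 'k" assume H: "{y, y'} <= H" "submodule H R N" "inj_on k H"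
   then have e: "k (y +[N] y') = k y +[sub_img k N H] k y'" using s(2)[OF H(3), of y y'] by simp
   show "frag_of (x, k (y +[N] y')) - frag_of (x, k y) - frag_of (x, k y') : tensor_relations R M (sub_img k N H)"
    unfolding e by (rule two_modules.rel_right[OF T[OF H(2,3)] right(1)]) (use H(1) s(1)[OF H(3)] in auto)
  qed (use right in auto)
  then show ?case by blast
 next
  case (bal r x y)
  have "?Q {y} (frag_of (r .[M] x, y) - frag_of (x, r .[N] y))"
   unfolding frag_extend_diff frag_extend_of prod.case
  proof (intro conjI allI impI)
   fix H and k :: "'n => 'k" assume H: "{y} <= H" "submodule H R N" "inj_on k H"
   have e: "k (r .[N] y) = r .[sub_img k N H] k y" using s(3)[OF H(3)] H(1) by simp
   have "k y el sub_img k N H" using s(1)[OF H(3)] H(1) by simp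
   then show "frag_of (r .[M] x, k y) - frag_of (x, k (r .[N] y)) : tensor_relations R M (sub_img k N H)"
    unfolding e by (rule two_modules.rel_bal[OF T[OF H(2,3)] bal(1,2)])
  qed (use bal in auto)
  then show ?case by blast
 qed
qed

lemma module_via_simps [simp]:
 "carrier (module_via B ph) = carrier B" "add (module_via B ph) = add B" "zero (module_via B ph) = zero B"
 "a .[module_via B ph] b = ph a *[B] b"
 by (simp_all add: module_via_def)

lemma module_via_module:
 assumes A: "cring A" and B: "cring B" and ph: "ph : ring_hom A B"
 shows "module A (module_via B ph)"
proof -
 interpret A: cring A by fact
 interpret B: cring B by fact
 note [simp] = hom_car[OF ph] ring_hom_mult[OF ph] ring_hom_add[OF ph] ring_hom_one[OF ph]
 show ?thesis
 proof (rule moduleI[OF A])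
  show "abelian_group (module_via B ph)"
  proof (rule abelian_groupI)
   show "EX y:carrier (module_via B ph). y +[module_via B ph] x = 0[module_via B ph]" if "x el module_via B ph" for x
    by (rule bexI[of _ "-[B] x"]) (use that in "simp_all add: B.l_neg")
  qed (simp_all add: B.a_ac)
 qed (auto simp: B.l_distr B.r_distr B.m_assoc)
qed

text \<open>The tensor product with a cyclic module is \<open>B\<close> modulo the extension of the
  annihilator of the generator. The inclusion asserted here comes from the balanced map that sends
  \<open>x\<close> and the copy of \<open>a .[N] n\<close> to the class of \<open>q x\<close> times
  \<open>q (ph a)\<close>.\<close>

lemma cyclic_tensor:
 assumes A: "cring A" and B: "cring B" and ph: "ph : ring_hom A B" and N: "module A N" and n: "n el N"
  and H: "H = {a .[N] n | a. a el A}" and k: "inj_on k H" and b: "b el B"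
  and r: "frag_of (b, k n) : tensor_relations A (module_via B ph) (sub_img k N H)"
  and sub: "submodule H A N"
 shows "b : genideal B (ph ` {a : carrier A. a .[N] n = 0[N]})"
proof -
 interpret A: cring A by fact
 interpret B: cring B by fact
 interpret N: module A N by fact
 define J where "J = genideal B (ph ` {a : carrier A. a .[N] n = 0[N]})"
 have Js: "ph ` {a : carrier A. a .[N] n = 0[N]} <= carrier B" using hom_car[OF ph] by blast
 have J: "ideal J B" unfolding J_def by (rule B.genideal_ideal[OF Js])
 let ?Q = "B Quot J" define q where "q b = J +>\<^bsub>B\<^esub> b" for b
 interpret Q: cring ?Q by (rule Quot_cring[OF B J])
 have q: "q : ring_hom B ?Q" unfolding q_def by (rule Quot_hom[OF B J])
 have qph: "(%a. q (ph a)) : ring_hom A ?Q" by (rule hom_comp[OF ph q])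
 note [simp] = hom_car[OF ph] hom_car[OF q]
 interpret qph: ring_hom_cring A ?Q "%a. q (ph a)" by unfold_locales (rule qph)
 have wd: "q (ph a) = q (ph a')" if a: "a el A" "a' el A" "a .[N] n = a' .[N] n" for a a'
 proof -
  have "(a -[A] a') .[N] n = 0[N]" using a n by (simp add: A.minus_eq N.smult_l_distr N.smult_l_minus N.M.r_neg)
  then have "ph (a -[A] a') : J" unfolding J_def using a B.genideal_self[OF Js] by blast
  then have "q (ph (a -[A] a')) = 0[?Q]" unfolding q_def using Quot_zero_iff[OF B J] a by simp
  then have "q (ph a) +[?Q] -[?Q] q (ph a') = 0[?Q]" using a by (simp add: A.minus_eq)
  then show ?thesis using a Q.minus_equality[of "q (ph a)" "-[?Q] q (ph a')"] by simp
 qed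
 define u where "u x = q (ph (SOME a. a el A & k (a .[N] n) = x))" for x
 have u: "u (k (a .[N] n)) = q (ph a)" if a: "a el A" for a
 proof -
  have "EX a'. a' el A & k (a' .[N] n) = k (a .[N] n)" using a by blast
  from someI_ex[OF this] show ?thesis unfolding u_def using a inj_onD[OF k] H by (intro wd) blast+
 qed
 let ?N = "N(|carrier := H|)" let ?I = "img_mod k ?N" let ?M = "module_via B ph"
 have ki: "inj_on k (carrier ?N)" using k by simp
 interpret T: two_modules A ?M ?I
  by (rule two_modulesI[OF module_via_module[OF A B ph] img_module[OF sub_module[OF N sub] ki]])
 note s = img_mod_simps[OF ki, simplified]
 have yE: "EX a:carrier A. y = k (a .[N] n)" if "y el ?I" for y
 proof -
  have "y : k ` H" using that s(1) by simp
  then show ?thesis unfolding H by blast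
 qed
 have Hm: "a .[N] n : H" if "a el A" for a using that H by blast
 have n1: "1[A] .[N] n = n" using n by simp
 have "q b *[?Q] u (k n) = 1[add_monoid ?Q]"
 proof (rule T.rel_hom[of "add_monoid ?Q" "%x y. q x *[?Q] u y"])
  show "comm_group (add_monoid ?Q)" by (rule Q.a_comm_group)
  show "q x *[?Q] u y el add_monoid ?Q" if "x el ?M" "y el ?I" for x y
   using that yE[OF that(2)] u by auto
  show "q (x +[?M] x') *[?Q] u y = q x *[?Q] u y *[add_monoid ?Q] (q x' *[?Q] u y)"
   if "x el ?M" "x' el ?M" "y el ?I" for x x' y
   using that yE[OF that(3)] u ring_hom_add[OF q] by (auto simp: Q.l_distr)
  show "q x *[?Q] u (y +[?I] y') = q x *[?Q] u y *[add_monoid ?Q] (q x *[?Q] u y')"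
   if x: "x el ?M" "y el ?I" "y' el ?I" for x y y'
  proof -
   obtain a a' where a: "a el A" "y = k (a .[N] n)" "a' el A" "y' = k (a' .[N] n)" using yE[OF x(2)] yE[OF x(3)] by blast
   then have "y +[?I] y' = k ((a +[A] a') .[N] n)" using s(3) Hm n by (simp add: N.smult_l_distr)
   then show ?thesis using a x u by (simp add: Q.r_distr)
  qed
  show "q (r .[?M] x) *[?Q] u y = q x *[?Q] u (r .[?I] y)" if x: "r el A" "x el ?M" "y el ?I" for r x y
  proof -
   obtain a where a: "a el A" "y = k (a .[N] n)" using yE[OF x(3)] by blast
   then have "r .[?I] y = k ((r *[A] a) .[N] n)" using s(4) Hm n x(1) by (simp add: N.smult_assoc1)
   then show ?thesis using a x u ring_hom_mult[OF q] by (simp add: Q.m_assoc Q.m_lcomm)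
  qed
  show "k n el ?I" unfolding s(1) using Hm[OF A.one_closed] n1 by simp
 qed (use b r in auto)
 moreover have "u (k n) = 1[?Q]" using u[OF A.one_closed] n1 by simp
 ultimately have "q b = 0[?Q]" using b by simp
 then show ?thesis using Quot_zero_iff[OF B J b] unfolding q_def J_def by simp
qed

lemma (in module) span_submodule:
 assumes f: "!!i. i < (k :: nat) ==> f i el M"
 defines "lc == %c. \<Oplus>\<^bsub>M\<^esub>i\<in>{..<k}. c i .[M] f i"
 defines "H == lc ` ({..<k} \<rightarrow> carrier R)"
 shows "submodule H R M" "!!i. i < k ==> f i : H"
proof -
 have cl: "c i .[M] f i el M" if "c : {..<k} \<rightarrow> carrier R" "i < k" for c i using that f by auto
 have sm: "a .[M] x : H" if a: "a el R" and x: "x : H" for a x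
 proof -
  obtain c where c: "c : {..<k} \<rightarrow> carrier R" "x = lc c" using x H_def by blast
  have "a .[M] x = (\<Oplus>\<^bsub>M\<^esub>i\<in>{..<k}. a .[M] (c i .[M] f i))"
   unfolding c(2) lc_def by (rule finsum_smult_ldistr) (use a c cl in auto)
  also have "... = lc (%i. a \<otimes> c i)" unfolding lc_def by (rule M.finsum_cong') (use a c f in "auto simp: smult_assoc1 Pi_iff")
  finally show ?thesis unfolding H_def using a c by (intro image_eqI[of _ _ "%i. a \<otimes> c i"]) auto
 qed
 have Hc: "x el M" if "x : H" for x using that cl unfolding H_def lc_def by (auto intro!: M.finsum_closed)
 show "submodule H R M"
 proof (rule submoduleI)
  show "H <= carrier M" using Hc by blast
  show "0[M] : H"
  proof -
   have "lc (%i. \<zero>) = (\<Oplus>\<^bsub>M\<^esub>i\<in>{..<k}. 0[M])" unfolding lc_def by (rule M.finsum_cong') (use f in "auto simp: smult_l_null")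
   then show ?thesis unfolding H_def by (intro image_eqI[of _ _ "%i. \<zero>"]) auto
  qed
  show "-[M] x : H" if x: "x : H" for x
   using sm[OF R.a_inv_closed[OF R.one_closed] x] smult_l_minus[OF R.one_closed Hc[OF x]] Hc[OF x] by simp
  show "x +[M] y : H" if x: "x : H" "y : H" for x y
  proof -
   obtain c d where c: "c : {..<k} \<rightarrow> carrier R" "x = lc c" "d : {..<k} \<rightarrow> carrier R" "y = lc d" using x H_def by blast
   have "x +[M] y = (\<Oplus>\<^bsub>M\<^esub>i\<in>{..<k}. c i .[M] f i +[M] d i .[M] f i)"
    unfolding c lc_def by (rule M.finsum_addf[symmetric]) (use c cl in auto)
   also have "... = lc (%i. c i \<oplus> d i)" unfolding lc_def by (rule M.finsum_cong') (use c f in "auto simp: smult_l_distr Pi_iff")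
   finally show ?thesis unfolding H_def using c by (intro image_eqI[of _ _ "%i. c i \<oplus> d i"]) auto
  qed
 qed (rule sm)
 show "f i : H" if i: "i < k" for i
 proof -
  have "lc (%j. if i = j then \<one> else \<zero>) = (\<Oplus>\<^bsub>M\<^esub>j\<in>{..<k}. if i = j then f j else 0[M])"
   unfolding lc_def by (rule M.finsum_cong') (use f in "auto simp: smult_l_null")
  also have "... = f i" by (rule M.finsum_singleton) (use i f in auto)
  finally show ?thesis unfolding H_def by (intro image_eqI[of _ _ "%j. if i = j then \<one> else \<zero>"]) auto
 qed
qed

lemma (in module) cyclic_submodule:
 assumes n: "n el M"
 shows "submodule {a .[M] n | a. a el R} R M"
proof (rule submoduleI)
 show "0[M] : {a .[M] n | a. a el R}" using smult_l_null[OF n] R.zero_closed by force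
 fix x assume "x : {a .[M] n | a. a el R}"
 then obtain c where c: "c el R" "x = c .[M] n" by blast
 then show "-[M] x : {a .[M] n | a. a el R}"
  using n by (intro CollectI exI[of _ "\<ominus> c"]) (simp add: smult_l_minus)
 show "a .[M] x : {a .[M] n | a. a el R}" if "a el R" for a
  using that c n by (intro CollectI exI[of _ "a \<otimes> c"]) (simp add: smult_assoc1)
 fix y assume "y : {a .[M] n | a. a el R}"
 then obtain d where "d el R" "y = d .[M] n" by blast
 then show "x +[M] y : {a .[M] n | a. a el R}"
  using c n by (intro CollectI exI[of _ "c \<oplus> d"]) (simp add: smult_l_distr)
next
 show "{a .[M] n | a. a el R} <= carrier M" using n by auto
qed

text \<open>The relation already holds over a finitely generated submodule \<open>H\<close>
  containing \<open>n\<close>; flatness brings it down to the cyclic submodule \<open>H1\<close>, to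
  which \<open>cyclic_tensor\<close> applies. Passing to \<open>H\<close> also brings the modules
  into the type on which flatness is tested.\<close>

lemma flat_annihilator:
 fixes A :: "('a, 'c) ring_scheme" and N :: "('a, 'n, 'e) module_scheme"
 assumes A: "cring A" and B: "cring B" and ph: "ph : ring_hom A B" and flat: "flat_module A (module_via B ph)"
  and N: "module A N" and n: "n el N" and b: "b el B"
  and r: "frag_of (b, n) : tensor_relations A (module_via B ph) N"
 shows "b : genideal B (ph ` {a : carrier A. a .[N] n = 0[N]})"
proof -
 interpret N: module A N by fact
 let ?M = "module_via B ph"
 have M: "module A ?M" by (rule module_via_module[OF A B ph])
 obtain F where F: "finite F" "F <= carrier N" and Fr: "!!H (k :: 'n => 'a test). F <= H ==> submodule H A N ==> inj_on k H ==>
  frag_extend (%(m, n). frag_of (m, k n)) (frag_of (b, n)) : tensor_relations A ?M (sub_img k N H)"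
  using rel_restrict[OF M N r, where 'k = "'a test"] by blast
 have "finite (insert n F)" using F(1) by simp
 then obtain k :: nat and f where f: "insert n F = f ` {i. i < k}" unfolding finite_conv_nat_seg_image by blast
 have fc: "f i el N" if "i < k" for i
 proof -
  have "f i : insert n F" unfolding f using that by blast
  then show ?thesis using F(2) n by blast
 qed
 define lc where "lc = (%c. \<Oplus>\<^bsub>N\<^esub>i\<in>{..<k}. c i .[N] f i)"
 define H where "H = lc ` ({..<k} \<rightarrow> carrier A)"
 define H1 where "H1 = {a .[N] n | a. a el A}"
 \<comment> \<open>An element of \<open>H\<close> is coded by the set of all coefficient sequences
   that produce it from the generators. For elements of \<open>H\<close> these sets are nonempty,
   and they are disjoint for distinct elements, so \<open>K\<close> is injective on
   \<open>H\<close>.\<close>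
 define K :: "'n => 'a test" where "K m = {c : {..<k} \<rightarrow> carrier A. m = lc c}" for m
 have H: "submodule H A N" and fH: "i < k ==> f i : H" for i
  using N.span_submodule[of k f] fc unfolding H_def lc_def by auto
 have "insert n F <= H" unfolding f using fH by blast
 then have FH: "F <= H" "n : H" by blast+
 have H1: "submodule H1 A N" unfolding H1_def by (rule N.cyclic_submodule[OF n])
 have H1H: "H1 <= H" using submodule.smult_closed[OF H] FH(2) unfolding H1_def by blast
 have K: "inj_on K H" by (rule inj_onI) (auto simp: H_def K_def set_eq_iff)
 have K1: "inj_on K H1" by (rule inj_on_subset[OF K H1H])
 let ?N' = "sub_img K N H" let ?N1 = "sub_img K N H1"
 have mod: "module A ?N'" "module A ?N1"
  using img_module[OF sub_module[OF N H]] img_module[OF sub_module[OF N H1]] K K1 by simp_all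
 have s: "inj_on K (carrier (N(|carrier := H|)))" "inj_on K (carrier (N(|carrier := H1|)))" using K K1 by simp_all
 note s' = img_mod_simps[OF s(1), simplified] and s1 = img_mod_simps[OF s(2), simplified]
 have "(%x. x) : module_hom A ?N1 ?N'"
  unfolding module_hom_def hom_def using H1H s' s1 by (auto simp: subset_iff)
 moreover have "inj_on (%x. x) (carrier ?N1)" by simp
 ultimately obtain h where h: "h : hom (tensor A ?M ?N1) (tensor A ?M ?N')"
  "ALL x:carrier ?M. ALL y:carrier ?N1. h (pure_tensor A ?M ?N1 x y) = pure_tensor A ?M ?N' x y"
  "inj_on h (carrier (tensor A ?M ?N1))"
  using flat mod unfolding flat_module_def by blast
 interpret T': two_modules A ?M ?N' by (rule two_modulesI[OF M mod(1)])
 interpret T1: two_modules A ?M ?N1 by (rule two_modulesI[OF M mod(2)])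
 interpret h: group_hom "tensor A ?M ?N1" "tensor A ?M ?N'" h
  by (intro group_hom.intro T1.tensor_group T'.tensor_group group_hom_axioms.intro h(1))
 have n1: "n : H1" unfolding H1_def using n by (intro CollectI exI[of _ "1[A]"]) simp
 have bn: "b el ?M" "K n el ?N1" "K n el ?N'" using b n1 FH(2) s'(1) s1(1) by auto
 have "pure_tensor A ?M ?N' b (K n) = 1[tensor A ?M ?N']"
  using T'.pure_zero_iff[OF bn(1,3)] Fr[OF FH(1) H K] by simp
 then have "h (pure_tensor A ?M ?N1 b (K n)) = h 1[tensor A ?M ?N1]" using h(2) bn by simp
 then have "pure_tensor A ?M ?N1 b (K n) = 1[tensor A ?M ?N1]"
  by (rule inj_onD[OF h(3)]) (use T1.pure_closed[OF bn(1,2)] in simp_all)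
 then have "frag_of (b, K n) : tensor_relations A ?M ?N1" using T1.pure_zero_iff[OF bn(1,2)] by simp
 then show ?thesis by (rule cyclic_tensor[OF A B ph N n H1_def K1 b _ H1])
qed

lemma prod_module_module:
 assumes A: "cring A" and Q: "!!i. i : I ==> module A (Q i)"
 shows "module A (prod_module I Q)"
proof -
 let ?P = "prod_module I Q"
 have ag: "abelian_group (Q i)" and a: "x el Q i ==> y el Q i ==> x +[Q i] y el Q i"
  "x el Q i ==> 0[Q i] +[Q i] x = x" "0[Q i] el Q i" "x el Q i ==> -[Q i] x el Q i"
  "x el Q i ==> -[Q i] x +[Q i] x = 0[Q i]" if "i : I" for i x y
 proof -
  interpret module A "Q i" by (rule Q[OF that])
  show "abelian_group (Q i)" by (rule M.abelian_group_axioms)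
  show "x el Q i ==> y el Q i ==> x +[Q i] y el Q i" "x el Q i ==> 0[Q i] +[Q i] x = x"
   "0[Q i] el Q i" "x el Q i ==> -[Q i] x el Q i" "x el Q i ==> -[Q i] x +[Q i] x = 0[Q i]"
   by (simp_all add: M.l_neg)
 qed
 have s: "carrier (?P) = (\<Pi>\<^sub>E i\<in>I. carrier (Q i))" "0[?P] = (\<lambda>i\<in>I. 0[Q i])"
  "x +[?P] y = (\<lambda>i\<in>I. x i +[Q i] y i)" "r .[?P] x = (\<lambda>i\<in>I. r .[Q i] x i)" for x y r
  by (simp_all add: prod_module_def pi_ring_def)
 have m: "x : (\<Pi>\<^sub>E i\<in>I. carrier (Q i)) ==> i : I ==> x i el Q i" for x i by (rule PiE_mem)
 show ?thesis
 proof (rule moduleI[OF A])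
  show "abelian_group (?P)"
  proof (rule abelian_groupI)
   show "EX y:carrier (?P). y +[?P] x = 0[?P]" if x: "x el ?P" for x
   proof -
    have "x i el Q i" if "i : I" for i using x that unfolding s by (rule PiE_mem)
    then show ?thesis using a(4,5) by (intro bexI[of _ "\<lambda>i\<in>I. -[Q i] x i"]) (auto simp: s intro!: restrict_ext)
   qed
   show "x +[?P] y +[?P] z = x +[?P] (y +[?P] z)"
    if "x el ?P" "y el ?P" "z el ?P" for x y z
    using that abelian_monoid.a_assoc[OF abelian_group.axioms(1)[OF ag]] unfolding s by (intro restrict_ext) (simp add: m)
   show "x +[?P] y = y +[?P] x" if "x el ?P" "y el ?P" for x y
    using that abelian_monoid.a_comm[OF abelian_group.axioms(1)[OF ag]] unfolding s by (intro restrict_ext) (simp add: m)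
   show "0[?P] +[?P] x = x" if "x el ?P" for x
    using that a(2) unfolding s by (auto simp: fun_eq_iff PiE_def Pi_iff extensional_def)
   show "x +[?P] y el ?P" if "x el ?P" "y el ?P" for x y
    using that a(1) unfolding s by (intro restrict_PiE_iff[THEN iffD2] ballI) (simp add: m)
  qed (use a(3) in "simp add: s")
  show "1[A] .[?P] x = x" if "x el ?P" for x
   using that module.smult_one[OF Q] unfolding s by (auto simp: fun_eq_iff PiE_def Pi_iff extensional_def)
  fix r t x y assume r: "r el A" and t: "t el A" and x: "x el ?P"
  show "r .[?P] x el ?P" using r x module.smult_closed[OF Q] unfolding s by (intro restrict_PiE_iff[THEN iffD2] ballI) (simp add: m)
  show "(r +[A] t) .[?P] x = r .[?P] x +[?P] t .[?P] x"
   "(r *[A] t) .[?P] x = r .[?P] (t .[?P] x)"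
   using r t x module.smult_l_distr[OF Q] module.smult_assoc1[OF Q] unfolding s by (intro restrict_ext; simp add: m)+
  assume y: "y el ?P"
  show "r .[?P] (x +[?P] y) = r .[?P] x +[?P] r .[?P] y"
   using r x y module.smult_r_distr[OF Q] unfolding s by (intro restrict_ext) (simp add: m)
 qed
qed

text \<open>The family \<open>q\<close> of ones in the product of the quotient rings is annihilated
  exactly by the intersection of the ideals. Hence \<open>flat_annihilator\<close> gives the claim
  once \<open>b\<close> tensor \<open>q\<close> vanishes, and the Mittag-Leffler condition allows
  this to be tested in each factor.\<close>

lemma mittag_leffler_Inter:
 fixes A :: "('a, 'c) ring_scheme"
 assumes A: "cring A" and B: "cring B" and ph: "ph : ring_hom A B" and flat: "flat_module A (module_via B ph)" and ml: "mittag_leffler A (module_via B ph)"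
  and I: "!!aa. aa : \<A> ==> ideal aa A" and b: "b el B" "!!aa. aa : \<A> ==> b : genideal B (ph ` aa)"
 shows "b : genideal B (ph ` {a : carrier A. ALL aa:\<A>. a : aa})"
proof -
 interpret A: cring A by fact
 interpret B: cring B by fact
 note [simp] = hom_car[OF ph]
 let ?M = "module_via B ph"
 have M: "module A ?M" by (rule module_via_module[OF A B ph])
 \<comment> \<open>Ideals and cosets are both sets of ring elements. Replacing elements by constant
   sequences moves them into the type \<open>test\<close>, the ideals as indices and the cosets as
   module elements.\<close>
 define K :: "'a set => 'a test" where "K S = (%x _. x) ` S" for S
 have K_iff: "(%_. x) : K S <-> x : S" for x S unfolding K_def by (auto simp: fun_eq_iff)
 have K: "inj_on K S" for S
 proof (rule inj_onI)
  fix U V assume e: "K U = K V"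
  have "x : U <-> x : V" for x unfolding K_iff[symmetric] e ..
  then show "U = V" by blast
 qed
 define dec :: "'a test => 'a set" where "dec i = {x. (%_. x) : i}" for i
 have dK [simp]: "dec (K S) = S" for S unfolding dec_def K_iff by simp
 define Q where "Q i = img_mod K (module_via (A Quot dec i) (%a. dec i +>\<^bsub>A\<^esub> a))" for i
 let ?I = "K ` \<A>" let ?N = "prod_module ?I Q"
 have id: "ideal (dec i) A" if "i : ?I" for i using that I by auto
 have Qm: "module A (Q i)" if "i : ?I" for i
  unfolding Q_def by (intro img_module module_via_module[OF A Quot_cring[OF A id[OF that]] Quot_hom[OF A id[OF that]]] K)
 have Qs: "carrier (Q i) = K ` carrier (A Quot dec i)" "0[Q i] = K 0[A Quot dec i]"
  "c el (A Quot dec i) ==> a .[Q i] K c = K ((dec i +>\<^bsub>A\<^esub> a) *[A Quot dec i] c)" for i a c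
  unfolding Q_def using img_mod_simps[OF K, where N = "module_via (A Quot dec i) (%a. dec i +>\<^bsub>A\<^esub> a)"] by simp_all
 define q where "q = (\<lambda>i\<in>?I. K 1[A Quot dec i])"
 have a1: "a .[Q i] K 1[A Quot dec i] = 0[Q i] <-> a : dec i" and one: "K 1[A Quot dec i] el Q i"
  if i: "i : ?I" and a: "a el A" for a i
 proof -
  interpret Qi: cring "A Quot dec i" by (rule Quot_cring[OF A id[OF i]])
  have "dec i +>\<^bsub>A\<^esub> a el (A Quot dec i)" by (rule hom_car[OF Quot_hom[OF A id[OF i]] a])
  then show "a .[Q i] K 1[A Quot dec i] = 0[Q i] <-> a : dec i"
   using Quot_zero_iff[OF A id[OF i] a] K[of UNIV] unfolding Qs(2) by (simp add: Qs(3) inj_eq)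
  show "K 1[A Quot dec i] el Q i" unfolding Qs(1) by simp
 qed
 have N: "module A ?N" by (rule prod_module_module[OF A Qm])
 have Ns: "carrier ?N = (\<Pi>\<^sub>E i\<in>?I. carrier (Q i))" "0[?N] = (\<lambda>i\<in>?I. 0[Q i])" "r .[?N] x = (\<lambda>i\<in>?I. r .[Q i] x i)" for x r
  by (simp_all add: prod_module_def pi_ring_def)
 have qN: "q el ?N" unfolding Ns q_def using one[OF _ A.zero_closed] by auto
 interpret TN: two_modules A ?M ?N by (rule two_modulesI[OF M N])
 have pz: "pure_tensor A ?M (Q i) b (q i) = 1[tensor A ?M (Q i)]" if i: "i : ?I" for i
 proof -
  interpret T: two_modules A ?M "Q i" by (rule two_modulesI[OF M Qm[OF i]])
  let ?u = "K 1[A Quot dec i]"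
  note u = one[OF i A.zero_closed]
  have z0: "frag_of (y, 0[Q i]) : T.Rel" if "y el B" for y
   using T.rel_minus[OF T.rel_right[of y "0[Q i]" "0[Q i]"]] that by simp
  \<comment> \<open>The factor \<open>y\<close> is built in so that \<open>L\<close> is an ideal of
    \<open>B\<close>. It contains the image of the ideal \<open>dec i\<close>, hence the ideal
    generated by it, and in particular \<open>b\<close>.\<close>
  define L where "L = {x : carrier B. ALL y:carrier B. frag_of (y *[B] x, ?u) : T.Rel}"
  have "ideal L B"
  proof (rule B.idealI')
   show "0[B] : L" unfolding L_def using T.rel_minus[OF T.rel_left[of "0[B]" "0[B]" ?u]] u by simp
   show "x +[B] x' : L" if "x : L" "x' : L" for x x'
   proof -
    have "frag_of (y *[B] x +[B] y *[B] x', ?u) : T.Rel" if y: "y el B" for y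
    proof -
     have c: "y *[B] x el ?M" "y *[B] x' el ?M" using y \<open>x : L\<close> \<open>x' : L\<close> L_def by auto
     have "frag_of (y *[B] x, ?u) : T.Rel" "frag_of (y *[B] x', ?u) : T.Rel" using y \<open>x : L\<close> \<open>x' : L\<close> L_def by auto
     from T.rel_add[OF T.rel_add[OF T.rel_left[OF c u] this(2)] this(1)] show ?thesis by simp
    qed
    then show ?thesis using that unfolding L_def by (simp add: B.r_distr)
   qed
   show "c *[B] x : L" if "c el B" "x : L" for c x
    using that unfolding L_def by (simp flip: B.m_assoc)
  qed (auto simp: L_def)
  moreover have "ph ` dec i <= L"
  proof
   fix x assume "x : ph ` dec i"
   then obtain a where a: "a : dec i" "x = ph a" by blast
   have aA: "a el A" using a(1) id[OF i] by (meson additive_subgroup.a_Hcarr ideal.axioms(1))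
   have "frag_of (y *[B] ph a, ?u) : T.Rel" if y: "y el B" for y
    using T.rel_add[OF T.rel_bal[of a y ?u] z0[OF y]] y aA u a1[OF i aA] a(1) by (simp add: B.m_comm)
   then show "x : L" unfolding a(2) L_def using aA by simp
  qed
  ultimately have "genideal B (ph ` dec i) <= L" by (rule B.genideal_minimal)
  moreover have "b : genideal B (ph ` dec i)" using b(2) i by auto
  ultimately have "frag_of (1[B] *[B] b, ?u) : T.Rel" unfolding L_def using B.one_closed by blast
  then show ?thesis using T.pure_zero_iff[of b ?u] b(1) u i by (simp add: q_def)
 qed
 obtain h where h: "h : hom (tensor A ?M ?N) (product_group ?I (%i. tensor A ?M (Q i)))"
  "ALL x:carrier ?M. ALL q:carrier ?N. h (pure_tensor A ?M ?N x q) = (\<lambda>i\<in>?I. pure_tensor A ?M (Q i) x (q i))"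
  "inj_on h (carrier (tensor A ?M ?N))"
  using ml Qm unfolding mittag_leffler_def by blast
 interpret h: group_hom "tensor A ?M ?N" "product_group ?I (%i. tensor A ?M (Q i))" h
  by (intro group_hom.intro TN.tensor_group group_hom_axioms.intro h(1) product_group two_modules.tensor_group two_modulesI M Qm)
 have bM: "b el ?M" using b(1) by simp
 have "h (pure_tensor A ?M ?N b q) = (\<lambda>i\<in>?I. pure_tensor A ?M (Q i) b (q i))" using h(2) bM qN by blast
 also have "... = 1[product_group ?I (%i. tensor A ?M (Q i))]" using pz by (auto simp: one_product_group intro!: restrict_ext)
 also have "... = h 1[tensor A ?M ?N]" by (rule h.hom_one[symmetric])
 finally have "pure_tensor A ?M ?N b q = 1[tensor A ?M ?N]"
  by (rule inj_onD[OF h(3)]) (use TN.pure_closed[OF bM qN] in simp_all)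
 then have "frag_of (b, q) : TN.Rel" using TN.pure_zero_iff[OF bM qN] by simp
 then have "b : genideal B (ph ` {a : carrier A. a .[?N] q = 0[?N]})" by (rule flat_annihilator[OF A B ph flat N qN b(1)])
 moreover have "{a : carrier A. a .[?N] q = 0[?N]} <= {a : carrier A. ALL aa:\<A>. a : aa}"
 proof clarify
  fix a aa assume a: "a el A" "a .[?N] q = 0[?N]" and aa: "aa : \<A>"
  have i: "K aa : ?I" using aa by blast
  have "a .[Q (K aa)] q (K aa) = 0[Q (K aa)]" using fun_cong[OF a(2), of "K aa"] i unfolding Ns by simp
  then show "a : aa" using a1[OF i a(1)] i by (simp add: q_def)
 qed
 ultimately show ?thesis
 proof -
  assume h: "b : genideal B (ph ` {a : carrier A. a .[?N] q = 0[?N]})" and s: "{a : carrier A. a .[?N] q = 0[?N]} <= {a : carrier A. ALL aa:\<A>. a : aa}"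
  have "genideal B (ph ` {a : carrier A. a .[?N] q = 0[?N]}) <= genideal B (ph ` {a : carrier A. ALL aa:\<A>. a : aa})"
   by (rule B.genideal_minimal[OF B.genideal_ideal order_trans[OF image_mono[OF s] B.genideal_self]]) auto
  then show ?thesis using h by blast
 qed
qed

section \<open>The universal ideal\<close>

text \<open>The bridge between the two tensor products: \<open>tens\<close> carries the ring
  structure and consists of sums without signs, whereas flatness speaks about a quotient of the free
  abelian group. An equality there becomes the membership of a difference here.\<close>

lemma teq_rel:
 assumes A: "cring A" and B: "cring B" and C: "cring C" and ph: "ph : ring_hom A B" and ps: "ps : ring_hom A C"
  and e: "teq B C {(ph a, ps a) | a. a el A} K L"
 shows "sum_mset (image_mset frag_of K) - sum_mset (image_mset frag_of L) : tensor_relations A (module_via B ph) (module_via C ps)"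
proof -
 interpret B: cring B by fact
 interpret C: cring C by fact
 interpret T: two_modules A "module_via B ph" "module_via C ps"
  by (intro two_modulesI module_via_module A B C ph ps)
 note [simp] = hom_car[OF ph] hom_car[OF ps]
 show ?thesis
  using e
 proof (induction rule: teq.induct)
  case (teq_refl M)
  show ?case using T.rel_zero by simp
 next
  case (teq_sym M N)
  then show ?case using T.rel_minus[OF teq_sym.IH] by simp
 next
  case (teq_trans M N K)
  then show ?case using T.rel_add[OF teq_trans.IH] by simp
 next
  case (teq_plus M N M' N')
  then show ?case using T.rel_add[OF teq_plus.IH] by (simp add: algebra_simps)
 next
  case (teq_left b b' c)
  then show ?case using T.rel_left[of b b' c] by (simp add: algebra_simps)
 next
  case (teq_right b c c')
  then show ?case using T.rel_right[of b c c'] by (simp add: algebra_simps)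
 next
  case (teq_left_zero c)
  then show ?case using T.rel_minus[OF T.rel_left[of "0[B]" "0[B]" c]] by simp
 next
  case (teq_right_zero b)
  then show ?case using T.rel_minus[OF T.rel_right[of b "0[C]" "0[C]"]] by simp
 next
  case (teq_balance b c r r')
  then obtain a where "a el A" "r = ph a" "r' = ps a" by blast
  then show ?case using T.rel_bal[of a b c] teq_balance.hyps by (simp add: B.m_comm)
 qed
qed

lemma kills_comp:
 assumes X: "presheaf X" and I: "ideal_sheaf X I" and P: "sheaf P" and Q: "sheaf Q" and a: "mor P X a" and l: "mor Q P l" and k: "kills X I P a"
 shows "kills X I Q (comp_mor P l a)"
 unfolding kills_def
proof (intro allI impI)
 interpret a: mor P X a by fact
 interpret l: mor Q P l by fact
 fix V s assume V: "opn X V" "s : I V"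
 note o = a.preim_open[OF V(1)]
 show "smap (comp_mor P l a) V s = 0[sec Q (preim Q (comp_mor P l a) V)]"
  using k V ring_hom_zero[OF l.smap_hom[OF o] a.X.sec_ring[OF o] l.X.sec_ring[OF l.preim_open[OF o]]]
  unfolding kills_def by (simp add: preim_comp[OF mor.axioms(1)[OF l]])
qed

locale projective_cover =
 fixes X :: "('x, 'rx) ringed_space" and Y :: "('y, 'ry) ringed_space"
  and p :: "('x, 'rx, 'y, 'ry) ringed_map" and J :: "'x set => 'rx set" and UU :: "'y set set" and VV :: "'y set => 'x set set"
 assumes X: "scheme X" and Y: "scheme Y" and p: "morphism X Y p" and J: "quasi_coherent_ideal X J"
  and U_aff: "!!U. U : UU ==> affine_open Y U" and U_cov: "\<Union>UU = points Y"
  and V_aff: "!!U V. U : UU ==> V : VV U ==> affine_open X V" and V_cov: "!!U. U : UU ==> \<Union>(VV U) = preim X p U"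
  and proj: "!!U V. U : UU ==> V : VV U ==> aleph1_projective_hom (sec Y U) (sec X V) (%s. res X (preim X p U) V (smap p U s))"
begin

lemma Xl: "locally_ringed_space X" and Yl: "locally_ringed_space Y"
 using scheme_lrs X Y by auto

sublocale closed_sub X J by (rule closed_subI[OF Xl J])
sublocale p: mor X Y p by (rule lrs_mor[OF Xl Yl p])

abbreviation "ph U V == %s. res X (preim X p U) V (smap p U s)"

lemma U_open: "U : UU ==> opn Y U" and V_open: "U : UU ==> V : VV U ==> opn X V"
 using U_aff V_aff by (auto simp: affine_open_def)

lemma V_sub: "U : UU ==> V : VV U ==> V <= preim X p U"
 using V_cov by blast

lemma ph_hom: "U : UU ==> V : VV U ==> ph U V : ring_hom (sec Y U) (sec X V)"
 using proj unfolding aleph1_projective_hom_def by blast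

text \<open>The smallest ideal of \<open>\<O>(U)\<close> whose extensions contain \<open>J\<close>; its existence is the Mittag-Leffler condition.\<close>

definition "\<AA> U = {aa. ideal aa (sec Y U) & (ALL V:VV U. J V <= genideal (sec X V) (ph U V ` aa))}"
definition "aa U = {a : carrier (sec Y U). ALL bb:\<AA> U. a : bb}"

lemma J_sub: "U : UU ==> V : VV U ==> J V <= genideal (sec X V) (ph U V ` aa U)"
proof
 fix b assume U: "U : UU" and V: "V : VV U" and b: "b : J V"
 have pr: "flat_module (sec Y U) (module_via (sec X V) (ph U V))" "mittag_leffler (sec Y U) (module_via (sec X V) (ph U V))"
  using proj[OF U V] unfolding aleph1_projective_hom_def by blast+
 show "b : genideal (sec X V) (ph U V ` aa U)"
  unfolding aa_def
 proof (rule mittag_leffler_Inter[OF p.Y.sec_cring[OF U_open[OF U]] sec_cring[OF V_open[OF U V]] ph_hom[OF U V] pr])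
  show "ideal bb (sec Y U)" if "bb : \<AA> U" for bb using that \<AA>_def by blast
  show "b el sec X V" by (rule I_carr[OF V_open[OF U V] b])
  show "b : genideal (sec X V) (ph U V ` bb)" if "bb : \<AA> U" for bb using that b V \<AA>_def by blast
 qed
qed

lemma aa_ideal: "U : UU ==> ideal (aa U) (sec Y U)"
proof -
 assume U: "U : UU"
 interpret cring "sec Y U" by (rule p.Y.sec_cring[OF U_open[OF U]])
 have I: "ideal bb (sec Y U)" if "bb : \<AA> U" for bb using that \<AA>_def by blast
 show ?thesis
 proof (rule idealI')
  show "0[sec Y U] : aa U" unfolding aa_def using additive_subgroup.zero_closed[OF ideal.axioms(1)[OF I]] by simp
  show "x +[sec Y U] y : aa U" if "x : aa U" "y : aa U" for x y
   using that additive_subgroup.a_closed[OF ideal.axioms(1)[OF I]] unfolding aa_def by simp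
  show "a *[sec Y U] x : aa U" if "a el sec Y U" "x : aa U" for a x
   using that ideal.I_l_closed[OF I] unfolding aa_def by simp
 qed (auto simp: aa_def)
qed

lemma aa_carr: "a : aa U ==> a el sec Y U"
 unfolding aa_def by blast

definition good :: "('t, 'rt) ringed_space => ('t, 'rt, 'y, 'ry) ringed_map => 't => 'y set => bool" where
 "good T g t U <-> (ALL a:aa U. germ T t (preim T g U) (smap g U a) = 0[stalk T t])"

text \<open>If the ideal of \<open>Z\<close> dies on a fibre product \<open>P\<close>, then
  \<open>P\<close> maps to \<open>Z\<close> and is itself a fibre product of \<open>Z\<close> and
  \<open>T\<close>, with the identity as base change of the inclusion. One \<open>U\<close> for each
  \<open>t\<close> suffices as hypothesis, whereas \<open>base_change_isoD\<close> concludes for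
  every \<open>U\<close>; \<open>E_le\<close> exploits this asymmetry.\<close>

lemma base_change_isoI:
 fixes T :: "('t, 'rt) ringed_space"
 assumes T: "scheme T" and g: "morphism T Y g" and weak: "!!t. t : points T ==> EX U:UU. pmap g t : U & good T g t U"
 shows "base_change_iso X Y p J T g"
proof -
 note Tl = scheme_lrs[OF T]
 interpret g: mor T Y g by (rule lrs_mor[OF Tl Yl g])
 obtain P :: "('x, 'rx, 't, 'rt) fp_space" and a b where P: "fibre_product X T Y p g P a b"
  by (rule fibre_product_exists[OF X T Y p g])
 have Ps: "scheme P" "morphism P X a" "morphism P T b" and sq: "mor_eq P Y (comp_mor X a p) (comp_mor T b g)"
  using P unfolding fibre_product_def by blast+
 note Pl = scheme_lrs[OF Ps(1)]
 interpret P: sheaf P by (rule lrsD(1)[OF Pl])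
 have a: "mor P X a" and b: "mor P T b" using lrs_mor[OF Pl] Xl Tl Ps by auto
 interpret a: mor P X a by (rule a)
 interpret b: mor P T b by (rule b)
 have "kills X J P a"
  unfolding kills_iff[OF P.sheaf_axioms a]
 proof (intro ballI)
  fix z ga assume z: "z : points P" and ga: "ga : ideal_stalk X J (pmap a z)"
  obtain U where U: "U : UU" "pmap g (pmap b z) : U" "good T g (pmap b z) U" using weak[OF b.pmap_in[OF z]] by blast
  have "pmap a z : preim X p U" using mor_eq_pmap[OF sq z] U(2) a.pmap_in[OF z] by simp
  then obtain V where V: "V : VV U" "pmap a z : V" using V_cov[OF U(1)] by blast
  note oV = V_open[OF U(1) V(1)] and oU = U_open[OF U(1)]
  note oP = p.preim_open[OF oU] and oG = g.preim_open[OF oU]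
  have hm: "(%s. stalk_map P X a z (germ X (pmap a z) V s)) : ring_hom (sec X V) (stalk P z)"
   by (rule hom_comp[OF germ_hom[OF oV V(2)] a.stalk_map_hom[OF z]])
  have zero: "stalk_map P X a z (germ X (pmap a z) V s) = 0[stalk P z]" if s: "s : J V" for s
  proof (rule genideal_zero_on[OF sec_cring[OF oV] P.stalk_cring[OF z] hm])
   show "s : genideal (sec X V) (ph U V ` aa U)" using J_sub[OF U(1) V(1)] s by blast
   show "ph U V ` aa U <= carrier (sec X V)" using hom_car[OF ph_hom[OF U(1) V(1)]] aa_carr by blast
   fix r assume "r : ph U V ` aa U"
   then obtain c where c: "c : aa U" "r = ph U V c" by blast
   note cc = aa_carr[OF c(1)]
   have pz: "pmap a z : preim X p U" "pmap b z : preim T g U" using V_sub[OF U(1) V(1)] V(2) U(2) b.pmap_in[OF z] by auto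
   \<comment> \<open>As \<open>c\<close> comes from \<open>Y\<close>, its pullback through
     \<open>X\<close> equals its pullback through \<open>T\<close>, where it vanishes by
     \<open>good\<close>.\<close>
   have "stalk_map P X a z (germ X (pmap a z) V r) = stalk_map P X a z (germ X (pmap a z) (preim X p U) (smap p U c))"
    unfolding c(2) germ_res[OF oP oV V(2) V_sub[OF U(1) V(1)] p.smap_closed[OF oU cc]] ..
   also have "... = germ P z (preim P a (preim X p U)) (smap a (preim X p U) (smap p U c))"
    by (rule a.stalk_map_germ[OF z oP pz(1) p.smap_closed[OF oU cc]])
   also have "... = germ P z (preim P b (preim T g U)) (smap b (preim T g U) (smap g U c))"
    using mor_eq_smap[OF sq oU cc] mor_eq_preim[OF sq, of U] preim_comp[OF mor.axioms(1)[OF a], of p U] preim_comp[OF mor.axioms(1)[OF b], of g U] by simp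
   also have "... = stalk_map P T b z (germ T (pmap b z) (preim T g U) (smap g U c))"
    by (rule b.stalk_map_germ[OF z oG pz(2) g.smap_closed[OF oU cc], symmetric])
   also have "... = stalk_map P T b z 0[stalk T (pmap b z)]" using U(3) c(1) unfolding good_def by simp
   also have "... = 0[stalk P z]"
    by (rule ring_hom_zero[OF b.stalk_map_hom[OF z] cring.axioms(1)[OF g.X.stalk_cring[OF b.pmap_in[OF z]]] cring.axioms(1)[OF P.stalk_cring[OF z]]])
   finally show "stalk_map P X a z (germ X (pmap a z) V r) = 0[stalk P z]" .
  qed
  show "stalk_map P X a z ga = 0[stalk P z]"
  proof (rule genideal_zero_on[OF stalk_cring[OF a.pmap_in[OF z]] P.stalk_cring[OF z] a.stalk_map_hom[OF z]])
   show "ga : genideal (stalk X (pmap a z)) (germ X (pmap a z) V ` J V)"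
    using ga qc_stalk_generated[OF Xl J V_aff[OF U(1) V(1)] V(2)] by simp
   show "germ X (pmap a z) V ` J V <= carrier (stalk X (pmap a z))" using germ_closed[OF oV V(2) I_carr[OF oV]] by blast
  qed (use zero in blast)
 qed
 then obtain c where c: "mor P Z c" "mor_eq P X a (comp_mor Z c incl)" by (rule factor[OF Pl a])
 have ac: "mor_eq Q X (comp_mor P h a) (comp_mor Z (comp_mor P h c) incl)" if "mor Q P h" for Q :: "('q, 's) ringed_space" and h
  by (rule mor_trans[OF mor_eq_comp_right[OF c(2) that a] mor_eq_sym[OF comp_assoc[OF c(1)]]])
 \<comment> \<open>Existence of the factoring morphism is inherited from \<open>P\<close> through
   the inclusion of \<open>Z\<close>, and compatibility with the projection to \<open>Z\<close> is
   tested in \<open>X\<close> by \<open>incl_mono\<close>.\<close>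
 have "fibre_product Z T Y (comp_mor X incl p) g P c b"
  unfolding fibre_product_def
 proof (intro conjI allI impI)
  show "scheme P" "morphism P T b" by fact+
  show "morphism P Z c" by (rule mor_morphism[OF c(1)])
  show "mor_eq P Y (comp_mor Z c (comp_mor X incl p)) (comp_mor T b g)"
   by (rule mor_trans[OF mor_eq_sym[OF comp_assoc[OF incl_mor]] mor_trans[OF mor_eq_comp_left[OF mor_eq_sym[OF c(2)] mor_comp[OF c(1) incl_mor] p.mor_axioms] sq]])
  fix Q :: "('x, 'rx, 't, 'rt) fp_space" and a' b'
  assume Q: "scheme Q" and a': "morphism Q Z a'" and b': "morphism Q T b'" and e: "mor_eq Q Y (comp_mor Z a' (comp_mor X incl p)) (comp_mor T b' g)"
  note Ql = scheme_lrs[OF Q]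
  have a'm: "mor Q Z a'" by (rule lrs_mor[OF Ql Z_lrs a'])
  have "morphism Q X (comp_mor Z a' incl)" by (rule mor_morphism[OF mor_comp[OF a'm incl_mor]])
  moreover have "mor_eq Q Y (comp_mor X (comp_mor Z a' incl) p) (comp_mor T b' g)" by (rule mor_trans[OF comp_assoc[OF incl_mor] e])
  ultimately obtain h where h: "morphism Q P h" "mor_eq Q X (comp_mor P h a) (comp_mor Z a' incl)" "mor_eq Q T (comp_mor P h b) b'"
   and hu: "!!h'. morphism Q P h' ==> mor_eq Q X (comp_mor P h' a) (comp_mor Z a' incl) ==> mor_eq Q T (comp_mor P h' b) b' ==> mor_eq Q P h h'"
   using P Q b' unfolding fibre_product_def by blast
  have hm: "mor Q P h" by (rule lrs_mor[OF Ql Pl h(1)])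
  have "mor_eq Q Z (comp_mor P h c) a'"
   by (rule incl_mono[OF lrsD(1)[OF Ql] mor_comp[OF hm c(1)] a'm mor_trans[OF mor_eq_sym[OF ac[OF hm]] h(2)]])
  moreover have "mor_eq Q P h h'" if h': "morphism Q P h'" "mor_eq Q Z (comp_mor P h' c) a'" "mor_eq Q T (comp_mor P h' b) b'" for h'
  proof (rule hu[OF h'(1) _ h'(3)])
   have hm': "mor Q P h'" by (rule lrs_mor[OF Ql Pl h'(1)])
   show "mor_eq Q X (comp_mor P h' a) (comp_mor Z a' incl)"
    by (rule mor_trans[OF ac[OF hm'] mor_eq_comp_left[OF h'(2) mor_comp[OF hm' c(1)] incl_mor]])
  qed
  ultimately show "EX h. morphism Q P h & mor_eq Q Z (comp_mor P h c) a' & mor_eq Q T (comp_mor P h b) b' &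
   (ALL h'. morphism Q P h' --> mor_eq Q Z (comp_mor P h' c) a' --> mor_eq Q T (comp_mor P h' b) b' --> mor_eq Q P h h')"
   using h by blast
 qed
 moreover have id: "morphism P P id_mor" by (rule mor_morphism[OF mor_id[OF P.presheaf_axioms]])
 moreover have "mor_eq P X (comp_mor P id_mor a) (comp_mor Z c incl)" by (rule mor_trans[OF comp_id_left[OF a] c(2)])
 moreover have "mor_eq P T (comp_mor P id_mor b) b" by (rule comp_id_left[OF b])
 moreover have "iso_mor P P id_mor"
  unfolding iso_mor_def using id comp_id_left[OF mor_id[OF P.presheaf_axioms]] by blast
 ultimately show ?thesis unfolding base_change_iso_def using P by blast
qed

text \<open>The inverse \<open>k\<close> of the isomorphism, followed by the projection
  \<open>c\<close>, factors the projection to \<open>X\<close> through \<open>Z\<close>, where the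
  ideal vanishes.\<close>

lemma base_change_iso_kills:
 fixes T :: "('t, 'rt) ringed_space"
 assumes bc: "base_change_iso X Y p J T g" and T: "scheme T"
 obtains P :: "('x, 'rx, 't, 'rt) fp_space" and a b where "fibre_product X T Y p g P a b" "kills X J P a"
proof -
 obtain P :: "('x, 'rx, 't, 'rt) fp_space" and a b
  and Z' :: "('x, 'rx, 't, 'rt) fp_space" and c d h
  where P: "fibre_product X T Y p g P a b" and Z': "fibre_product Z T Y (comp_mor X incl p) g Z' c d"
   and h: "morphism Z' P h" "mor_eq Z' X (comp_mor P h a) (comp_mor Z c incl)" "iso_mor Z' P h"
  using bc unfolding base_change_iso_def by blast
 have Ps: "scheme P" "morphism P X a" and Zs: "scheme Z'" "morphism Z' Z c" using P Z' unfolding fibre_product_def by blast+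
 note Pl = scheme_lrs[OF Ps(1)] and Zl = scheme_lrs[OF Zs(1)]
 obtain k where k: "morphism P Z' k" "mor_eq P P (comp_mor Z' k h) id_mor" using h(3) unfolding iso_mor_def by blast
 have a: "mor P X a" and c: "mor Z' Z c" and hm: "mor Z' P h" and km: "mor P Z' k"
  using lrs_mor[OF Pl Xl Ps(2)] lrs_mor[OF Zl Z_lrs Zs(2)] lrs_mor[OF Zl Pl h(1)] lrs_mor[OF Pl Zl k(1)] by auto
 have "mor_eq P X a (comp_mor P (comp_mor Z' k h) a)"
  by (rule mor_eq_sym[OF mor_trans[OF mor_eq_comp_left[OF k(2) mor_comp[OF km hm] a] comp_id_left[OF a]]])
 moreover have "mor_eq P X (comp_mor P (comp_mor Z' k h) a) (comp_mor Z (comp_mor Z' k c) incl)"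
  by (rule mor_trans[OF comp_assoc[OF hm] mor_trans[OF mor_eq_comp_right[OF h(2) km mor_comp[OF hm a]] mor_eq_sym[OF comp_assoc[OF c]]]])
 ultimately have "mor_eq P X a (comp_mor Z (comp_mor Z' k c) incl)" by (rule mor_trans)
 then have "kills X J P a"
  by (rule kills_cong[OF _ presheaf_axioms ideal_sheaf factors_kills[OF lrsD(1)[OF Pl] mor_comp[OF km c]]])
 then show ?thesis using that P by blast
qed

text \<open>The kernel of the map from the sections over \<open>U\<close> to the stalk at
  \<open>t\<close> turns out to be one of the ideals in \<open>\<AA> U\<close>, so it contains their
  intersection \<open>aa U\<close>.\<close>

lemma base_change_isoD:
 fixes T :: "('t, 'rt) ringed_space"
 assumes bc: "base_change_iso X Y p J T g" and T: "scheme T" and g: "morphism T Y g"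
  and t: "t : points T" and U: "U : UU" "pmap g t : U"
 shows "good T g t U"
proof -
 note Tl = scheme_lrs[OF T]
 interpret T: sheaf T by (rule lrsD(1)[OF Tl])
 interpret g: mor T Y g by (rule lrs_mor[OF Tl Yl g])
 obtain P :: "('x, 'rx, 't, 'rt) fp_space" and a b where P: "fibre_product X T Y p g P a b" and kl: "kills X J P a"
  by (rule base_change_iso_kills[OF bc T])
 note oU = U_open[OF U(1)]
 note oG = g.preim_open[OF oU]
 let ?A = "sec Y U" let ?C = "stalk T t"
 define ps where "ps = (%a. germ T t (preim T g U) (smap g U a))"
 have tg: "t : preim T g U" using t U by simp
 have ps: "ps : ring_hom ?A ?C" unfolding ps_def by (rule hom_comp[OF g.smap_hom[OF oU] T.germ_hom[OF oG tg]])
 interpret A: cring ?A by (rule p.Y.sec_cring[OF oU])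
 interpret C: cring ?C by (rule T.stalk_cring[OF t])
 interpret CU: chart Y U ?A "%s. s" by (rule affine_chart[OF Yl U_aff[OF U(1)]])
 have "J V <= genideal (sec X V) (ph U V ` {a : carrier ?A. ps a = 0[?C]})" if V: "V : VV U" for V
 proof
  fix s assume s: "s : J V"
  let ?B = "sec X V"
  note oV = V_open[OF U(1) V] and VU = V_sub[OF U(1) V] and ph = ph_hom[OF U(1) V]
  interpret B: cring ?B by (rule sec_cring[OF oV])
  interpret CV: chart X V ?B "%s. s" by (rule affine_chart[OF Xl V_aff[OF U(1) V]])
  have sB: "s el ?B" by (rule I_carr[OF oV s])
  \<comment> \<open>The ring \<open>D.D\<close> below is the base change of the sections over
    \<open>V\<close> to the local ring at \<open>t\<close>. Its spectrum \<open>?Q\<close> maps to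
    \<open>X\<close> through \<open>V\<close> and to \<open>T\<close> by
    \<open>morphism_from_stalk\<close>.\<close>
  define Rl where "Rl = {(ph U V a, ps a) | a. a el ?A}"
  interpret D: tens_ring ?B ?C Rl
   by (rule tens_ringI[OF B.cring_axioms C.cring_axioms]) (use hom_car[OF ph] hom_car[OF ps] in "auto simp: Rl_def")
  let ?Q = "Spec D.D" let ?e = "Spec_elt D.D" let ?p = "points ?Q"
  interpret Q: chart ?Q ?p D.D ?e by (rule Spec_chart[OF D.D_cring])
  obtain u where u: "mor ?Q X u" "!!q. q : ?p ==> pmap u q : V" "!!b. b el ?B ==> smap u V b = ?e (D.in1 b)"
   by (rule CV.morphism_to_chart[OF Q.lrs hom_comp[OF D.in1_hom Q.iota_hom]]) blast
  obtain v where v: "mor ?Q T v" "!!N q. opn T N ==> t : N ==> q : ?p ==> pmap v q : N"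
   "!!N c. opn T N ==> t : N ==> c el sec T N ==> smap v N c = ?e (D.in2 (germ T t N c))"
   by (rule morphism_from_stalk[OF T t Q.lrs hom_comp[OF D.in2_hom Q.iota_hom]]) blast
  interpret u: mor ?Q X u by (rule u(1))
  have uv: "mor_eq ?Q Y (comp_mor X u p) (comp_mor T v g)"
  proof (rule CU.morphisms_to_chart_eq[OF Q.sheaf_axioms mor_comp[OF u(1) p.mor_axioms] mor_comp[OF v(1) g.mor_axioms]])
   show "pmap (comp_mor X u p) q : U" "pmap (comp_mor T v g) q : U" if "q : ?p" for q
    using u(2)[OF that] VU v(2)[OF oG tg that] by auto
   fix r assume r: "r el ?A"
   have pu: "preim ?Q u V = ?p" "preim ?Q u (preim X p U) = ?p" using u(2) VU by (auto simp: preim_def)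
   note sc = p.smap_closed[OF oU r]
   have "smap u (preim X p U) (smap p U r) = smap u V (ph U V r)"
    using u.smap_res[OF p.preim_open[OF oU] oV VU sc] Q.res_id[OF Q.V_open] u.smap_closed[OF p.preim_open[OF oU] sc] unfolding pu by simp
   also have "... = ?e (D.in2 (ps r))"
   proof -
    have "(ph U V r, ps r) : Rl" using r unfolding Rl_def by blast
    from D.in_balance[OF this] show ?thesis using u(3)[OF hom_car[OF ph r]] by simp
   qed
   also have "... = smap v (preim T g U) (smap g U r)" using v(3)[OF oG tg g.smap_closed[OF oU r]] ps_def by simp
   finally show "smap (comp_mor X u p) U r = smap (comp_mor T v g) U r" by simp
  qed
  \<comment> \<open>The universal property of \<open>P\<close> speaks about spaces over the type
    \<open>fp\<close> only, so \<open>?Q\<close> has to be copied into it. This is possible because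
    the elements of \<open>D.D\<close> are finite sums of products and are coded by lists.\<close>
  obtain c :: "('x, 'rx, 't, 'rt) fpe list => ('x, 'rx, 't, 'rt) fpe" where c: "inj c" by (rule list_code)
  obtain e2 :: "_ => ('x, 'rx, 't, 'rt) fpe" where e2: "inj_on e2 (carrier ?C)"
   by (rule inj_scheme_stalk[OF c T t, of "%r. Inr (Inr (Inr (Inl r)))"]) (simp_all add: inj_def)
  have gen: "EX l:lists (carrier ?B \<times> carrier ?C). x = foldr (%(b, c) y. D.in1 b *[D.D] D.in2 c +[D.D] y) l 0[D.D]" if "x el D.D" for x
   using that
  proof (induction rule: D.D_induct)
   case zero
   show ?case by (rule bexI[of _ "[]"]) auto
  next
   case (add b c x)
   then obtain l where "l : lists (carrier ?B \<times> carrier ?C)" "x = foldr (%(b, c) y. D.in1 b *[D.D] D.in2 c +[D.D] y) l 0[D.D]" by blast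
   then show ?case using add(1,2) by (intro bexI[of _ "(b, c) # l"]) auto
  qed
  have e1: "inj_on (%r. Inr (Inl r) :: ('x, 'rx, 't, 'rt) fpe) (carrier ?B)" by (simp add: inj_on_def)
  obtain e3 :: "_ => ('x, 'rx, 't, 'rt) fpe" where e3: "inj_on e3 (carrier D.D)"
   by (rule inj_of_lists[OF c e1 e2 gen]) blast+
  obtain i :: "_ => ('x, 'rx, 't, 'rt) fp" and j :: "_ => _ => ('x, 'rx, 't, 'rt) fp" where "transport ?Q i j"
   by (rule Spec_transport[OF c D.D_cring e3])
  then interpret tp: transport ?Q i j .
  have Qs: "scheme tp.P'" by (rule tp.P'_scheme[OF scheme_Spec[OF D.D_cring]])
  note to = tp.to_P_mor and fr = tp.of_P_mor
  have "mor_eq tp.P' Y (comp_mor X (comp_mor ?Q tp.to_P u) p) (comp_mor T (comp_mor ?Q tp.to_P v) g)"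
   by (rule mor_trans[OF comp_assoc[OF u(1)] mor_trans[OF mor_eq_comp_right[OF uv to mor_comp[OF u(1) p.mor_axioms]] mor_eq_sym[OF comp_assoc[OF v(1)]]]])
  moreover have "morphism tp.P' X (comp_mor ?Q tp.to_P u)" "morphism tp.P' T (comp_mor ?Q tp.to_P v)"
   by (intro mor_morphism mor_comp[OF to] u(1) v(1))+
  ultimately obtain l where l: "morphism tp.P' P l" "mor_eq tp.P' X (comp_mor P l a) (comp_mor ?Q tp.to_P u)"
   using P Qs unfolding fibre_product_def by blast
  have Ps: "scheme P" "morphism P X a" using P unfolding fibre_product_def by blast+
  note Pl = scheme_lrs[OF Ps(1)]
  have lm: "mor tp.P' P l" by (rule lrs_mor[OF scheme_lrs[OF Qs] Pl l(1)])
  have am: "mor P X a" by (rule lrs_mor[OF Pl Xl Ps(2)])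
  have "kills X J tp.P' (comp_mor ?Q tp.to_P u)"
   by (rule kills_cong[OF mor_eq_sym[OF l(2)] presheaf_axioms ideal_sheaf kills_comp[OF presheaf_axioms ideal_sheaf lrsD(1)[OF Pl] tp.P'_sheaf am lm kl]])
  from kills_comp[OF presheaf_axioms ideal_sheaf tp.P'_sheaf Q.sheaf_axioms mor_comp[OF to u(1)] fr this]
  have "kills X J ?Q (comp_mor tp.P' tp.of_P (comp_mor ?Q tp.to_P u))" .
  moreover have "mor_eq ?Q X u (comp_mor tp.P' tp.of_P (comp_mor ?Q tp.to_P u))"
   by (rule mor_eq_sym[OF mor_trans[OF mor_eq_sym[OF comp_assoc[OF to]] mor_trans[OF mor_eq_comp_left[OF tp.of_to mor_comp[OF fr to] u(1)] comp_id_left[OF u(1)]]]])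
  ultimately have "kills X J ?Q u" using kills_cong[OF _ presheaf_axioms ideal_sheaf] by blast
  then have "?e (D.in1 s) = 0[sec ?Q (preim ?Q u V)]" using s oV u(3)[OF sB] unfolding kills_def by metis
  moreover have "preim ?Q u V = ?p" using u(2) by (auto simp: preim_def)
  ultimately have "?e (D.in1 s) = ?e 0[D.D]"
   using ring_hom_zero[OF Q.iota_hom D.D.ring_axioms Q.sec_ring[OF Q.V_open]] by simp
  then have "D.in1 s = 0[D.D]" by (rule inj_onD[OF Q.iota_inj]) (use sB in simp_all)
  then have "teq ?B ?C Rl {#(s, 1[?C])#} {#}" unfolding D.in1_def D.D_zero using D.cl_eq_iff[of "{#(s, 1[?C])#}" "{#}"] sB by simp
  from teq_rel[OF A.cring_axioms B.cring_axioms C.cring_axioms ph ps this[unfolded Rl_def]]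
  have "frag_of (s, 1[?C]) : tensor_relations ?A (module_via ?B (ph U V)) (module_via ?C ps)" by simp
  \<comment> \<open>The stalk at \<open>t\<close> is taken as a module over the sections of
    \<open>Y\<close> over \<open>U\<close>, with the element 1. The annihilator of 1 is the kernel
    of \<open>ps\<close>.\<close>
  from flat_annihilator[OF A.cring_axioms B.cring_axioms ph _ module_via_module[OF A.cring_axioms C.cring_axioms ps] _ sB this]
  have "s : genideal ?B (ph U V ` {a : carrier ?A. ps a *[?C] 1[?C] = 0[?C]})"
   using proj[OF U(1) V] unfolding aleph1_projective_hom_def by simp
  moreover have "{a : carrier ?A. ps a *[?C] 1[?C] = 0[?C]} = {a : carrier ?A. ps a = 0[?C]}"
   using hom_car[OF ps] by auto
  ultimately show "s : genideal ?B (ph U V ` {a : carrier ?A. ps a = 0[?C]})" by simp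
 qed
 moreover have "ideal {a : carrier ?A. ps a = 0[?C]} ?A"
  using cring_vimage_ideal[OF ps A.cring_axioms C.cring_axioms C.zeroideal] by simp
 \<comment> \<open>The inclusion was shown for every \<open>V\<close> in the cover, with one and the
   same kernel, as membership in \<open>\<AA> U\<close> demands.\<close>
 ultimately have K: "{a : carrier ?A. ps a = 0[?C]} : \<AA> U" unfolding \<AA>_def by blast
 have "ps a = 0[?C]" if a: "a : aa U" for a
 proof -
  have "ALL bb:\<AA> U. a : bb" using a unfolding aa_def by (elim CollectE conjE)
  from bspec[OF this K] show ?thesis by simp
 qed
 then show ?thesis unfolding good_def ps_def by simp
qed

section \<open>Comparison of the local ideals at stalks and the resulting ideal sheaf\<close>

definition "E y U = genideal (stalk Y y) (germ Y y U ` aa U)"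

lemma E_sub: "U : UU ==> y : U ==> germ Y y U ` aa U <= carrier (stalk Y y)"
 using p.Y.germ_closed[OF U_open] aa_carr by blast

lemma E_ideal: "U : UU ==> y : U ==> ideal (E y U) (stalk Y y)"
 unfolding E_def using U_cov by (intro ring.genideal_ideal[OF cring.axioms(1)[OF p.Y.stalk_cring]] E_sub) auto

text \<open>Both extensions to \<open>\<O>\<^sub>y\<close> are the smallest ideal whose quotient ring gives a point of the functor.\<close>

lemma E_le:
 assumes U: "U : UU" "y : U" and U': "U' : UU" "y : U'"
 shows "E y U' <= E y U"
proof -
 have y: "y : points Y" using U U_cov by blast
 let ?S = "stalk Y y" let ?R = "?S Quot E y U"
 interpret S: cring ?S by (rule p.Y.stalk_cring[OF y])
 note I = E_ideal[OF U]
 interpret R: cring ?R by (rule Quot_cring[OF S.cring_axioms I])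
 let ?T = "Spec ?R" let ?e = "Spec_elt ?R" let ?p = "points ?T"
 interpret T: chart ?T ?p ?R ?e by (rule Spec_chart[OF R.cring_axioms])
 define q where "q ga = E y U +>\<^bsub>?S\<^esub> ga" for ga
 have q: "q : ring_hom ?S ?R" unfolding q_def by (rule Quot_hom[OF S.cring_axioms I])
 obtain g where g: "mor ?T Y g" "!!N t. opn Y N ==> y : N ==> t : ?p ==> pmap g t : N"
  "!!N c. opn Y N ==> y : N ==> c el sec Y N ==> smap g N c = ?e (q (germ Y y N c))"
  by (rule morphism_from_stalk[OF Y y T.lrs hom_comp[OF q T.iota_hom]]) blast
 have gm: "morphism ?T Y g" by (rule mor_morphism[OF g(1)])
 have pre: "preim ?T g N = ?p" if "opn Y N" "y : N" for N using g(2)[OF that] by (auto simp: preim_def)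
 have "good ?T g t U" if t: "t : ?p" for t
  unfolding good_def
 proof
  fix a assume a: "a : aa U"
  have "germ Y y U a : E y U" unfolding E_def using S.genideal_self[OF E_sub[OF U]] a by blast
  then have "q (germ Y y U a) = 0[?R]" unfolding q_def
   using Quot_zero_iff[OF S.cring_axioms I p.Y.germ_closed[OF U_open[OF U(1)] U(2) aa_carr[OF a]]] by simp
  then show "germ ?T t (preim ?T g U) (smap g U a) = 0[stalk ?T t]"
   using g(3)[OF U_open[OF U(1)] U(2) aa_carr[OF a]] pre[OF U_open[OF U(1)] U(2)] T.gi_zero[OF t] by simp
 qed
 \<comment> \<open>The choice of \<open>?T\<close> makes \<open>U\<close> good at every point, and
   one good \<open>U\<close> implies the base change condition. That condition in turn makes
   \<open>U'\<close> good, so \<open>aa U'\<close> dies in the quotient ring.\<close>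
 then have bc: "base_change_iso X Y p J ?T g"
  using U(1) g(2)[OF U_open[OF U(1)] U(2)] by (intro base_change_isoI[OF scheme_Spec[OF R.cring_axioms] gm]) blast
 have "germ Y y U' ` aa U' <= E y U"
 proof clarify
  fix a assume a: "a : aa U'"
  note oU = U_open[OF U'(1)] and ac = aa_carr[OF a]
  have gc: "germ Y y U' a el ?S" by (rule p.Y.germ_closed[OF oU U'(2) ac])
  have qc: "q (germ Y y U' a) el ?R" by (rule hom_car[OF q gc])
  have "?e (q (germ Y y U' a)) = ?e 0[?R]"
  proof (rule T.sec_eqI[OF T.V_open])
   fix t assume t: "t : ?p"
   have "good ?T g t U'" by (rule base_change_isoD[OF bc scheme_Spec[OF R.cring_axioms] gm t U'(1) g(2)[OF oU U'(2) t]])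
   then show "germ ?T t ?p (?e (q (germ Y y U' a))) = germ ?T t ?p (?e 0[?R])"
    using a T.gi_zero[OF t] unfolding good_def pre[OF oU U'(2)] g(3)[OF oU U'(2) ac, symmetric] by simp
  qed (use hom_car[OF T.iota_hom] qc in auto)
  then have "q (germ Y y U' a) = 0[?R]" by (rule inj_onD[OF T.iota_inj]) (use qc in auto)
  then show "germ Y y U' a : E y U" using Quot_zero_iff[OF S.cring_axioms I gc] unfolding q_def by simp
 qed
 then show ?thesis unfolding E_def[of y U'] by (rule S.genideal_minimal[OF I])
qed

text \<open>All \<open>U\<close> around \<open>y\<close> are required at once, so that no choice
  enters; by \<open>E_le\<close> the ideal \<open>E y U\<close> is the same for each of them, and
  one decides (\<open>\<I>_sub\<close>).\<close>

definition "\<I> W = (if opn Y W then {s : carrier (sec Y W). ALL y:W. ALL U:UU. y : U --> germ Y y W s : E y U} else {})"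

lemma \<I>_sub: "U : UU ==> opn Y V ==> V <= U ==> \<I> V = {s : carrier (sec Y V). ALL y:V. germ Y y V s : E y U}"
 using E_le unfolding \<I>_def by auto blast

lemma \<I>_qc: "quasi_coherent_ideal Y \<I>"
 unfolding quasi_coherent_ideal_def
proof (intro conjI ballI)
 show "ideal_sheaf Y \<I>"
  unfolding ideal_sheaf_def
 proof (intro conjI allI impI ballI)
  show "\<I> W = {}" if "~ opn Y W" for W using that by (simp add: \<I>_def)
  show "ideal (\<I> W) (sec Y W)" if W: "opn Y W" for W
  proof -
   interpret R: cring "sec Y W" by (rule p.Y.sec_cring[OF W])
   show ?thesis
   proof (rule R.idealI')
    show "0[sec Y W] : \<I> W"
     using W additive_subgroup.zero_closed[OF ideal.axioms(1)[OF E_ideal]] by (simp add: \<I>_def p.Y.germ_zero[OF W])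
    show "s +[sec Y W] t : \<I> W" if "s : \<I> W" "t : \<I> W" for s t
     using that W additive_subgroup.a_closed[OF ideal.axioms(1)[OF E_ideal]] by (simp add: \<I>_def flip: p.Y.stalk_add[OF W])
    show "a *[sec Y W] s : \<I> W" if "a el sec Y W" "s : \<I> W" for a s
     using that W ideal.I_l_closed[OF E_ideal] p.Y.germ_closed[OF W] by (simp add: \<I>_def flip: p.Y.stalk_mult[OF W])
   qed (use W in "auto simp: \<I>_def")
  qed
  show "res Y W V s : \<I> V" if o: "opn Y W" "opn Y V" "V <= W" and s: "s : \<I> W" for W V s
   using s o p.Y.res_closed[OF o] p.Y.germ_res[OF o(1,2) _ o(3)] by (auto simp: \<I>_def)
  show "s : \<I> (\<Union>\<W>)" if W: "ALL U:\<W>. opn Y U" and s: "s el sec Y (\<Union>\<W>)" and r: "ALL U:\<W>. res Y (\<Union>\<W>) U s : \<I> U" for \<W> s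
  proof -
   have o: "opn Y (\<Union>\<W>)" using W by blast
   have "germ Y y (\<Union>\<W>) s : E y U" if yU: "y : \<Union>\<W>" "U : UU" "y : U" for y U
   proof -
    obtain V where V: "V : \<W>" "y : V" using yU(1) by blast
    have oV: "opn Y V" using W V by blast
    have "germ Y y V (res Y (\<Union>\<W>) V s) : E y U" using bspec[OF r V(1)] V(2) yU(2,3) oV by (simp add: \<I>_def)
    then show ?thesis using p.Y.germ_res[OF o oV V(2) _ s] V(1) by (simp add: Union_upper)
   qed
   then show ?thesis using o s unfolding \<I>_def by auto
  qed
 qed
 fix y assume "y : points Y"
 then obtain U where U: "U : UU" "y : U" unfolding U_cov[symmetric] by (rule UnionE)
 show "EX U. y : U & affine_open Y U & (EX aa. ideal aa (sec Y U) & (ALL V. opn Y V --> V <= U -->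
  \<I> V = {s : carrier (sec Y V). ALL y:V. germ Y y V s : genideal (stalk Y y) (germ Y y U ` aa)}))"
  by (rule exI[of _ U], intro conjI U(2) U_aff[OF U(1)] exI[of _ "aa U"] aa_ideal[OF U(1)] allI impI, rule \<I>_sub[OF U(1), unfolded E_def])
qed

sublocale \<I>: ideal_sh Y \<I>
 by (rule qc_ideal_sh[OF p.Y.presheaf_axioms \<I>_qc])

lemma aa_\<I>: "U : UU ==> a : aa U ==> a : \<I> U"
 unfolding \<I>_sub[OF _ U_open order_refl]
 using aa_carr ring.genideal_self[OF cring.axioms(1)[OF p.Y.stalk_cring] E_sub] U_cov unfolding E_def by blast

lemma kills_iff_base_change:
 fixes T :: "('t, 'rt) ringed_space"
 assumes T: "scheme T" and g: "morphism T Y g"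
 shows "kills Y \<I> T g <-> base_change_iso X Y p J T g"
proof
 note Tl = scheme_lrs[OF T]
 interpret T: sheaf T by (rule lrsD(1)[OF Tl])
 interpret g: mor T Y g by (rule lrs_mor[OF Tl Yl g])
 have cov: "EX U:UU. pmap g t : U" if "t : points T" for t using g.pmap_in[OF that] U_cov by blast
 show "base_change_iso X Y p J T g" if k: "kills Y \<I> T g"
 proof (rule base_change_isoI[OF T g])
  fix t assume t: "t : points T"
  obtain U where U: "U : UU" "pmap g t : U" using cov[OF t] by blast
  have "good T g t U"
   unfolding good_def
  proof
   fix a assume a: "a : aa U"
   have "smap g U a = 0[sec T (preim T g U)]" using k aa_\<I>[OF U(1) a] U_open[OF U(1)] unfolding kills_def by blast
   then show "germ T t (preim T g U) (smap g U a) = 0[stalk T t]"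
    using T.germ_zero[OF g.preim_open[OF U_open[OF U(1)]]] t U(2) by simp
  qed
  then show "EX U:UU. pmap g t : U & good T g t U" using U by blast
 qed
 assume bc: "base_change_iso X Y p J T g"
 show "kills Y \<I> T g"
  unfolding kills_def
 proof (intro allI impI)
  fix V s assume V: "opn Y V" "s : \<I> V"
  note o = g.preim_open[OF V(1)] and sc = \<I>.I_carr[OF V]
  show "smap g V s = 0[sec T (preim T g V)]"
  proof (rule T.sec_eqI[OF o g.smap_closed[OF V(1) sc] cring.cring_simprules(2)[OF T.sec_cring[OF o]]])
   fix t assume "t : preim T g V"
   then have t: "t : points T" "pmap g t : V" by auto
   obtain U where U: "U : UU" "pmap g t : U" using cov[OF t(1)] by blast
   note gd = base_change_isoD[OF bc T g t(1) U]
   have "stalk_map T Y g t (germ Y (pmap g t) V s) = 0[stalk T t]"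
   proof (rule genideal_zero_on[OF p.Y.stalk_cring[OF g.pmap_in[OF t(1)]] T.stalk_cring[OF t(1)] g.stalk_map_hom[OF t(1)] E_sub[OF U]])
    show "germ Y (pmap g t) V s : genideal (stalk Y (pmap g t)) (germ Y (pmap g t) U ` aa U)"
     using V t(2) U unfolding \<I>_def E_def[symmetric] by simp
    fix ga assume "ga : germ Y (pmap g t) U ` aa U"
    then obtain a where a: "a : aa U" "ga = germ Y (pmap g t) U a" by blast
    then show "stalk_map T Y g t ga = 0[stalk T t]"
     using g.stalk_map_germ[OF t(1) U_open[OF U(1)] U(2) aa_carr[OF a(1)]] gd unfolding good_def by simp
   qed
   then show "germ T t (preim T g V) (smap g V s) = germ T t (preim T g V) 0[sec T (preim T g V)]"
    using g.stalk_map_germ[OF t(1) V(1) t(2) sc] T.germ_zero[OF o] t by simp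
  qed
 qed
qed

text \<open>Here \<open>kills_iff_base_change\<close> is applied to inclusions of closed subschemes:
  to that of \<open>\<I>\<close>, which shows that \<open>\<I>\<close> belongs to
  \<open>Omega\<close>, and to that of each \<open>W\<close> in \<open>Omega\<close>, which shows
  \<open>\<I> <= W\<close>. Being itself a member, \<open>\<I>\<close> bounds every competitor for
  the greatest lower bound.\<close>

lemma union_eq: "schematic_union Y (Omega X Y p J) = \<I>"
 unfolding schematic_union_def
proof (rule Greatest_equality)
 interpret CI: closed_sub Y \<I> by (rule closed_subI[OF Yl \<I>_qc])
 have "\<I> : Omega X Y p J"
  unfolding Omega_def using \<I>_qc kills_iff_base_change[OF scheme_subscheme[OF Y \<I>_qc] mor_morphism[OF CI.incl_mor]] CI.incl_kills by blast
 then show "I <= \<I>" if "quasi_coherent_ideal Y I & (ALL W:Omega X Y p J. I <= W)" for I using that by blast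
 have "\<I> <= W" if W: "W : Omega X Y p J" for W
 proof -
  have qc: "quasi_coherent_ideal Y W" and bc: "base_change_iso X Y p J (subscheme Y W) (inclusion Y W)" using W unfolding Omega_def by auto
  interpret CW: closed_sub Y W by (rule closed_subI[OF Yl qc])
  have k: "kills Y \<I> CW.Z CW.incl" using kills_iff_base_change[OF scheme_subscheme[OF Y qc] mor_morphism[OF CW.incl_mor]] bc by blast
  have "s : W V" if V: "opn Y V" and s: "s : \<I> V" for V s
   unfolding CW.ideal_sheaf_mem_iff[OF V \<I>.I_carr[OF V s]]
  proof
   fix y assume y: "y : V"
   note gc = p.Y.germ_closed[OF V y \<I>.I_carr[OF V s]]
   show "germ Y y V s : ideal_stalk Y W y"
   proof (cases "y : CW.supp")
    case True
    have "smap CW.incl V s = 0[sec CW.Z (V Int CW.supp)]" using k V s unfolding kills_def CW.preim_incl by blast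
    then have "smap CW.incl V s y = 0[CW.quot y]" using CW.Z_zero[OF CW.V_supp_open[OF V]] y True by simp
    then show ?thesis using Quot_zero_iff[OF CW.stq[OF True] gc] y True by (simp add: CW.incl_smap)
   next
    \<comment> \<open>Outside the support of the quotient by \<open>W\<close>, the stalk of
      \<open>W\<close> is the whole local ring.\<close>
    case False
    then show ?thesis using gc openin_subset[OF V] y by (auto simp: ideal_support_def)
   qed
  qed
  then show ?thesis unfolding le_fun_def using \<I>_def by (metis empty_subsetI subsetI)
 qed
 then show "quasi_coherent_ideal Y \<I> & (ALL W:Omega X Y p J. \<I> <= W)" using \<I>_qc by blast
qed

end

theorem theorem3p10:
  fixes X :: "('x, 'rx) ringed_space" and Y :: "('y, 'ry) ringed_space"
    and p :: "('x, 'rx, 'y, 'ry) ringed_map" and J :: "'x set \<Rightarrow> 'rx set"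
  assumes "scheme X" and "scheme Y" and "morphism X Y p"
    and "quasi_coherent_ideal X J"
    and "aleph1_projective X Y p"
  shows "quasi_coherent_ideal Y (schematic_union Y (Omega X Y p J)) \<and>
    (\<forall>(T :: ('t, 'rt) ringed_space) g. scheme T \<longrightarrow> morphism T Y g \<longrightarrow>
       (factors_through T Y (schematic_union Y (Omega X Y p J)) g \<longleftrightarrow> base_change_iso X Y p J T g))"
proof -
 obtain UU where U: "ALL U:UU. affine_open Y U" "\<Union>UU = points Y"
  and "ALL U:UU. EX VV. (ALL V:VV. affine_open X V) & \<Union>VV = preim X p U &
   (ALL V:VV. aleph1_projective_hom (sec Y U) (sec X V) (%s. res X (preim X p U) V (smap p U s)))"
  using assms(5) unfolding aleph1_projective_def by blast
 then obtain VV where V: "ALL U:UU. (ALL V:VV U. affine_open X V) & \<Union>(VV U) = preim X p U &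
   (ALL V:VV U. aleph1_projective_hom (sec Y U) (sec X V) (%s. res X (preim X p U) V (smap p U s)))"
  by metis
 interpret projective_cover X Y p J UU VV
  by (rule projective_cover.intro) (use assms U V in blast)+
 show ?thesis
  unfolding union_eq
  using \<I>_qc factors_through_iff_kills[OF Yl \<I>_qc scheme_lrs lrs_mor[OF scheme_lrs Yl]] kills_iff_base_change by blast
qed

end
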